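(* Let $1\le p\le\infty$, $\alpha,\beta>0$ and $\rho,\eta\in\mathbb{R}$, and let $\Lambda:E\times E\to\mathbb{C}$ be a Hankel bilinear form. Then $\Lambda$ satisfies $|\Lambda(f,g)|\lesssim \|f\|_{F^p_{\alpha,\rho}}\|g\|_{F^{p'}_{\beta,\eta}}$ for $f,g\in E$ if and only if there exists $b\in F^{\infty}_{\frac{\alpha+\beta}{4},-\rho-\eta}$ such that $$\Lambda(f,g)=\langle fg,b\rangle_{\frac{\alpha+\beta}{2}}\qquad (f,g\in E).$$ In this case, $\|\Lambda\|\simeq \|b\|_{F^{\infty}_{\frac{\alpha+\beta}{4},-\rho-\eta}}$, and there exists $\varphi\in L^\infty_{0,-\rho-\eta}$ such that the bounded bilinear form $\widetilde{\Lambda}:L^p_{\alpha,\rho}\times L^{p'}_{\beta,\eta}\to\mathbb{C}$ defined by $$\widetilde\Lambda(f,g)=\langle fg,\varphi\rangle_{\frac{\alpha+\beta}{2}}$$ coincides with $\Lambda$ on $E\times E$ and satisfies $\|\widetilde\Lambda\|\simeq\|\Lambda\|$.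
   Context: Fix an integer $n\ge 1$ and a real number $\ell\ge 1$. $p'=p/(p-1)$ is the conjugate exponent of $p$ ($1'=\infty$, $\infty'=1$). $dV$ is Lebesgue measure on $\mathbb{C}^n$ normalized so that the unit ball has measure $1$. For $1\le p<\infty$, $\alpha\ge 0$, $\rho\in\mathbb{R}$, $L^p_{\alpha,\rho}$ is the space of measurable functions $f$ on $\mathbb{C}^n$ with $\|f\|_{L^p_{\alpha,\rho}}^p=\int_{\mathbb{C}^n}|f(z)(1+|z|)^{\rho}e^{-\frac{\alpha}{2}|z|^{2\ell}}|^p\,dV(z)<\infty$; $L^\infty_{\alpha,\rho}$ is the space of measurable $f$ with $\|f\|_{L^\infty_{\alpha,\rho}}=\operatorname{ess\,sup}_{z}|f(z)|(1+|z|)^{\rho}e^{-\frac{\alpha}{2}|z|^{2\ell}}<\infty$. For $\alpha>0$, $F^p_{\alpha,\rho}$ is the space of entire functions on $\mathbb{C}^n$ belonging to $L^p_{\alpha,\rho}$, with the same norm. $E$ is the space of entire functions $f$ on $\mathbb{C}^n$ such that $|f(z)|=O(e^{\tau|z|^\ell})$ for some $\tau>0$ (depending on $f$). For $\gamma>0$, $\langle f,g\rangle_\gamma=\int_{\mathbb{C}^n}f(z)\overline{g(z)}e^{-\gamma|z|^{2\ell}}dV(z)$. A bilinear form $\Lambda:E\times E\to\mathbb{C}$ is called Hankel if $\Lambda(f,g)=\Lambda(fg,1)$ for all $f,g\in E$. $\|\Lambda\|$ is the least constant $C$ with $|\Lambda(f,g)|\le C\|f\|_{F^p_{\alpha,\rho}}\|g\|_{F^{p'}_{\beta,\eta}}$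 for $f,g\in E$, and $\|\widetilde\Lambda\|$ is the analogous norm on $L^p_{\alpha,\rho}\times L^{p'}_{\beta,\eta}$. $\Phi\lesssim\Psi$ means $\Phi\le C\Psi$ with a constant $C>0$ independent of the variables involved (in $|\Lambda(f,g)|\lesssim\dots$: independent of $f,g$; in the norm equivalences: depending only on $n,\ell,p,\alpha,\beta,\rho,\eta$). $\Phi\simeq\Psi$ means $\Phi\lesssim\Psi$ and $\Psi\lesssim\Phi$. *)

theory Defs
  imports "HOL-Analysis.Analysis" "HOL-Probability.Essential_Supremum"
begin

text \<open>Throughout, \<open>\<complex>\<^sup>n\<close> is \<open>complex ^ 'n\<close> with \<open>n = CARD('n)\<close>; its library norm is the
  Euclidean norm \<open>|z|\<close>. The parameter \<open>l\<close> stands for \<open>\<ell>\<close>.\<close>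

definition dV :: "(complex ^ 'n::finite) measure" where
  "dV = density lebesgue (\<lambda>_. ennreal (1 / measure lebesgue (ball (0 :: complex ^ 'n) 1)))"

definition conj_exponent :: "ennreal \<Rightarrow> ennreal" where
  "conj_exponent p =
    (if p = 1 then \<infinity> else if p = \<infinity> then 1 else ennreal (enn2real p / (enn2real p - 1)))"

definition weighted_abs ::
    "real \<Rightarrow> real \<Rightarrow> real \<Rightarrow> (complex ^ 'n::finite \<Rightarrow> complex) \<Rightarrow> complex ^ 'n \<Rightarrow> real" where
  "weighted_abs l \<alpha> \<rho> f z =
    norm (f z) * (1 + norm z) powr \<rho> * exp (- (\<alpha> / 2) * norm z powr (2 * l))"

text \<open>Elements are functions, not classes modulo null sets, so \<open>L_norm\<close> is only a seminorm on
  \<open>L_space\<close>. Outside \<open>L_space\<close> its value carries no meaning.\<close>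

definition L_space ::
    "real \<Rightarrow> ennreal \<Rightarrow> real \<Rightarrow> real \<Rightarrow> (complex ^ 'n::finite \<Rightarrow> complex) set" where
  "L_space l p \<alpha> \<rho> = {f \<in> borel_measurable dV.
    if p = \<infinity> then esssup dV (\<lambda>z. ennreal (weighted_abs l \<alpha> \<rho> f z)) < \<infinity>
    else (\<integral>\<^sup>+ z. ennreal (weighted_abs l \<alpha> \<rho> f z powr enn2real p) \<partial>dV) < \<infinity>}"

definition L_norm ::
    "real \<Rightarrow> ennreal \<Rightarrow> real \<Rightarrow> real \<Rightarrow> (complex ^ 'n::finite \<Rightarrow> complex) \<Rightarrow> real" where
  "L_norm l p \<alpha> \<rho> f =
    (if p = \<infinity> then enn2real (esssup dV (\<lambda>z. ennreal (weighted_abs l \<alpha> \<rho> f z)))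
     else enn2real (\<integral>\<^sup>+ z. ennreal (weighted_abs l \<alpha> \<rho> f z powr enn2real p) \<partial>dV)
            powr (1 / enn2real p))"

text \<open>Entire in several variables: the real Frechet derivative exists and is complex linear at
  every point.\<close>

definition entire :: "(complex ^ 'n::finite \<Rightarrow> complex) \<Rightarrow> bool" where
  "entire f \<longleftrightarrow>
    (\<forall>z. \<exists>D. (f has_derivative D) (at z) \<and> (\<forall>c v. D (c *s v) = c * D v))"

definition F_space ::
    "real \<Rightarrow> ennreal \<Rightarrow> real \<Rightarrow> real \<Rightarrow> (complex ^ 'n::finite \<Rightarrow> complex) set" where
  "F_space l p \<alpha> \<rho> = {f \<in> L_space l p \<alpha> \<rho>. entire f}"

definition E_space :: "real \<Rightarrow> (complex ^ 'n::finite \<Rightarrow> complex) set" where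
  "E_space l = {f. entire f \<and>
    (\<exists>\<tau>>0. (\<lambda>z. norm (f z)) \<in> O[at_infinity](\<lambda>z. exp (\<tau> * norm z powr l)))}"

text \<open>A Bochner integral, hence \<open>0\<close> by convention when the integrand is not integrable; on the
  function spaces used below it always converges absolutely.\<close>

definition pairing ::
    "real \<Rightarrow> real \<Rightarrow> (complex ^ 'n::finite \<Rightarrow> complex) \<Rightarrow> (complex ^ 'n \<Rightarrow> complex) \<Rightarrow> complex" where
  "pairing l \<gamma> f g =
    (LINT z|dV. f z * cnj (g z) * complex_of_real (exp (- \<gamma> * norm z powr (2 * l))))"

text \<open>A form on \<open>A \<times> B\<close> is a total function of which only the values on \<open>A\<close> and \<open>B\<close> matter.\<close>

definition bilinear_form_on ::
    "('a \<Rightarrow> complex) set \<Rightarrow> ('a \<Rightarrow> complex) set \<Rightarrow>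
     (('a \<Rightarrow> complex) \<Rightarrow> ('a \<Rightarrow> complex) \<Rightarrow> complex) \<Rightarrow> bool" where
  "bilinear_form_on A B \<Lambda> \<longleftrightarrow>
    (\<forall>f\<^sub>1\<in>A. \<forall>f\<^sub>2\<in>A. \<forall>g\<in>B. \<Lambda> (\<lambda>z. f\<^sub>1 z + f\<^sub>2 z) g = \<Lambda> f\<^sub>1 g + \<Lambda> f\<^sub>2 g) \<and>
    (\<forall>c. \<forall>f\<in>A. \<forall>g\<in>B. \<Lambda> (\<lambda>z. c * f z) g = c * \<Lambda> f g) \<and>
    (\<forall>f\<in>A. \<forall>g\<^sub>1\<in>B. \<forall>g\<^sub>2\<in>B. \<Lambda> f (\<lambda>z. g\<^sub>1 z + g\<^sub>2 z) = \<Lambda> f g\<^sub>1 + \<Lambda> f g\<^sub>2) \<and>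
    (\<forall>c. \<forall>f\<in>A. \<forall>g\<in>B. \<Lambda> f (\<lambda>z. c * g z) = c * \<Lambda> f g)"

definition hankel_form ::
    "real \<Rightarrow>
     ((complex ^ 'n::finite \<Rightarrow> complex) \<Rightarrow> (complex ^ 'n \<Rightarrow> complex) \<Rightarrow> complex) \<Rightarrow> bool" where
  "hankel_form l \<Lambda> \<longleftrightarrow>
    bilinear_form_on (E_space l) (E_space l) \<Lambda> \<and>
    (\<forall>f\<in>E_space l. \<forall>g\<in>E_space l. \<Lambda> f g = \<Lambda> (\<lambda>z. f z * g z) (\<lambda>_. 1))"

definition bounded_form_on ::
    "'a set \<Rightarrow> 'b set \<Rightarrow> ('a \<Rightarrow> real) \<Rightarrow> ('b \<Rightarrow> real) \<Rightarrow> ('a \<Rightarrow> 'b \<Rightarrow> complex) \<Rightarrow> bool" where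
  "bounded_form_on A B N M \<Lambda> \<longleftrightarrow>
    (\<exists>C>0. \<forall>f\<in>A. \<forall>g\<in>B. norm (\<Lambda> f g) \<le> C * N f * M g)"

text \<open>The least admissible constant. Meaningful only for bounded forms, for which the infimum is
  attained.\<close>

definition form_norm_on ::
    "'a set \<Rightarrow> 'b set \<Rightarrow> ('a \<Rightarrow> real) \<Rightarrow> ('b \<Rightarrow> real) \<Rightarrow> ('a \<Rightarrow> 'b \<Rightarrow> complex) \<Rightarrow> real" where
  "form_norm_on A B N M \<Lambda> =
    Inf {C. 0 \<le> C \<and> (\<forall>f\<in>A. \<forall>g\<in>B. norm (\<Lambda> f g) \<le> C * N f * M g)}"

end

theory Submission
  imports Defs "HOL-Complex_Analysis.Complex_Analysis" "HOL-Real_Asymp.Real_Asymp"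
begin

text \<open>Write \<open>\<gamma> = (\<alpha> + \<beta>) / 2\<close>, \<open>\<sigma> = \<rho> + \<eta>\<close>, let \<open>z \<cdot> w = \<Sum> z\<^sub>i cnj w\<^sub>i\<close>, and put \<open>T h = \<Lambda>(h, 1)\<close>, so that a
  Hankel form is \<open>\<Lambda>(f, g) = T(fg)\<close>. Everything rests on decomposing entire functions into
  homogeneous parts \<open>h = \<Sum> h\<^sub>k\<close>. Parts of different degree are orthogonal for every radial weight
  (rotate by a phase), and for parts of the same degree \<open>k\<close> a change of radial weight multiplies
  the pairing by a constant that depends only on \<open>k\<close> and the two weights. Comparison with the
  Gaussian weight, whose reproducing kernel is \<open>exp(w \<cdot> z)\<close>, gives
  \<open>\<langle>h, (\<cdot> \<cdot> w)\<^sup>k\<rangle>\<^sub>\<gamma> = (k! / M\<^sub>k) h\<^sub>k(w)\<close>, where the numbers \<open>M\<^sub>k\<close> (called \<open>moment\<close> below) are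
  proportional to \<open>\<gamma>\<^sup>s\<^sup>/\<^sup>l \<Gamma>(1 + s) / \<Gamma>(1 + s/l)\<close> with \<open>s = k + n\<close>.

  From \<open>b\<close> to a bounded form. The norm of \<open>b\<close> only gives
  \<open>|b(z)| \<le> ||b|| (1 + |z|)\<^sup>\<sigma> exp(\<gamma>/4 |z|\<^sup>2\<^sup>l)\<close>, so Hoelder's inequality does not apply to \<open>\<langle>fg, b\<rangle>\<^sub>\<gamma>\<close>
  directly. Doubling the weight multiplies the pairing in degree \<open>k\<close> by
  \<open>2\<^sup>-\<^sup>(\<^sup>k\<^sup>+\<^sup>n\<^sup>)\<^sup>/\<^sup>l\<close>, which a dilation undoes. Hence
  \<open>\<phi>(z) = 2\<^sup>n\<^sup>/\<^sup>l b(2\<^sup>1\<^sup>/\<^sup>l z) exp(-\<gamma> |z|\<^sup>2\<^sup>l)\<close> induces the same functional on \<open>E\<close> as \<open>b\<close>. The dilation multiplies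
  \<open>|z|\<^sup>2\<^sup>l\<close> by four, the exponentials cancel, \<open>|\<phi>(z)| \<le> C ||b|| (1 + |z|)\<^sup>\<sigma>\<close>, and Hoelder's
  inequality bounds the form on the Lebesgue spaces (\<open>bounded_form_of_symbol\<close>).

  From a bounded form to \<open>b\<close>. The kernel formula shows that the only candidate is
  \<open>b(w) = \<Sum> M\<^sub>k S\<^sub>k(w)\<close> with \<open>S\<^sub>k(w) = cnj T((\<cdot> \<cdot> w)\<^sup>k) / k!\<close>, and this \<open>b\<close> represents \<open>T\<close> as soon as
  its growth is under control. The series \<open>\<Sum> S\<^sub>k(w)\<close> sums to \<open>S(w) = cnj T(exp(\<cdot> \<cdot> w))\<close>; splitting
  this exponential into the product of the exponentials at \<open>\<alpha>w/(2\<gamma>)\<close> and \<open>\<beta>w/(2\<gamma>)\<close> makes the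
  hypothesis on \<open>\<Lambda>\<close> applicable, and computing the two norms around their common saddle point
  bounds \<open>|S(w)|\<close> by an explicit function of \<open>|w|\<close> (\<open>exp_norm_product_bound\<close>). To pass from \<open>S\<close> to \<open>b\<close>
  the point is that \<open>M\<^sub>k = \<integral> \<xi>\<^sup>k dN(\<xi>)\<close> for a positive measure \<open>N\<close> on the half line
  (\<open>moment_measure\<close>), so \<open>b(w) = \<integral> S(\<xi>w) dN(\<xi>)\<close>. The measure comes from
  Zolotarev's integral
  \<open>\<integral>\<^sub>0\<^sup>\<pi> Z(\<phi>)\<^sup>s d\<phi> = \<pi> \<Gamma>(1 + s) / (\<Gamma>(1 + \<theta>s) \<Gamma>(1 + (1 - \<theta>)s))\<close> with \<open>\<theta> = 1/l\<close>, the last Gamma factor being removed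
  by Euler's integral. Since \<open>N\<close> is positive, absolute values may be taken inside, and Laplace's
  method in the two variables of \<open>N\<close> yields exactly the growth that \<open>F\<^sup>\<infinity>\<close> asks for, with a constant
  proportional to the bound of \<open>\<Lambda>\<close> (\<open>symbol_of_bounded_form\<close>). Both passages are linear estimates, which gives
  the equivalences of norms.\<close>

section \<open>Lebesgue measure under affine maps and isometries\<close>

lemma nn_integral_lborel_affine:
  fixes f :: "'a::euclidean_space \<Rightarrow> ennreal"
  assumes [measurable]: "f \<in> borel_measurable borel" and "c \<noteq> 0"
  shows "(\<integral>\<^sup>+x. f (t + c *\<^sub>R x) \<partial>lborel) = ennreal (1 / \<bar>c\<bar> ^ DIM('a)) * (\<integral>\<^sup>+x. f x \<partial>lborel)"
proof -
  have "(\<integral>\<^sup>+x. f x \<partial>lborel) = (\<integral>\<^sup>+x. f x \<partial>density (distr lborel borel (\<lambda>x. t + c *\<^sub>R x)) (\<lambda>_. ennreal (\<bar>c\<bar> ^ DIM('a))))"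
    using lborel_affine[OF \<open>c \<noteq> 0\<close>, of t] by simp
  also have "\<dots> = ennreal (\<bar>c\<bar> ^ DIM('a)) * (\<integral>\<^sup>+x. f (t + c *\<^sub>R x) \<partial>lborel)"
    by (simp add: nn_integral_density nn_integral_distr nn_integral_cmult)
  finally show ?thesis
    using \<open>c \<noteq> 0\<close> by (simp add: mult.assoc[symmetric] ennreal_mult'[symmetric])
qed

lemma integral_lborel_affine:
  fixes f :: "'a::euclidean_space \<Rightarrow> 'b::{banach, second_countable_topology}"
  assumes [measurable]: "f \<in> borel_measurable borel" and "c \<noteq> 0"
  shows "(\<integral>x. f (t + c *\<^sub>R x) \<partial>lborel) = (1 / \<bar>c\<bar> ^ DIM('a)) *\<^sub>R (\<integral>x. f x \<partial>lborel)"
proof -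
  have "(\<integral>x. f x \<partial>lborel) = (\<integral>x. f x \<partial>density (distr lborel borel (\<lambda>x. t + c *\<^sub>R x)) (\<lambda>_. ennreal (\<bar>c\<bar> ^ DIM('a))))"
    using lborel_affine[OF \<open>c \<noteq> 0\<close>, of t] by simp
  also have "\<dots> = (\<bar>c\<bar> ^ DIM('a)) *\<^sub>R (\<integral>x. f (t + c *\<^sub>R x) \<partial>lborel)"
    by (simp add: integral_density integral_distr)
  finally show ?thesis
    using \<open>c \<noteq> 0\<close> by simp
qed

text \<open>By translation invariance, the integral of \<open>1\<^sub>A(Tx) 1\<^sub>B(y + Tx)\<close> over \<open>x\<close> and \<open>y\<close> is \<open>|T\<^sup>-\<^sup>1 A| |B|\<close>
  when \<open>y\<close> is integrated first and \<open>|A| |T\<^sup>-\<^sup>1 B|\<close> when \<open>x\<close> is. For the unit ball \<open>B\<close> the isometry gives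
  \<open>T\<^sup>-\<^sup>1 B = B\<close>, so the two factors \<open>|B|\<close> cancel.\<close>

lemma distr_lborel_linear_isometry:
  fixes T :: "'a::euclidean_space \<Rightarrow> 'a"
  assumes T: "linear T" and iso: "\<And>x. norm (T x) = norm x"
  shows "distr lborel borel T = lborel"
proof (rule measure_eqI)
  show "sets (distr lborel borel T) = sets lborel" by simp
next
  fix A assume "A \<in> sets (distr lborel borel T)"
  then have [measurable]: "A \<in> sets borel" by simp
  have [measurable]: "T \<in> borel_measurable borel"
    using T by (intro borel_measurable_continuous_onI linear_continuous_on linear_linear[THEN iffD2])
  have inj: "inj T"
    by (rule linear_inj_on_iff_eq_0[THEN iffD2, of T UNIV, simplified, rule_format, OF T])
       (use iso in \<open>metis norm_eq_zero\<close>)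
  then have surj: "surj T" using T linear_inj_imp_surj by blast
  define B where "B = ball (0::'a) 1"
  have [measurable]: "B \<in> sets borel" by (simp add: B_def)
  define I :: "'a set \<Rightarrow> 'a \<Rightarrow> ennreal" where "I = (\<lambda>S x. indicator S x)"
  have [measurable]: "I S \<in> borel_measurable borel" if "S \<in> sets borel" for S
    unfolding I_def using that by measurable
  have trans: "(\<integral>\<^sup>+x. f (x + t) \<partial>lborel) = (\<integral>\<^sup>+x. f x \<partial>lborel)"
    if "f \<in> borel_measurable borel" for f :: "'a \<Rightarrow> ennreal" and t
    using nn_integral_lborel_affine[OF that, of 1 t] by (simp add: add.commute)
  have refl: "(\<integral>\<^sup>+x. f (t - x) \<partial>lborel) = (\<integral>\<^sup>+x. f x \<partial>lborel)"
    if "f \<in> borel_measurable borel" for f :: "'a \<Rightarrow> ennreal" and t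
    using nn_integral_lborel_affine[OF that, of "-1" t] by simp
  have em: "emeasure (distr lborel borel T) S = (\<integral>\<^sup>+x. I S (T x) \<partial>lborel)"
    if [measurable]: "S \<in> sets borel" for S
  proof -
    have "emeasure (distr lborel borel T) S = (\<integral>\<^sup>+x. I S x \<partial>distr lborel borel T)"
      unfolding I_def by simp
    also have "\<dots> = (\<integral>\<^sup>+x. I S (T x) \<partial>lborel)"
      by (subst nn_integral_distr) auto
    finally show ?thesis .
  qed
  have em': "emeasure lborel S = (\<integral>\<^sup>+x. I S x \<partial>lborel)" if "S \<in> sets borel" for S
    unfolding I_def using that by simp
  have "(\<integral>\<^sup>+x. I A (T x) \<partial>lborel) * emeasure lborel B
      = (\<integral>\<^sup>+x. I A (T x) * (\<integral>\<^sup>+y. I B y \<partial>lborel) \<partial>lborel)"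
    by (simp add: em' nn_integral_multc)
  also have "\<dots> = (\<integral>\<^sup>+x. (\<integral>\<^sup>+y. I A (T x) * I B (y + T x) \<partial>lborel) \<partial>lborel)"
  proof (rule nn_integral_cong)
    fix x
    have "(\<integral>\<^sup>+y. I B y \<partial>lborel) = (\<integral>\<^sup>+y. I B (y + T x) \<partial>lborel)"
      by (rule trans[symmetric]) measurable
    then show "I A (T x) * (\<integral>\<^sup>+y. I B y \<partial>lborel) = (\<integral>\<^sup>+y. I A (T x) * I B (y + T x) \<partial>lborel)"
      by (simp add: nn_integral_cmult)
  qed
  also have "\<dots> = (\<integral>\<^sup>+y. (\<integral>\<^sup>+x. I A (T x) * I B (y + T x) \<partial>lborel) \<partial>lborel)"
    by (rule lborel_pair.Fubini') measurable
  also have "\<dots> = (\<integral>\<^sup>+y. (\<integral>\<^sup>+x. I A (T x - y) * I B (T x) \<partial>lborel) \<partial>lborel)"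
  proof (rule nn_integral_cong)
    fix y
    obtain y' where y': "y = T y'" using surj by (metis surjD)
    have "(\<integral>\<^sup>+x. I A (T x) * I B (y + T x) \<partial>lborel)
        = (\<integral>\<^sup>+x. I A (T (x + y') - y) * I B (T (x + y')) \<partial>lborel)"
      by (intro nn_integral_cong) (simp add: y' linear_add[OF T] add.commute)
    also have "\<dots> = (\<integral>\<^sup>+x. I A (T x - y) * I B (T x) \<partial>lborel)"
      by (rule trans) measurable
    finally show "(\<integral>\<^sup>+x. I A (T x) * I B (y + T x) \<partial>lborel) = (\<integral>\<^sup>+x. I A (T x - y) * I B (T x) \<partial>lborel)" .
  qed
  also have "\<dots> = (\<integral>\<^sup>+x. (\<integral>\<^sup>+y. I A (T x - y) * I B (T x) \<partial>lborel) \<partial>lborel)"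
    by (rule lborel_pair.Fubini') measurable
  also have "\<dots> = (\<integral>\<^sup>+x. (\<integral>\<^sup>+y. I A y \<partial>lborel) * I B (T x) \<partial>lborel)"
    by (rule nn_integral_cong) (simp add: nn_integral_multc refl)
  also have "\<dots> = emeasure lborel A * (\<integral>\<^sup>+x. I B (T x) \<partial>lborel)"
    by (simp add: em' nn_integral_cmult)
  also have "(\<integral>\<^sup>+x. I B (T x) \<partial>lborel) = emeasure lborel B"
    by (simp add: em' I_def B_def iso indicator_def)
  finally have "emeasure lborel B * (\<integral>\<^sup>+x. I A (T x) \<partial>lborel) = emeasure lborel B * emeasure lborel A"
    by (simp add: mult.commute)
  moreover have "emeasure lborel B \<noteq> 0"
    using content_ball_pos[of 1 "0::'a"] unfolding B_def measure_def by (metis enn2real_0 less_irrefl zero_less_one)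
  moreover have "emeasure lborel B \<noteq> \<infinity>"
    unfolding B_def using emeasure_lborel_ball_finite[of "0::'a" 1] by (metis less_irrefl)
  ultimately show "emeasure (distr lborel borel T) A = emeasure lborel A"
    unfolding em[OF \<open>A \<in> sets borel\<close>] by (metis ennreal_mult_cancel_left infinity_ennreal_def)
qed

section \<open>Complex coordinate space\<close>

definition cdot :: "complex ^ 'n::finite \<Rightarrow> complex ^ 'n \<Rightarrow> complex" where
  "cdot z w = (\<Sum>i\<in>UNIV. z $ i * cnj (w $ i))"

lemma norm_scalar_mult [simp]: "norm (c *s v) = norm c * norm (v :: complex ^ 'n::finite)"
  by (simp add: norm_vec_def vector_scalar_mult_def norm_mult L2_set_right_distrib)

lemma scalar_mult_of_real: "of_real r *s v = r *\<^sub>R (v :: complex ^ 'n::finite)"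
  by (simp add: vec_eq_iff scaleR_conv_of_real[where 'a=complex] del: of_real_mult)

lemma Re_cdot: "Re (cdot z w) = inner z w"
  by (simp add: cdot_def inner_vec_def inner_complex_def)

lemma cdot_scale_left: "cdot (c *s z) w = c * cdot z w"
  by (simp add: cdot_def sum_distrib_left mult.assoc)

lemma cdot_scale_right: "cdot z (c *s w) = cnj c * cdot z w"
  by (simp add: cdot_def sum_distrib_left algebra_simps)

lemma cdot_scaleR_right: "cdot z (r *\<^sub>R w) = r * cdot z w"
  using cdot_scale_right[of z "of_real r" w] by (simp add: scalar_mult_of_real)

lemma cdot_scaleR_left: "cdot (r *\<^sub>R z) w = r * cdot z w"
  using cdot_scale_left[of "of_real r" z w] by (simp add: scalar_mult_of_real)

lemma cdot_add_left: "cdot (z + z') w = cdot z w + cdot z' w"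
  by (simp add: cdot_def sum.distrib algebra_simps)

lemma cdot_add_right: "cdot z (w + w') = cdot z w + cdot z w'"
  by (simp add: cdot_def sum.distrib algebra_simps)

lemma cnj_cdot: "cnj (cdot z w) = cdot w z"
  by (simp add: cdot_def mult.commute)

lemma cdot_zero [simp]: "cdot 0 w = 0" "cdot w 0 = 0"
  by (simp_all add: cdot_def)

lemma norm_cdot_le: "norm (cdot z w) \<le> norm z * norm w"
proof (cases "cdot z w = 0")
  case False
  define u where "u = cnj (sgn (cdot z w))"
  have u: "norm u = 1" using False by (simp add: u_def norm_sgn)
  have "complex_of_real (norm (cdot z w)) = u * cdot z w"
    using False by (simp add: u_def sgn_eq complex_norm_square[symmetric] field_simps power2_eq_square)
  then have "norm (cdot z w) = Re (cdot (u *s z) w)"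
    by (metis Re_complex_of_real cdot_scale_left)
  also have "\<dots> \<le> norm (u *s z) * norm w"
    unfolding Re_cdot by (rule norm_cauchy_schwarz)
  finally show ?thesis using u by simp
qed simp

lemma bounded_linear_cdot_left: "bounded_linear (\<lambda>z. cdot z w)"
  by (rule bounded_linear_intro[where K = "norm w"])
     (auto simp: cdot_add_left cdot_scaleR_left norm_cdot_le scaleR_conv_of_real[where 'a=complex])

lemma continuous_cdot_left [continuous_intros]:
  "continuous_on S f \<Longrightarrow> continuous_on S (\<lambda>z. cdot (f z) w)"
  by (rule bounded_linear.continuous_on[OF bounded_linear_cdot_left])

lemma bounded_linear_cdot_right: "bounded_linear (\<lambda>w. cdot z w)"
  by (rule bounded_linear_intro[where K = "norm z"])
     (auto simp: cdot_add_right cdot_scaleR_right scaleR_conv_of_real[where 'a=complex] norm_cdot_le mult.commute[of _ "norm z"])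

lemma continuous_cdot_right [continuous_intros]:
  "continuous_on S f \<Longrightarrow> continuous_on S (\<lambda>w. cdot z (f w))"
  by (rule bounded_linear.continuous_on[OF bounded_linear_cdot_right])

lemma linear_scalar_mult: "linear (\<lambda>z. c *s (z :: complex ^ 'n::finite))"
  by (rule linearI) (simp_all add: vec_eq_iff algebra_simps)

lemma borel_measurable_cdot [measurable]:
  "(\<lambda>z. cdot z w) \<in> borel_measurable borel" "(\<lambda>z. cdot w z) \<in> borel_measurable borel"
  by (auto intro!: borel_measurable_continuous_onI continuous_intros)

lemma borel_measurable_scalar_mult [measurable]:
  "(\<lambda>z. c *s (z :: complex ^ 'n::finite)) \<in> borel_measurable borel"
  by (intro borel_measurable_continuous_onI linear_continuous_on linear_linear[THEN iffD2] linear_scalar_mult)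

lemma integral_lborel_rotate:
  fixes f :: "complex ^ 'n::finite \<Rightarrow> complex"
  assumes [measurable]: "f \<in> borel_measurable borel" and c: "norm c = 1"
  shows "(\<integral>z. f (c *s z) \<partial>lborel) = (\<integral>z. f z \<partial>lborel)"
proof -
  have "distr lborel borel (\<lambda>z. c *s z) = (lborel :: (complex ^ 'n) measure)"
    by (rule distr_lborel_linear_isometry[OF linear_scalar_mult]) (simp add: c)
  then have "(\<integral>z. f z \<partial>lborel) = (\<integral>z. f z \<partial>distr lborel borel (\<lambda>z. c *s z))" by simp
  also have "\<dots> = (\<integral>z. f (c *s z) \<partial>lborel)"
    by (subst integral_distr) auto
  finally show ?thesis ..
qed

subsection \<open>The normalised measure\<close>

definition ball_vol :: "'n::finite itself \<Rightarrow> real" where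
  "ball_vol _ = measure lborel (ball (0 :: complex ^ 'n) 1)"

lemma ball_vol_pos: "ball_vol TYPE('n::finite) > 0"
  unfolding ball_vol_def using content_ball_pos[of 1 "0 :: complex ^ 'n"] by (simp add: measure_def)

lemma dV_eq: "(dV :: (complex ^ 'n::finite) measure) = density lebesgue (\<lambda>_. ennreal (1 / ball_vol TYPE('n)))"
  unfolding dV_def ball_vol_def by simp

lemma sets_dV [simp]: "sets dV = sets lebesgue" and space_dV [simp]: "space dV = UNIV"
  by (simp_all add: dV_def)

lemma measurable_dV_borel [measurable (raw)]:
  "f \<in> borel_measurable borel \<Longrightarrow> f \<in> borel_measurable dV"
  by (simp add: dV_def measurable_completion)

lemma nn_integral_dV:
  fixes f :: "complex ^ 'n::finite \<Rightarrow> ennreal"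
  assumes [measurable]: "f \<in> borel_measurable borel"
  shows "(\<integral>\<^sup>+z. f z \<partial>dV) = ennreal (1 / ball_vol TYPE('n)) * (\<integral>\<^sup>+z. f z \<partial>lborel)"
proof -
  have [measurable]: "f \<in> borel_measurable lebesgue" by (simp add: measurable_completion)
  show ?thesis unfolding dV_eq
    by (simp add: nn_integral_density nn_integral_cmult nn_integral_completion)
qed

lemma integral_dV:
  fixes f :: "complex ^ 'n::finite \<Rightarrow> complex"
  assumes [measurable]: "f \<in> borel_measurable borel"
  shows "(\<integral>z. f z \<partial>dV) = (1 / ball_vol TYPE('n)) *\<^sub>R (\<integral>z. f z \<partial>lborel)"
proof -
  have [measurable]: "f \<in> borel_measurable lebesgue" by (simp add: measurable_completion)
  have "(\<integral>z. f z \<partial>dV) = (\<integral>z. (1 / ball_vol TYPE('n)) *\<^sub>R f z \<partial>lebesgue)"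
    unfolding dV_eq using ball_vol_pos[where 'n='n] by (subst integral_density) auto
  then show ?thesis by (simp add: integral_completion)
qed

lemma AE_dV: "(AE z in dV. P z) \<longleftrightarrow> (AE z in lebesgue. P (z :: complex ^ 'n::finite))"
  unfolding dV_eq using ball_vol_pos[where 'n='n] by (subst AE_density) (auto simp: ennreal_zero_less_divide)

section \<open>Entire functions\<close>

lemma entireD:
  assumes "entire f"
  obtains D where "\<And>z. (f has_derivative D z) (at z)" "\<And>z c v. D z (c *s v) = c * D z v"
  using assms unfolding entire_def by metis

lemma entireI:
  assumes "\<And>z. (f has_derivative D z) (at z)" "\<And>z c v. D z (c *s v) = c * D z v"
  shows "entire f"
  using assms unfolding entire_def by blast

lemma entire_continuous_on: "entire f \<Longrightarrow> continuous_on S f"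
  by (meson continuous_at_imp_continuous_on entireD has_derivative_continuous)

lemma entire_borel [measurable_dest]: "entire f \<Longrightarrow> f \<in> borel_measurable borel"
  by (simp add: borel_measurable_continuous_onI entire_continuous_on)

lemma entire_const: "entire (\<lambda>z. c)"
  by (rule entireI[where D = "\<lambda>_ _. 0"]) auto

lemma entire_cdot: "entire (\<lambda>z. cdot z w)"
  by (rule entireI[where D = "\<lambda>_ z. cdot z w"])
     (auto simp: bounded_linear_imp_has_derivative[OF bounded_linear_cdot_left] cdot_scale_left)

lemma entire_add: "entire f \<Longrightarrow> entire g \<Longrightarrow> entire (\<lambda>z. f z + g z)"
  by (elim entireD, rule entireI, rule has_derivative_add) (auto simp: algebra_simps)

lemma entire_mult: "entire f \<Longrightarrow> entire g \<Longrightarrow> entire (\<lambda>z. f z * g z)"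
  by (elim entireD, rule entireI, rule has_derivative_mult) (assumption, assumption, simp add: algebra_simps)

lemma entire_cmult: "entire f \<Longrightarrow> entire (\<lambda>z. c * f z)"
  by (rule entire_mult[OF entire_const])

lemma entire_diff: "entire f \<Longrightarrow> entire g \<Longrightarrow> entire (\<lambda>z. f z - g z)"
  using entire_add[of f "\<lambda>z. - 1 * g z"] entire_cmult[of g "-1"] by simp

lemma entire_sum: "(\<And>i. i \<in> I \<Longrightarrow> entire (f i)) \<Longrightarrow> entire (\<lambda>z. \<Sum>i\<in>I. f i z)"
  by (induction I rule: infinite_finite_induct) (auto intro: entire_const entire_add)

lemma entire_power: "entire f \<Longrightarrow> entire (\<lambda>z. f z ^ k)"
  by (induction k) (auto intro: entire_const entire_mult)

lemma entire_exp: assumes "entire f" shows "entire (\<lambda>z. exp (f z))"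
proof -
  obtain D where D: "\<And>z. (f has_derivative D z) (at z)" "\<And>z c v. D z (c *s v) = c * D z v"
    using entireD[OF assms] by metis
  show ?thesis
  proof (rule entireI[where D = "\<lambda>z v. exp (f z) * D z v"])
    show "((\<lambda>z. exp (f z)) has_derivative (\<lambda>v. exp (f z) * D z v)) (at z)" for z
      using has_derivative_compose[OF D(1), of exp "(*) (exp (f z))"] DERIV_exp[of "f z"]
      by (simp add: has_field_derivative_def)
  qed (simp add: D algebra_simps)
qed

lemma entire_affine: assumes "entire f" shows "entire (\<lambda>z. f (c *s z + w))"
proof -
  obtain D where D: "\<And>z. (f has_derivative D z) (at z)" "\<And>z c v. D z (c *s v) = c * D z v"
    using entireD[OF assms] by metis
  have "bounded_linear (\<lambda>z. c *s z)" for c :: complex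
    using linear_scalar_mult linear_linear by blast
  then have "((\<lambda>z. c *s z + w) has_derivative (\<lambda>v. c *s v)) (at z)" for z
    by (auto intro!: derivative_eq_intros bounded_linear_imp_has_derivative)
  then have "((\<lambda>z. f (c *s z + w)) has_derivative (\<lambda>v. D (c *s z + w) (c *s v))) (at z)" for z
    using D(1) by (rule has_derivative_compose)
  then show ?thesis
    by (rule entireI) (simp add: D)
qed

lemma entire_line_derivative:
  fixes f :: "complex ^ 'n::finite \<Rightarrow> complex"
  assumes D: "\<And>z. (f has_derivative D z) (at z)" "\<And>z c v. D z (c *s v) = c * D z v"
  shows "((\<lambda>t. f (z + t *s v)) has_field_derivative D (z + t *s v) v) (at t)"
proof -
  have "bounded_linear (\<lambda>t. t *s v)"
    by (rule bounded_linear_intro[where K = "norm v"]) (auto simp: vec_eq_iff algebra_simps)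
  then have "((\<lambda>t. z + t *s v) has_derivative (\<lambda>s. s *s v)) (at t)"
    by (auto intro!: derivative_eq_intros bounded_linear_imp_has_derivative)
  then have "((\<lambda>t. f (z + t *s v)) has_derivative (\<lambda>s. D (z + t *s v) (s *s v))) (at t)"
    using D(1) by (rule has_derivative_compose)
  then show ?thesis by (simp add: has_field_derivative_def D(2) mult.commute[of _ "D _ _"])
qed

lemma entire_line_holomorphic:
  assumes "entire f" shows "(\<lambda>t. f (z + t *s v)) holomorphic_on S"
  using entire_line_derivative[of f] assms unfolding entire_def
  by (metis (no_types, lifting) entireD[OF assms] field_differentiable_at_within field_differentiable_def holomorphic_onI)

lemma entire_radial_holomorphic:
  assumes "entire f" shows "(\<lambda>t. f (t *s v)) holomorphic_on S"
  using entire_line_holomorphic[OF assms, of 0 v] by simp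

text \<open>Along complex lines Weierstrass' theorem applies, and Cauchy's estimate on the disc of radius
  \<open>1/|h|\<close> turns uniform convergence of the functions into uniform convergence of the directional
  derivatives, after which differentiation and limit may be exchanged.\<close>

lemma entire_uniform_limit:
  fixes F :: "nat \<Rightarrow> complex ^ 'n::finite \<Rightarrow> complex"
  assumes ent: "\<And>m. entire (F m)" and lim: "\<And>R. uniform_limit (cball 0 R) F f sequentially"
  shows "entire f"
proof -
  have "\<exists>D. \<forall>z. (F m has_derivative D z) (at z) \<and> (\<forall>c v. D z (c *s v) = c * D z v)" for m
    using ent[of m] unfolding entire_def by metis
  then obtain D where D: "\<And>m z. (F m has_derivative D m z) (at z)"
      "\<And>m z c v. D m z (c *s v) = c * D m z v"
    by metis
  have lim_pt: "(\<lambda>m. F m z) \<longlonglongrightarrow> f z" for z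
    using tendsto_uniform_limitI[OF lim[of "norm z"], of z] by simp
  have hol: "(\<lambda>t. f (z + t *s v)) holomorphic_on UNIV" for z v
  proof (rule holomorphic_uniform_sequence[where f = "\<lambda>m t. F m (z + t *s v)"])
    show "(\<lambda>t. F m (z + t *s v)) holomorphic_on UNIV" for m
      by (rule entire_line_holomorphic[OF ent])
    fix x :: complex
    have "norm (z + t *s v) \<le> norm z + (norm x + 1) * norm v" if "t \<in> cball x 1" for t
    proof -
      have "norm t \<le> norm x + 1"
        using that norm_triangle_ineq2[of t x] by (simp add: dist_norm norm_minus_commute)
      then show ?thesis
        using norm_triangle_ineq[of z "t *s v"] mult_right_mono[of "norm t" "norm x + 1" "norm v"] by simp
    qed
    then have "(\<lambda>t. z + t *s v) ` cball x 1 \<subseteq> cball 0 (norm z + (norm x + 1) * norm v)" by auto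
    then have "uniform_limit (cball x 1) (\<lambda>m t. F m (z + t *s v)) (\<lambda>t. f (z + t *s v)) sequentially"
      using lim[of "norm z + (norm x + 1) * norm v"] unfolding uniform_limit_iff
      by (auto elim!: eventually_mono simp: image_subset_iff)
    then show "\<exists>d>0. cball x d \<subseteq> UNIV \<and> uniform_limit (cball x d) (\<lambda>m t. F m (z + t *s v)) (\<lambda>t. f (z + t *s v)) sequentially"
      by (intro exI[of _ 1]) auto
  qed auto
  define g' where "g' x v = deriv (\<lambda>t. f (x + t *s v)) 0" for x v
  have lin: "g' x (c *s v) = c * g' x v" for x c v
  proof -
    have "(\<lambda>t. f (x + t *s v)) field_differentiable at (c * 0)"
      using hol holomorphic_on_imp_differentiable_at by blast
    from deriv_compose_linear[OF this] show ?thesis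
      unfolding g'_def by (simp add: vector_smult_assoc mult.commute[of c])
  qed
  show ?thesis
  proof (rule entireI[where D = g'])
    fix z :: "complex ^ 'n"
    have "\<exists>g. \<forall>x\<in>ball z 1. (\<lambda>n. F n x) \<longlonglongrightarrow> g x \<and> (g has_derivative g' x) (at x within ball z 1)"
    proof (rule has_derivative_sequence[where ?x0.0 = z and f' = D and l = "f z"])
      show "(F n has_derivative D n x) (at x within ball z 1)" for n x
        using D(1) has_derivative_at_withinI by blast
      fix e :: real assume e: "e > 0"
      have "\<forall>\<^sub>F n in sequentially. \<forall>x\<in>cball 0 (norm z + 2). dist (F n x) (f x) < e"
        using lim[of "norm z + 2"] e unfolding uniform_limit_iff by auto
      then show "\<forall>\<^sub>F n in sequentially. \<forall>x\<in>ball z 1. \<forall>h. norm (D n x h - g' x h) \<le> e * norm h"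
      proof eventually_elim
        case (elim n)
        show ?case
        proof (intro ballI allI)
          fix x h assume x: "x \<in> ball z 1"
          show "norm (D n x h - g' x h) \<le> e * norm h"
          proof (cases "h = 0")
            case True
            then have "D n x h = 0" "g' x h = 0"
              using D(2)[of n x 0 h] lin[of x 0 h] by simp_all
            then show ?thesis by (simp add: True)
          next
            case False
            define \<phi> where "\<phi> t = F n (x + t *s h) - f (x + t *s h)" for t
            have hF: "(\<lambda>t. F n (x + t *s h)) holomorphic_on UNIV"
              by (rule entire_line_holomorphic[OF ent])
            have h\<phi>: "\<phi> holomorphic_on S" for S
              unfolding \<phi>_def
              by (rule holomorphic_on_subset[of _ UNIV]) (use hol hF in \<open>auto intro!: holomorphic_intros\<close>)
            have "(\<lambda>t. F n (x + t *s h)) field_differentiable at 0" "(\<lambda>t. f (x + t *s h)) field_differentiable at 0"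
              using hol[of x h] hF holomorphic_on_imp_differentiable_at by blast+
            moreover have "deriv (\<lambda>t. F n (x + t *s h)) 0 = D n x h"
              using DERIV_imp_deriv[OF entire_line_derivative[of "F n" "D n" x h 0]] D by simp
            ultimately have der: "deriv \<phi> 0 = D n x h - g' x h"
              unfolding \<phi>_def g'_def by (subst deriv_diff) auto
            have "norm ((deriv ^^ 1) \<phi> 0) \<le> fact 1 * e / (1 / norm h) ^ 1"
            proof (rule Cauchy_inequality)
              show "\<phi> holomorphic_on ball 0 (1 / norm h)" "continuous_on (cball 0 (1 / norm h)) \<phi>"
                using h\<phi> holomorphic_on_imp_continuous_on by blast+
              show "0 < 1 / norm h" using False by simp
              fix t :: complex assume "norm (0 - t) = 1 / norm h"
              then have "norm (t *s h) = 1" using False by (simp add: field_simps)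
              then have "norm (x + t *s h) \<le> norm z + 2"
                using x norm_triangle_ineq[of x "t *s h"] norm_triangle_ineq2[of x z]
                by (simp add: dist_norm norm_minus_commute)
              then show "norm (\<phi> t) \<le> e" using elim unfolding \<phi>_def by (force simp: dist_norm)
            qed
            then show ?thesis by (simp add: der)
          qed
        qed
      qed
    qed (use lim_pt in auto)
    then obtain g where g: "\<And>x. x \<in> ball z 1 \<Longrightarrow> (\<lambda>n. F n x) \<longlonglongrightarrow> g x"
      "\<And>x. x \<in> ball z 1 \<Longrightarrow> (g has_derivative g' x) (at x within ball z 1)" by blast
    have eq: "g x = f x" if "x \<in> ball z 1" for x
      using LIMSEQ_unique[OF g(1)[OF that] lim_pt] .
    have "(g has_derivative g' z) (at z)"
      using g(2)[of z] by (simp add: at_within_open[of z "ball z 1"])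
    then show "(f has_derivative g' z) (at z)"
      by (rule has_derivative_transform_within_open[where s = "ball z 1"]) (auto simp: eq)
  qed (rule lin)
qed

subsection \<open>Homogeneous parts\<close>

text \<open>The part of degree \<open>k\<close> of the Taylor expansion at the origin, read off from the restriction of
  \<open>f\<close> to the complex line through \<open>z\<close>.\<close>

definition hpart :: "nat \<Rightarrow> (complex ^ 'n::finite \<Rightarrow> complex) \<Rightarrow> complex ^ 'n \<Rightarrow> complex" where
  "hpart k f z = (deriv ^^ k) (\<lambda>t. f (t *s z)) 0 / fact k"

lemma hpart_sums:
  assumes "entire f" shows "(\<lambda>k. hpart k f z * t ^ k) sums f (t *s z)"
  using holomorphic_power_series[OF entire_radial_holomorphic[OF assms], where r = "norm t + 1" and z = 0 and w = t]
  unfolding hpart_def by simp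

lemma hpart_sums_1: "entire f \<Longrightarrow> (\<lambda>k. hpart k f z) sums f z"
  using hpart_sums[of f z 1] by simp

lemma hpart_homogeneous:
  assumes "entire f" shows "hpart k f (c *s z) = c ^ k * hpart k f z"
proof -
  have "(deriv ^^ k) (\<lambda>t. (\<lambda>s. f (s *s z)) (c * t)) 0 = c ^ k * (deriv ^^ k) (\<lambda>s. f (s *s z)) (c * 0)"
    by (rule higher_deriv_compose_linear[where T = UNIV and S = UNIV]) (auto intro: entire_radial_holomorphic assms)
  then show ?thesis
    unfolding hpart_def by (simp add: vector_smult_assoc mult.commute[of _ c])
qed

lemma norm_hpart_le:
  assumes "entire f" and "r > 0" and "\<And>t. norm t = r \<Longrightarrow> norm (f (t *s z)) \<le> B"
  shows "norm (hpart k f z) \<le> B / r ^ k"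
proof -
  have "norm ((deriv ^^ k) (\<lambda>t. f (t *s z)) 0) \<le> fact k * B / r ^ k"
    by (rule Cauchy_inequality)
       (use assms in \<open>auto intro!: entire_radial_holomorphic holomorphic_on_imp_continuous_on\<close>)
  then show ?thesis
    by (simp add: hpart_def norm_divide field_simps)
qed

lemma power_series_unique:
  fixes a b :: "nat \<Rightarrow> complex"
  assumes "\<And>t. (\<lambda>k. a k * t ^ k) sums f t" "\<And>t. (\<lambda>k. b k * t ^ k) sums f t"
  shows "a = b"
proof (rule ext)
  fix k
  have "(\<lambda>k. (a k - b k) * t ^ k) sums 0" for t
    using sums_diff[OF assms(1)[of t] assms(2)[of t]] by (simp add: algebra_simps)
  note s = this
  have "f has_fps_expansion Abs_fps a" if "\<And>t. (\<lambda>k. a k * t ^ k) sums f t" for a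
  proof -
    have "fps_conv_radius (Abs_fps a) \<ge> 1"
      unfolding fps_conv_radius_def
      by (rule conv_radius_geI_ex') (use that sums_summable in auto)
    then have "fps_conv_radius (Abs_fps a) > 0" by (rule less_le_trans[rotated]) simp
    moreover have "eval_fps (Abs_fps a) z = f z" for z
      using that[of z] by (simp add: eval_fps_def sums_iff)
    ultimately show ?thesis by (simp add: has_fps_expansion_def)
  qed
  from this[OF assms(1)] this[OF assms(2)] show "a k = b k"
    by (metis fps_expansion_unique_complex fps_nth_Abs_fps)
qed

lemma hpart_unique:
  assumes "entire f" "\<And>t. (\<lambda>k. a k * t ^ k) sums f (t *s z)"
  shows "hpart k f z = a k"
  using power_series_unique[of "\<lambda>k. hpart k f z" "\<lambda>t. f (t *s z)" a] hpart_sums[OF assms(1)] assms(2)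
  by metis

lemma norm_hpart_series_tail:
  assumes "entire f" and B: "\<And>\<zeta>. norm \<zeta> \<le> r * norm z \<Longrightarrow> norm (f \<zeta>) \<le> B" and "r > 1" and "B \<ge> 0"
  shows "norm (f z - (\<Sum>k<N. hpart k f z)) \<le> B * (1/r) ^ N * (r / (r - 1))"
proof -
  have h: "norm (hpart k f z) \<le> B * (1/r) ^ k" for k
    using norm_hpart_le[OF assms(1), of r z B k] B \<open>r > 1\<close> by (simp add: power_one_over divide_inverse power_inverse)
  have "(\<lambda>k. hpart (k + N) f z) sums (f z - (\<Sum>k<N. hpart k f z))"
    using hpart_sums_1[OF assms(1)] by (rule sums_split_initial_segment)
  moreover have g: "(\<lambda>k. B * (1/r) ^ N * (1/r) ^ k) sums (B * (1/r) ^ N * (1 / (1 - 1/r)))"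
    by (intro sums_mult geometric_sums) (use \<open>r > 1\<close> in auto)
  ultimately have "norm (f z - (\<Sum>k<N. hpart k f z)) \<le> B * (1/r) ^ N * (1 / (1 - 1/r))"
    using h by (metis (no_types, lifting) ab_semigroup_mult_class.mult_ac(1) add.commute norm_suminf_le power_add sums_iff)
  then show ?thesis using \<open>r > 1\<close> by (simp add: field_simps)
qed

text \<open>Derivatives in \<open>t\<close> hide the dependence on \<open>z\<close>. It becomes accessible because the part of
  degree \<open>k\<close> is the locally uniform limit of
  \<open>(f(tz) - \<Sum>\<^sub>j\<^sub><\<^sub>k t\<^sup>j f\<^sub>j(z)) / t\<^sup>k\<close> as \<open>t \<rightarrow> 0\<close>.\<close>

lemma entire_hpart:
  fixes f :: "complex ^ 'n::finite \<Rightarrow> complex"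
  assumes f: "entire f" shows "entire (hpart k f)"
proof (induction k rule: less_induct)
  case (less k)
  \<comment> \<open>Points at most \<open>1/2\<close>, so that the tail estimate can be used with radius \<open>2/\<tau>\<close>.\<close>
  define \<tau> :: "nat \<Rightarrow> real" where "\<tau> m = 1 / of_nat (Suc (Suc m))" for m :: nat
  define F :: "nat \<Rightarrow> complex ^ 'n \<Rightarrow> complex" where "F m z = (f (of_real (\<tau> m) *s z) - (\<Sum>j<k. of_real (\<tau> m) ^ j * hpart j f z)) / of_real (\<tau> m) ^ k" for m z
  have \<tau>: "0 < \<tau> m" "\<tau> m \<le> 1 / 2" for m by (auto simp: \<tau>_def field_simps)
  show ?case
  proof (rule entire_uniform_limit[where F = F])
    fix m
    show "entire (F m)"
      unfolding F_def divide_inverse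
      using entire_affine[OF f, of "of_real (\<tau> m)" 0] less
      by (subst mult.commute) (auto intro!: entire_cmult entire_diff entire_sum)
  next
    fix R
    obtain B where B: "\<And>\<zeta>. norm \<zeta> \<le> 2 * \<bar>R\<bar> \<Longrightarrow> norm (f \<zeta>) \<le> B" and B0: "B \<ge> 0"
    proof -
      have "bounded (f ` cball 0 (2 * \<bar>R\<bar>))"
        by (intro compact_imp_bounded compact_continuous_image entire_continuous_on f compact_cball)
      then obtain B where "B > 0" "\<forall>\<zeta>\<in>cball 0 (2 * \<bar>R\<bar>). norm (f \<zeta>) \<le> B"
        unfolding bounded_pos by auto
      with that[of B] show thesis by force
    qed
    have bd: "norm (F m z - hpart k f z) \<le> \<tau> m * (2 * B)" if z: "norm z \<le> R" for m z
    proof -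
      define t where "t = complex_of_real (\<tau> m)"
      have t: "t \<noteq> 0" "norm t = \<tau> m" using \<tau>(1)[of m] by (auto simp: t_def)
      have "norm (f (t *s z) - (\<Sum>j<Suc k. hpart j f (t *s z)))
          \<le> B * (1 / (2 / \<tau> m)) ^ Suc k * ((2 / \<tau> m) / (2 / \<tau> m - 1))"
      proof (rule norm_hpart_series_tail[OF f])
        fix \<zeta> :: "complex ^ 'n" assume "norm \<zeta> \<le> 2 / \<tau> m * norm (t *s z)"
        also have "\<dots> \<le> 2 * \<bar>R\<bar>" using t \<tau>(1)[of m] z by simp
        finally show "norm (f \<zeta>) \<le> B" by (rule B)
      next
        show "1 < 2 / \<tau> m" using \<tau>[of m] by (simp add: field_simps)
      qed (rule B0)
      also have "(2 / \<tau> m) / (2 / \<tau> m - 1) \<le> 2"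
        using \<tau>[of m] by (simp add: field_simps)
      also have "B * (1 / (2 / \<tau> m)) ^ Suc k * 2 \<le> B * \<tau> m ^ Suc k * 2"
        using B0 \<tau>[of m] by (intro mult_right_mono mult_left_mono power_mono) auto
      finally have a: "norm (f (t *s z) - (\<Sum>j<Suc k. hpart j f (t *s z))) \<le> B * \<tau> m ^ Suc k * 2"
        using B0 \<tau>(1)[of m] by (simp add: mult_left_mono)
      have "F m z - hpart k f z = (f (t *s z) - (\<Sum>j<Suc k. hpart j f (t *s z))) / t ^ k"
        unfolding F_def t_def[symmetric] hpart_homogeneous[OF f] using t(1) by (simp add: field_simps)
      also have "norm \<dots> = norm (f (t *s z) - (\<Sum>j<Suc k. hpart j f (t *s z))) / \<tau> m ^ k"
        by (simp add: norm_divide norm_power t)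
      also have "\<dots> \<le> B * \<tau> m ^ Suc k * 2 / \<tau> m ^ k"
        using a \<tau>(1)[of m] by (intro divide_right_mono) auto
      also have "\<dots> = \<tau> m * (2 * B)" using \<tau>(1)[of m] by simp
      finally show ?thesis .
    qed
    have \<tau>_lim: "(\<lambda>m. \<tau> m * (2 * B)) \<longlonglongrightarrow> 0 * (2 * B)"
      unfolding \<tau>_def using LIMSEQ_Suc[OF LIMSEQ_inverse_real_of_nat]
      by (intro tendsto_mult_right) (simp add: divide_inverse)
    show "uniform_limit (cball 0 R) F (hpart k f) sequentially"
      unfolding uniform_limit_iff
    proof (intro allI impI)
      fix e :: real assume "e > 0"
      then have "\<forall>\<^sub>F m in sequentially. \<tau> m * (2 * B) < e"
        using \<tau>_lim by (auto dest: order_tendstoD)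
      then show "\<forall>\<^sub>F m in sequentially. \<forall>z\<in>cball 0 R. dist (F m z) (hpart k f z) < e"
      proof eventually_elim
        case (elim m)
        show ?case
        proof
          fix z :: "complex ^ 'n" assume "z \<in> cball 0 R"
          then show "dist (F m z) (hpart k f z) < e"
            using bd[of z m] elim by (simp add: dist_norm)
        qed
      qed
    qed
  qed
qed

section \<open>Radial weights\<close>

definition radial_const :: "'n::finite itself \<Rightarrow> real \<Rightarrow> real \<Rightarrow> real \<Rightarrow> real" where
  "radial_const _ l g d = g powr (- (d + 2 * CARD('n)) / (2 * l)) * Gamma (1 + (d + 2 * CARD('n)) / (2 * l))"

lemma radial_const_pos: "l > 0 \<Longrightarrow> g > 0 \<Longrightarrow> d \<ge> 0 \<Longrightarrow> radial_const TYPE('n::finite) l g d > 0"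
  unfolding radial_const_def by (intro mult_pos_pos Gamma_real_pos add_pos_nonneg) auto

lemma nn_integral_exp_tail: "(\<integral>\<^sup>+u. ennreal (exp (- u)) * indicator {a..} u \<partial>lborel) = ennreal (exp (- a))"
proof -
  have "((\<lambda>u::real. exp (- u)) \<longlongrightarrow> 0) at_top"
    by (rule filterlim_compose[OF exp_at_bot filterlim_uminus_at_bot_at_top])
  then have "((\<lambda>u::real. - exp (- u)) \<longlongrightarrow> 0) at_top" by (auto intro: tendsto_eq_intros)
  then have "(\<integral>\<^sup>+u. ennreal (exp (- u)) * indicator {a..} u \<partial>lborel) = ennreal (0 - (- exp (- a)))"
    by (intro nn_integral_FTC_atLeast[where F = "\<lambda>u. - exp (- u)"]) (auto intro!: derivative_eq_intros)
  then show ?thesis by simp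
qed

lemma nn_integral_homogeneous_ball:
  fixes H :: "complex ^ 'n::finite \<Rightarrow> ennreal"
  assumes [measurable]: "H \<in> borel_measurable borel"
    and hom: "\<And>r z. r > 0 \<Longrightarrow> H (r *\<^sub>R z) = ennreal (r powr d) * H z" and R: "R > 0"
  shows "(\<integral>\<^sup>+z. H z * indicator (cball 0 R) z \<partial>lborel)
    = ennreal (R powr (d + 2 * CARD('n))) * (\<integral>\<^sup>+z. H z * indicator (cball 0 1) z \<partial>lborel)"
proof -
  have [measurable]: "cball (0 :: complex ^ 'n) R \<in> sets borel" "cball (0 :: complex ^ 'n) 1 \<in> sets borel" by simp_all
  have [measurable]: "(\<lambda>z. H z * indicator (cball 0 R) z) \<in> borel_measurable borel" by measurable
  have "ennreal (1 / \<bar>R\<bar> ^ DIM(complex ^ 'n)) * (\<integral>\<^sup>+z. H z * indicator (cball 0 R) z \<partial>lborel)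
      = (\<integral>\<^sup>+z. H (0 + R *\<^sub>R z) * indicator (cball 0 R) (0 + R *\<^sub>R z) \<partial>lborel)"
    by (rule nn_integral_lborel_affine[symmetric, of "\<lambda>z. H z * indicator (cball 0 R) z"]) (use R in simp_all)
  also have "\<dots> = (\<integral>\<^sup>+z. ennreal (R powr d) * (H z * indicator (cball 0 1) z) \<partial>lborel)"
    by (rule nn_integral_cong) (use R in \<open>auto simp: hom indicator_def mult.assoc\<close>)
  also have "\<dots> = ennreal (R powr d) * (\<integral>\<^sup>+z. H z * indicator (cball 0 1) z \<partial>lborel)"
    by (rule nn_integral_cmult) measurable
  finally have "ennreal (R ^ DIM(complex ^ 'n)) * (ennreal (1 / \<bar>R\<bar> ^ DIM(complex ^ 'n)) * (\<integral>\<^sup>+z. H z * indicator (cball 0 R) z \<partial>lborel))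
      = ennreal (R ^ DIM(complex ^ 'n)) * (ennreal (R powr d) * (\<integral>\<^sup>+z. H z * indicator (cball 0 1) z \<partial>lborel))"
    by simp
  moreover have "R ^ DIM(complex ^ 'n) * R powr d = R powr (d + 2 * CARD('n))"
    using R by (simp add: powr_add powr_realpow[symmetric] mult.commute)
  ultimately show ?thesis
    using R by (simp add: mult.assoc[symmetric] ennreal_mult[symmetric])
qed

text \<open>The layer-cake formula, with the weight written as the integral of \<open>exp(-u)\<close> over
  \<open>u \<ge> g |z|\<^sup>2\<^sup>l\<close>, replaces polar coordinates: the integral over each ball is a power of its radius.
  Hence weights with different \<open>l\<close> and \<open>g\<close> integrate a homogeneous function to multiples of the
  same number.\<close>

lemma nn_integral_homogeneous_weight:
  fixes H :: "complex ^ 'n::finite \<Rightarrow> ennreal"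
  assumes [measurable]: "H \<in> borel_measurable borel"
    and hom: "\<And>r z. r > 0 \<Longrightarrow> H (r *\<^sub>R z) = ennreal (r powr d) * H z"
    and "d \<ge> 0" "l > 0" "g > 0"
  shows "(\<integral>\<^sup>+z. H z * ennreal (exp (- g * norm z powr (2 * l))) \<partial>lborel)
    = ennreal (radial_const TYPE('n) l g d) * (\<integral>\<^sup>+z. H z * indicator (cball 0 1) z \<partial>lborel)"
proof -
  define D where "D = (d + 2 * real CARD('n)) / (2 * l)"
  have D: "D > 0" using assms by (auto simp: D_def intro!: divide_pos_pos add_nonneg_pos)
  define J where "J = (\<integral>\<^sup>+z. H z * indicator (cball 0 1) z \<partial>lborel)"
  have iff: "g * norm z powr (2 * l) \<le> u \<longleftrightarrow> norm z \<le> (u / g) powr (1 / (2 * l))" if "u > 0" for u and z :: "complex ^ 'n"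
  proof -
    have "norm z \<le> (u / g) powr (1 / (2 * l)) \<longleftrightarrow> norm z powr (2 * l) \<le> ((u / g) powr (1 / (2 * l))) powr (2 * l)"
      using \<open>l > 0\<close> by (metis norm_ge_zero powr_ge_zero powr_less_mono2 powr_mono2 linorder_not_le mult_pos_pos zero_less_numeral order_less_imp_le)
    also have "((u / g) powr (1 / (2 * l))) powr (2 * l) = u / g"
      using that assms by (simp add: powr_powr)
    finally show ?thesis using \<open>g > 0\<close> by (simp add: field_simps)
  qed
  have "(\<integral>\<^sup>+z. H z * ennreal (exp (- g * norm z powr (2 * l))) \<partial>lborel)
      = (\<integral>\<^sup>+z. H z * (\<integral>\<^sup>+u. ennreal (exp (- u)) * indicator {g * norm z powr (2 * l)..} u \<partial>lborel) \<partial>lborel)"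
    by (simp add: nn_integral_exp_tail)
  also have "\<dots> = (\<integral>\<^sup>+z. (\<integral>\<^sup>+u. H z * (ennreal (exp (- u)) * indicator {(z, u). g * norm z powr (2 * l) \<le> u} (z, u)) \<partial>lborel) \<partial>lborel)"
    by (intro nn_integral_cong, subst nn_integral_cmult[symmetric])
       (auto intro!: nn_integral_cong simp: indicator_def)
  also have "\<dots> = (\<integral>\<^sup>+u. (\<integral>\<^sup>+z. H z * (ennreal (exp (- u)) * indicator {(z, u). g * norm z powr (2 * l) \<le> u} (z, u)) \<partial>lborel) \<partial>lborel)"
    by (rule lborel_pair.Fubini') measurable
  also have "\<dots> = (\<integral>\<^sup>+u. ennreal (indicator {0..} u * u powr ((1 + D) - 1) / exp u) * (ennreal (g powr (- D)) * J) \<partial>lborel)"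
  proof (rule nn_integral_cong_AE)
    have "AE u in lborel. u \<noteq> (0::real)" by (rule AE_lborel_singleton)
    then show "AE u in lborel. (\<integral>\<^sup>+z. H z * (ennreal (exp (- u)) * indicator {(z, u). g * norm z powr (2 * l) \<le> u} (z, u)) \<partial>lborel)
      = ennreal (indicator {0..} u * u powr ((1 + D) - 1) / exp u) * (ennreal (g powr (- D)) * J)"
    proof eventually_elim
      case (elim u)
      show ?case
      proof (cases "u > 0")
        case True
        have "(\<integral>\<^sup>+z. H z * (ennreal (exp (- u)) * indicator {(z, u). g * norm z powr (2 * l) \<le> u} (z, u)) \<partial>lborel)
          = (\<integral>\<^sup>+z. ennreal (exp (- u)) * (H z * indicator (cball 0 ((u / g) powr (1 / (2 * l)))) z) \<partial>lborel)"
        proof (rule nn_integral_cong)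
          fix z
          show "H z * (ennreal (exp (- u)) * indicator {(z, u). g * norm z powr (2 * l) \<le> u} (z, u))
            = ennreal (exp (- u)) * (H z * indicator (cball 0 ((u / g) powr (1 / (2 * l)))) z)"
            using iff[OF True, of z]
            by (cases "norm z \<le> (u / g) powr (1 / (2 * l))") (simp_all add: mult.commute)
        qed
        also have "\<dots> = ennreal (exp (- u)) * (ennreal (((u / g) powr (1 / (2 * l))) powr (d + 2 * CARD('n))) * J)"
        proof -
          have [measurable]: "cball (0 :: complex ^ 'n) ((u / g) powr (1 / (2 * l))) \<in> sets borel" by simp
          have "(u / g) powr (1 / (2 * l)) > 0" using True \<open>g > 0\<close> by simp
          from nn_integral_homogeneous_ball[OF assms(1) hom this]
          show ?thesis unfolding J_def by (subst nn_integral_cmult) simp_all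
        qed
        also have "((u / g) powr (1 / (2 * l))) powr (d + 2 * CARD('n)) = (u / g) powr D"
          by (simp add: powr_powr D_def)
        also have "(u / g) powr D = u powr D * g powr (- D)"
          using True \<open>g > 0\<close> by (simp add: powr_divide powr_minus field_simps)
        also have "ennreal (u powr D * g powr (- D)) = ennreal (u powr D) * ennreal (g powr (- D))"
          by (simp add: ennreal_mult)
        also have "ennreal (exp (- u)) * (ennreal (u powr D) * ennreal (g powr (- D)) * J)
            = (ennreal (exp (- u)) * ennreal (u powr D)) * (ennreal (g powr (- D)) * J)"
          by (simp only: mult.assoc)
        also have "ennreal (exp (- u)) * ennreal (u powr D) = ennreal (indicator {0..} u * u powr ((1 + D) - 1) / exp u)"
          using True by (simp add: ennreal_mult[symmetric] exp_minus field_simps)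
        finally show ?thesis .
      next
        case False
        then have "indicator {(z, u). g * norm z powr (2 * l) \<le> u} (z, u) = (0::ennreal)" for z :: "complex ^ 'n"
        proof -
          have "0 \<le> g * norm z powr (2 * l)" using \<open>g > 0\<close> by simp
          then have "\<not> g * norm z powr (2 * l) \<le> u" using elim False by linarith
          then show ?thesis by simp
        qed
        then show ?thesis using False elim by simp
      qed
    qed
  qed
  also have "\<dots> = ennreal (Gamma (1 + D)) * (ennreal (g powr (- D)) * J)"
    using D by (subst nn_integral_multc) (auto simp: Gamma_conv_nn_integral_real)
  also have "\<dots> = ennreal (radial_const TYPE('n) l g d) * J"
  proof -
    have "radial_const TYPE('n) l g d = Gamma (1 + D) * g powr (- D)"
      by (simp add: radial_const_def D_def minus_divide_left)
    moreover have "Gamma (1 + D) \<ge> 0" using D by (simp add: Gamma_real_nonneg)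
    ultimately show ?thesis by (simp add: ennreal_mult mult.assoc)
  qed
  finally show ?thesis unfolding J_def .
qed

lemma integrable_weight:
  assumes "l > 0" "g > 0"
  shows "integrable lborel (\<lambda>z :: complex ^ 'n::finite. exp (- g * norm z powr (2 * l)))"
proof (rule integrableI_nonneg)
  have "(\<integral>\<^sup>+z. 1 * ennreal (exp (- g * norm (z :: complex ^ 'n) powr (2 * l))) \<partial>lborel)
    = ennreal (radial_const TYPE('n) l g 0) * (\<integral>\<^sup>+z. 1 * indicator (cball 0 1) (z :: complex ^ 'n) \<partial>lborel)"
    using nn_integral_homogeneous_weight[of "\<lambda>_ :: complex ^ 'n. 1" 0 l g] assms by simp
  also have "\<dots> < \<infinity>"
    using emeasure_lborel_cball_finite[of "0 :: complex ^ 'n" 1] by (simp add: ennreal_mult_less_top)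
  finally show "(\<integral>\<^sup>+z. ennreal (exp (- g * norm (z :: complex ^ 'n) powr (2 * l))) \<partial>lborel) < \<infinity>" by simp
qed auto

lemma integral_homogeneous_weight_real:
  fixes F :: "complex ^ 'n::finite \<Rightarrow> real"
  assumes cont: "continuous_on UNIV F"
    and hom: "\<And>r z. r > 0 \<Longrightarrow> F (r *\<^sub>R z) = r powr d * F z"
    and "d \<ge> 0" "l > 0" "g > 0"
  shows "integrable lborel (\<lambda>z. F z * exp (- g * norm z powr (2 * l)))"
    and "(\<integral>z. F z * exp (- g * norm z powr (2 * l)) \<partial>lborel)
      = radial_const TYPE('n) l g d * (\<integral>z. F z * indicator (cball 0 1) z \<partial>lborel)"
proof -
  have [measurable]: "F \<in> borel_measurable borel" using cont by (rule borel_measurable_continuous_onI)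
  have int_ball: "integrable lborel (\<lambda>z. F z * indicator (cball 0 1) z)"
    using borel_integrable_compact[of "cball 0 1" F] continuous_on_subset[OF cont]
    by (simp add: mult.commute)
  have nn: "(\<integral>\<^sup>+z. ennreal (F' z * exp (- g * norm z powr (2 * l))) \<partial>lborel)
      = ennreal (radial_const TYPE('n) l g d) * (\<integral>\<^sup>+z. ennreal (F' z * indicator (cball 0 1) z) \<partial>lborel)"
    if [measurable]: "F' \<in> borel_measurable borel" and "\<And>r z. r > 0 \<Longrightarrow> F' (r *\<^sub>R z) = r powr d * F' z"
    for F' :: "complex ^ 'n \<Rightarrow> real"
    using nn_integral_homogeneous_weight[of "\<lambda>z. ennreal (F' z)" d l g] that assms
    by (simp add: ennreal_mult' ennreal_mult'' ennreal_indicator)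
  have n1: "(\<integral>\<^sup>+z. ennreal (norm (F z * exp (- g * norm z powr (2 * l)))) \<partial>lborel)
      = ennreal (radial_const TYPE('n) l g d) * (\<integral>\<^sup>+z. ennreal (norm (F z * indicator (cball 0 1) z)) \<partial>lborel)"
    using nn[of "\<lambda>z. \<bar>F z\<bar>"] by (simp add: hom abs_mult)
  then show int: "integrable lborel (\<lambda>z. F z * exp (- g * norm z powr (2 * l)))"
    using int_ball unfolding integrable_iff_bounded by (auto simp: ennreal_mult_less_top)
  have p: "(\<integral>\<^sup>+z. ennreal (- (F z * exp (- g * norm z powr (2 * l)))) \<partial>lborel)
      = ennreal (radial_const TYPE('n) l g d) * (\<integral>\<^sup>+z. ennreal (- (F z * indicator (cball 0 1) z)) \<partial>lborel)"
    using nn[of "\<lambda>z. - F z"] by (simp add: hom)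
  have q: "(\<integral>\<^sup>+z. ennreal (F z * exp (- g * norm z powr (2 * l))) \<partial>lborel)
      = ennreal (radial_const TYPE('n) l g d) * (\<integral>\<^sup>+z. ennreal (F z * indicator (cball 0 1) z) \<partial>lborel)"
    by (rule nn[of F]) (simp_all add: hom)
  have r: "radial_const TYPE('n) l g d \<ge> 0"
    using radial_const_pos[of l g d, where 'n = 'n] assms by (simp add: less_imp_le)
  have e: "enn2real (ennreal (radial_const TYPE('n) l g d) * x) = radial_const TYPE('n) l g d * enn2real x" for x
    unfolding enn2real_mult enn2real_ennreal[OF r] ..
  show "(\<integral>z. F z * exp (- g * norm z powr (2 * l)) \<partial>lborel)
      = radial_const TYPE('n) l g d * (\<integral>z. F z * indicator (cball 0 1) z \<partial>lborel)"
    unfolding real_lebesgue_integral_def[OF int] real_lebesgue_integral_def[OF int_ball]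
      trans[OF arg_cong[OF q, of enn2real] e] trans[OF arg_cong[OF p, of enn2real] e]
    by (rule right_diff_distrib[symmetric])
qed

lemma integral_homogeneous_weight:
  fixes F :: "complex ^ 'n::finite \<Rightarrow> complex"
  assumes cont: "continuous_on UNIV F"
    and hom: "\<And>r z. r > 0 \<Longrightarrow> F (r *\<^sub>R z) = of_real (r powr d) * F z"
    and "d \<ge> 0" "l > 0" "g > 0"
  shows "(\<integral>z. F z * of_real (exp (- g * norm z powr (2 * l))) \<partial>lborel)
      = radial_const TYPE('n) l g d * (\<integral>z. F z * indicator (cball 0 1) z \<partial>lborel)"
proof -
  note Re = integral_homogeneous_weight_real[where F = "\<lambda>z. Re (F z)" and d = d and l = l and g = g]
  note Im = integral_homogeneous_weight_real[where F = "\<lambda>z. Im (F z)" and d = d and l = l and g = g]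
  have c: "continuous_on UNIV (\<lambda>z. Re (F z))" "continuous_on UNIV (\<lambda>z. Im (F z))"
    using cont by (auto intro!: continuous_intros)
  have int: "integrable lborel (\<lambda>z. F z * of_real (exp (- g * norm z powr (2 * l))))"
  proof (rule integrable_norm_iff[THEN iffD1])
    have [measurable]: "F \<in> borel_measurable borel" using cont by (rule borel_measurable_continuous_onI)
    show "(\<lambda>z. F z * of_real (exp (- g * norm z powr (2 * l)))) \<in> borel_measurable lborel" by measurable
    show "integrable lborel (\<lambda>z. norm (F z * of_real (exp (- g * norm z powr (2 * l)))))"
      using integral_homogeneous_weight_real(1)[of "\<lambda>z. norm (F z)" d l g] cont assms
      by (simp add: norm_mult continuous_intros)
  qed
  have int': "integrable lborel (\<lambda>z. F z * indicator (cball 0 1) z)"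
  proof -
    have "integrable lborel (\<lambda>z. indicator (cball 0 1) z *\<^sub>R F z)"
      using continuous_on_subset[OF cont] by (intro borel_integrable_compact) auto
    moreover have "(\<lambda>z. indicator (cball 0 1) z *\<^sub>R F z) = (\<lambda>z. F z * indicator (cball 0 1) z)"
      by (auto simp: indicator_def)
    ultimately show ?thesis by simp
  qed
  show ?thesis
  proof (rule complex_eqI)
    have i: "(\<integral>z. Re (F z * indicator (cball 0 1) z) \<partial>lborel) = (\<integral>z. Re (F z) * indicator (cball 0 1) z \<partial>lborel)"
            "(\<integral>z. Im (F z * indicator (cball 0 1) z) \<partial>lborel) = (\<integral>z. Im (F z) * indicator (cball 0 1) z \<partial>lborel)"
      by (auto intro!: Bochner_Integration.integral_cong simp: indicator_def)
    have w: "(\<integral>z. Re (F z * of_real (exp (- g * norm z powr (2 * l)))) \<partial>lborel) = (\<integral>z. Re (F z) * exp (- g * norm z powr (2 * l)) \<partial>lborel)"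
            "(\<integral>z. Im (F z * of_real (exp (- g * norm z powr (2 * l)))) \<partial>lborel) = (\<integral>z. Im (F z) * exp (- g * norm z powr (2 * l)) \<partial>lborel)"
      by simp_all
    have Re': "(\<integral>z. Re (F z) * exp (- g * norm z powr (2 * l)) \<partial>lborel) = radial_const TYPE('n) l g d * (\<integral>z. Re (F z) * indicator (cball 0 1) z \<partial>lborel)"
      by (rule Re(2)) (use c assms in auto)
    have Im': "(\<integral>z. Im (F z) * exp (- g * norm z powr (2 * l)) \<partial>lborel) = radial_const TYPE('n) l g d * (\<integral>z. Im (F z) * indicator (cball 0 1) z \<partial>lborel)"
      by (rule Im(2)) (use c assms in auto)
    have m: "Re (of_real K * x) = K * Re x" "Im (of_real K * x) = K * Im x" for K x by simp_all
    show "Re (\<integral>z. F z * of_real (exp (- g * norm z powr (2 * l))) \<partial>lborel)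
      = Re (radial_const TYPE('n) l g d * (\<integral>z. F z * indicator (cball 0 1) z \<partial>lborel))"
      unfolding m integral_Re[OF int, symmetric] integral_Re[OF int', symmetric] i w by (rule Re')
    show "Im (\<integral>z. F z * of_real (exp (- g * norm z powr (2 * l))) \<partial>lborel)
      = Im (radial_const TYPE('n) l g d * (\<integral>z. F z * indicator (cball 0 1) z \<partial>lborel))"
      unfolding m integral_Im[OF int, symmetric] integral_Im[OF int', symmetric] i w by (rule Im')
  qed
qed

section \<open>Entire functions of growth \<open>exp (a |z|\<^sup>2\<^sup>l)\<close>\<close>

definition growth :: "real \<Rightarrow> real \<Rightarrow> (complex ^ 'n::finite \<Rightarrow> complex) \<Rightarrow> bool" where
  "growth l a f \<longleftrightarrow> entire f \<and> (\<exists>C\<ge>0. \<forall>z. norm (f z) \<le> C * exp (a * norm z powr (2 * l)))"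

lemma borel_measurable_cnj [measurable (raw)]:
  "f \<in> borel_measurable M \<Longrightarrow> (\<lambda>x. cnj (f x)) \<in> borel_measurable M"
  by (rule measurable_compose[OF _ borel_measurable_continuous_onI[of cnj]]) (auto intro: continuous_intros)

lemma growth_entire: "growth l a f \<Longrightarrow> entire f"
  by (simp add: growth_def)

lemma growthE:
  assumes "growth l a f" obtains C where "C \<ge> 0" "\<And>z. norm (f z) \<le> C * exp (a * norm z powr (2 * l))"
  using assms unfolding growth_def by blast

lemma growthI: "entire f \<Longrightarrow> C \<ge> 0 \<Longrightarrow> (\<And>z. norm (f z) \<le> C * exp (a * norm z powr (2 * l))) \<Longrightarrow> growth l a f"
  unfolding growth_def by blast

lemma growth_mono: "growth l a f \<Longrightarrow> a \<le> b \<Longrightarrow> growth l b f"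
  unfolding growth_def by (meson exp_le_cancel_iff mult_left_mono mult_right_mono order_trans powr_ge_zero)

lemma growth_mult: assumes "growth l a f" "growth l b g" shows "growth l (a + b) (\<lambda>z. f z * g z)"
proof -
  obtain C C' where C: "C \<ge> 0" "\<And>z. norm (f z) \<le> C * exp (a * norm z powr (2 * l))"
      "C' \<ge> 0" "\<And>z. norm (g z) \<le> C' * exp (b * norm z powr (2 * l))"
    using growthE[OF assms(1)] growthE[OF assms(2)] by metis
  show ?thesis
  proof (rule growthI)
    show "norm (f z * g z) \<le> (C * C') * exp ((a + b) * norm z powr (2 * l))" for z
      using mult_mono[OF C(2)[of z] C(4)[of z]] C by (simp add: norm_mult exp_add algebra_simps)
  qed (use assms C in \<open>auto intro: entire_mult growth_entire\<close>)
qed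

lemma norm_hpart_growth:
  assumes "entire f" "\<And>z. norm (f z) \<le> C * exp (a * norm z powr (2 * l))" "r > 0"
  shows "norm (hpart k f z) \<le> C * exp (a * r powr (2 * l) * norm z powr (2 * l)) * (1 / r) ^ k"
proof -
  have "norm (hpart k f z) \<le> C * exp (a * r powr (2 * l) * norm z powr (2 * l)) / r ^ k"
  proof (rule norm_hpart_le)
    fix t :: complex assume "norm t = r"
    then show "norm (f (t *s z)) \<le> C * exp (a * r powr (2 * l) * norm z powr (2 * l))"
      using assms(2)[of "t *s z"] \<open>r > 0\<close> by (simp add: powr_mult mult.assoc)
  qed (use assms in auto)
  then show ?thesis by (simp add: power_one_over)
qed

lemma dilation_room:
  assumes "0 \<le> (a::real)" "a < b" "l > 0"
  obtains r where "r > 1" "a * r powr (2 * l) < b"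
proof (cases "a = 0")
  case True then show ?thesis using that[of 2] assms by simp
next
  case False
  \<comment> \<open>\<open>r\<^sup>2\<^sup>l\<close> is the midpoint of \<open>1\<close> and \<open>b/a\<close>.\<close>
  define r where "r = ((b / a + 1) / 2) powr (1 / (2 * l))"
  have "1 < (b / a + 1) / 2" "(b / a + 1) / 2 < b / a" using False assms by (auto simp: field_simps)
  then have "r > 1" "r powr (2 * l) = (b / a + 1) / 2"
    using \<open>l > 0\<close> unfolding r_def by (auto simp: powr_powr intro!: gr_one_powr)
  moreover have "a * ((b / a + 1) / 2) < b" using False assms by (simp add: field_simps)
  ultimately show ?thesis using that[of r] by metis
qed

text \<open>A slightly dilated copy of the growth bound still has room under the weight, and the parts of
  degree \<open>j\<close> then decay like \<open>r\<^sup>-\<^sup>j\<close>, so the expansion may be integrated term by term.\<close>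

lemma integral_hpart_series:
  fixes f m :: "complex ^ 'n::finite \<Rightarrow> complex"
  assumes f: "growth l a f" and [measurable]: "m \<in> borel_measurable borel"
    and m: "\<And>z. norm (m z) \<le> C' * exp (a' * norm z powr (2 * l))"
    and "0 \<le> a" "a + a' < g" "l > 0"
  shows "integrable lborel (\<lambda>z. f z * m z * of_real (exp (- g * norm z powr (2 * l))))"
    and "(\<lambda>j. \<integral>z. hpart j f z * m z * of_real (exp (- g * norm z powr (2 * l))) \<partial>lborel)
      sums (\<integral>z. f z * m z * of_real (exp (- g * norm z powr (2 * l))) \<partial>lborel)"
proof -
  obtain C where C: "C \<ge> 0" "\<And>z. norm (f z) \<le> C * exp (a * norm z powr (2 * l))"
    by (rule growthE[OF f], rule that)
  have ent: "entire f" using f by (rule growth_entire)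
  note [measurable] = entire_borel[OF ent] entire_borel[OF entire_hpart[OF ent]]
  obtain r where r: "r > 1" "a * r powr (2 * l) < g - a'"
    using dilation_room[of a "g - a'" l] assms by auto
  have C': "C' \<ge> 0" using m[of 0] norm_ge_zero[of "m 0"] by (smt (verit) exp_gt_zero mult_neg_pos)
  \<comment> \<open>The part of the weight left over after the growth of both factors, the first one dilated.\<close>
  define h where "h = g - a' - a * r powr (2 * l)"
  have h: "h > 0" using r by (simp add: h_def)
  define W where "W z = exp (- h * norm z powr (2 * l))" for z :: "complex ^ 'n"
  have Wint: "integrable lborel W" unfolding W_def using integrable_weight[OF \<open>l > 0\<close> h] .
  have comb: "exp (a * r powr (2 * l) * x) * exp (a' * x) * exp (- g * x) = exp (- h * x)" for x
    by (simp add: exp_add[symmetric] h_def algebra_simps)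
  have a_le: "a \<le> a * r powr (2 * l)"
    using r(1) \<open>0 \<le> a\<close> \<open>l > 0\<close> by (simp add: mult_le_cancel_left1 ge_one_powr_ge_zero)
  have bound: "norm (p * m z * of_real (exp (- g * norm z powr (2 * l)))) \<le> B * C' * W z"
    if "norm p \<le> B * exp (a * r powr (2 * l) * norm z powr (2 * l))" for p B z
  proof -
    have "norm p * norm (m z) * exp (- g * norm z powr (2 * l))
       \<le> (B * exp (a * r powr (2 * l) * norm z powr (2 * l))) * (C' * exp (a' * norm z powr (2 * l))) * exp (- g * norm z powr (2 * l))"
      using that m[of z] by (intro mult_right_mono mult_mono order_trans[OF norm_ge_zero that]) auto
    also have "\<dots> = B * C' * W z"
      unfolding W_def comb[symmetric] by (simp add: algebra_simps)
    finally show ?thesis by (simp add: norm_mult)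
  qed
  have fb: "norm (f z) \<le> C * exp (a * r powr (2 * l) * norm z powr (2 * l))" for z
    using C(2)[of z] a_le C(1)
    by (meson exp_le_cancel_iff mult_left_mono mult_right_mono order_trans powr_ge_zero)
  have pb: "norm (hpart j f z) \<le> (C * (1/r) ^ j) * exp (a * r powr (2 * l) * norm z powr (2 * l))" for j z
    using norm_hpart_growth[OF ent C(2), of r j z] r(1) by (simp add: mult_ac)
  show "integrable lborel (\<lambda>z. f z * m z * of_real (exp (- g * norm z powr (2 * l))))"
    by (rule Bochner_Integration.integrable_bound[of _ "\<lambda>z. C * C' * W z"])
       (use Wint bound[OF fb] in \<open>auto intro!: AE_I2 order_trans[OF _ abs_ge_self]\<close>)
  define F where "F j z = hpart j f z * m z * of_real (exp (- g * norm z powr (2 * l)))" for j z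
  have Fb: "norm (F j z) \<le> (C * (1/r) ^ j) * C' * W z" for j z
    unfolding F_def by (rule bound[OF pb])
  have Fint: "integrable lborel (F j)" for j
  proof (rule Bochner_Integration.integrable_bound[of _ "\<lambda>z. (C * (1/r) ^ j) * C' * W z"])
    show "F j \<in> borel_measurable lborel" unfolding F_def by measurable
  qed (use Wint Fb in \<open>auto intro!: AE_I2 order_trans[OF _ abs_ge_self]\<close>)
  have geo: "summable (\<lambda>j. (1/r) ^ j)" using r by (intro summable_geometric) auto
  have "(\<lambda>j. integral\<^sup>L lborel (F j)) sums (\<integral>z. (\<Sum>j. F j z) \<partial>lborel)"
  proof (rule sums_integral)
    show "AE z in lborel. summable (\<lambda>j. norm (F j z))"
    proof (rule AE_I2)
      fix z
      have "summable (\<lambda>j. (C * C' * W z) * (1/r) ^ j)" using geo by (rule summable_mult)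
      then show "summable (\<lambda>j. norm (F j z))"
      proof (rule summable_comparison_test'[where N = 0])
        fix j :: nat
        have "norm (F j z) \<le> (C * C' * W z) * (1/r) ^ j"
          using Fb[of j z] by (simp only: mult.assoc mult.commute mult.left_commute)
        then show "norm (norm (F j z)) \<le> (C * C' * W z) * (1/r) ^ j" by (simp only: real_norm_def abs_norm_cancel)
      qed
    qed
    have "summable (\<lambda>j. (C * C' * integral\<^sup>L lborel W) * (1/r) ^ j)" using geo by (rule summable_mult)
    then show "summable (\<lambda>j. \<integral>z. norm (F j z) \<partial>lborel)"
    proof (rule summable_comparison_test'[where N = 0])
      fix j :: nat
      have "(\<integral>z. norm (F j z) \<partial>lborel) \<le> (\<integral>z. (C * (1/r) ^ j) * C' * W z \<partial>lborel)"
        by (intro integral_mono integrable_norm Fint integrable_mult_right Wint Fb)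
      also have "\<dots> = (C * (1/r) ^ j) * C' * integral\<^sup>L lborel W"
        by (rule integral_mult_right_zero)
      also have "\<dots> = (C * C' * integral\<^sup>L lborel W) * (1/r) ^ j"
        by (simp only: mult.assoc mult.commute mult.left_commute)
      finally have "(\<integral>z. norm (F j z) \<partial>lborel) \<le> (C * C' * integral\<^sup>L lborel W) * (1/r) ^ j" .
      moreover have "0 \<le> (\<integral>z. norm (F j z) \<partial>lborel)" by simp
      ultimately show "norm (\<integral>z. norm (F j z) \<partial>lborel) \<le> (C * C' * integral\<^sup>L lborel W) * (1/r) ^ j"
        by (simp only: real_norm_def abs_of_nonneg)
    qed
  qed (rule Fint)
  moreover have "(\<Sum>j. F j z) = f z * m z * of_real (exp (- g * norm z powr (2 * l)))" for z
    unfolding F_def by (rule sums_unique[symmetric], intro sums_mult2 hpart_sums_1 ent)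
  ultimately show "(\<lambda>j. \<integral>z. hpart j f z * m z * of_real (exp (- g * norm z powr (2 * l))) \<partial>lborel)
      sums (\<integral>z. f z * m z * of_real (exp (- g * norm z powr (2 * l))) \<partial>lborel)"
    unfolding F_def by simp
qed

text \<open>Rotating by the phase \<open>exp(\<i>\<pi>/(j - k))\<close> preserves the measure and the weight but changes the
  sign of the integrand.\<close>

lemma integral_homogeneous_orthogonal:
  fixes p q :: "complex ^ 'n::finite \<Rightarrow> complex"
  assumes [measurable]: "p \<in> borel_measurable borel" "q \<in> borel_measurable borel"
    and p: "\<And>t z. p (t *s z) = t ^ j * p z" and q: "\<And>t z. q (t *s z) = t ^ k * q z" and "j \<noteq> k"
  shows "(\<integral>z. p z * cnj (q z) * of_real (exp (- g * norm z powr (2 * l))) \<partial>lborel) = 0" (is "?I = 0")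
proof -
  \<comment> \<open>Chosen so that \<open>c\<^sup>j cnj(c)\<^sup>k = -1\<close>.\<close>
  define \<theta> where "\<theta> = pi / (real j - real k)"
  define c where "c = cis \<theta>"
  have "real j * \<theta> - real k * \<theta> = (real j - real k) * \<theta>" by (simp only: left_diff_distrib)
  also have "\<dots> = pi" using \<open>j \<noteq> k\<close> by (simp add: \<theta>_def)
  finally have "real j * \<theta> - real k * \<theta> = pi" .
  then have "cis (real j * \<theta> - real k * \<theta>) = - 1" by (simp only: cis_pi)
  moreover have "c ^ j * cnj c ^ k = cis (real j * \<theta> - real k * \<theta>)"
  proof -
    have 1: "cis \<theta> ^ j = cis (real j * \<theta>)" and 2: "cis (- \<theta>) ^ k = cis (real k * - \<theta>)"
      by (rule Complex.DeMoivre)+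
    show ?thesis unfolding c_def cis_cnj 1 2 cis_mult by simp
  qed
  ultimately have c: "c ^ j * cnj c ^ k = - 1" "norm c = 1" by (simp_all add: c_def)
  have "?I = (\<integral>z. p (c *s z) * cnj (q (c *s z)) * of_real (exp (- g * norm (c *s z) powr (2 * l))) \<partial>lborel)"
    by (rule integral_lborel_rotate[symmetric]) (use c in auto)
  also have "\<dots> = (\<integral>z. (c ^ j * cnj c ^ k) * (p z * cnj (q z) * of_real (exp (- g * norm z powr (2 * l)))) \<partial>lborel)"
    by (simp add: p q c(2) mult_ac)
  also have "\<dots> = - ?I" unfolding c by simp
  finally show ?thesis by simp
qed

lemma integral_homogeneous_projection:
  fixes f q :: "complex ^ 'n::finite \<Rightarrow> complex"
  assumes f: "growth l a f" and qg: "growth l a' q" and q: "\<And>t z. q (t *s z) = t ^ k * q z"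
    and "0 \<le> a" "a + a' < g" "l > 0"
  shows "(\<integral>z. f z * cnj (q z) * of_real (exp (- g * norm z powr (2 * l))) \<partial>lborel)
    = (\<integral>z. hpart k f z * cnj (q z) * of_real (exp (- g * norm z powr (2 * l))) \<partial>lborel)"
proof -
  have ent: "entire f" "entire q" using f qg by (auto intro: growth_entire)
  note [measurable] = entire_borel[OF ent(1)] entire_borel[OF ent(2)] entire_borel[OF entire_hpart[OF ent(1)]]
  have [measurable]: "(\<lambda>z. cnj (q z)) \<in> borel_measurable borel" by measurable
  obtain C' where C': "\<And>z. norm (q z) \<le> C' * exp (a' * norm z powr (2 * l))" by (rule growthE[OF qg], rule that)
  let ?I = "\<lambda>j. (\<integral>z. hpart j f z * cnj (q z) * of_real (exp (- g * norm z powr (2 * l))) \<partial>lborel)"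
  have "?I sums (\<integral>z. f z * cnj (q z) * of_real (exp (- g * norm z powr (2 * l))) \<partial>lborel)"
    by (rule integral_hpart_series(2)[OF f, where C' = C' and a' = a']) (use C' assms in auto)
  moreover have "?I j = 0" if "j \<noteq> k" for j
    by (rule integral_homogeneous_orthogonal[OF _ _ hpart_homogeneous[OF ent(1)] q that]) measurable
  then have "?I sums ?I k" using sums_finite[of "{k}" ?I] by simp
  ultimately show ?thesis using sums_unique2 by blast
qed

lemma power_le_exp: fixes x :: real assumes "x \<ge> 0" shows "x ^ k \<le> fact k * exp x"
proof -
  have "(\<lambda>n. x ^ n /\<^sub>R fact n) sums exp x" by (rule exp_converges)
  then have "(\<Sum>n\<in>{k}. x ^ n /\<^sub>R fact n) \<le> exp x"
    using assms by (intro sum_le_suminf[of "\<lambda>n. x ^ n /\<^sub>R fact n", THEN order_trans])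
      (auto simp: sums_iff divide_inverse)
  then show ?thesis by (simp add: field_simps)
qed

lemma growth_homogeneous:
  fixes q :: "complex ^ 'n::finite \<Rightarrow> complex"
  assumes ent: "entire q" and q: "\<And>t z. q (t *s z) = t ^ k * q z" and "\<epsilon> > 0" "l \<ge> 1 / 2"
  shows "growth l \<epsilon> q"
proof -
  have "bounded (q ` cball 0 1)"
    by (intro compact_imp_bounded compact_continuous_image entire_continuous_on ent compact_cball)
  then obtain B where B: "B > 0" "\<And>z. norm z \<le> 1 \<Longrightarrow> norm (q z) \<le> B"
    unfolding bounded_pos by auto
  have bd: "norm (q z) \<le> B * norm z ^ k" for z :: "complex ^ 'n"
  proof (cases "z = 0")
    case True
    then show ?thesis using q[of 0 0] B(2)[of 0] by (cases k) auto
  next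
    case False
    define u where "u = of_real (1 / norm z) *s z"
    have "norm u = 1" "z = of_real (norm z) *s u" using False by (simp_all add: u_def vector_smult_assoc norm_divide)
    then show ?thesis using B(2)[of u] q[of "of_real (norm z)" u] \<open>B > 0\<close>
      by (simp add: norm_mult norm_power mult.commute[of _ "_ ^ k"] mult_left_mono)
  qed
  have le: "r \<le> 1 + r powr (2 * l)" if "r \<ge> 0" for r :: real
  proof (cases "r \<le> 1")
    case False
    then have "r powr 1 \<le> r powr (2 * l)" using \<open>l \<ge> 1 / 2\<close> by (intro powr_mono) auto
    then show ?thesis using False by simp
  qed (simp add: add_increasing2)
  show ?thesis
  proof (rule growthI[OF ent])
    show "0 \<le> B * (fact k / \<epsilon> ^ k * exp \<epsilon>)" using B \<open>\<epsilon> > 0\<close> by simp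
    fix z :: "complex ^ 'n"
    have "(\<epsilon> * norm z) ^ k \<le> fact k * exp (\<epsilon> * norm z)" using \<open>\<epsilon> > 0\<close> by (intro power_le_exp) auto
    also have "\<dots> \<le> fact k * exp (\<epsilon> + \<epsilon> * norm z powr (2 * l))"
      using le[of "norm z"] mult_left_mono[of "norm z" "1 + norm z powr (2 * l)" \<epsilon>] \<open>\<epsilon> > 0\<close> by (simp add: distrib_left)
    finally have "norm z ^ k \<le> fact k / \<epsilon> ^ k * exp \<epsilon> * exp (\<epsilon> * norm z powr (2 * l))"
      using \<open>\<epsilon> > 0\<close> by (simp add: power_mult_distrib exp_add field_simps)
    then have "B * norm z ^ k \<le> B * (fact k / \<epsilon> ^ k * exp \<epsilon> * exp (\<epsilon> * norm z powr (2 * l)))"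
      using B(1) by (intro mult_left_mono) auto
    then show "norm (q z) \<le> B * (fact k / \<epsilon> ^ k * exp \<epsilon>) * exp (\<epsilon> * norm z powr (2 * l))"
      using bd[of z] by (simp add: mult.assoc)
  qed
qed

subsection \<open>The Gaussian weight\<close>

text \<open>The Gaussian weight is spelled as the case \<open>l = g = 1\<close> of the general weight, so that the lemmas
  on radial weights apply to it verbatim.\<close>

definition gauss_mass :: "'n::finite itself \<Rightarrow> real" where
  "gauss_mass _ = (\<integral>z. exp (- 1 * norm (z :: complex ^ 'n) powr (2 * 1)) \<partial>lborel)"

lemma gauss_mass_eq: "gauss_mass TYPE('n::finite) = Gamma (1 + CARD('n)) * ball_vol TYPE('n)"
proof -
  have "gauss_mass TYPE('n) = radial_const TYPE('n) 1 1 0 * (\<integral>z. 1 * indicator (cball 0 1) (z :: complex ^ 'n) \<partial>lborel)"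
    unfolding gauss_mass_def
    using integral_homogeneous_weight_real(2)[of "\<lambda>_ :: complex ^ 'n. 1" 0 1 1] by simp
  also have "(\<integral>z. 1 * indicator (cball 0 1) (z :: complex ^ 'n) \<partial>lborel) = ball_vol TYPE('n)"
    using content_ball[of 1 "0 :: complex ^ 'n"] content_cball[of 1 "0 :: complex ^ 'n"]
    by (simp add: ball_vol_def measure_def)
  finally show ?thesis by (simp add: radial_const_def)
qed

lemma integral_gauss_mean:
  fixes F :: "complex ^ 'n::finite \<Rightarrow> complex"
  assumes F: "growth 1 a F" "0 \<le> a" "a < 1"
  shows "(\<integral>z. F z * of_real (exp (- 1 * norm z powr (2 * 1))) \<partial>lborel) = F 0 * gauss_mass TYPE('n)"
proof -
  have "(\<integral>z. F z * cnj 1 * of_real (exp (- 1 * norm z powr (2 * 1))) \<partial>lborel)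
    = (\<integral>z. hpart 0 F z * cnj 1 * of_real (exp (- 1 * norm z powr (2 * 1))) \<partial>lborel)"
    by (rule integral_homogeneous_projection[OF F(1), where q = "\<lambda>_. 1" and a' = 0])
       (use F in \<open>auto intro!: growthI[where C = 1] entire_const\<close>)
  also have "\<dots> = (\<integral>z. F 0 * of_real (exp (- 1 * norm (z :: complex ^ 'n) powr (2 * 1))) \<partial>lborel)"
    by (simp add: hpart_def)
  also have "\<dots> = F 0 * gauss_mass TYPE('n)"
    unfolding gauss_mass_def integral_mult_right_zero integral_complex_of_real ..
  finally show ?thesis by simp
qed

lemma cdot_self: "cdot z z = of_real (norm z ^ 2)"
proof (rule complex_eqI)
  show "Im (cdot z z) = Im (of_real (norm z ^ 2))" using arg_cong[OF cnj_cdot[of z z], of Im] by simp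
qed (simp add: Re_cdot power2_norm_eq_inner)

lemma norm_exp_cdot_le: "norm (exp (cdot z w)) \<le> exp (norm w ^ 2) * exp (1 / 4 * norm z powr (2 * 1))"
proof -
  have "Re (cdot z w) \<le> norm z * norm w"
    using complex_Re_le_cmod norm_cdot_le order_trans by blast
  also have "\<dots> \<le> norm w ^ 2 + 1 / 4 * norm z ^ 2"
    using zero_le_power2[of "norm z / 2 - norm w"] by (simp add: power2_eq_square algebra_simps)
  finally show ?thesis by (simp add: exp_add[symmetric])
qed

text \<open>After the shift \<open>z \<mapsto> z + w\<close> the exponents combine to an entire function times the centred
  Gaussian, and the mean value property evaluates the integral at the origin.\<close>

lemma integral_gauss_reproducing:
  fixes f :: "complex ^ 'n::finite \<Rightarrow> complex"
  assumes f: "growth 1 (1/8) f"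
  shows "(\<integral>z. f z * exp (cdot w z) * of_real (exp (- 1 * norm z powr (2 * 1))) \<partial>lborel) = f w * gauss_mass TYPE('n)"
proof -
  define \<Phi> where "\<Phi> z = f z * exp (cdot w z) * of_real (exp (- 1 * norm z powr (2 * 1)))" for z
  define F where "F z = f (1 *s z + w) * exp (- 1 * cdot z w)" for z
  have ent: "entire f" using f by (rule growth_entire)
  note [measurable] = entire_borel[OF ent]
  have "\<Phi> \<in> borel_measurable borel" unfolding \<Phi>_def by measurable
  from integral_lborel_affine[OF this, of 1 w]
  have shift: "(\<integral>z. \<Phi> z \<partial>lborel) = (\<integral>z. \<Phi> (w + z) \<partial>lborel)" by simp
  have "\<Phi> (w + z) = F z * of_real (exp (- 1 * norm z powr (2 * 1)))" for z
  proof -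
    have sq: "of_real (norm (w + z) ^ 2) = cdot w w + cdot w z + cdot z w + cdot z z"
      unfolding cdot_self[symmetric] by (simp add: cdot_add_left cdot_add_right)
    have e: "of_real (exp (- 1 * norm v powr (2 * 1))) = exp (- cdot v v)" for v :: "complex ^ 'n"
      by (simp add: cdot_self exp_of_real[symmetric])
    have "exp (cdot w (w + z)) * exp (- cdot (w + z) (w + z)) = exp (- 1 * cdot z w) * exp (- cdot z z)"
      by (simp add: exp_add[symmetric] cdot_add_left cdot_add_right algebra_simps)
    then show ?thesis unfolding \<Phi>_def F_def e by (simp add: add.commute mult.assoc)
  qed
  then have "(\<integral>z. \<Phi> z \<partial>lborel) = (\<integral>z. F z * of_real (exp (- 1 * norm z powr (2 * 1))) \<partial>lborel)"
    unfolding shift by (rule Bochner_Integration.integral_cong[OF refl])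
  also have "(\<integral>z. F z * of_real (exp (- 1 * norm z powr (2 * 1))) \<partial>lborel) = F 0 * gauss_mass TYPE('n)"
  proof (rule integral_gauss_mean[where a = "1/2"])
    obtain C where C: "C \<ge> 0" "\<And>z. norm (f z) \<le> C * exp (1 / 8 * norm z powr (2 * 1))"
      by (rule growthE[OF f], rule that)
    show "growth 1 (1/2) F"
    proof (rule growthI)
      show "entire F" unfolding F_def
        by (rule entire_mult[OF entire_affine[OF ent] entire_exp[OF entire_cmult[OF entire_cdot]]])
      show "0 \<le> C * exp (norm w ^ 2 / 4) * exp (norm w ^ 2)" using C by simp
      fix z :: "complex ^ 'n"
      have "norm (z + w) ^ 2 \<le> (norm z + norm w) ^ 2" by (intro power_mono norm_triangle_ineq) auto
      also have "\<dots> \<le> 2 * norm z ^ 2 + 2 * norm w ^ 2"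
        using zero_le_power2[of "norm z - norm w"] by (simp add: power2_eq_square algebra_simps)
      finally have "norm (f (z + w)) \<le> C * (exp (norm w ^ 2 / 4) * exp (norm z ^ 2 / 4))"
        using C(2)[of "z + w"] C(1)
        by (simp add: exp_add[symmetric]) (erule order_trans, intro mult_left_mono, auto)
      moreover have "norm (exp (- 1 * cdot z w)) \<le> exp (norm w ^ 2) * exp (norm z ^ 2 / 4)"
        using norm_exp_cdot_le[of z "- w"] by (simp add: Re_cdot)
      ultimately have "norm (F z) \<le> (C * (exp (norm w ^ 2 / 4) * exp (norm z ^ 2 / 4))) * (exp (norm w ^ 2) * exp (norm z ^ 2 / 4))"
        unfolding F_def norm_mult using C(1) by (intro mult_mono) auto
      also have "\<dots> = C * exp (norm w ^ 2 / 4) * exp (norm w ^ 2) * exp (1 / 2 * norm z powr (2 * 1))"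
        by (simp add: exp_add[symmetric] mult.assoc algebra_simps)
      finally show "norm (F z) \<le> C * exp (norm w ^ 2 / 4) * exp (norm w ^ 2) * exp (1 / 2 * norm z powr (2 * 1))" .
    qed
  qed auto
  also have "F 0 = f w" by (simp add: F_def)
  finally show ?thesis unfolding \<Phi>_def .
qed

lemma hpart_exp_cdot: "hpart k (\<lambda>z. exp (cdot z w)) z = cdot z w ^ k / fact k"
proof (rule hpart_unique)
  show "entire (\<lambda>z. exp (cdot z w))" by (intro entire_exp entire_cdot)
  show "(\<lambda>k. cdot z w ^ k / fact k * t ^ k) sums exp (cdot (t *s z) w)" for t
    using exp_converges[of "t * cdot z w"]
    by (simp add: cdot_scale_left power_mult_distrib scaleR_conv_of_real divide_inverse mult_ac)
qed

text \<open>The degree \<open>k\<close> part of the reproducing formula.\<close>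

lemma integral_gauss_cdot_power:
  fixes f :: "complex ^ 'n::finite \<Rightarrow> complex"
  assumes ent: "entire f" and hom: "\<And>t z. f (t *s z) = t ^ k * f z"
  shows "(\<integral>z. f z * cnj (cdot z w ^ k) * of_real (exp (- 1 * norm z powr (2 * 1))) \<partial>lborel)
    = fact k * f w * gauss_mass TYPE('n)"
proof -
  let ?W = "\<lambda>z :: complex ^ 'n. complex_of_real (exp (- 1 * norm z powr (2 * 1)))"
  have gr: "growth 1 (1/8) f" by (rule growth_homogeneous[OF ent hom]) auto
  have h: "growth 1 (1/4) (\<lambda>z. exp (cdot z w))"
    by (rule growthI[where C = "exp (norm w ^ 2)", OF _ _ norm_exp_cdot_le]) (auto intro!: entire_exp entire_cdot)
  have "f w * gauss_mass TYPE('n) = (\<integral>z. cnj (exp (cdot z w) * cnj (f z) * ?W z) \<partial>lborel)"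
    unfolding integral_gauss_reproducing[OF gr, of w, symmetric]
    by (simp add: exp_cnj cnj_cdot mult_ac)
  also have "\<dots> = cnj (\<integral>z. exp (cdot z w) * cnj (f z) * ?W z \<partial>lborel)"
    by (rule Bochner_Integration.integral_cnj)
  also have "(\<integral>z. exp (cdot z w) * cnj (f z) * ?W z \<partial>lborel)
     = (\<integral>z. hpart k (\<lambda>z. exp (cdot z w)) z * cnj (f z) * ?W z \<partial>lborel)"
    by (rule integral_homogeneous_projection[OF h gr hom]) auto
  also have "cnj \<dots> = (\<integral>z. cnj (hpart k (\<lambda>z. exp (cdot z w)) z * cnj (f z) * ?W z) \<partial>lborel)"
    by (rule Bochner_Integration.integral_cnj[symmetric])
  also have "\<dots> = (\<integral>z. (1 / fact k) * (f z * cnj (cdot z w ^ k) * ?W z) \<partial>lborel)"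
    unfolding hpart_exp_cdot by (rule Bochner_Integration.integral_cong) (simp_all add: mult_ac)
  also have "\<dots> = (1 / fact k) * (\<integral>z. f z * cnj (cdot z w ^ k) * ?W z \<partial>lborel)"
    by (rule integral_mult_right_zero)
  finally show ?thesis by (simp add: field_simps)
qed

section \<open>The pairing on homogeneous parts\<close>

text \<open>The reproducing kernel of the weight \<open>exp(-g |z|\<^sup>2\<^sup>l)\<close> is \<open>\<Sum> M\<^sub>k (z \<cdot> w)\<^sup>k / k!\<close> with these \<open>M\<^sub>k\<close>; they will
  turn out to be the moments of a positive measure on the half line.\<close>

definition moment :: "'n::finite itself \<Rightarrow> real \<Rightarrow> real \<Rightarrow> nat \<Rightarrow> real" where
  "moment _ l g k = g powr ((k + CARD('n)) / l) * Gamma (1 + (k + CARD('n)))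
     / (Gamma (1 + (k + CARD('n)) / l) * Gamma (1 + CARD('n)))"

lemma moment_pos: "l > 0 \<Longrightarrow> g > 0 \<Longrightarrow> moment TYPE('n::finite) l g k > 0"
  unfolding moment_def by (intro divide_pos_pos mult_pos_pos Gamma_real_pos add_pos_nonneg) auto

lemma pairing_lborel:
  fixes f g :: "complex ^ 'n::finite \<Rightarrow> complex"
  assumes [measurable]: "f \<in> borel_measurable borel" "g \<in> borel_measurable borel"
  shows "pairing l \<gamma> f g = (1 / ball_vol TYPE('n)) *\<^sub>R
    (\<integral>z. f z * cnj (g z) * of_real (exp (- \<gamma> * norm z powr (2 * l))) \<partial>lborel)"
  unfolding pairing_def by (rule integral_dV) measurable

lemma cdot_power_homogeneous: "cdot (t *s z) w ^ k = t ^ k * cdot z w ^ k"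
  by (simp add: cdot_scale_left power_mult_distrib)

lemma entire_cdot_power: "entire (\<lambda>z. cdot z w ^ k)"
  by (intro entire_power entire_cdot)

lemma radial_const_even:
  assumes "l > 0"
  shows "radial_const TYPE('n::finite) l g (2 * real k) = g powr (- ((k + CARD('n)) / l)) * Gamma (1 + (k + CARD('n)) / l)"
proof -
  have 1: "(2 * real k + real (2 * CARD('n))) / (2 * l) = (k + CARD('n)) / l"
    and 2: "- (2 * real k + real (2 * CARD('n))) / (2 * l) = - ((k + CARD('n)) / l)"
    using assms by (simp_all add: field_simps)
  show ?thesis unfolding radial_const_def using 1 2 by simp
qed

lemma integral_homogeneous_scaled:
  fixes F :: "complex ^ 'n::finite \<Rightarrow> complex"
  assumes "continuous_on UNIV F"
    and "\<And>r z. r > 0 \<Longrightarrow> F (r *\<^sub>R z) = of_real (r powr d) * F z"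
    and "d \<ge> 0" "l > 0" "g > 0" "l' > 0" "g' > 0"
  shows "radial_const TYPE('n) l' g' d * (\<integral>z. F z * of_real (exp (- g * norm z powr (2 * l))) \<partial>lborel)
    = radial_const TYPE('n) l g d * (\<integral>z. F z * of_real (exp (- g' * norm z powr (2 * l'))) \<partial>lborel)"
  using integral_homogeneous_weight[OF assms(1,2), of l g] integral_homogeneous_weight[OF assms(1,2), of l' g'] assms
  by simp

lemma homogeneous_product:
  assumes "\<And>t z. p (t *s z) = t ^ k * p z" "\<And>t z. q (t *s z) = t ^ k * q z" "r > 0"
  shows "p (r *\<^sub>R z) * cnj (q (r *\<^sub>R z)) = of_real (r powr (2 * real k)) * (p z * cnj (q (z :: complex ^ 'n::finite)))"
proof -
  have "r powr (2 * real k) = r ^ k * r ^ k"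
    using \<open>r > 0\<close> by (simp add: powr_realpow[symmetric] powr_add[symmetric])
  then show ?thesis
    using assms(1)[of "of_real r" z] assms(2)[of "of_real r" z] by (simp add: scalar_mult_of_real)
qed

text \<open>Only the part of \<open>h\<close> of degree \<open>k\<close> contributes. For it the weight may be exchanged for the
  Gaussian one at the price of a quotient of radial constants, and there the reproducing formula
  is available.\<close>

lemma pairing_cdot_power:
  fixes h :: "complex ^ 'n::finite \<Rightarrow> complex"
  assumes h: "growth l a h" "0 \<le> a" "a < g" and "l \<ge> 1"
  shows "pairing l g h (\<lambda>z. cdot z w ^ k) = of_real (fact k / moment TYPE('n) l g k) * hpart k h w"
proof -
  have g: "g > 0" using assms by simp
  have ent: "entire h" "entire (hpart k h)" using h(1) by (auto intro: growth_entire entire_hpart)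
  let ?q = "\<lambda>z. cdot z w ^ k"
  let ?F = "\<lambda>z. hpart k h z * cnj (?q z)"
  have [measurable]: "h \<in> borel_measurable borel" using ent(1) by (rule entire_borel)
  have q: "growth l ((g - a) / 2) ?q"
    by (rule growth_homogeneous[OF entire_cdot_power cdot_power_homogeneous]) (use assms in auto)
  have "(\<integral>z. h z * cnj (?q z) * of_real (exp (- g * norm z powr (2 * l))) \<partial>lborel)
    = (\<integral>z. ?F z * of_real (exp (- g * norm z powr (2 * l))) \<partial>lborel)" (is "?L = ?R")
    by (rule integral_homogeneous_projection[OF h(1) q cdot_power_homogeneous]) (use assms in \<open>auto simp: field_simps\<close>)
  moreover have "radial_const TYPE('n) 1 1 (2 * real k) * ?R
     = radial_const TYPE('n) l g (2 * real k) * (\<integral>z. ?F z * of_real (exp (- 1 * norm z powr (2 * 1))) \<partial>lborel)"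
  proof (rule integral_homogeneous_scaled)
    show "continuous_on UNIV ?F"
      by (intro continuous_intros entire_continuous_on ent)
    show "?F (r *\<^sub>R z) = of_real (r powr (2 * real k)) * ?F z" if "r > 0" for r z
      by (rule homogeneous_product[OF hpart_homogeneous[OF ent(1)] cdot_power_homogeneous that])
  qed (use g \<open>l \<ge> 1\<close> in auto)
  moreover have "(\<integral>z. ?F z * of_real (exp (- 1 * norm z powr (2 * 1))) \<partial>lborel) = fact k * hpart k h w * gauss_mass TYPE('n)"
    by (rule integral_gauss_cdot_power[OF ent(2) hpart_homogeneous[OF ent(1)]])
  ultimately have "radial_const TYPE('n) 1 1 (2 * real k) * ?L
     = radial_const TYPE('n) l g (2 * real k) * (fact k * hpart k h w * gauss_mass TYPE('n))" by simp
  moreover have pos: "radial_const TYPE('n) 1 1 (2 * real k) > 0" "radial_const TYPE('n) l g (2 * real k) > 0"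
    using g \<open>l \<ge> 1\<close> by (auto intro!: radial_const_pos)
  ultimately have L: "?L = of_real (radial_const TYPE('n) l g (2 * real k) / radial_const TYPE('n) 1 1 (2 * real k) * gauss_mass TYPE('n)) * (fact k * hpart k h w)"
    by (simp add: field_simps)
  have r1: "radial_const TYPE('n) 1 1 (2 * real k) = Gamma (1 + (k + CARD('n)))"
    by (simp add: radial_const_def add_divide_distrib)
  have r2: "radial_const TYPE('n) l g (2 * real k) = g powr (- ((k + CARD('n)) / l)) * Gamma (1 + (k + CARD('n)) / l)"
    using \<open>l \<ge> 1\<close> by (simp add: radial_const_even del: of_nat_add)
  have "radial_const TYPE('n) l g (2 * real k) / radial_const TYPE('n) 1 1 (2 * real k) * gauss_mass TYPE('n)
      = ball_vol TYPE('n) / moment TYPE('n) l g k"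
    unfolding gauss_mass_eq r1 r2 moment_def by (simp add: powr_minus divide_inverse mult_ac)
  from L[unfolded this] have "?L = of_real (ball_vol TYPE('n) / moment TYPE('n) l g k) * (fact k * hpart k h w)" .
  then show ?thesis
    using ball_vol_pos[where 'n='n] by (subst pairing_lborel) (auto simp: scaleR_conv_of_real)
qed

lemma pairing_sums:
  fixes h b :: "complex ^ 'n::finite \<Rightarrow> complex"
  assumes h: "growth l a h" and b: "growth l a' b" and "0 \<le> a" "0 \<le> a'" "a + a' < g" "l \<ge> 1"
  shows "(\<lambda>k. pairing l g h (hpart k b)) sums pairing l g h b"
    and "pairing l g h (hpart k b) = pairing l g (hpart k h) (hpart k b)"
proof -
  have ent: "entire h" "entire b" using h b by (auto intro: growth_entire)
  note [measurable] = entire_borel[OF ent(1)] entire_borel[OF ent(2)] entire_borel[OF entire_hpart[OF ent(2)]] entire_borel[OF entire_hpart[OF ent(1)]]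
  obtain C where C: "C \<ge> 0" "\<And>z. norm (h z) \<le> C * exp (a * norm z powr (2 * l))"
    by (rule growthE[OF h], rule that)
  let ?W = "\<lambda>z. complex_of_real (exp (- g * norm z powr (2 * l)))"
  have "(\<lambda>k. \<integral>z. hpart k b z * cnj (h z) * ?W z \<partial>lborel) sums (\<integral>z. b z * cnj (h z) * ?W z \<partial>lborel)"
    by (rule integral_hpart_series(2)[OF b, where C' = C and a' = a]) (use C assms in auto)
  then have "(\<lambda>k. cnj (\<integral>z. hpart k b z * cnj (h z) * ?W z \<partial>lborel)) sums cnj (\<integral>z. b z * cnj (h z) * ?W z \<partial>lborel)"
    by (rule bounded_linear.sums[OF bounded_linear_cnj])
  then have "(\<lambda>k. (1 / ball_vol TYPE('n)) *\<^sub>R cnj (\<integral>z. hpart k b z * cnj (h z) * ?W z \<partial>lborel))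
     sums ((1 / ball_vol TYPE('n)) *\<^sub>R cnj (\<integral>z. b z * cnj (h z) * ?W z \<partial>lborel))"
    by (rule sums_scaleR_right)
  moreover have sw: "pairing l g h f = (1 / ball_vol TYPE('n)) *\<^sub>R cnj (\<integral>z. f z * cnj (h z) * ?W z \<partial>lborel)"
    if [measurable]: "f \<in> borel_measurable borel" for f
    unfolding Bochner_Integration.integral_cnj[symmetric]
    by (subst pairing_lborel) (simp_all add: mult.commute)
  ultimately show "(\<lambda>k. pairing l g h (hpart k b)) sums pairing l g h b" by simp
  obtain r where r: "r > 1" "a' * r powr (2 * l) < g - a"
    using dilation_room[of a' "g - a" l] assms by auto
  have "growth l ((g - a) / 2) (hpart k b)"
    by (rule growth_homogeneous[OF entire_hpart[OF ent(2)] hpart_homogeneous[OF ent(2)]]) (use assms in auto)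
  from integral_homogeneous_projection[OF h this hpart_homogeneous[OF ent(2)], of g]
  show "pairing l g h (hpart k b) = pairing l g (hpart k h) (hpart k b)"
    using assms by (simp add: pairing_lborel field_simps)
qed

text \<open>This is what makes a representation by a bounded function possible: passing to the doubled
  weight costs a factor that is geometric in \<open>k\<close>, hence can be absorbed by a dilation.\<close>

lemma pairing_homogeneous_double:
  fixes p q :: "complex ^ 'n::finite \<Rightarrow> complex"
  assumes ent: "entire p" "entire q" and hom: "\<And>t z. p (t *s z) = t ^ k * p z" "\<And>t z. q (t *s z) = t ^ k * q z"
    and "l \<ge> 1" "g > 0"
  shows "pairing l g p q = of_real (2 powr ((k + CARD('n)) / l)) * pairing l (2 * g) p q"
proof -
  note [measurable] = entire_borel[OF ent(1)] entire_borel[OF ent(2)]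
  define s where "s = (k + CARD('n)) / l"
  have s: "s \<ge> 0" using \<open>l \<ge> 1\<close> by (simp add: s_def)
  have rc: "radial_const TYPE('n) l \<gamma> (2 * real k) = \<gamma> powr (- s) * Gamma (1 + s)" for \<gamma>
    unfolding s_def using \<open>l \<ge> 1\<close> by (simp add: radial_const_even del: of_nat_add)
  have "radial_const TYPE('n) l (2 * g) (2 * real k) * (\<integral>z. p z * cnj (q z) * of_real (exp (- g * norm z powr (2 * l))) \<partial>lborel)
    = radial_const TYPE('n) l g (2 * real k) * (\<integral>z. p z * cnj (q z) * of_real (exp (- (2 * g) * norm z powr (2 * l))) \<partial>lborel)"
  proof (rule integral_homogeneous_scaled[where F = "\<lambda>z. p z * cnj (q z)"])
    show "continuous_on UNIV (\<lambda>z. p z * cnj (q z))"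
      by (intro continuous_on_mult continuous_on_cnj entire_continuous_on ent)
    show "p (r *\<^sub>R z) * cnj (q (r *\<^sub>R z)) = of_real (r powr (2 * real k)) * (p z * cnj (q z))" if "r > 0" for r z
      by (rule homogeneous_product[OF hom that])
  qed (use assms in auto)
  moreover have "Gamma (1 + s) > 0" using s by (intro Gamma_real_pos) auto
  ultimately have "(\<integral>z. p z * cnj (q z) * of_real (exp (- g * norm z powr (2 * l))) \<partial>lborel)
    = of_real (2 powr s) * (\<integral>z. p z * cnj (q z) * of_real (exp (- (2 * g) * norm z powr (2 * l))) \<partial>lborel)"
    unfolding rc using \<open>g > 0\<close> by (simp add: powr_mult powr_minus field_simps)
  then show ?thesis unfolding s_def by (simp add: pairing_lborel scaleR_conv_of_real)
qed

section \<open>Zolotarev's integral\<close>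

text \<open>Partial fractions of \<open>s! / (x (x + 1) \<dots> (x + s))\<close>.\<close>

lemma sum_alternating_binomial_inverse:
  fixes x :: real
  assumes "\<And>j. x + real j \<noteq> 0"
  shows "(\<Sum>j\<le>s. (-1) ^ j * real (s choose j) / (x + real j)) = fact s / pochhammer x (Suc s)"
  using assms
proof (induction s arbitrary: x)
  case 0
  then show ?case by simp
next
  case (Suc s)
  have nz: "x + 1 + real j \<noteq> 0" "x + real j \<noteq> 0" for j
    using Suc.prems[of "Suc j"] Suc.prems[of j] by (simp_all add: algebra_simps)
  define f where "f j = (-1) ^ j / (x + real j)" for j
  have "(\<Sum>j\<le>Suc s. real (Suc s choose j) * f j)
      = (\<Sum>j\<le>s. real (s choose j) * f j) + (\<Sum>j\<le>s. real (s choose j) * f (Suc j))"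
  proof -
    have "(\<Sum>j\<le>Suc s. real (Suc s choose j) * f j)
       = f 0 + (\<Sum>j\<le>s. real (Suc s choose Suc j) * f (Suc j))"
      by (subst sum.atMost_Suc_shift) simp
    also have "\<dots> = (f 0 + (\<Sum>j\<le>s. real (s choose Suc j) * f (Suc j))) + (\<Sum>j\<le>s. real (s choose j) * f (Suc j))"
      by (simp add: sum.distrib algebra_simps)
    also have "f 0 + (\<Sum>j\<le>s. real (s choose Suc j) * f (Suc j)) = (\<Sum>j\<le>Suc s. real (s choose j) * f j)"
      by (subst sum.atMost_Suc_shift[where n = s]) simp
    also have "\<dots> = (\<Sum>j\<le>s. real (s choose j) * f j)" by simp
    finally show ?thesis .
  qed
  moreover have "(\<Sum>j\<le>s. real (s choose j) * f j) = fact s / pochhammer x (Suc s)"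
    using Suc.IH[of x] Suc.prems by (simp add: f_def mult.commute)
  moreover have "(\<Sum>j\<le>s. real (s choose j) * f (Suc j)) = - (fact s / pochhammer (x + 1) (Suc s))"
    using Suc.IH[of "x + 1"] nz by (simp add: f_def mult.commute sum_negf add.assoc)
  ultimately have "(\<Sum>j\<le>Suc s. (-1) ^ j * real (Suc s choose j) / (x + real j))
      = fact s / pochhammer x (Suc s) - fact s / pochhammer (x + 1) (Suc s)"
    by (simp add: f_def mult.commute)
  also have "\<dots> = fact (Suc s) / pochhammer x (Suc (Suc s))"
  proof -
    have a: "pochhammer x (Suc (Suc s)) = pochhammer x (Suc s) * (x + real (Suc s))" by (rule pochhammer_Suc)
    have b: "pochhammer x (Suc (Suc s)) = x * pochhammer (x + 1) (Suc s)" by (rule pochhammer_rec)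
    have c: "x + real (Suc s) \<noteq> 0" "x \<noteq> 0" using nz(2)[of "Suc s"] nz(2)[of 0] by auto
    have "fact s / pochhammer x (Suc s) = fact s * (x + real (Suc s)) / pochhammer x (Suc (Suc s))"
      unfolding a using c by simp
    moreover have "fact s / pochhammer (x + 1) (Suc s) = fact s * x / pochhammer x (Suc (Suc s))"
      unfolding b using c by simp
    ultimately show ?thesis by (simp add: diff_divide_distrib[symmetric] algebra_simps)
  qed
  finally show ?case .
qed

text \<open>Since \<open>sin((j - a)\<pi>) = -(-1)\<^sup>j sin(\<pi>a)\<close>, the partial fraction identity and the reflection
  formula evaluate the sum. For an integer \<open>a\<close> all terms but one vanish, and the remaining one is
  the limit \<open>\<pi>\<close> of the quotient.\<close>

lemma sum_binomial_sinc:
  fixes a :: real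
  assumes "0 < a" "a < real s"
  shows "(\<Sum>j\<le>s. real (s choose j) * (if real j = a then pi else sin ((real j - a) * pi) / (real j - a)))
    = pi * Gamma (1 + real s) / (Gamma (1 + a) * Gamma (1 + (real s - a)))"
proof (cases "a \<in> \<int>")
  case True
  then obtain m where m: "a = real m" using assms(1) by (metis Ints_cases of_int_0_less_iff of_int_of_nat_eq zero_less_imp_eq_int)
  have "m \<le> s" using assms m by simp
  have z: "sin ((real j - real m) * pi) = 0" for j
    by (metis of_int_diff of_int_of_nat_eq sin_int_times_real sin_integer_2pi sin_npi_int mult.commute)
  have "(\<Sum>j\<le>s. real (s choose j) * (if real j = a then pi else sin ((real j - a) * pi) / (real j - a)))
      = (\<Sum>j\<le>s. if j = m then real (s choose j) * pi else 0)"
    unfolding m z by (rule sum.cong) auto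
  also have "\<dots> = real (s choose m) * pi" using \<open>m \<le> s\<close> by simp
  also have "\<dots> = pi * Gamma (1 + real s) / (Gamma (1 + a) * Gamma (1 + (real s - a)))"
    using \<open>m \<le> s\<close> by (simp add: m Gamma_fact binomial_fact flip: of_nat_diff)
  finally show ?thesis .
next
  case False
  have ne: "real j \<noteq> a" for j using False by auto
  have sa: "sin (pi * a) \<noteq> 0"
    using False by (metis Ints_of_int mult.commute mult_cancel_left pi_neq_zero sin_zero_iff_int2)
  have ni: "- a \<notin> \<int>\<^sub>\<le>\<^sub>0" "1 + a \<notin> \<int>\<^sub>\<le>\<^sub>0"
  proof -
    show "- a \<notin> \<int>\<^sub>\<le>\<^sub>0" using False nonpos_Ints_Int Ints_minus[of "- a"] by auto
    show "1 + a \<notin> \<int>\<^sub>\<le>\<^sub>0" using False nonpos_Ints_Int[of "1 + a"] Ints_diff[of "1 + a" 1] by auto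
  qed
  have sj: "sin ((real j - a) * pi) = - ((-1) ^ j * sin (pi * a))" for j
    by (simp only: left_diff_distrib sin_diff sin_npi cos_npi) (simp add: mult.commute)
  have "(\<Sum>j\<le>s. real (s choose j) * (if real j = a then pi else sin ((real j - a) * pi) / (real j - a)))
      = - sin (pi * a) * (\<Sum>j\<le>s. (-1) ^ j * real (s choose j) / (- a + real j))"
    unfolding sum_distrib_left by (rule sum.cong) (auto simp: ne sj)
  also have "(\<Sum>j\<le>s. (-1) ^ j * real (s choose j) / (- a + real j)) = fact s / pochhammer (- a) (Suc s)"
  proof (rule sum_alternating_binomial_inverse)
    show "- a + real j \<noteq> 0" for j using ne[of j] by simp
  qed
  also have "pochhammer (- a) (Suc s) = Gamma (1 + (real s - a)) / Gamma (- a)"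
    using pochhammer_Gamma[OF ni(1), of "Suc s"] by (simp add: algebra_simps)
  also have "Gamma (- a) = - pi / (sin (pi * a) * Gamma (1 + a))"
  proof -
    have "Gamma (- a) * Gamma (1 - (- a)) = pi / sin (pi * (- a))"
    proof -
      have "complex_of_real (pi / sin (pi * (- a))) = of_real pi / sin (of_real pi * of_real (- a))"
        using sin_of_real[of "pi * (- a)", where 'a = complex] by simp
      also have "\<dots> = Gamma (of_real (- a)) * Gamma (1 - of_real (- a))"
        by (rule Gamma_reflection_complex[symmetric])
      also have "\<dots> = complex_of_real (Gamma (- a) * Gamma (1 - (- a)))"
        using Gamma_complex_of_real[of "- a"] Gamma_complex_of_real[of "1 - (- a)"] by simp
      finally have "complex_of_real (Gamma (- a) * Gamma (1 - (- a))) = of_real (pi / sin (pi * (- a)))" ..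
      then show ?thesis by (simp only: of_real_eq_iff)
    qed
    moreover have "Gamma (1 + a) \<noteq> 0" using ni(2) by (simp add: Gamma_eq_zero_iff)
    ultimately show ?thesis using sa by (simp add: field_simps)
  qed
  also have "- sin (pi * a) * (fact s / (Gamma (1 + (real s - a)) / (- pi / (sin (pi * a) * Gamma (1 + a)))))
     = pi * fact s / (Gamma (1 + a) * Gamma (1 + (real s - a)))"
    using sa by (simp add: mult.commute)
  finally show ?thesis by (simp add: Gamma_fact)
qed

text \<open>Zolotarev's function, known from the densities of one-sided stable laws.\<close>

definition zolotarev :: "real \<Rightarrow> real \<Rightarrow> real" where
  "zolotarev \<theta> \<phi> = sin \<phi> / (sin (\<theta> * \<phi>) powr \<theta> * sin ((1 - \<theta>) * \<phi>) powr (1 - \<theta>))"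

lemma zolotarev_sin_pos:
  assumes "0 < \<theta>" "\<theta> < 1" "0 < \<phi>" "\<phi> \<le> pi"
  shows "sin (\<theta> * \<phi>) > 0" "sin ((1 - \<theta>) * \<phi>) > 0"
proof -
  have "\<theta> * \<phi> < 1 * pi" "(1 - \<theta>) * \<phi> < 1 * pi"
    using assms by (intro mult_less_le_imp_less; simp)+
  then show "sin (\<theta> * \<phi>) > 0" "sin ((1 - \<theta>) * \<phi>) > 0"
    using assms by (auto intro!: sin_gt_zero)
qed

lemma zolotarev_nonneg: "0 < \<theta> \<Longrightarrow> \<theta> < 1 \<Longrightarrow> 0 \<le> \<phi> \<Longrightarrow> \<phi> \<le> pi \<Longrightarrow> zolotarev \<theta> \<phi> \<ge> 0"
  unfolding zolotarev_def by (auto intro!: divide_nonneg_nonneg sin_ge_zero)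

text \<open>The sine rule in the triangle with angles \<open>\<theta>\<phi>\<close>, \<open>(1 - \<theta>)\<phi>\<close>, \<open>\<pi> - \<phi>\<close> reads
  \<open>1 + R exp(\<i>\<phi>) = (sin \<phi> / sin((1 - \<theta>)\<phi>)) exp(\<i>\<theta>\<phi>)\<close>. Its \<open>s\<close>-th power, multiplied by
  \<open>R\<^sup>-\<^sup>a exp(-\<i>a\<phi>)\<close> so that the left-hand phase disappears, is \<open>Z(\<phi>)\<^sup>s\<close>; expand by the binomial theorem
  and separate real and imaginary parts.\<close>

lemma zolotarev_binomial:
  fixes s :: nat
  assumes \<theta>: "0 < \<theta>" "\<theta> < 1" and \<phi>: "0 < \<phi>" "\<phi> \<le> pi"
  defines "R \<equiv> sin (\<theta> * \<phi>) / sin ((1 - \<theta>) * \<phi>)" and "a \<equiv> \<theta> * real s"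
  shows "zolotarev \<theta> \<phi> ^ s = (\<Sum>j\<le>s. real (s choose j) * (R powr (real j - a) * cos ((real j - a) * \<phi>)))"
    and "(\<Sum>j\<le>s. real (s choose j) * (R powr (real j - a) * sin ((real j - a) * \<phi>))) = 0"
proof -
  define A B where "A = sin (\<theta> * \<phi>)" and "B = sin ((1 - \<theta>) * \<phi>)"
  have AB: "A > 0" "B > 0" using zolotarev_sin_pos[OF \<theta> \<phi>] by (auto simp: A_def B_def)
  then have R: "R > 0" "R = A / B" by (simp_all add: R_def A_def B_def)
  have tri: "complex_of_real B + of_real A * cis \<phi> = of_real (sin \<phi>) * cis (\<theta> * \<phi>)"
    by (rule complex_eqI) (simp_all add: A_def B_def left_diff_distrib sin_diff cos_diff algebra_simps)
  have z: "1 + of_real R * cis \<phi> = of_real (sin \<phi> / B) * cis (\<theta> * \<phi>)"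
    using tri AB by (simp add: R(2) field_simps)
  have "(1 + of_real R * cis \<phi>) ^ s = (\<Sum>j\<le>s. of_nat (s choose j) * (of_real R * cis \<phi>) ^ j)"
    by (subst add.commute, subst binomial_ring) simp
  also have "\<dots> = (\<Sum>j\<le>s. of_nat (s choose j) * (of_real (R ^ j) * cis (real j * \<phi>)))"
    by (simp only: power_mult_distrib Complex.DeMoivre of_real_power)
  finally have "of_real ((sin \<phi> / B) ^ s) * cis (a * \<phi>) = (\<Sum>j\<le>s. of_nat (s choose j) * (of_real (R ^ j) * cis (real j * \<phi>)))"
    unfolding z power_mult_distrib Complex.DeMoivre of_real_power a_def by (simp add: mult_ac)
  then have f1: "of_real (R powr (- a)) * cis (- a * \<phi>) * (of_real ((sin \<phi> / B) ^ s) * cis (a * \<phi>))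
     = of_real (R powr (- a)) * cis (- a * \<phi>) * (\<Sum>j\<le>s. of_nat (s choose j) * (of_real (R ^ j) * cis (real j * \<phi>)))"
    by simp
  have f2: "of_real (R powr (- a)) * cis (- a * \<phi>) * (of_real ((sin \<phi> / B) ^ s) * cis (a * \<phi>))
     = of_real (R powr (- a) * (sin \<phi> / B) ^ s) * (cis (- a * \<phi>) * cis (a * \<phi>))"
    by simp
  have f3: "cis (- a * \<phi>) * cis (a * \<phi>) = 1" by (simp add: cis_mult)
  have f4: "R powr (- a) * (sin \<phi> / B) ^ s = zolotarev \<theta> \<phi> ^ s"
  proof -
    have "zolotarev \<theta> \<phi> ^ s = sin \<phi> ^ s / (A powr a * B powr (real s - a))"
    proof -
      have pp: "(x powr t) ^ s = x powr (t * real s)" if "x > 0" for x t :: real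
        using that by (simp add: powr_realpow[symmetric] powr_powr)
      have e: "(1 - \<theta>) * real s = real s - a" by (simp add: a_def algebra_simps)
      show ?thesis
        unfolding zolotarev_def A_def[symmetric] B_def[symmetric] power_divide power_mult_distrib
          pp[OF AB(1)] pp[OF AB(2)] e by (simp add: a_def)
    qed
    also have "B powr (real s - a) = B ^ s / B powr a"
      using AB by (simp add: powr_diff powr_realpow)
    also have "sin \<phi> ^ s / (A powr a * (B ^ s / B powr a)) = R powr (- a) * (sin \<phi> / B) ^ s"
      using AB by (simp add: R(2) powr_divide powr_minus power_divide field_simps)
    finally show ?thesis ..
  qed
  have f5: "of_real (R powr (- a)) * cis (- a * \<phi>) * (\<Sum>j\<le>s. of_nat (s choose j) * (of_real (R ^ j) * cis (real j * \<phi>)))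
    = (\<Sum>j\<le>s. of_nat (s choose j) * (of_real (R powr (real j - a)) * cis ((real j - a) * \<phi>)))"
    unfolding sum_distrib_left
  proof (rule sum.cong[OF refl])
    fix j
    have 1: "R powr (real j - a) = R powr (- a) * R ^ j"
      using R(1) by (simp add: powr_diff powr_minus powr_realpow field_simps)
    have 2: "cis ((real j - a) * \<phi>) = cis (- a * \<phi>) * cis (real j * \<phi>)"
      by (simp add: cis_mult algebra_simps)
    show "of_real (R powr (- a)) * cis (- a * \<phi>) * (of_nat (s choose j) * (of_real (R ^ j) * cis (real j * \<phi>)))
      = of_nat (s choose j) * (of_real (R powr (real j - a)) * cis ((real j - a) * \<phi>))"
      unfolding 1 2 by simp
  qed
  have e: "complex_of_real (zolotarev \<theta> \<phi> ^ s)
     = (\<Sum>j\<le>s. of_nat (s choose j) * (of_real (R powr (real j - a)) * cis ((real j - a) * \<phi>)))"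
    using f1 unfolding f2 f3 f4 f5 mult_1_right .
  show "zolotarev \<theta> \<phi> ^ s = (\<Sum>j\<le>s. real (s choose j) * (R powr (real j - a) * cos ((real j - a) * \<phi>)))"
    using arg_cong[OF e, of Re] by (simp add: Re_sum del: of_real_power)
  show "(\<Sum>j\<le>s. real (s choose j) * (R powr (real j - a) * sin ((real j - a) * \<phi>))) = 0"
    using arg_cong[OF e, of Im] by (simp add: Im_sum del: of_real_power)
qed

text \<open>The function \<open>Q\<close> in the proof is an explicit primitive. Differentiating it term by term produces
  the real part in \<open>zolotarev_binomial\<close>, plus \<open>R'/R\<close> times the imaginary part, which vanishes. It
  tends to \<open>0\<close> at the origin, and at \<open>\<pi>\<close>, where \<open>R = 1\<close>, it is the sum of \<open>sum_binomial_sinc\<close>.\<close>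

lemma zolotarev_integral:
  fixes s :: nat
  assumes \<theta>: "0 < \<theta>" "\<theta> < 1" and "s > 0"
  shows "(\<integral>\<^sup>+\<phi>. ennreal (zolotarev \<theta> \<phi> ^ s) * indicator {0<..<pi} \<phi> \<partial>lborel)
    = ennreal (pi * Gamma (1 + real s) / (Gamma (1 + \<theta> * real s) * Gamma (1 + (1 - \<theta>) * real s)))"
proof -
  define a where "a = \<theta> * real s"
  define R where "R \<phi> = sin (\<theta> * \<phi>) / sin ((1 - \<theta>) * \<phi>)" for \<phi>
  define q where "q j \<phi> = (if real j = a then \<phi> else R \<phi> powr (real j - a) * sin ((real j - a) * \<phi>) / (real j - a))" for j \<phi>
  define Q where "Q \<phi> = (\<Sum>j\<le>s. real (s choose j) * q j \<phi>)" for \<phi>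
  have a: "0 < a" "a < real s" using assms by (auto simp: a_def)
  have pos: "sin (\<theta> * \<phi>) > 0" "sin ((1 - \<theta>) * \<phi>) > 0" "R \<phi> > 0" if "0 < \<phi>" "\<phi> \<le> pi" for \<phi>
    using zolotarev_sin_pos[OF \<theta> that] by (auto simp: R_def)
  have DQ: "(Q has_real_derivative zolotarev \<theta> \<phi> ^ s) (at \<phi>)" if \<phi>: "0 < \<phi>" "\<phi> \<le> pi" for \<phi>
  proof -
    define R' where "R' = (\<theta> * cos (\<theta> * \<phi>) * sin ((1 - \<theta>) * \<phi>) - sin (\<theta> * \<phi>) * ((1 - \<theta>) * cos ((1 - \<theta>) * \<phi>))) / sin ((1 - \<theta>) * \<phi>) ^ 2"
    have DR: "(R has_real_derivative R') (at \<phi>)"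
      unfolding R_def R'_def using pos[OF \<phi>]
      by (auto intro!: derivative_eq_intros simp: power2_eq_square)
    have Dq: "(q j has_real_derivative
        R' / R \<phi> * (R \<phi> powr (real j - a) * sin ((real j - a) * \<phi>)) + R \<phi> powr (real j - a) * cos ((real j - a) * \<phi>)) (at \<phi>)" for j
    proof (cases "real j = a")
      case True
      then show ?thesis using pos(3)[OF \<phi>] unfolding q_def by (auto intro!: derivative_eq_intros)
    next
      case False
      define c where "c = real j - a"
      have c: "c \<noteq> 0" using False by (simp add: c_def)
      have "((\<lambda>x. R x powr c * sin (c * x) / c) has_real_derivative
          ((c * R \<phi> powr (c - 1) * R') * sin (c * \<phi>) + (cos (c * \<phi>) * c) * R \<phi> powr c) / c) (at \<phi>)"
        by (intro DERIV_cdivide DERIV_mult DERIV_fun_powr[OF DR pos(3)[OF \<phi>], of c, unfolded of_nat_1])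
           (auto intro!: derivative_eq_intros)
      also have "((c * R \<phi> powr (c - 1) * R') * sin (c * \<phi>) + (cos (c * \<phi>) * c) * R \<phi> powr c) / c
        = R' / R \<phi> * (R \<phi> powr c * sin (c * \<phi>)) + R \<phi> powr c * cos (c * \<phi>)"
        using c pos(3)[OF \<phi>] by (simp add: powr_diff field_simps)
      finally show ?thesis unfolding q_def c_def[symmetric] using False by simp
    qed
    have "(Q has_real_derivative (\<Sum>j\<le>s. real (s choose j) *
        (R' / R \<phi> * (R \<phi> powr (real j - a) * sin ((real j - a) * \<phi>)) + R \<phi> powr (real j - a) * cos ((real j - a) * \<phi>)))) (at \<phi>)"
      unfolding Q_def by (intro DERIV_sum DERIV_cmult Dq)
    also have "(\<Sum>j\<le>s. real (s choose j) *
        (R' / R \<phi> * (R \<phi> powr (real j - a) * sin ((real j - a) * \<phi>)) + R \<phi> powr (real j - a) * cos ((real j - a) * \<phi>)))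
      = R' / R \<phi> * (\<Sum>j\<le>s. real (s choose j) * (R \<phi> powr (real j - a) * sin ((real j - a) * \<phi>)))
        + (\<Sum>j\<le>s. real (s choose j) * (R \<phi> powr (real j - a) * cos ((real j - a) * \<phi>)))"
      by (simp add: sum.distrib sum_distrib_left algebra_simps)
    also have "\<dots> = zolotarev \<theta> \<phi> ^ s"
      using zolotarev_binomial[OF \<theta> \<phi>, of s] unfolding R_def a_def by simp
    finally show ?thesis .
  qed
  have Rlim: "(R \<longlongrightarrow> \<theta> / (1 - \<theta>)) (at_right 0)"
  proof -
    have "(R \<longlongrightarrow> \<theta> * inverse (1 - \<theta>)) (at_right 0)"
      unfolding R_def using \<theta> by real_asymp
    then show ?thesis by (simp add: divide_inverse)
  qed
  have lim0: "(Q \<longlongrightarrow> 0) (at_right 0)"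
  proof -
    have "(q j \<longlongrightarrow> 0) (at_right 0)" for j
    proof (cases "real j = a")
      case True
      then show ?thesis unfolding q_def by (auto intro!: tendsto_eq_intros)
    next
      case False
      have "((\<lambda>\<phi>. R \<phi> powr (real j - a) * sin ((real j - a) * \<phi>) / (real j - a)) \<longlongrightarrow> 
         (\<theta> / (1 - \<theta>)) powr (real j - a) * sin ((real j - a) * 0) / (real j - a)) (at_right 0)"
        using False \<theta> by (intro tendsto_intros Rlim) auto
      then show ?thesis unfolding q_def using False by simp
    qed
    then have "(Q \<longlongrightarrow> (\<Sum>j\<le>s. real (s choose j) * 0)) (at_right 0)"
      unfolding Q_def by (intro tendsto_intros)
    then show ?thesis by simp
  qed
  have limpi: "(Q \<longlongrightarrow> Q pi) (at_left pi)"
    using DERIV_isCont[OF DQ[of pi]] pi_gt_zero unfolding isCont_def by (auto intro: tendsto_within_subset)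
  have cont: "isCont (\<lambda>\<phi>. zolotarev \<theta> \<phi> ^ s) \<phi>" if "0 < \<phi>" "\<phi> < pi" for \<phi>
    unfolding zolotarev_def using pos[of \<phi>] that by (auto intro!: continuous_intros)
  note ftc = interval_integral_FTC_nonneg[where a = 0 and b = "ereal pi" and F = Q and f = "\<lambda>\<phi>. zolotarev \<theta> \<phi> ^ s" and A = 0 and B = "Q pi"]
  have ei: "einterval 0 (ereal pi) = {0<..<pi}"
    unfolding zero_ereal_def by (rule einterval_eq)
  have set_int: "set_integrable lborel {0<..<pi} (\<lambda>\<phi>. zolotarev \<theta> \<phi> ^ s)"
    and val: "(LBINT \<phi>=0..ereal pi. zolotarev \<theta> \<phi> ^ s) = Q pi - 0"
  proof -
    have 1: "DERIV Q x :> zolotarev \<theta> x ^ s" if "0 < ereal x" "ereal x < ereal pi" for x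
      using DQ[of x] that by simp
    have 2: "isCont (\<lambda>\<phi>. zolotarev \<theta> \<phi> ^ s) x" if "0 < ereal x" "ereal x < ereal pi" for x
      using cont that by simp
    have 3: "AE x in lborel. 0 < ereal x \<longrightarrow> ereal x < ereal pi \<longrightarrow> 0 \<le> zolotarev \<theta> x ^ s"
      using zolotarev_nonneg[OF \<theta>] by (auto intro!: AE_I2)
    have 4: "((Q \<circ> real_of_ereal) \<longlongrightarrow> 0) (at_right 0)"
      using lim0 ereal_tendsto_simps(2)[of Q 0 0] unfolding zero_ereal_def by simp
    have 5: "((Q \<circ> real_of_ereal) \<longlongrightarrow> Q pi) (at_left (ereal pi))"
      using limpi ereal_tendsto_simps(1)[of Q "Q pi" pi] by simp
    show "set_integrable lborel {0<..<pi} (\<lambda>\<phi>. zolotarev \<theta> \<phi> ^ s)"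
      using ftc(1)[OF _ 1 2 3 4 5] unfolding ei by simp
    show "(LBINT \<phi>=0..ereal pi. zolotarev \<theta> \<phi> ^ s) = Q pi - 0"
      using ftc(2)[OF _ 1 2 3 4 5] by simp
  qed
  have Qpi: "Q pi = pi * Gamma (1 + real s) / (Gamma (1 + a) * Gamma (1 + (real s - a)))"
  proof -
    have "sin ((1 - \<theta>) * pi) = sin (\<theta> * pi)" by (simp add: left_diff_distrib sin_diff)
    then have R1: "R pi = 1" using pos(1)[of pi] pi_gt_zero unfolding R_def by simp
    have "Q pi = (\<Sum>j\<le>s. real (s choose j) * (if real j = a then pi else sin ((real j - a) * pi) / (real j - a)))"
      unfolding Q_def q_def R1 powr_one_eq_one mult_1 ..
    then show ?thesis using sum_binomial_sinc[OF a] by simp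
  qed
  have "(\<integral>\<^sup>+\<phi>. ennreal (zolotarev \<theta> \<phi> ^ s) * indicator {0<..<pi} \<phi> \<partial>lborel)
    = (\<integral>\<^sup>+\<phi>. ennreal (indicator {0<..<pi} \<phi> *\<^sub>R zolotarev \<theta> \<phi> ^ s) \<partial>lborel)"
    by (rule nn_integral_cong) (auto simp: indicator_def)
  also have "\<dots> = ennreal (LBINT \<phi>:{0<..<pi}. zolotarev \<theta> \<phi> ^ s)"
    using set_int zolotarev_nonneg[OF \<theta>] unfolding set_integrable_def set_lebesgue_integral_def
    by (intro nn_integral_eq_integral) (auto intro!: AE_I2 simp: indicator_def)
  also have "(LBINT \<phi>:{0<..<pi}. zolotarev \<theta> \<phi> ^ s) = Q pi"
    using val pi_gt_zero unfolding interval_lebesgue_integral_def ei by simp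
  finally show ?thesis unfolding Qpi a_def by (simp add: algebra_simps)
qed

subsection \<open>Decay of the integrand\<close>

text \<open>Expresses that \<open>(sin x / x) exp(x\<^sup>2/6)\<close> decreases, which is the quantitative form of
  \<open>sin x / x\<close> being largest at the origin.\<close>

lemma sin_over_x_gauss_mono:
  fixes x y :: real
  assumes "0 < x" "x \<le> y" "y < pi"
  shows "ln (sin y) - ln y + y\<^sup>2 / 6 \<le> ln (sin x) - ln x + x\<^sup>2 / 6"
proof -
  \<comment> \<open>Up to a positive factor, \<open>k\<close> is the derivative of the function in question, and \<open>k' = t m / 3\<close>.\<close>
  define m :: "real \<Rightarrow> real" where "m t = t * cos t - sin t" for t
  define k :: "real \<Rightarrow> real" where "k t = t * cos t - sin t + t\<^sup>2 * sin t / 3" for t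
  have m: "m t \<le> 0" if "0 \<le> t" "t \<le> pi" for t
  proof -
    have "m t \<le> m 0"
    proof (rule DERIV_nonpos_imp_nonincreasing[OF that(1)])
      fix u assume "0 \<le> u" "u \<le> t"
      moreover have "(m has_real_derivative - u * sin u) (at u)"
        unfolding m_def by (auto intro!: derivative_eq_intros)
      moreover have "- u * sin u \<le> 0" using calculation(1,2) that by (simp add: sin_ge_zero)
      ultimately show "\<exists>z. DERIV m u :> z \<and> z \<le> 0" by blast
    qed
    then show ?thesis by (simp add: m_def)
  qed
  have k: "k t \<le> 0" if "0 \<le> t" "t \<le> pi" for t
  proof -
    have "k t \<le> k 0"
    proof (rule DERIV_nonpos_imp_nonincreasing[OF that(1)])
      fix u assume u: "0 \<le> u" "u \<le> t"
      have "(k has_real_derivative u * m u / 3) (at u)"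
        unfolding k_def m_def by (auto intro!: derivative_eq_intros simp: field_simps power2_eq_square)
      moreover have "u * m u / 3 \<le> 0" using m[of u] u that by (simp add: mult_nonneg_nonpos)
      ultimately show "\<exists>z. DERIV k u :> z \<and> z \<le> 0" by blast
    qed
    then show ?thesis by (simp add: k_def)
  qed
  show ?thesis
  proof (rule DERIV_nonpos_imp_nonincreasing[OF assms(2), of "\<lambda>t. ln (sin t) - ln t + t\<^sup>2 / 6"])
    fix u assume u: "x \<le> u" "u \<le> y"
    then have u': "0 < u" "u < pi" using assms by auto
    then have s: "sin u > 0" by (intro sin_gt_zero)
    have "((\<lambda>t. ln (sin t) - ln t + t\<^sup>2 / 6) has_real_derivative cos u / sin u - 1 / u + u / 3) (at u)"
      using s u' by (auto intro!: derivative_eq_intros simp: field_simps)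
    moreover have "cos u / sin u - 1 / u + u / 3 = k u / (u * sin u)"
      using s u' by (simp add: k_def field_simps power2_eq_square)
    moreover have "k u / (u * sin u) \<le> 0" using k[of u] s u' by (simp add: divide_nonpos_pos)
    ultimately show "\<exists>z. DERIV (\<lambda>t. ln (sin t) - ln t + t\<^sup>2 / 6) u :> z \<and> z \<le> 0" by metis
  qed
qed

text \<open>The limit of \<open>Z(\<phi>)\<close> as \<open>\<phi>\<close> tends to \<open>0\<close>, where the maximum sits.\<close>

definition zolotarev_max :: "real \<Rightarrow> real" where
  "zolotarev_max \<theta> = \<theta> powr (- \<theta>) * (1 - \<theta>) powr (- (1 - \<theta>))"

lemma zolotarev_max_pos: "0 < \<theta> \<Longrightarrow> \<theta> < 1 \<Longrightarrow> zolotarev_max \<theta> > 0"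
  by (simp add: zolotarev_max_def)

text \<open>The logarithm of \<open>Z\<close> relative to its maximum is an average of the differences of \<open>ln(sin x / x)\<close>
  between \<open>\<phi>\<close> and the smaller angles \<open>\<theta>\<phi>\<close> and \<open>(1 - \<theta>)\<phi>\<close>, so the monotonicity above gives Gaussian decay in the angle.\<close>

lemma zolotarev_le:
  assumes \<theta>: "0 < \<theta>" "\<theta> < 1" and \<phi>: "0 < \<phi>" "\<phi> < pi"
  shows "zolotarev \<theta> \<phi> > 0" "zolotarev \<theta> \<phi> \<le> zolotarev_max \<theta> * exp (- (\<theta> * (1 - \<theta>) / 2 * \<phi>\<^sup>2))"
proof -
  have s: "sin \<phi> > 0" "sin (\<theta> * \<phi>) > 0" "sin ((1 - \<theta>) * \<phi>) > 0"
    using zolotarev_sin_pos[OF \<theta>, of \<phi>] \<phi> by (auto intro: sin_gt_zero)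
  then show pos: "zolotarev \<theta> \<phi> > 0" by (simp add: zolotarev_def)
  define L where "L x = ln (sin x) - ln x" for x :: real
  have le: "\<theta> * \<phi> \<le> \<phi>" "(1 - \<theta>) * \<phi> \<le> \<phi>"
    using \<theta> \<phi> mult_right_mono[of \<theta> 1 \<phi>] mult_right_mono[of "1 - \<theta>" 1 \<phi>] by auto
  have 1: "L \<phi> \<le> L (\<theta> * \<phi>) + ((\<theta> * \<phi>)\<^sup>2 - \<phi>\<^sup>2) / 6"
    using sin_over_x_gauss_mono[of "\<theta> * \<phi>" \<phi>] \<theta> \<phi> le by (simp add: L_def diff_divide_distrib)
  have 2: "L \<phi> \<le> L ((1 - \<theta>) * \<phi>) + (((1 - \<theta>) * \<phi>)\<^sup>2 - \<phi>\<^sup>2) / 6"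
    using sin_over_x_gauss_mono[of "(1 - \<theta>) * \<phi>" \<phi>] \<theta> \<phi> le by (simp add: L_def diff_divide_distrib)
  have lz: "ln (zolotarev \<theta> \<phi>) = ln (sin \<phi>) - (\<theta> * ln (sin (\<theta> * \<phi>)) + (1 - \<theta>) * ln (sin ((1 - \<theta>) * \<phi>)))"
    using s by (simp add: zolotarev_def ln_div ln_mult ln_powr)
  have lm: "ln (zolotarev_max \<theta>) = - \<theta> * ln \<theta> - (1 - \<theta>) * ln (1 - \<theta>)"
    using \<theta> by (simp add: zolotarev_max_def ln_mult ln_powr left_diff_distrib)
  have "ln (zolotarev \<theta> \<phi>) - ln (zolotarev_max \<theta>) = L \<phi> - (\<theta> * L (\<theta> * \<phi>) + (1 - \<theta>) * L ((1 - \<theta>) * \<phi>))"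
  proof -
    have e: "ln (\<theta> * \<phi>) = ln \<theta> + ln \<phi>" "ln ((1 - \<theta>) * \<phi>) = ln (1 - \<theta>) + ln \<phi>"
      using \<theta> \<phi> by (simp_all add: ln_mult)
    show ?thesis unfolding lz lm L_def e by algebra
  qed
  also have "\<dots> = \<theta> * (L \<phi> - L (\<theta> * \<phi>)) + (1 - \<theta>) * (L \<phi> - L ((1 - \<theta>) * \<phi>))"
    by (simp add: algebra_simps)
  also have "\<dots> \<le> \<theta> * (((\<theta> * \<phi>)\<^sup>2 - \<phi>\<^sup>2) / 6) + (1 - \<theta>) * ((((1 - \<theta>) * \<phi>)\<^sup>2 - \<phi>\<^sup>2) / 6)"
  proof (intro add_mono mult_left_mono)
    show "L \<phi> - L (\<theta> * \<phi>) \<le> ((\<theta> * \<phi>)\<^sup>2 - \<phi>\<^sup>2) / 6"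
      "L \<phi> - L ((1 - \<theta>) * \<phi>) \<le> (((1 - \<theta>) * \<phi>)\<^sup>2 - \<phi>\<^sup>2) / 6"
      using 1 2 by linarith+
  qed (use \<theta> in auto)
  also have "\<dots> = - (\<theta> * (1 - \<theta>) / 2 * \<phi>\<^sup>2)"
    by (simp add: power2_eq_square field_simps)
  finally have "ln (zolotarev \<theta> \<phi>) \<le> ln (zolotarev_max \<theta> * exp (- (\<theta> * (1 - \<theta>) / 2 * \<phi>\<^sup>2)))"
    using zolotarev_max_pos[OF \<theta>] by (simp add: ln_mult)
  then show "zolotarev \<theta> \<phi> \<le> zolotarev_max \<theta> * exp (- (\<theta> * (1 - \<theta>) / 2 * \<phi>\<^sup>2))"
    using pos zolotarev_max_pos[OF \<theta>] by simp
qed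

section \<open>Elementary inequalities for Laplace's method\<close>

text \<open>For \<open>\<mu> \<le> 1/2\<close> apply Young's inequality to \<open>ab\<close> and \<open>b\<^sup>2\<close> in place of \<open>a\<^sup>2\<close> and \<open>b\<^sup>2\<close>; compared
  with the plain weighted mean this gains exactly the quadratic term. This term localises Laplace's integral.\<close>

lemma amgm_refined:
  fixes a b \<mu> :: real
  assumes "a \<ge> 0" "b \<ge> 0" "0 < \<mu>" "\<mu> < 1"
  shows "(a\<^sup>2) powr \<mu> * (b\<^sup>2) powr (1 - \<mu>) \<le> \<mu> * a\<^sup>2 + (1 - \<mu>) * b\<^sup>2 - min \<mu> (1 - \<mu>) * (a - b)\<^sup>2"
proof -
  have young: "x powr t * y powr (1 - t) \<le> t * x + (1 - t) * y" if "x > 0" "y > 0" "0 \<le> t" "t \<le> 1" for x y t :: real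
    using Youngs_inequality_0[of t "1 - t" x y] that by simp
  have half: "(a\<^sup>2) powr \<mu> * (b\<^sup>2) powr (1 - \<mu>) \<le> \<mu> * a\<^sup>2 + (1 - \<mu>) * b\<^sup>2 - \<mu> * (a - b)\<^sup>2"
    if "a > 0" "b > 0" "0 < \<mu>" "\<mu> \<le> 1/2" for a b \<mu> :: real
  proof -
    have "(a\<^sup>2) powr \<mu> * (b\<^sup>2) powr (1 - \<mu>) = (a * b) powr (2 * \<mu>) * (b\<^sup>2) powr (1 - 2 * \<mu>)"
    proof -
      have "(a * b) powr (2 * \<mu>) = a powr (2 * \<mu>) * b powr (2 * \<mu>)" using that by (simp add: powr_mult)
      moreover have "(x\<^sup>2) powr t = x powr (2 * t)" if "x > 0" for x t :: real
        using that by (simp add: powr_powr flip: powr_numeral)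
      ultimately show ?thesis using that by (simp add: powr_add[symmetric] mult.assoc)
    qed
    also have "\<dots> \<le> (2 * \<mu>) * (a * b) + (1 - 2 * \<mu>) * b\<^sup>2"
      using that by (intro young) auto
    also have "\<dots> = \<mu> * a\<^sup>2 + (1 - \<mu>) * b\<^sup>2 - \<mu> * (a - b)\<^sup>2"
      by (simp add: power2_eq_square algebra_simps)
    finally show ?thesis .
  qed
  show ?thesis
  proof (cases "a = 0 \<or> b = 0")
    case True
    then have "min \<mu> (1 - \<mu>) * (a - b)\<^sup>2 \<le> \<mu> * a\<^sup>2 + (1 - \<mu>) * b\<^sup>2"
      by (auto intro!: mult_right_mono)
    with True show ?thesis by auto
  next
    case False
    then have ab: "a > 0" "b > 0" using assms by auto
    show ?thesis
    proof (cases "\<mu> \<le> 1/2")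
      case True
      then show ?thesis using half[OF ab \<open>0 < \<mu>\<close>] by (simp add: min_def)
    next
      case False
      have "(b - a)\<^sup>2 = (a - b)\<^sup>2" by (rule power2_commute)
      then show ?thesis using half[OF ab(2,1), of "1 - \<mu>"] False assms by (simp add: min_def mult.commute)
    qed
  qed
qed

lemma geometric_mean_between:
  fixes a b \<mu> :: real
  assumes "a \<ge> 0" "b \<ge> 0" "0 \<le> \<mu>" "\<mu> \<le> 1"
  shows "\<bar>a powr \<mu> * b powr (1 - \<mu>) - b\<bar> \<le> \<bar>a - b\<bar>"
proof (cases "a = 0 \<or> b = 0")
  case True
  then show ?thesis using assms by (auto simp: powr_def)
next
  case False
  then have ab: "a > 0" "b > 0" using assms by auto
  have pw: "x powr \<mu> * x powr (1 - \<mu>) = x" if "x > 0" for x using that by (simp add: powr_add[symmetric])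
  show ?thesis
  proof (cases "a \<le> b")
    case True
    have "a powr \<mu> * a powr (1 - \<mu>) \<le> a powr \<mu> * b powr (1 - \<mu>)"
      using True ab assms by (intro mult_left_mono powr_mono2) auto
    moreover have "a powr \<mu> * b powr (1 - \<mu>) \<le> b powr \<mu> * b powr (1 - \<mu>)"
      using True ab assms by (intro mult_right_mono powr_mono2) auto
    ultimately show ?thesis using pw ab True by simp
  next
    case False
    have "b powr \<mu> * b powr (1 - \<mu>) \<le> a powr \<mu> * b powr (1 - \<mu>)"
      using False ab assms by (intro mult_right_mono powr_mono2) auto
    moreover have "a powr \<mu> * b powr (1 - \<mu>) \<le> a powr \<mu> * a powr (1 - \<mu>)"
      using False ab assms by (intro mult_left_mono powr_mono2) auto
    ultimately show ?thesis using pw ab False by simp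
  qed
qed

text \<open>Peetre's inequality: a polynomial weight changes by at most a polynomial in the distance, which
  Gaussian factors absorb.\<close>

lemma peetre:
  fixes a b s :: real
  assumes "a \<ge> 0" "b \<ge> 0"
  shows "(1 + a) powr s \<le> (1 + b) powr s * (1 + \<bar>a - b\<bar>) powr \<bar>s\<bar>"
proof -
  have main: "1 + x \<le> (1 + y) * (1 + \<bar>x - y\<bar>)" if "x \<ge> 0" "y \<ge> 0" for x y :: real
  proof -
    have "0 \<le> y * \<bar>x - y\<bar>" using that by simp
    then show ?thesis by (simp add: algebra_simps)
  qed
  show ?thesis
  proof (cases "s \<ge> 0")
    case True
    have "(1 + a) powr s \<le> ((1 + b) * (1 + \<bar>a - b\<bar>)) powr s"
      using assms True main[of a b] by (intro powr_mono2) auto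
    then show ?thesis using assms True by (simp add: powr_mult)
  next
    case False
    have "(1 + b) powr (- s) \<le> ((1 + a) * (1 + \<bar>a - b\<bar>)) powr (- s)"
      using assms False main[of b a] by (intro powr_mono2) (auto simp: abs_minus_commute)
    then have "(1 + b) powr (- s) \<le> (1 + a) powr (- s) * (1 + \<bar>a - b\<bar>) powr \<bar>s\<bar>"
      using assms False by (simp add: powr_mult)
    then have "(1 + a) powr s * (1 + b) powr (- s) * (1 + b) powr s
        \<le> (1 + a) powr s * ((1 + a) powr (- s) * (1 + \<bar>a - b\<bar>) powr \<bar>s\<bar>) * (1 + b) powr s"
      by (intro mult_right_mono mult_left_mono) auto
    moreover have "x powr s * x powr (- s) = 1" if "x > 0" for x :: real
      using that by (simp add: powr_add[symmetric])
    moreover have "(1 + a) powr s * (1 + b) powr (- s) * (1 + b) powr s = (1 + a) powr s * ((1 + b) powr s * (1 + b) powr (- s))"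
      "(1 + a) powr s * ((1 + a) powr (- s) * (1 + \<bar>a - b\<bar>) powr \<bar>s\<bar>) * (1 + b) powr s
        = ((1 + a) powr s * (1 + a) powr (- s)) * ((1 + b) powr s * (1 + \<bar>a - b\<bar>) powr \<bar>s\<bar>)"
      by (simp_all only: mult.assoc mult.commute mult.left_commute)
    ultimately show ?thesis using assms by simp
  qed
qed

lemma poly_le_gauss:
  fixes K \<epsilon> :: real
  assumes "\<epsilon> > 0"
  obtains C where "C > 0" "\<And>D. D \<ge> 0 \<Longrightarrow> (1 + D) powr K \<le> C * exp (\<epsilon> * D\<^sup>2)"
proof -
  define m where "m = nat \<lceil>\<bar>K\<bar>\<rceil>"
  have m: "K \<le> real m" unfolding m_def by linarith
  define C where "C = fact m / \<epsilon> ^ m * exp (\<epsilon> + \<epsilon>)"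
  show thesis
  proof
    show "C > 0" using assms by (simp add: C_def)
    fix D :: real assume D: "D \<ge> 0"
    have "(1 + D) powr K \<le> (1 + D) powr real m" using m D by (intro powr_mono) auto
    also have "\<dots> = (1 + D) ^ m" using D by (simp add: powr_realpow)
    also have "\<dots> = (\<epsilon> * (1 + D)) ^ m / \<epsilon> ^ m" using assms by (simp add: power_mult_distrib)
    also have "\<dots> \<le> fact m * exp (\<epsilon> * (1 + D)) / \<epsilon> ^ m"
      using assms D by (intro divide_right_mono power_le_exp) auto
    also have "\<dots> \<le> fact m * exp (\<epsilon> * (2 + D\<^sup>2)) / \<epsilon> ^ m"
    proof -
      have "1 + D \<le> 2 + D\<^sup>2" using zero_le_power2[of "D - 1/2"] by (simp add: power2_eq_square algebra_simps)
      then have "\<epsilon> * (1 + D) \<le> \<epsilon> * (2 + D\<^sup>2)" using assms by (intro mult_left_mono) auto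
      then show ?thesis using assms by (intro divide_right_mono mult_left_mono) auto
    qed
    also have "\<dots> = C * exp (\<epsilon> * D\<^sup>2)" by (simp add: C_def exp_add[symmetric] algebra_simps)
    finally show "(1 + D) powr K \<le> C * exp (\<epsilon> * D\<^sup>2)" .
  qed
qed

subsection \<open>Gaussian integrals\<close>

definition gauss_const :: real where
  "gauss_const = enn2real (\<integral>\<^sup>+x. ennreal (exp (- x\<^sup>2)) \<partial>(lborel :: real measure))"

lemma nn_integral_gauss:
  fixes a b :: real
  assumes "b > 0"
  shows "(\<integral>\<^sup>+x. ennreal (exp (- ((x - a) / b)\<^sup>2)) \<partial>lborel) = ennreal (b * gauss_const)"
proof -
  let ?J = "\<integral>\<^sup>+x. ennreal (exp (- x\<^sup>2)) \<partial>(lborel :: real measure)"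
  have "?J \<le> (\<integral>\<^sup>+x. ennreal (exp 1) * (ennreal (exp (- x)) * indicator {0..} x + ennreal (exp (- (- x))) * indicator {0..} (- x)) \<partial>(lborel :: real measure))"
  proof (rule nn_integral_mono)
    fix x :: real
    have "- x\<^sup>2 \<le> 1 - \<bar>x\<bar>" using zero_le_power2[of "\<bar>x\<bar> - 1/2"] by (simp add: power2_eq_square algebra_simps)
    then have "ennreal (exp (- x\<^sup>2)) \<le> ennreal (exp 1 * exp (- \<bar>x\<bar>))"
      by (intro ennreal_leI) (simp add: exp_add[symmetric])
    also have "\<dots> = ennreal (exp 1) * ennreal (exp (- \<bar>x\<bar>))" by (simp add: ennreal_mult)
    also have "ennreal (exp (- \<bar>x\<bar>)) \<le> ennreal (exp (- x)) * indicator {0..} x + ennreal (exp (- (- x))) * indicator {0..} (- x)"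
      by (cases "x \<ge> 0") (auto simp: indicator_def)
    finally show "ennreal (exp (- x\<^sup>2)) \<le> ennreal (exp 1) * (ennreal (exp (- x)) * indicator {0..} x + ennreal (exp (- (- x))) * indicator {0..} (- x))"
      by (simp add: mult_left_mono)
  qed
  also have "\<dots> = ennreal (exp 1) * ((\<integral>\<^sup>+x. ennreal (exp (- x)) * indicator {0..} x \<partial>(lborel :: real measure)) + (\<integral>\<^sup>+x. ennreal (exp (- (- x))) * indicator {0..} (- x) \<partial>(lborel :: real measure)))"
    by (subst nn_integral_cmult, measurable, subst nn_integral_add) simp_all
  also have "(\<integral>\<^sup>+x. ennreal (exp (- (- x))) * indicator {0..} (- x) \<partial>(lborel :: real measure)) = (\<integral>\<^sup>+x. ennreal (exp (- x)) * indicator {0..} x \<partial>(lborel :: real measure))"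
    using nn_integral_lborel_affine[of "\<lambda>x::real. ennreal (exp (- x)) * indicator {0..} x" "-1" 0] by simp
  also have "ennreal (exp 1) * ((\<integral>\<^sup>+x. ennreal (exp (- x)) * indicator {0..} x \<partial>(lborel :: real measure)) + (\<integral>\<^sup>+x. ennreal (exp (- x)) * indicator {0..} x \<partial>(lborel :: real measure))) < \<infinity>"
    unfolding nn_integral_exp_tail by (simp add: ennreal_mult_less_top)
  finally have J: "?J = ennreal gauss_const" unfolding gauss_const_def by (simp add: less_top)
  have "(\<integral>\<^sup>+x. ennreal (exp (- ((x - a) / b)\<^sup>2)) \<partial>lborel)
     = (\<integral>\<^sup>+x. ennreal (exp (- (- (a / b) + (1 / b) *\<^sub>R x)\<^sup>2)) \<partial>lborel)"
    by (simp add: diff_divide_distrib)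
  also have "\<dots> = ennreal b * ?J"
    using assms by (subst nn_integral_lborel_affine[of "\<lambda>x. ennreal (exp (- x\<^sup>2))"]) auto
  also have "\<dots> = ennreal (b * gauss_const)"
    unfolding J using assms by (simp add: ennreal_mult gauss_const_def)
  finally show ?thesis .
qed

lemma gauss_const_nonneg: "gauss_const \<ge> 0" by (simp add: gauss_const_def)

text \<open>For \<open>sqrt y \<le> 2M\<close> the exponent is a Gaussian in \<open>y\<close> of width proportional to \<open>1 + M\<close>; beyond that
  it is at most \<open>-c y / 4\<close>.\<close>

lemma nn_integral_sqrt_gauss:
  fixes c M :: real
  assumes "c > 0" "M \<ge> 0"
  shows "(\<integral>\<^sup>+y. ennreal (exp (- c * (sqrt y - M)\<^sup>2)) * indicator {0<..} y \<partial>lborel)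
    \<le> ennreal ((3 / sqrt c * gauss_const + 4 / c) * (1 + M))"
proof -
  define b where "b = 3 * (1 + M) / sqrt c"
  have b: "b > 0" using assms by (simp add: b_def)
  have "(\<integral>\<^sup>+y. ennreal (exp (- c * (sqrt y - M)\<^sup>2)) * indicator {0<..} y \<partial>lborel)
    \<le> (\<integral>\<^sup>+y. ennreal (exp (- ((y - M\<^sup>2) / b)\<^sup>2)) + ennreal (exp (- (0 + (c / 4) *\<^sub>R y))) * indicator {0..} (0 + (c / 4) *\<^sub>R y) \<partial>lborel)"
  proof (rule nn_integral_mono)
    fix y :: real
    show "ennreal (exp (- c * (sqrt y - M)\<^sup>2)) * indicator {0<..} y
      \<le> ennreal (exp (- ((y - M\<^sup>2) / b)\<^sup>2)) + ennreal (exp (- (0 + (c / 4) *\<^sub>R y))) * indicator {0..} (0 + (c / 4) *\<^sub>R y)"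
    proof (cases "y > 0")
      case True
      define x where "x = sqrt y"
      have x: "x > 0" "y = x\<^sup>2" using True by (simp_all add: x_def)
      show ?thesis
      proof (cases "x \<le> 2 * M")
        case True
        have "(y - M\<^sup>2)\<^sup>2 = (x - M)\<^sup>2 * (x + M)\<^sup>2" by (simp add: x power2_eq_square algebra_simps)
        also have "\<dots> \<le> (x - M)\<^sup>2 * (3 * (1 + M))\<^sup>2"
          using True x assms by (intro mult_left_mono power_mono) auto
        finally have "(y - M\<^sup>2)\<^sup>2 / b\<^sup>2 \<le> (x - M)\<^sup>2 * (3 * (1 + M))\<^sup>2 / b\<^sup>2"
          by (rule divide_right_mono) simp
        then have "((y - M\<^sup>2) / b)\<^sup>2 \<le> (x - M)\<^sup>2 * (3 * (1 + M))\<^sup>2 / b\<^sup>2"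
          by (simp only: power_divide)
        also have "b\<^sup>2 = (3 * (1 + M))\<^sup>2 / c" using assms by (simp add: b_def power_divide)
        also have "(x - M)\<^sup>2 * (3 * (1 + M))\<^sup>2 / ((3 * (1 + M))\<^sup>2 / c) = c * (x - M)\<^sup>2"
          using assms by simp
        finally have "((y - M\<^sup>2) / b)\<^sup>2 \<le> c * (x - M)\<^sup>2" .
        then have "ennreal (exp (- c * (sqrt y - M)\<^sup>2)) \<le> ennreal (exp (- ((y - M\<^sup>2) / b)\<^sup>2))"
          unfolding x_def by (intro ennreal_leI) simp
        then show ?thesis using \<open>y > 0\<close> by (simp add: add_increasing2)
      next
        case False
        then have "(x / 2)\<^sup>2 \<le> (x - M)\<^sup>2" using x by (intro power_mono) auto
        then have "c * (y / 4) \<le> c * (x - M)\<^sup>2" using assms x by (intro mult_left_mono) (auto simp: power_divide)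
        then have "ennreal (exp (- c * (sqrt y - M)\<^sup>2)) \<le> ennreal (exp (- (0 + (c / 4) *\<^sub>R y)))"
          unfolding x_def by (intro ennreal_leI) simp
        then show ?thesis using \<open>y > 0\<close> assms by (simp add: add_increasing)
      qed
    qed simp
  qed
  also have "\<dots> = (\<integral>\<^sup>+y. ennreal (exp (- ((y - M\<^sup>2) / b)\<^sup>2)) \<partial>lborel)
     + (\<integral>\<^sup>+y. ennreal (exp (- (0 + (c / 4) *\<^sub>R y))) * indicator {0..} (0 + (c / 4) *\<^sub>R y) \<partial>lborel)"
    by (rule nn_integral_add) measurable
  also have "(\<integral>\<^sup>+y. ennreal (exp (- ((y - M\<^sup>2) / b)\<^sup>2)) \<partial>lborel) = ennreal (b * gauss_const)"
    by (rule nn_integral_gauss[OF b])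
  also have "(\<integral>\<^sup>+y. ennreal (exp (- (0 + (c / 4) *\<^sub>R y))) * indicator {0..} (0 + (c / 4) *\<^sub>R y) \<partial>lborel)
     = ennreal (4 / c) * (\<integral>\<^sup>+y. ennreal (exp (- y)) * indicator {0..} y \<partial>lborel)"
    using assms by (subst nn_integral_lborel_affine[of "\<lambda>y. ennreal (exp (- y)) * indicator {0..} y"]) auto
  also have "ennreal (b * gauss_const) + ennreal (4 / c) * (\<integral>\<^sup>+y. ennreal (exp (- y)) * indicator {0..} y \<partial>lborel)
     = ennreal (b * gauss_const + 4 / c)"
    unfolding nn_integral_exp_tail using assms b gauss_const_nonneg by (simp add: ennreal_plus)
  also have "b * gauss_const + 4 / c \<le> (3 / sqrt c * gauss_const + 4 / c) * (1 + M)"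
    using assms by (simp add: b_def field_simps)
  finally show ?thesis by (simp add: ennreal_leI)
qed

text \<open>The gain \<open>1/(1 + P)\<close> in the angular variable pays for the loss \<open>1 + M\<close> in the radial one.\<close>

lemma nn_integral_angle_gauss:
  fixes c P :: real
  assumes "c > 0" "P \<ge> 0"
  shows "(\<integral>\<^sup>+\<phi>. ennreal (exp (- c * P\<^sup>2 * \<phi>\<^sup>2)) * indicator {0<..<pi} \<phi> \<partial>lborel) * ennreal (1 + P)
    \<le> ennreal (2 * pi + 2 * gauss_const / sqrt c)"
proof (cases "P \<le> 1")
  case True
  have "(\<integral>\<^sup>+\<phi>. ennreal (exp (- c * P\<^sup>2 * \<phi>\<^sup>2)) * indicator {0<..<pi} \<phi> \<partial>lborel)
     \<le> (\<integral>\<^sup>+\<phi>. indicator {0<..<pi} \<phi> \<partial>lborel)"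
    using assms by (intro nn_integral_mono) (auto simp: indicator_def ennreal_le_1)
  also have "\<dots> = ennreal pi" by simp
  finally have "(\<integral>\<^sup>+\<phi>. ennreal (exp (- c * P\<^sup>2 * \<phi>\<^sup>2)) * indicator {0<..<pi} \<phi> \<partial>lborel) * ennreal (1 + P) \<le> ennreal pi * ennreal 2"
    using True by (intro mult_mono ennreal_leI) auto
  also have "\<dots> = ennreal (2 * pi)" by (simp add: ennreal_mult[symmetric] mult.commute del: ennreal_numeral)
  also have "\<dots> \<le> ennreal (2 * pi + 2 * gauss_const / sqrt c)"
    using gauss_const_nonneg assms by (intro ennreal_leI) auto
  finally show ?thesis .
next
  case False
  define b where "b = 1 / (sqrt c * P)"
  have b: "b > 0" using False assms by (simp add: b_def)
  have "(\<integral>\<^sup>+\<phi>. ennreal (exp (- c * P\<^sup>2 * \<phi>\<^sup>2)) * indicator {0<..<pi} \<phi> \<partial>lborel)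
     \<le> (\<integral>\<^sup>+\<phi>. ennreal (exp (- ((\<phi> - 0) / b)\<^sup>2)) \<partial>lborel)"
    using assms by (intro nn_integral_mono) (auto simp: indicator_def b_def power_mult_distrib mult_ac)
  also have "\<dots> = ennreal (b * gauss_const)" by (rule nn_integral_gauss[OF b])
  finally have "(\<integral>\<^sup>+\<phi>. ennreal (exp (- c * P\<^sup>2 * \<phi>\<^sup>2)) * indicator {0<..<pi} \<phi> \<partial>lborel) * ennreal (1 + P)
     \<le> ennreal (b * gauss_const) * ennreal (1 + P)" by (rule mult_right_mono) simp
  also have "\<dots> = ennreal (b * gauss_const * (1 + P))"
    using b gauss_const_nonneg assms by (simp add: ennreal_mult)
  also have "\<dots> \<le> ennreal (2 * pi + 2 * gauss_const / sqrt c)"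
  proof (rule ennreal_leI)
    have "b * (1 + P) \<le> 2 / sqrt c" using False assms by (simp add: b_def field_simps)
    then have "gauss_const * (b * (1 + P)) \<le> gauss_const * (2 / sqrt c)"
      using gauss_const_nonneg by (rule mult_left_mono)
    then show "b * gauss_const * (1 + P) \<le> 2 * pi + 2 * gauss_const / sqrt c"
      by (simp add: mult_ac add_increasing)
  qed
  finally show ?thesis .
qed

section \<open>Laplace's method for the moment measure\<close>

lemma powr_comparable:
  fixes a b c \<kappa> :: real
  assumes "0 < a" "0 < b" "a \<le> c * b" "b \<le> c * a" "c \<ge> 1"
  shows "a powr \<kappa> \<le> c powr \<bar>\<kappa>\<bar> * b powr \<kappa>"
proof (cases "\<kappa> \<ge> 0")
  case True
  have "a powr \<kappa> \<le> (c * b) powr \<kappa>" using assms True by (intro powr_mono2) auto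
  then show ?thesis using assms True by (simp add: powr_mult)
next
  case False
  have "b powr (- \<kappa>) \<le> (c * a) powr (- \<kappa>)" using assms False by (intro powr_mono2) auto
  then have "b powr (- \<kappa>) \<le> c powr \<bar>\<kappa>\<bar> * a powr (- \<kappa>)" using assms False by (simp add: powr_mult)
  then show ?thesis using assms by (simp add: powr_minus field_simps)
qed

text \<open>With \<open>x\<close> the solution of \<open>2 g l x\<^sup>2\<^sup>l\<^sup>-\<^sup>1 = t\<close>, this is \<open>(1 + x)\<^sup>\<kappa> exp((2l - 1) g x\<^sup>2\<^sup>l)\<close>. The
  function \<open>t y - g y\<^sup>2\<^sup>l\<close> has its maximum \<open>(2l - 1) g x\<^sup>2\<^sup>l\<close> at \<open>y = x\<close>, so \<open>peak\<close> is the saddle point value of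
  \<open>(1 + y)\<^sup>\<kappa> exp(t y - g y\<^sup>2\<^sup>l)\<close>.\<close>

definition peak :: "real \<Rightarrow> real \<Rightarrow> real \<Rightarrow> real \<Rightarrow> real" where
  "peak l g \<kappa> t = (1 + (t / (2 * g * l)) powr (1 / (2 * l - 1))) powr \<kappa>
     * exp ((2 * l - 1) * g * ((t / (2 * g * l)) powr (1 / (2 * l - 1))) powr (2 * l))"

text \<open>In these coordinates \<open>x\<^sup>l\<close> is the weighted geometric mean \<open>u\<close> of \<open>V\<close> and \<open>M\<close>, and the refined
  mean inequality bounds the exponent: it is at most its value at \<open>V = M\<close>, minus a quadratic
  deviation.\<close>

lemma peak_bound:
  fixes l g V M \<kappa> t :: real
  assumes "l > 1" "g > 0" "V \<ge> 0" "M \<ge> 0"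
    and t: "t = 2 * g * l * (V powr (2 - 2 / l) * M powr (1 / l))"
  defines "\<mu> \<equiv> (2 * l - 2) / (2 * l - 1)"
  defines "u \<equiv> V powr \<mu> * M powr (1 - \<mu>)"
  shows "exp (- ((2 * l - 2) * g * V\<^sup>2)) * peak l g \<kappa> t
    \<le> 2 powr \<bar>\<kappa>\<bar> * (1 + u) powr (\<kappa> / l) * exp (g * (M\<^sup>2 - min (2 * l - 2) 1 * (V - M)\<^sup>2))"
proof -
  have \<mu>: "0 < \<mu>" "\<mu> < 1" "1 - \<mu> = 1 / (2 * l - 1)" using \<open>l > 1\<close> by (simp_all add: \<mu>_def field_simps)
  have u: "u \<ge> 0" by (simp add: u_def)
  define x where "x = u powr (1 / l)"
  have x0: "(t / (2 * g * l)) powr (1 / (2 * l - 1)) = x"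
  proof -
    have e1: "(2 - 2 / l) * (1 / (2 * l - 1)) = \<mu> * (1 / l)" using \<open>l > 1\<close> by (simp add: \<mu>_def field_simps)
    have e2: "(1 / l) * (1 / (2 * l - 1)) = (1 - \<mu>) * (1 / l)" using \<mu>(3) by simp
    have "t / (2 * g * l) = V powr (2 - 2 / l) * M powr (1 / l)" using assms by simp
    then have "(t / (2 * g * l)) powr (1 / (2 * l - 1)) = V powr ((2 - 2 / l) * (1 / (2 * l - 1))) * M powr ((1 / l) * (1 / (2 * l - 1)))"
      by (simp add: powr_mult powr_powr)
    also have "\<dots> = x" unfolding e1 e2 x_def u_def by (simp add: powr_mult powr_powr)
    finally show ?thesis .
  qed
  have x2: "x powr (2 * l) = (V\<^sup>2) powr \<mu> * (M\<^sup>2) powr (1 - \<mu>)"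
  proof -
    have sq: "(a\<^sup>2) powr c = (a powr c)\<^sup>2" if "a \<ge> 0" for a c :: real
      using that by (cases "a = 0") (simp_all add: powr_powr mult.commute flip: powr_numeral)
    have "x powr (2 * l) = u powr 2" using \<open>l > 1\<close> by (simp add: x_def powr_powr)
    then show ?thesis using u assms sq by (simp add: u_def power_mult_distrib)
  qed
  have poly: "(1 + x) powr \<kappa> \<le> 2 powr \<bar>\<kappa>\<bar> * (1 + u) powr (\<kappa> / l)"
  proof -
    define A where "A = (1 + u) powr (1 / l)"
    have "1 \<le> A" unfolding A_def using u \<open>l > 1\<close> by (intro ge_one_powr_ge_zero) auto
    moreover have "x \<le> A" unfolding A_def x_def using u \<open>l > 1\<close> by (intro powr_mono2) auto
    ultimately have 1: "1 + x \<le> 2 * A" by simp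
    have 2: "A \<le> 2 * (1 + x)"
    proof (cases "u \<le> 1")
      case True
      have "A \<le> 2 powr (1 / l)" unfolding A_def using True u \<open>l > 1\<close> by (intro powr_mono2) auto
      also have "\<dots> \<le> 2 powr 1" using \<open>l > 1\<close> by (intro powr_mono) auto
      finally show ?thesis by (simp add: x_def add_increasing2)
    next
      case False
      have "A \<le> (2 * u) powr (1 / l)" unfolding A_def using False \<open>l > 1\<close> by (intro powr_mono2) auto
      also have "\<dots> = 2 powr (1 / l) * x" using u by (simp add: powr_mult x_def)
      also have "\<dots> \<le> 2 powr 1 * x" using \<open>l > 1\<close> by (intro mult_right_mono powr_mono) (auto simp: x_def)
      finally show ?thesis by simp
    qed
    have "(1 + x) powr \<kappa> \<le> 2 powr \<bar>\<kappa>\<bar> * A powr \<kappa>"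
      using 1 2 u by (intro powr_comparable) (auto simp: A_def x_def intro: add_pos_nonneg)
    then show ?thesis by (simp add: A_def powr_powr)
  qed
  have "(2 * l - 1) * x powr (2 * l) \<le> (2 * l - 2) * V\<^sup>2 + M\<^sup>2 - min (2 * l - 2) 1 * (V - M)\<^sup>2"
  proof -
    have "(2 * l - 1) * x powr (2 * l) \<le> (2 * l - 1) * (\<mu> * V\<^sup>2 + (1 - \<mu>) * M\<^sup>2 - min \<mu> (1 - \<mu>) * (V - M)\<^sup>2)"
      unfolding x2 using \<open>l > 1\<close> assms \<mu> by (intro mult_left_mono amgm_refined) auto
    also have "\<dots> = ((2 * l - 1) * \<mu>) * V\<^sup>2 + ((2 * l - 1) * (1 - \<mu>)) * M\<^sup>2 - ((2 * l - 1) * min \<mu> (1 - \<mu>)) * (V - M)\<^sup>2"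
      by (simp add: algebra_simps)
    also have "(2 * l - 1) * min \<mu> (1 - \<mu>) = min ((2 * l - 1) * \<mu>) ((2 * l - 1) * (1 - \<mu>))"
      using \<open>l > 1\<close> by (simp add: min_mult_distrib_left)
    also have "(2 * l - 1) * \<mu> = 2 * l - 2" using \<open>l > 1\<close> by (simp add: \<mu>_def)
    also have "(2 * l - 1) * (1 - \<mu>) = 1" using \<open>l > 1\<close> unfolding \<mu>(3) by simp
    finally show ?thesis by simp
  qed
  then have "g * ((2 * l - 1) * x powr (2 * l)) \<le> g * ((2 * l - 2) * V\<^sup>2 + M\<^sup>2 - min (2 * l - 2) 1 * (V - M)\<^sup>2)"
    using \<open>g > 0\<close> by (intro mult_left_mono) auto
  then have "exp (- ((2 * l - 2) * g * V\<^sup>2)) * exp ((2 * l - 1) * g * x powr (2 * l)) \<le> exp (g * (M\<^sup>2 - min (2 * l - 2) 1 * (V - M)\<^sup>2))"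
    unfolding exp_add[symmetric] by (simp add: algebra_simps)
  then have "(1 + x) powr \<kappa> * (exp (- ((2 * l - 2) * g * V\<^sup>2)) * exp ((2 * l - 1) * g * x powr (2 * l)))
     \<le> (2 powr \<bar>\<kappa>\<bar> * (1 + u) powr (\<kappa> / l)) * exp (g * (M\<^sup>2 - min (2 * l - 2) 1 * (V - M)\<^sup>2))"
    using poly by (intro mult_mono) auto
  then show ?thesis unfolding peak_def x0 by (simp add: mult_ac)
qed

text \<open>The point \<open>\<xi>\<close> of the half line that the measure assigns to the Gamma variable \<open>y\<close> and the angle \<open>\<phi>\<close>.\<close>

definition zol_node :: "real \<Rightarrow> real \<Rightarrow> real \<Rightarrow> real \<Rightarrow> real" where
  "zol_node l g y \<phi> = g powr (1 / l) * y powr (1 - 1 / l) * zolotarev (1 / l) \<phi>"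

text \<open>Three scales occur: \<open>V\<close>, which is \<open>sqrt y\<close> normalised; \<open>M\<close>, the location of the peak in \<open>V\<close> for the
  given angle; and \<open>P = r\<^sup>l/2\<close>, the value of \<open>M\<close> at angle \<open>0\<close>, where the overall maximum
  \<open>exp(g P\<^sup>2) = exp(g/4 r\<^sup>2\<^sup>l)\<close> lies. The exponent loses a multiple of \<open>(V - M)\<^sup>2\<close> off the radial peak and a
  multiple of \<open>P\<^sup>2 - M\<^sup>2\<close>, hence of \<open>P\<^sup>2 \<phi>\<^sup>2\<close>, off the angular one. Peetre's inequality moves all
  polynomial factors to \<open>P\<close>; their exponents add up to \<open>\<sigma>/l\<close> because the shift \<open>2n(l - 1)\<close> in
  \<open>peak\<close> compensates the factor \<open>\<xi>\<^sup>n\<close>.\<close>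

lemma zol_node_peak_bound:
  fixes l g \<sigma> :: real and n :: nat
  assumes "l > 1" "g > 0"
  obtains C c1 c2 where "C > 0" "c1 > 0" "c2 > 0"
    "\<And>y \<phi> r. y > 0 \<Longrightarrow> 0 < \<phi> \<Longrightarrow> \<phi> < pi \<Longrightarrow> r \<ge> 0 \<Longrightarrow>
      zol_node l g y \<phi> \<ge> 0 \<and>
      exp (- y) * zol_node l g y \<phi> ^ n * peak l g (\<sigma> - 2 * n * (l - 1)) (zol_node l g y \<phi> * r)
      \<le> C * (1 + r powr l / 2) powr (\<sigma> / l) * exp (g / 4 * r powr (2 * l))
        * exp (- c1 * (sqrt y - sqrt ((2 * l - 2) * g) * (r powr l / 2 * (zolotarev (1 / l) \<phi> / zolotarev_max (1 / l)) powr l))\<^sup>2)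
        * exp (- c2 * (r powr l / 2)\<^sup>2 * \<phi>\<^sup>2)"
proof -
  define \<theta> where "\<theta> = 1 / l"
  have \<theta>: "0 < \<theta>" "\<theta> < 1" using \<open>l > 1\<close> by (auto simp: \<theta>_def)
  define \<kappa> where "\<kappa> = \<sigma> - 2 * real n * (l - 1)"
  define a where "a = real n * (2 - 2 / l)"
  have "2 / l \<le> 2" using \<open>l > 1\<close> by (simp add: field_simps)
  then have a: "a \<ge> 0" by (simp add: a_def)
  have a\<kappa>: "a + \<kappa> / l = \<sigma> / l" using \<open>l > 1\<close> by (simp add: a_def \<kappa>_def field_simps)
  \<comment> \<open>The coefficient of the quadratic gain in \<open>peak_bound\<close>.\<close>
  define c0 where "c0 = min (2 * l - 2) 1"
  have c0: "0 < c0" "c0 \<le> 1" using \<open>l > 1\<close> by (auto simp: c0_def)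
  define B where "B = (2 * l - 2) * g"
  have B: "B > 0" using assms by (simp add: B_def)
  \<comment> \<open>At most half of the quadratic gain is spent on absorbing polynomial factors.\<close>
  define \<epsilon> where "\<epsilon> = g * c0 / 4"
  have "\<epsilon> > 0" using c0 \<open>g > 0\<close> by (simp add: \<epsilon>_def)
  then obtain C3 where C3: "C3 > 0" "\<And>D. D \<ge> 0 \<Longrightarrow> (1 + D) powr (a + \<bar>\<kappa> / l\<bar>) \<le> C3 * exp (\<epsilon> * D\<^sup>2)"
    using poly_le_gauss[of \<epsilon> "a + \<bar>\<kappa> / l\<bar>"] by metis
  define C where "C = (2 * l * g) ^ n * 2 powr \<bar>\<kappa>\<bar> * C3"
  define c1 where "c1 = g * c0 / (2 * B)"
  define c2 where "c2 = g / 2 * ((1 - \<theta>) / (1 + pi\<^sup>2))"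
  show thesis
  proof (rule that[of C c1 c2])
    show "C > 0" using C3 assms by (simp add: C_def)
    show "c1 > 0" using B c0 assms by (simp add: c1_def)
    show "c2 > 0" using \<theta> assms by (simp add: c2_def add_pos_nonneg)
    fix y \<phi> r :: real
    assume y: "y > 0" and \<phi>: "0 < \<phi>" "\<phi> < pi" and r: "r \<ge> 0"
    define \<tau> where "\<tau> = zolotarev \<theta> \<phi> / zolotarev_max \<theta>"
    have \<tau>: "\<tau> > 0" "\<tau> \<le> exp (- (\<theta> * (1 - \<theta>) / 2 * \<phi>\<^sup>2))"
      using zolotarev_le[OF \<theta> \<phi>] zolotarev_max_pos[OF \<theta>] by (simp_all add: \<tau>_def field_simps)
    then have \<tau>1: "\<tau> \<le> 1" using \<theta> by (elim order_trans) simp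
    have zol: "zolotarev \<theta> \<phi> = zolotarev_max \<theta> * \<tau>"
      using zolotarev_max_pos[OF \<theta>] by (simp add: \<tau>_def)
    define V where "V = sqrt (y / B)"
    have V: "V > 0" "y = B * V\<^sup>2" "sqrt y = sqrt B * V"
      using y B by (simp_all add: V_def real_sqrt_divide power_divide)
    define P where "P = r powr l / 2"
    define M where "M = P * \<tau> powr l"
    have P: "P \<ge> 0" by (simp add: P_def)
    have \<tau>l: "\<tau> powr l \<le> 1" using \<tau> \<tau>1 \<open>l > 1\<close> by (intro powr_le1) auto
    have M: "M \<ge> 0" "M \<le> P" using P \<tau>l by (auto simp: M_def mult_left_le)
    have node: "zol_node l g y \<phi> = 2 powr (1 - \<theta>) * l * g * V powr (2 - 2 / l) * \<tau>"
    proof -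
      have 1: "y powr (1 - \<theta>) = (2 * (1 - \<theta>) * l) powr (1 - \<theta>) * g powr (1 - \<theta>) * V powr (2 - 2 / l)"
      proof -
        have "B = 2 * (1 - \<theta>) * l * g" using \<open>l > 1\<close> by (simp add: B_def \<theta>_def field_simps)
        then have "y = 2 * (1 - \<theta>) * l * g * V powr 2" using V by simp
        moreover have "2 * (1 - \<theta>) = 2 - 2 / l" by (simp add: \<theta>_def)
        ultimately show ?thesis using \<theta> assms V by (simp add: powr_mult powr_powr del: powr_numeral)
      qed
      have "(2 * (1 - \<theta>) * l) powr (1 - \<theta>) * zolotarev_max \<theta> = 2 powr (1 - \<theta>) * l"
      proof -
        have "(2 * (1 - \<theta>) * l) powr (1 - \<theta>) = 2 powr (1 - \<theta>) * (1 - \<theta>) powr (1 - \<theta>) * l powr (1 - \<theta>)"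
        proof -
          have "(2 * (1 - \<theta>) * l) powr (1 - \<theta>) = (2 * (1 - \<theta>)) powr (1 - \<theta>) * l powr (1 - \<theta>)"
            by (rule powr_mult)
          also have "(2 * (1 - \<theta>)) powr (1 - \<theta>) = 2 powr (1 - \<theta>) * (1 - \<theta>) powr (1 - \<theta>)"
            by (rule powr_mult)
          finally show ?thesis .
        qed
        moreover have "\<theta> powr (- \<theta>) = l powr \<theta>" using \<open>l > 1\<close> by (simp add: \<theta>_def powr_minus powr_divide)
        moreover have "(1 - \<theta>) powr (1 - \<theta>) * (1 - \<theta>) powr (- (1 - \<theta>)) = 1" "l powr (1 - \<theta>) * l powr \<theta> = l"
          using \<theta> \<open>l > 1\<close> by (simp_all add: powr_add[symmetric])
        moreover have "2 powr (1 - \<theta>) * (1 - \<theta>) powr (1 - \<theta>) * l powr (1 - \<theta>) * (l powr \<theta> * (1 - \<theta>) powr (- (1 - \<theta>)))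
           = 2 powr (1 - \<theta>) * ((1 - \<theta>) powr (1 - \<theta>) * (1 - \<theta>) powr (- (1 - \<theta>))) * (l powr (1 - \<theta>) * l powr \<theta>)"
          by (simp only: mult.assoc mult.commute mult.left_commute)
        ultimately show ?thesis unfolding zolotarev_max_def by simp
      qed
      moreover have "g powr \<theta> * g powr (1 - \<theta>) = g" using \<open>g > 0\<close> by (simp add: powr_add[symmetric])
      moreover have "zol_node l g y \<phi> = (g powr \<theta> * g powr (1 - \<theta>)) * ((2 * (1 - \<theta>) * l) powr (1 - \<theta>) * zolotarev_max \<theta>) * V powr (2 - 2 / l) * \<tau>"
        unfolding zol_node_def \<theta>_def[symmetric] zol 1 by (simp only: mult.assoc mult.commute mult.left_commute)
      ultimately show ?thesis by (simp only: mult.assoc mult.commute mult.left_commute)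
    qed
    have nn: "zol_node l g y \<phi> \<ge> 0" unfolding node using assms \<tau> by simp
    have t: "zol_node l g y \<phi> * r = 2 * g * l * (V powr (2 - 2 / l) * M powr (1 / l))"
    proof -
      have "M powr (1 / l) = P powr \<theta> * \<tau>"
        using \<tau> P \<open>l > 1\<close> by (simp add: M_def powr_mult powr_powr \<theta>_def)
      also have "P powr \<theta> = r / 2 powr \<theta>"
        using r \<open>l > 1\<close> by (simp add: P_def powr_divide powr_powr \<theta>_def)
      finally have "M powr (1 / l) = r / 2 powr \<theta> * \<tau>" .
      moreover have "2 powr (1 - \<theta>) = 2 / 2 powr \<theta>" by (simp add: powr_diff)
      ultimately show ?thesis unfolding node by simp
    qed
    define \<mu> where "\<mu> = (2 * l - 2) / (2 * l - 1)"
    define u where "u = V powr \<mu> * M powr (1 - \<mu>)"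
    have \<mu>: "0 \<le> \<mu>" "\<mu> \<le> 1" using \<open>l > 1\<close> by (simp_all add: \<mu>_def field_simps)
    have pk: "exp (- y) * peak l g \<kappa> (zol_node l g y \<phi> * r)
      \<le> 2 powr \<bar>\<kappa>\<bar> * (1 + u) powr (\<kappa> / l) * exp (g * (M\<^sup>2 - c0 * (V - M)\<^sup>2))"
      using peak_bound[OF \<open>l > 1\<close> \<open>g > 0\<close> _ M(1) t, of \<kappa>] V(1)
      unfolding V(2) B_def c0_def u_def \<mu>_def by simp
    have np: "zol_node l g y \<phi> ^ n \<le> (2 * l * g) ^ n * (1 + V) powr a"
    proof -
      have "zol_node l g y \<phi> \<le> 2 * l * g * (1 + V) powr (2 - 2 / l)"
      proof -
        have "2 powr (1 - \<theta>) \<le> 2 powr 1" using \<theta> by (intro powr_mono) auto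
        moreover have "V powr (2 - 2 / l) \<le> (1 + V) powr (2 - 2 / l)"
          using V \<open>l > 1\<close> by (intro powr_mono2) (auto simp: field_simps)
        ultimately have "2 powr (1 - \<theta>) * l * g * V powr (2 - 2 / l) * \<tau> \<le> 2 powr 1 * l * g * (1 + V) powr (2 - 2 / l) * 1"
          using assms \<tau> \<tau>1 by (intro mult_mono) auto
        then show ?thesis unfolding node by simp
      qed
      then have "zol_node l g y \<phi> ^ n \<le> (2 * l * g * (1 + V) powr (2 - 2 / l)) ^ n"
        using nn by (intro power_mono)
      also have "\<dots> = (2 * l * g) ^ n * (1 + V) powr a"
      proof -
        have "(1 + V) powr (2 - 2 / l) > 0" using V by simp
        then have "((1 + V) powr (2 - 2 / l)) ^ n = ((1 + V) powr (2 - 2 / l)) powr real n"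
          by (rule powr_realpow[symmetric])
        also have "\<dots> = (1 + V) powr a" unfolding powr_powr a_def by (simp only: mult.commute)
        finally show ?thesis by (simp only: power_mult_distrib)
      qed
      finally show ?thesis .
    qed
    \<comment> \<open>A common bound for the distances of \<open>V\<close> and \<open>u\<close> from \<open>P\<close>.\<close>
    define D where "D = \<bar>V - M\<bar> + (P - M)"
    have D: "D \<ge> 0" "\<bar>V - P\<bar> \<le> D" "\<bar>u - P\<bar> \<le> D"
    proof -
      have "\<bar>u - M\<bar> \<le> \<bar>V - M\<bar>"
        unfolding u_def using V M \<mu> by (intro geometric_mean_between) auto
      then show "D \<ge> 0" "\<bar>V - P\<bar> \<le> D" "\<bar>u - P\<bar> \<le> D" using M by (auto simp: D_def)
    qed
    have "(1 + V) powr a * (1 + u) powr (\<kappa> / l)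
       \<le> ((1 + P) powr a * (1 + D) powr a) * ((1 + P) powr (\<kappa> / l) * (1 + D) powr \<bar>\<kappa> / l\<bar>)"
    proof (intro mult_mono)
      have "(1 + V) powr a \<le> (1 + P) powr a * (1 + \<bar>V - P\<bar>) powr \<bar>a\<bar>"
        by (rule peetre) (use V P in auto)
      also have "\<dots> \<le> (1 + P) powr a * (1 + D) powr \<bar>a\<bar>"
        using D by (intro mult_left_mono powr_mono2) auto
      finally show "(1 + V) powr a \<le> (1 + P) powr a * (1 + D) powr a" using a by simp
      have "(1 + u) powr (\<kappa> / l) \<le> (1 + P) powr (\<kappa> / l) * (1 + \<bar>u - P\<bar>) powr \<bar>\<kappa> / l\<bar>"
        by (rule peetre) (use P in \<open>auto simp: u_def\<close>)
      also have "\<dots> \<le> (1 + P) powr (\<kappa> / l) * (1 + D) powr \<bar>\<kappa> / l\<bar>"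
        using D by (intro mult_left_mono powr_mono2) auto
      finally show "(1 + u) powr (\<kappa> / l) \<le> (1 + P) powr (\<kappa> / l) * (1 + D) powr \<bar>\<kappa> / l\<bar>" .
    qed auto
    also have "\<dots> = (1 + P) powr (\<sigma> / l) * (1 + D) powr (a + \<bar>\<kappa> / l\<bar>)"
      by (simp add: a\<kappa>[symmetric] powr_add)
    also have "\<dots> \<le> (1 + P) powr (\<sigma> / l) * (C3 * exp (\<epsilon> * D\<^sup>2))"
      by (intro mult_left_mono C3 D) auto
    finally have pol: "(1 + V) powr a * (1 + u) powr (\<kappa> / l) \<le> (1 + P) powr (\<sigma> / l) * (C3 * exp (\<epsilon> * D\<^sup>2))" .
    have expo: "\<epsilon> * D\<^sup>2 + g * (M\<^sup>2 - c0 * (V - M)\<^sup>2) \<le> g * P\<^sup>2 - g * c0 / 2 * (V - M)\<^sup>2 - c2 * P\<^sup>2 * \<phi>\<^sup>2"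
    proof -
      have D2: "D\<^sup>2 \<le> 2 * (V - M)\<^sup>2 + 2 * (P - M)\<^sup>2"
        using zero_le_power2[of "\<bar>V - M\<bar> - (P - M)"] unfolding D_def by (simp add: power2_eq_square algebra_simps)
      have PM: "(P - M)\<^sup>2 \<le> P\<^sup>2 - M\<^sup>2"
        using mult_right_mono[OF M(2), of M] M by (simp add: power2_eq_square algebra_simps)
      have gain: "c2 * P\<^sup>2 * \<phi>\<^sup>2 \<le> g / 2 * (P\<^sup>2 - M\<^sup>2)"
      proof -
        define x where "x = (1 - \<theta>) * \<phi>\<^sup>2"
        have x: "x \<ge> 0" "x \<le> pi\<^sup>2"
        proof -
          have "(1 - \<theta>) * \<phi>\<^sup>2 \<le> 1 * pi\<^sup>2" using \<theta> \<phi> by (intro mult_mono power_mono) auto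
          then show "x \<ge> 0" "x \<le> pi\<^sup>2" using \<theta> by (auto simp: x_def)
        qed
        have "(\<tau> powr l)\<^sup>2 = \<tau> powr (2 * l)" using \<tau> by (simp add: powr_powr mult.commute flip: powr_numeral)
        also have "\<dots> \<le> exp (- (\<theta> * (1 - \<theta>) / 2 * \<phi>\<^sup>2)) powr (2 * l)"
          using \<tau> \<open>l > 1\<close> by (intro powr_mono2) auto
        also have "\<dots> = exp (- x)"
          using \<open>l > 1\<close> by (simp add: powr_def x_def \<theta>_def field_simps)
        also have "\<dots> \<le> 1 / (1 + x)"
          using exp_ge_add_one_self[of x] x by (simp add: exp_minus divide_inverse le_imp_inverse_le)
        finally have "1 - (\<tau> powr l)\<^sup>2 \<ge> x / (1 + x)" using x by (simp add: field_simps)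
        moreover have "x / (1 + x) \<ge> x / (1 + pi\<^sup>2)" using x by (intro divide_left_mono) (auto intro!: mult_pos_pos add_pos_nonneg)
        ultimately have "P\<^sup>2 * (x / (1 + pi\<^sup>2)) \<le> P\<^sup>2 * (1 - (\<tau> powr l)\<^sup>2)" by (intro mult_left_mono) auto
        also have "\<dots> = P\<^sup>2 - M\<^sup>2" by (simp add: M_def power_mult_distrib algebra_simps)
        finally have "g / 2 * (P\<^sup>2 * (x / (1 + pi\<^sup>2))) \<le> g / 2 * (P\<^sup>2 - M\<^sup>2)"
          using \<open>g > 0\<close> by (intro mult_left_mono) auto
        moreover have "g / 2 * (P\<^sup>2 * (x / (1 + pi\<^sup>2))) = c2 * P\<^sup>2 * \<phi>\<^sup>2"
          by (simp add: c2_def x_def)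
        ultimately show ?thesis by (simp only:)
      qed
      have "\<epsilon> * D\<^sup>2 \<le> \<epsilon> * (2 * (V - M)\<^sup>2 + 2 * (P - M)\<^sup>2)" using \<open>\<epsilon> > 0\<close> D2 by simp
      also have "\<dots> = g * c0 / 2 * (V - M)\<^sup>2 + (g / 2) * (c0 * (P - M)\<^sup>2)" by (simp add: \<epsilon>_def algebra_simps)
      also have "(g / 2) * (c0 * (P - M)\<^sup>2) \<le> (g / 2) * (1 * (P\<^sup>2 - M\<^sup>2))"
        using c0 PM \<open>g > 0\<close> by (intro mult_left_mono mult_mono) auto
      finally show ?thesis using gain by (simp add: algebra_simps)
    qed
    have "exp (- y) * zol_node l g y \<phi> ^ n * peak l g \<kappa> (zol_node l g y \<phi> * r)
       = zol_node l g y \<phi> ^ n * (exp (- y) * peak l g \<kappa> (zol_node l g y \<phi> * r))" by simp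
    also have "\<dots> \<le> ((2 * l * g) ^ n * (1 + V) powr a) * (2 powr \<bar>\<kappa>\<bar> * (1 + u) powr (\<kappa> / l) * exp (g * (M\<^sup>2 - c0 * (V - M)\<^sup>2)))"
    proof (rule mult_mono[OF np pk])
      show "0 \<le> (2 * l * g) ^ n * (1 + V) powr a" using assms by simp
      show "0 \<le> exp (- y) * peak l g \<kappa> (zol_node l g y \<phi> * r)" by (simp add: peak_def)
    qed
    also have "\<dots> = (2 * l * g) ^ n * 2 powr \<bar>\<kappa>\<bar> * ((1 + V) powr a * (1 + u) powr (\<kappa> / l)) * exp (g * (M\<^sup>2 - c0 * (V - M)\<^sup>2))"
      by (simp only: mult.assoc mult.commute mult.left_commute)
    also have "\<dots> \<le> (2 * l * g) ^ n * 2 powr \<bar>\<kappa>\<bar> * ((1 + P) powr (\<sigma> / l) * (C3 * exp (\<epsilon> * D\<^sup>2))) * exp (g * (M\<^sup>2 - c0 * (V - M)\<^sup>2))"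
      using assms by (intro mult_right_mono mult_left_mono pol) auto
    also have "\<dots> = C * (1 + P) powr (\<sigma> / l) * exp (\<epsilon> * D\<^sup>2 + g * (M\<^sup>2 - c0 * (V - M)\<^sup>2))"
      unfolding C_def exp_add by (simp only: mult.assoc mult.commute mult.left_commute)
    also have "\<dots> \<le> C * (1 + P) powr (\<sigma> / l) * exp (g * P\<^sup>2 - g * c0 / 2 * (V - M)\<^sup>2 - c2 * P\<^sup>2 * \<phi>\<^sup>2)"
      using expo \<open>C > 0\<close> by (intro mult_left_mono) auto
    also have "\<dots> = C * (1 + P) powr (\<sigma> / l) * exp (g * P\<^sup>2) * exp (- (g * c0 / 2 * (V - M)\<^sup>2)) * exp (- c2 * P\<^sup>2 * \<phi>\<^sup>2)"
      by (simp add: exp_add[symmetric] mult.assoc algebra_simps)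
    also have "g * P\<^sup>2 = g / 4 * r powr (2 * l)"
      using r by (simp add: P_def power_divide powr_powr mult.commute[of l] flip: powr_numeral)
    also have "g * c0 / 2 * (V - M)\<^sup>2 = c1 * (sqrt y - sqrt B * M)\<^sup>2"
      using B by (simp add: c1_def V(3) right_diff_distrib[symmetric] power_mult_distrib)
    finally show "zol_node l g y \<phi> \<ge> 0 \<and>
      exp (- y) * zol_node l g y \<phi> ^ n * peak l g (\<sigma> - 2 * n * (l - 1)) (zol_node l g y \<phi> * r)
      \<le> C * (1 + r powr l / 2) powr (\<sigma> / l) * exp (g / 4 * r powr (2 * l))
        * exp (- c1 * (sqrt y - sqrt ((2 * l - 2) * g) * (r powr l / 2 * (zolotarev (1 / l) \<phi> / zolotarev_max (1 / l)) powr l))\<^sup>2)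
        * exp (- c2 * (r powr l / 2)\<^sup>2 * \<phi>\<^sup>2)"
      using nn unfolding P_def M_def B_def \<tau>_def \<theta>_def \<kappa>_def by simp
  qed
qed

subsection \<open>The measure\<close>

text \<open>Image of the product of Lebesgue measures in \<open>y > 0\<close> and \<open>0 < \<phi> < \<pi>\<close> with density
  \<open>exp(-y) \<xi>\<^sup>n\<close>, suitably normalised. The factor \<open>\<xi>\<^sup>n\<close> shifts the moments from \<open>k\<close> to \<open>s = k + n\<close>. The absolute
  value makes the image nonnegative outside the relevant range of \<open>\<phi>\<close> as well.\<close>

definition zol_measure :: "nat \<Rightarrow> real \<Rightarrow> real \<Rightarrow> real measure" where
  "zol_measure n l g = distr
     (density (lborel \<Otimes>\<^sub>M lborel) (\<lambda>(y, \<phi>). ennreal (exp (- y) * \<bar>zol_node l g y \<phi>\<bar> ^ n / (pi * Gamma (1 + real n)))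
        * indicator {0<..} y * indicator {0<..<pi} \<phi>))
     borel (\<lambda>(y, \<phi>). \<bar>zol_node l g y \<phi>\<bar>)"

lemma zol_node_measurable [measurable]: "(\<lambda>(y, \<phi>). zol_node l g y \<phi>) \<in> borel_measurable (lborel \<Otimes>\<^sub>M lborel)"
  unfolding zol_node_def zolotarev_def by measurable

lemma nn_integral_zol_measure:
  assumes [measurable]: "f \<in> borel_measurable borel"
  shows "(\<integral>\<^sup>+\<xi>. f \<xi> \<partial>zol_measure n l g) =
    (\<integral>\<^sup>+\<phi>. (\<integral>\<^sup>+y. ennreal (exp (- y) * \<bar>zol_node l g y \<phi>\<bar> ^ n / (pi * Gamma (1 + real n)))
        * indicator {0<..} y * indicator {0<..<pi} \<phi> * f \<bar>zol_node l g y \<phi>\<bar> \<partial>lborel) \<partial>lborel)"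
proof -
  have "(\<integral>\<^sup>+\<xi>. f \<xi> \<partial>zol_measure n l g) = (\<integral>\<^sup>+x. (case x of (y, \<phi>) \<Rightarrow> ennreal (exp (- y) * \<bar>zol_node l g y \<phi>\<bar> ^ n / (pi * Gamma (1 + real n)))
        * indicator {0<..} y * indicator {0<..<pi} \<phi>) * f (case x of (y, \<phi>) \<Rightarrow> \<bar>zol_node l g y \<phi>\<bar>) \<partial>(lborel \<Otimes>\<^sub>M lborel))"
    unfolding zol_measure_def by (subst nn_integral_distr, measurable, subst nn_integral_density) simp_all
  also have "\<dots> = (\<integral>\<^sup>+\<phi>. (\<integral>\<^sup>+y. (case (y, \<phi>) of (y, \<phi>) \<Rightarrow> ennreal (exp (- y) * \<bar>zol_node l g y \<phi>\<bar> ^ n / (pi * Gamma (1 + real n)))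
        * indicator {0<..} y * indicator {0<..<pi} \<phi>) * f (case (y, \<phi>) of (y, \<phi>) \<Rightarrow> \<bar>zol_node l g y \<phi>\<bar>) \<partial>lborel) \<partial>lborel)"
    by (rule lborel_pair.nn_integral_snd[symmetric]) measurable
  finally show ?thesis by simp
qed

lemma zol_measure_nonneg: "AE \<xi> in zol_measure n l g. \<xi> \<ge> 0"
  unfolding zol_measure_def by (subst AE_distr_iff) (auto intro!: AE_I2)

text \<open>The power \<open>\<xi>\<^sup>s\<close> factors into a power of \<open>y\<close>, integrated by Euler's formula, and \<open>Z(\<phi>)\<^sup>s\<close>, integrated
  by Zolotarev's formula; the two occurrences of \<open>\<Gamma>(1 + (1 - \<theta>)s)\<close> cancel.\<close>

lemma zol_measure_moment:
  assumes "l > 1" "g > 0"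
  shows "(\<integral>\<^sup>+\<xi>. ennreal (\<xi> ^ k) \<partial>zol_measure CARD('n::finite) l g) = ennreal (moment TYPE('n) l g k)"
proof -
  define \<theta> where "\<theta> = 1 / l"
  have \<theta>: "0 < \<theta>" "\<theta> < 1" using \<open>l > 1\<close> by (auto simp: \<theta>_def)
  define s where "s = k + CARD('n)"
  have s: "s > 0" by (simp add: s_def)
  define K where "K = pi * Gamma (1 + real CARD('n))"
  have K: "K > 0" by (simp add: K_def Gamma_real_pos)
  define A where "A = g powr (\<theta> * s)"
  define G where "G = Gamma (1 + (1 - \<theta>) * s)"
  have G: "G > 0" unfolding G_def using \<theta> by (intro Gamma_real_pos add_pos_nonneg mult_nonneg_nonneg) auto
  have inner: "(\<integral>\<^sup>+y. ennreal (exp (- y) * \<bar>zol_node l g y \<phi>\<bar> ^ CARD('n) / K)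
        * indicator {0<..} y * indicator {0<..<pi} \<phi> * ennreal (\<bar>zol_node l g y \<phi>\<bar> ^ k) \<partial>lborel)
      = ennreal (A * G / K) * (ennreal (zolotarev \<theta> \<phi> ^ s) * indicator {0<..<pi} \<phi>)" for \<phi>
  proof (cases "0 < \<phi> \<and> \<phi> < pi")
    case True
    then have z: "zolotarev \<theta> \<phi> \<ge> 0" using zolotarev_nonneg[OF \<theta>, of \<phi>] by simp
    have "(\<integral>\<^sup>+y. ennreal (exp (- y) * \<bar>zol_node l g y \<phi>\<bar> ^ CARD('n) / K)
        * indicator {0<..} y * indicator {0<..<pi} \<phi> * ennreal (\<bar>zol_node l g y \<phi>\<bar> ^ k) \<partial>lborel)
      = (\<integral>\<^sup>+y. ennreal (A / K * zolotarev \<theta> \<phi> ^ s) * ennreal (indicator {0..} y * y powr ((1 + (1 - \<theta>) * s) - 1) / exp y) \<partial>lborel)"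
    proof (rule nn_integral_cong_AE)
      have "AE y in lborel. y \<noteq> (0::real)" by (rule AE_lborel_singleton)
      then show "AE y in lborel. ennreal (exp (- y) * \<bar>zol_node l g y \<phi>\<bar> ^ CARD('n) / K)
        * indicator {0<..} y * indicator {0<..<pi} \<phi> * ennreal (\<bar>zol_node l g y \<phi>\<bar> ^ k)
        = ennreal (A / K * zolotarev \<theta> \<phi> ^ s) * ennreal (indicator {0..} y * y powr ((1 + (1 - \<theta>) * s) - 1) / exp y)"
      proof eventually_elim
        case (elim y)
        show ?case
        proof (cases "y > 0")
          case True
          have nn: "zol_node l g y \<phi> \<ge> 0" using z by (simp add: zol_node_def \<theta>_def)
          have pw: "zol_node l g y \<phi> ^ s = A * y powr ((1 - \<theta>) * s) * zolotarev \<theta> \<phi> ^ s"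
          proof -
            have pp: "(x powr t) ^ s = x powr (t * real s)" if "x > 0" for x t :: real
              using that by (simp add: powr_realpow[symmetric] powr_powr)
            show ?thesis
              unfolding zol_node_def \<theta>_def[symmetric] power_mult_distrib pp[OF \<open>g > 0\<close>] pp[OF True] A_def ..
          qed
          have "exp (- y) * zol_node l g y \<phi> ^ CARD('n) / K * zol_node l g y \<phi> ^ k
             = exp (- y) * zol_node l g y \<phi> ^ s / K" by (simp add: s_def power_add)
          also have "\<dots> = (A / K * zolotarev \<theta> \<phi> ^ s) * (y powr ((1 - \<theta>) * s) / exp y)"
            unfolding pw by (simp add: exp_minus divide_inverse mult_ac)
          finally have e: "exp (- y) * zol_node l g y \<phi> ^ CARD('n) / K * zol_node l g y \<phi> ^ k
            = (A / K * zolotarev \<theta> \<phi> ^ s) * (y powr ((1 - \<theta>) * s) / exp y)" .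
          have "ennreal (exp (- y) * zol_node l g y \<phi> ^ CARD('n) / K) * ennreal (zol_node l g y \<phi> ^ k)
            = ennreal (exp (- y) * zol_node l g y \<phi> ^ CARD('n) / K * zol_node l g y \<phi> ^ k)"
            using nn K by (intro ennreal_mult[symmetric]) auto
          also have "\<dots> = ennreal (A / K * zolotarev \<theta> \<phi> ^ s) * ennreal (y powr ((1 - \<theta>) * s) / exp y)"
            unfolding e using z K by (intro ennreal_mult) (auto simp: A_def)
          finally show ?thesis using True \<open>0 < \<phi> \<and> \<phi> < pi\<close> nn by simp
        next
          case False
          then show ?thesis using elim by simp
        qed
      qed
    qed
    also have "\<dots> = ennreal (A / K * zolotarev \<theta> \<phi> ^ s) * ennreal G"
    proof -
      have "1 + (1 - \<theta>) * real s > 0" using \<theta> by (intro add_pos_nonneg mult_nonneg_nonneg) auto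
      from Gamma_conv_nn_integral_real[OF this]
      show ?thesis unfolding G_def by (subst nn_integral_cmult) simp_all
    qed
    also have "\<dots> = ennreal (A * G / K) * ennreal (zolotarev \<theta> \<phi> ^ s)"
    proof -
      have "A / K * zolotarev \<theta> \<phi> ^ s * G = A * G / K * zolotarev \<theta> \<phi> ^ s" by simp
      moreover have "A \<ge> 0" by (simp add: A_def)
      ultimately show ?thesis using z K G by (simp add: ennreal_mult[symmetric])
    qed
    finally show ?thesis using True by simp
  qed simp
  have "(\<integral>\<^sup>+\<xi>. ennreal (\<xi> ^ k) \<partial>zol_measure CARD('n) l g)
     = (\<integral>\<^sup>+\<phi>. ennreal (A * G / K) * (ennreal (zolotarev \<theta> \<phi> ^ s) * indicator {0<..<pi} \<phi>) \<partial>lborel)"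
    by (subst nn_integral_zol_measure) (measurable, simp only: K_def[symmetric] inner)
  also have "\<dots> = ennreal (A * G / K) * (\<integral>\<^sup>+\<phi>. ennreal (zolotarev \<theta> \<phi> ^ s) * indicator {0<..<pi} \<phi> \<partial>lborel)"
    by (rule nn_integral_cmult) (simp add: zolotarev_def)
  also have "\<dots> = ennreal (A * G / K) * ennreal (pi * Gamma (1 + real s) / (Gamma (1 + \<theta> * real s) * G))"
    unfolding G_def zolotarev_integral[OF \<theta> s] ..
  also have "\<dots> = ennreal (A * G / K * (pi * Gamma (1 + real s) / (Gamma (1 + \<theta> * real s) * G)))"
  proof -
    have "0 < 1 + \<theta> * real s" using \<theta> by (intro add_pos_nonneg) auto
    then have "Gamma (1 + \<theta> * real s) > 0" "Gamma (1 + real s) > 0" by (auto intro!: Gamma_real_pos)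
    then show ?thesis using K G by (intro ennreal_mult[symmetric]) (auto simp: A_def)
  qed
  also have "A * G / K * (pi * Gamma (1 + real s) / (Gamma (1 + \<theta> * real s) * G)) = moment TYPE('n) l g k"
    using G by (simp add: moment_def A_def K_def s_def \<theta>_def field_simps)
  finally show ?thesis .
qed

lemma peak_measurable [measurable]: "peak l g \<kappa> \<in> borel_measurable borel"
  unfolding peak_def by measurable

lemma peak_nonneg: "peak l g \<kappa> t \<ge> 0" by (simp add: peak_def)

text \<open>Laplace's method: integrate the bound of \<open>zol_node_peak_bound\<close> first in \<open>y\<close>, which costs a factor
  \<open>1 + P\<close>, and then in the angle, which regains it.\<close>

lemma zol_measure_peak:
  fixes l g \<sigma> :: real and n :: nat
  assumes "l > 1" "g > 0"
  obtains C where "C > 0" "\<And>r. r \<ge> 0 \<Longrightarrow>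
    (\<integral>\<^sup>+\<xi>. ennreal (peak l g (\<sigma> - 2 * n * (l - 1)) (\<xi> * r)) \<partial>zol_measure n l g)
    \<le> ennreal (C * (1 + r powr l / 2) powr (\<sigma> / l) * exp (g / 4 * r powr (2 * l)))"
proof -
  obtain C0 c1 c2 where C: "C0 > 0" "c1 > 0" "c2 > 0" and bound:
    "\<And>y \<phi> r. y > 0 \<Longrightarrow> 0 < \<phi> \<Longrightarrow> \<phi> < pi \<Longrightarrow> r \<ge> 0 \<Longrightarrow>
      zol_node l g y \<phi> \<ge> 0 \<and>
      exp (- y) * zol_node l g y \<phi> ^ n * peak l g (\<sigma> - 2 * n * (l - 1)) (zol_node l g y \<phi> * r)
      \<le> C0 * (1 + r powr l / 2) powr (\<sigma> / l) * exp (g / 4 * r powr (2 * l))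
        * exp (- c1 * (sqrt y - sqrt ((2 * l - 2) * g) * (r powr l / 2 * (zolotarev (1 / l) \<phi> / zolotarev_max (1 / l)) powr l))\<^sup>2)
        * exp (- c2 * (r powr l / 2)\<^sup>2 * \<phi>\<^sup>2)"
    using zol_node_peak_bound[OF assms, of n \<sigma>] by metis
  define \<theta> where "\<theta> = 1 / l"
  have \<theta>: "0 < \<theta>" "\<theta> < 1" using \<open>l > 1\<close> by (auto simp: \<theta>_def)
  define b where "b = sqrt ((2 * l - 2) * g)"
  have b: "b > 0" using assms by (simp add: b_def)
  define K where "K = pi * Gamma (1 + real n)"
  have K: "K > 0" by (simp add: K_def Gamma_real_pos)
  define C1 where "C1 = (3 / sqrt c1 * gauss_const + 4 / c1) * (1 + b)"
  have C1: "C1 \<ge> 0" using C b gauss_const_nonneg by (simp add: C1_def)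
  define C2 where "C2 = 2 * pi + 2 * gauss_const / sqrt c2"
  have C2: "C2 > 0" using C gauss_const_nonneg by (simp add: C2_def add_pos_nonneg)
  define C where "C = C0 / K * (C1 + 1) * C2"
  show thesis
  proof (rule that[of C])
    show "C > 0" using C(1) K C1 C2 by (simp add: C_def)
    fix r :: real assume r: "r \<ge> 0"
    define P where "P = r powr l / 2"
    have P: "P \<ge> 0" by (simp add: P_def)
    define E where "E = C0 / K * ((1 + P) powr (\<sigma> / l) * exp (g / 4 * r powr (2 * l)))"
    have E: "E \<ge> 0" using C K by (simp add: E_def)
    define M where "M \<phi> = P * (zolotarev \<theta> \<phi> / zolotarev_max \<theta>) powr l" for \<phi>
    have [measurable]: "M \<in> borel_measurable borel" unfolding M_def zolotarev_def by measurable
    have M: "0 \<le> M \<phi> \<and> M \<phi> \<le> P" if "0 < \<phi>" "\<phi> < pi" for \<phi>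
    proof -
      have "0 < zolotarev \<theta> \<phi>" "zolotarev \<theta> \<phi> \<le> zolotarev_max \<theta>"
      proof -
        have "zolotarev_max \<theta> * exp (- (\<theta> * (1 - \<theta>) / 2 * \<phi>\<^sup>2)) \<le> zolotarev_max \<theta> * 1"
          using zolotarev_max_pos[OF \<theta>] \<theta> by (intro mult_left_mono) auto
        then show "0 < zolotarev \<theta> \<phi>" "zolotarev \<theta> \<phi> \<le> zolotarev_max \<theta>"
          using zolotarev_le[OF \<theta> that] by auto
      qed
      then have "(zolotarev \<theta> \<phi> / zolotarev_max \<theta>) powr l \<le> 1"
        using zolotarev_max_pos[OF \<theta>] \<open>l > 1\<close> by (intro powr_le1) (auto simp: field_simps)
      then show ?thesis using P by (simp add: M_def mult_left_le)
    qed
    have "(\<integral>\<^sup>+\<xi>. ennreal (peak l g (\<sigma> - 2 * n * (l - 1)) (\<xi> * r)) \<partial>zol_measure n l g)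
      = (\<integral>\<^sup>+\<phi>. (\<integral>\<^sup>+y. ennreal (exp (- y) * \<bar>zol_node l g y \<phi>\<bar> ^ n / (pi * Gamma (1 + real n)))
        * indicator {0<..} y * indicator {0<..<pi} \<phi> * ennreal (peak l g (\<sigma> - 2 * n * (l - 1)) (\<bar>zol_node l g y \<phi>\<bar> * r)) \<partial>lborel) \<partial>lborel)"
      by (rule nn_integral_zol_measure) measurable
    also have "\<dots> \<le> (\<integral>\<^sup>+\<phi>. ennreal E * (ennreal (exp (- c2 * P\<^sup>2 * \<phi>\<^sup>2)) * indicator {0<..<pi} \<phi>) * ennreal (C1 * (1 + P)) \<partial>lborel)"
    proof (rule nn_integral_mono)
      fix \<phi> :: real
      show "(\<integral>\<^sup>+y. ennreal (exp (- y) * \<bar>zol_node l g y \<phi>\<bar> ^ n / (pi * Gamma (1 + real n)))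
        * indicator {0<..} y * indicator {0<..<pi} \<phi> * ennreal (peak l g (\<sigma> - 2 * n * (l - 1)) (\<bar>zol_node l g y \<phi>\<bar> * r)) \<partial>lborel)
        \<le> ennreal E * (ennreal (exp (- c2 * P\<^sup>2 * \<phi>\<^sup>2)) * indicator {0<..<pi} \<phi>) * ennreal (C1 * (1 + P))"
      proof (cases "0 < \<phi> \<and> \<phi> < pi")
        case True
        have "(\<integral>\<^sup>+y. ennreal (exp (- y) * \<bar>zol_node l g y \<phi>\<bar> ^ n / (pi * Gamma (1 + real n)))
          * indicator {0<..} y * indicator {0<..<pi} \<phi> * ennreal (peak l g (\<sigma> - 2 * n * (l - 1)) (\<bar>zol_node l g y \<phi>\<bar> * r)) \<partial>lborel)
          \<le> (\<integral>\<^sup>+y. ennreal (E * exp (- c2 * P\<^sup>2 * \<phi>\<^sup>2)) * (ennreal (exp (- c1 * (sqrt y - b * M \<phi>)\<^sup>2)) * indicator {0<..} y) \<partial>lborel)"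
        proof (rule nn_integral_mono)
          fix y :: real
          show "ennreal (exp (- y) * \<bar>zol_node l g y \<phi>\<bar> ^ n / (pi * Gamma (1 + real n)))
            * indicator {0<..} y * indicator {0<..<pi} \<phi> * ennreal (peak l g (\<sigma> - 2 * n * (l - 1)) (\<bar>zol_node l g y \<phi>\<bar> * r))
            \<le> ennreal (E * exp (- c2 * P\<^sup>2 * \<phi>\<^sup>2)) * (ennreal (exp (- c1 * (sqrt y - b * M \<phi>)\<^sup>2)) * indicator {0<..} y)"
          proof (cases "y > 0")
            case y: True
            have nn: "zol_node l g y \<phi> \<ge> 0" and
              le: "exp (- y) * zol_node l g y \<phi> ^ n * peak l g (\<sigma> - 2 * n * (l - 1)) (zol_node l g y \<phi> * r)
                \<le> C0 * (1 + P) powr (\<sigma> / l) * exp (g / 4 * r powr (2 * l)) * exp (- c1 * (sqrt y - b * M \<phi>)\<^sup>2) * exp (- c2 * P\<^sup>2 * \<phi>\<^sup>2)"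
              using bound[OF y conjunct1[OF True] conjunct2[OF True] r] unfolding P_def M_def b_def \<theta>_def by auto
            from divide_right_mono[OF le, of K] K
            have "exp (- y) * zol_node l g y \<phi> ^ n / K * peak l g (\<sigma> - 2 * n * (l - 1)) (zol_node l g y \<phi> * r)
              \<le> E * exp (- c2 * P\<^sup>2 * \<phi>\<^sup>2) * exp (- c1 * (sqrt y - b * M \<phi>)\<^sup>2)"
              by (simp add: E_def mult_ac)
            note le_E = this
            have "ennreal (exp (- y) * zol_node l g y \<phi> ^ n / K) * ennreal (peak l g (\<sigma> - 2 * n * (l - 1)) (zol_node l g y \<phi> * r))
              = ennreal (exp (- y) * zol_node l g y \<phi> ^ n / K * peak l g (\<sigma> - 2 * n * (l - 1)) (zol_node l g y \<phi> * r))"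
              using nn K by (intro ennreal_mult[symmetric] peak_nonneg) auto
            also have "\<dots> \<le> ennreal (E * exp (- c2 * P\<^sup>2 * \<phi>\<^sup>2) * exp (- c1 * (sqrt y - b * M \<phi>)\<^sup>2))"
              by (rule ennreal_leI[OF le_E])
            also have "\<dots> = ennreal (E * exp (- c2 * P\<^sup>2 * \<phi>\<^sup>2)) * ennreal (exp (- c1 * (sqrt y - b * M \<phi>)\<^sup>2))"
              using E by (intro ennreal_mult) auto
            finally have le': "ennreal (exp (- y) * zol_node l g y \<phi> ^ n / K) * ennreal (peak l g (\<sigma> - 2 * n * (l - 1)) (zol_node l g y \<phi> * r))
              \<le> ennreal (E * exp (- c2 * P\<^sup>2 * \<phi>\<^sup>2)) * ennreal (exp (- c1 * (sqrt y - b * M \<phi>)\<^sup>2))" .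
            have i: "indicator {0<..} y = (1::ennreal)" "indicator {0<..<pi} \<phi> = (1::ennreal)" "\<bar>zol_node l g y \<phi>\<bar> = zol_node l g y \<phi>"
              using y True nn by auto
            show ?thesis unfolding i K_def[symmetric] mult_1_right by (rule le')
          qed simp
        qed
        also have "\<dots> = ennreal (E * exp (- c2 * P\<^sup>2 * \<phi>\<^sup>2)) * (\<integral>\<^sup>+y. ennreal (exp (- c1 * (sqrt y - b * M \<phi>)\<^sup>2)) * indicator {0<..} y \<partial>lborel)"
          by (rule nn_integral_cmult) measurable
        also have "\<dots> \<le> ennreal (E * exp (- c2 * P\<^sup>2 * \<phi>\<^sup>2)) * ennreal ((3 / sqrt c1 * gauss_const + 4 / c1) * (1 + b * M \<phi>))"
          using M True b C(2) by (intro mult_left_mono nn_integral_sqrt_gauss) auto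
        also have "\<dots> \<le> ennreal (E * exp (- c2 * P\<^sup>2 * \<phi>\<^sup>2)) * ennreal (C1 * (1 + P))"
        proof (intro mult_left_mono ennreal_leI)
          have "b * M \<phi> \<le> b * P" using M[of \<phi>] True b by simp
          also have "1 + b * P \<le> (1 + b) * (1 + P)" using b P by (simp add: algebra_simps)
          finally have "1 + b * M \<phi> \<le> (1 + b) * (1 + P)" by simp
          then show "(3 / sqrt c1 * gauss_const + 4 / c1) * (1 + b * M \<phi>) \<le> C1 * (1 + P)"
            unfolding C1_def mult.assoc using C gauss_const_nonneg by (intro mult_left_mono) auto
        qed simp
        finally show ?thesis using True E by (simp add: ennreal_mult)
      qed simp
    qed
    also have "\<dots> = ennreal E * ennreal C1 * ((\<integral>\<^sup>+\<phi>. ennreal (exp (- c2 * P\<^sup>2 * \<phi>\<^sup>2)) * indicator {0<..<pi} \<phi> \<partial>lborel) * ennreal (1 + P))"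
    proof -
      have "(\<integral>\<^sup>+\<phi>. ennreal E * (ennreal (exp (- c2 * P\<^sup>2 * \<phi>\<^sup>2)) * indicator {0<..<pi} \<phi>) * ennreal (C1 * (1 + P)) \<partial>lborel)
         = ennreal E * (\<integral>\<^sup>+\<phi>. ennreal (exp (- c2 * P\<^sup>2 * \<phi>\<^sup>2)) * indicator {0<..<pi} \<phi> \<partial>lborel) * ennreal (C1 * (1 + P))"
        by (subst nn_integral_multc, measurable, subst nn_integral_cmult, measurable)
      then show ?thesis using C1 P by (simp add: ennreal_mult mult_ac)
    qed
    also have "\<dots> \<le> ennreal E * ennreal C1 * ennreal C2"
      unfolding C2_def by (intro mult_left_mono nn_integral_angle_gauss C P) simp
    also have "\<dots> = ennreal (E * C1 * C2)" using E C1 C2 by (simp add: ennreal_mult)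
    also have "\<dots> \<le> ennreal (C * (1 + r powr l / 2) powr (\<sigma> / l) * exp (g / 4 * r powr (2 * l)))"
    proof (rule ennreal_leI)
      have "E * C1 * C2 \<le> E * (C1 + 1) * C2" using E C1 C2 by (intro mult_right_mono mult_left_mono) auto
      then show "E * C1 * C2 \<le> C * (1 + r powr l / 2) powr (\<sigma> / l) * exp (g / 4 * r powr (2 * l))"
        unfolding E_def C_def P_def[symmetric] by (simp add: mult_ac)
    qed
    finally show "(\<integral>\<^sup>+\<xi>. ennreal (peak l g (\<sigma> - 2 * n * (l - 1)) (\<xi> * r)) \<partial>zol_measure n l g)
      \<le> ennreal (C * (1 + r powr l / 2) powr (\<sigma> / l) * exp (g / 4 * r powr (2 * l)))" .
  qed
qed

section \<open>Weighted Lebesgue norms\<close>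

text \<open>The norms of the weighted spaces as functions of the weighted modulus alone, so that estimates
  can be made for nonnegative functions.\<close>

definition Lp_norm :: "ennreal \<Rightarrow> (complex ^ 'n::finite \<Rightarrow> real) \<Rightarrow> real" where
  "Lp_norm p \<psi> = (if p = \<infinity> then enn2real (esssup dV (\<lambda>z. ennreal (\<psi> z)))
     else enn2real (\<integral>\<^sup>+ z. ennreal (\<psi> z powr enn2real p) \<partial>dV) powr (1 / enn2real p))"

definition Lp_finite :: "ennreal \<Rightarrow> (complex ^ 'n::finite \<Rightarrow> real) \<Rightarrow> bool" where
  "Lp_finite p \<psi> \<longleftrightarrow> (if p = \<infinity> then esssup dV (\<lambda>z. ennreal (\<psi> z)) < \<infinity>
    else (\<integral>\<^sup>+ z. ennreal (\<psi> z powr enn2real p) \<partial>dV) < \<infinity>)"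

lemma L_norm_eq: "L_norm l p \<alpha> \<rho> f = Lp_norm p (weighted_abs l \<alpha> \<rho> f)"
  by (simp add: L_norm_def Lp_norm_def)

lemma L_space_iff: "f \<in> L_space l p \<alpha> \<rho> \<longleftrightarrow> f \<in> borel_measurable dV \<and> Lp_finite p (weighted_abs l \<alpha> \<rho> f)"
  by (simp add: L_space_def Lp_finite_def)

lemma weighted_abs_nonneg: "weighted_abs l \<alpha> \<rho> f z \<ge> 0"
  by (simp add: weighted_abs_def)

lemma weighted_abs_measurable [measurable]:
  assumes [measurable]: "f \<in> borel_measurable dV"
  shows "weighted_abs l \<alpha> \<rho> f \<in> borel_measurable dV"
proof -
  have "(\<lambda>z :: complex ^ 'a. (1 + norm z) powr \<rho> * exp (- (\<alpha> / 2) * norm z powr (2 * l))) \<in> borel_measurable borel"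
    by measurable
  then have [measurable]: "(\<lambda>z :: complex ^ 'a. (1 + norm z) powr \<rho> * exp (- (\<alpha> / 2) * norm z powr (2 * l))) \<in> borel_measurable dV"
    by (rule measurable_dV_borel)
  show ?thesis unfolding weighted_abs_def mult.assoc by measurable
qed

lemma Lp_norm_nonneg: "Lp_norm p \<psi> \<ge> 0" by (simp add: Lp_norm_def)

lemma enn2real_ge_1: "1 \<le> p \<Longrightarrow> p \<noteq> \<infinity> \<Longrightarrow> enn2real p \<ge> 1"
  by (metis enn2real_1 enn2real_mono infinity_ennreal_def top.not_eq_extremum)

lemma Lp_norm_mono:
  assumes "1 \<le> p" and [measurable]: "\<psi> \<in> borel_measurable dV" "\<psi>' \<in> borel_measurable dV"
    and le: "\<And>z. 0 \<le> \<psi> z" "\<And>z. \<psi> z \<le> K * \<psi>' z" and nn: "\<And>z. 0 \<le> \<psi>' z" and "K \<ge> 0" and fin: "Lp_finite p \<psi>'"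
  shows "Lp_finite p \<psi>" "Lp_norm p \<psi> \<le> K * Lp_norm p \<psi>'"
proof -
  have "Lp_finite p \<psi> \<and> Lp_norm p \<psi> \<le> K * Lp_norm p \<psi>'"
  proof (cases "p = \<infinity>")
    case True
    define s where "s = esssup dV (\<lambda>z. ennreal (\<psi>' z))"
    have s: "s < \<infinity>" using fin True by (simp add: Lp_finite_def s_def)
    have "esssup dV (\<lambda>z. ennreal (\<psi> z)) \<le> ennreal K * s"
    proof (rule esssup_I)
      have "AE z in dV. ennreal (\<psi>' z) \<le> s" unfolding s_def by (rule esssup_AE)
      then show "AE z in dV. ennreal (\<psi> z) \<le> ennreal K * s"
      proof eventually_elim
        case (elim z)
        have "ennreal (\<psi> z) \<le> ennreal (K * \<psi>' z)" by (intro ennreal_leI le)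
        also have "\<dots> = ennreal K * ennreal (\<psi>' z)" using \<open>K \<ge> 0\<close> nn by (intro ennreal_mult) auto
        also have "\<dots> \<le> ennreal K * s" by (intro mult_left_mono elim) auto
        finally show ?case .
      qed
    qed simp
    moreover have f: "ennreal K * s < \<infinity>" using s by (simp add: ennreal_mult_less_top)
    ultimately have "enn2real (esssup dV (\<lambda>z. ennreal (\<psi> z))) \<le> enn2real (ennreal K * s)"
      by (intro enn2real_mono) auto
    also have "\<dots> = K * enn2real s" using \<open>K \<ge> 0\<close> by (simp add: enn2real_mult)
    finally show ?thesis
      using True \<open>esssup dV (\<lambda>z. ennreal (\<psi> z)) \<le> ennreal K * s\<close> f
      by (auto simp: Lp_finite_def Lp_norm_def s_def intro: le_less_trans)
  next
    case False
    define q where "q = enn2real p"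
    have q: "q \<ge> 1" unfolding q_def using enn2real_ge_1 assms False by blast
    have fin': "(\<integral>\<^sup>+ z. ennreal (\<psi>' z powr q) \<partial>dV) < \<infinity>" using fin False by (simp add: Lp_finite_def q_def)
    have "(\<integral>\<^sup>+ z. ennreal (\<psi> z powr q) \<partial>dV) \<le> (\<integral>\<^sup>+ z. ennreal (K powr q) * ennreal (\<psi>' z powr q) \<partial>dV)"
    proof (rule nn_integral_mono)
      fix z
      have "\<psi> z powr q \<le> (K * \<psi>' z) powr q" using le q by (intro powr_mono2) auto
      then show "ennreal (\<psi> z powr q) \<le> ennreal (K powr q) * ennreal (\<psi>' z powr q)"
        by (simp add: powr_mult ennreal_mult[symmetric] ennreal_leI)
    qed
    also have "\<dots> = ennreal (K powr q) * (\<integral>\<^sup>+ z. ennreal (\<psi>' z powr q) \<partial>dV)"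
      by (rule nn_integral_cmult) measurable
    finally have le': "(\<integral>\<^sup>+ z. ennreal (\<psi> z powr q) \<partial>dV) \<le> ennreal (K powr q) * (\<integral>\<^sup>+ z. ennreal (\<psi>' z powr q) \<partial>dV)" .
    have f: "ennreal (K powr q) * (\<integral>\<^sup>+ z. ennreal (\<psi>' z powr q) \<partial>dV) < \<infinity>"
      using fin' by (simp add: ennreal_mult_less_top)
    have "enn2real (\<integral>\<^sup>+ z. ennreal (\<psi> z powr q) \<partial>dV) \<le> enn2real (ennreal (K powr q) * (\<integral>\<^sup>+ z. ennreal (\<psi>' z powr q) \<partial>dV))"
      using le' f by (intro enn2real_mono) auto
    also have "\<dots> = K powr q * enn2real (\<integral>\<^sup>+ z. ennreal (\<psi>' z powr q) \<partial>dV)"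
      by (simp add: enn2real_mult)
    finally have "enn2real (\<integral>\<^sup>+ z. ennreal (\<psi> z powr q) \<partial>dV) powr (1 / q)
        \<le> (K powr q * enn2real (\<integral>\<^sup>+ z. ennreal (\<psi>' z powr q) \<partial>dV)) powr (1 / q)"
      using q by (intro powr_mono2) auto
    also have "\<dots> = K * enn2real (\<integral>\<^sup>+ z. ennreal (\<psi>' z powr q) \<partial>dV) powr (1 / q)"
      using q \<open>K \<ge> 0\<close> by (simp add: powr_mult powr_powr)
    finally show ?thesis
      using False le' f by (auto simp: Lp_finite_def Lp_norm_def q_def intro: le_less_trans)
  qed
  then show "Lp_finite p \<psi>" "Lp_norm p \<psi> \<le> K * Lp_norm p \<psi>'" by auto
qed

definition inv_exponent :: "ennreal \<Rightarrow> real" where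
  "inv_exponent p = (if p = \<infinity> then 0 else 1 / enn2real p)"

lemma conj_exponent_ge_1: assumes "1 \<le> p" shows "1 \<le> conj_exponent p"
proof -
  have "1 \<le> ennreal (enn2real p / (enn2real p - 1))" if "p \<noteq> 1" "p \<noteq> \<infinity>"
  proof -
    have "enn2real p \<ge> 1" using enn2real_ge_1 assms that by blast
    moreover have "enn2real p \<noteq> 1" using that by (metis ennreal_1 ennreal_enn2real infinity_ennreal_def top.not_eq_extremum)
    ultimately have "enn2real p > 1" by linarith
    then have "1 \<le> enn2real p / (enn2real p - 1)" by (simp add: field_simps)
    then have "ennreal 1 \<le> ennreal (enn2real p / (enn2real p - 1))" by (rule ennreal_leI)
    then show ?thesis by simp
  qed
  then show ?thesis by (simp add: conj_exponent_def)
qed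

lemma inv_exponent_conj: assumes "1 \<le> p" shows "inv_exponent p + inv_exponent (conj_exponent p) = 1"
proof (cases "p = 1 \<or> p = \<infinity>")
  case True
  then show ?thesis by (auto simp: inv_exponent_def conj_exponent_def)
next
  case False
  have "enn2real p \<ge> 1" using enn2real_ge_1 assms False by blast
  moreover have "enn2real p \<noteq> 1" using False by (metis ennreal_1 ennreal_enn2real infinity_ennreal_def top.not_eq_extremum)
  ultimately show ?thesis using False by (simp add: inv_exponent_def conj_exponent_def field_simps)
qed

text \<open>Scaling: a Gaussian of width \<open>1/\<kappa>\<close> has norm proportional to \<open>\<kappa>\<^sup>-\<^sup>2\<^sup>n\<^sup>/\<^sup>p\<close>.\<close>

lemma Lp_norm_gauss:
  fixes c :: real
  assumes "1 \<le> p" "c > 0"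
  obtains C where "C > 0" "\<And>\<kappa> (a :: complex ^ 'n::finite). \<kappa> > 0 \<Longrightarrow>
      Lp_finite p (\<lambda>z. exp (- c * (\<kappa> * norm (z - a))\<^sup>2)) \<and>
      Lp_norm p (\<lambda>z. exp (- c * (\<kappa> * norm (z - a))\<^sup>2)) \<le> C * \<kappa> powr (- (2 * CARD('n)) * inv_exponent p)"
proof (cases "p = \<infinity>")
  case True
  have "Lp_finite p (\<lambda>z :: complex ^ 'n. exp (- c * (\<kappa> * norm (z - a))\<^sup>2)) \<and>
      Lp_norm p (\<lambda>z. exp (- c * (\<kappa> * norm (z - a))\<^sup>2)) \<le> 1 * \<kappa> powr (- (2 * CARD('n)) * inv_exponent p)" if "\<kappa> > 0" for \<kappa> a
  proof -
    have "esssup dV (\<lambda>z :: complex ^ 'n. ennreal (exp (- c * (\<kappa> * norm (z - a))\<^sup>2))) \<le> ennreal 1"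
      using \<open>c > 0\<close> by (intro esssup_I measurable_dV_borel AE_I2 ennreal_leI) simp_all
    then have "esssup dV (\<lambda>z :: complex ^ 'n. ennreal (exp (- c * (\<kappa> * norm (z - a))\<^sup>2))) \<le> 1" by simp
    moreover from this have "enn2real (esssup dV (\<lambda>z :: complex ^ 'n. ennreal (exp (- c * (\<kappa> * norm (z - a))\<^sup>2)))) \<le> 1"
      using enn2real_mono by fastforce
    ultimately show ?thesis
      using True that by (auto simp: Lp_finite_def Lp_norm_def inv_exponent_def intro: le_less_trans)
  qed
  then show ?thesis using that[of 1] by simp
next
  case False
  define q where "q = enn2real p"
  have q: "q \<ge> 1" unfolding q_def using enn2real_ge_1 assms False by blast
  define J where "J = 1 / ball_vol TYPE('n) * (\<integral>y. exp (- (q * c) * norm (y :: complex ^ 'n) powr (2 * 1)) \<partial>lborel)"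
  have Jint: "integrable lborel (\<lambda>y :: complex ^ 'n. exp (- (q * c) * norm y powr (2 * 1)))"
    using q assms by (intro integrable_weight) auto
  have J: "J \<ge> 0" unfolding J_def using ball_vol_pos[where 'n='n] by (intro mult_nonneg_nonneg) auto
  have main: "(\<integral>\<^sup>+ z. ennreal (exp (- c * (\<kappa> * norm (z - a))\<^sup>2) powr q) \<partial>dV) = ennreal (J * \<kappa> powr (- (2 * CARD('n))))"
    if \<kappa>: "\<kappa> > 0" for \<kappa> and a :: "complex ^ 'n"
  proof -
    have "(\<integral>\<^sup>+ z. ennreal (exp (- c * (\<kappa> * norm (z - a))\<^sup>2) powr q) \<partial>dV)
       = ennreal (1 / ball_vol TYPE('n)) * (\<integral>\<^sup>+ z. ennreal (exp (- c * (\<kappa> * norm (z - a))\<^sup>2) powr q) \<partial>lborel)"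
      by (rule nn_integral_dV) measurable
    also have "(\<integral>\<^sup>+ z. ennreal (exp (- c * (\<kappa> * norm (z - a))\<^sup>2) powr q) \<partial>lborel)
       = (\<integral>\<^sup>+ z. ennreal (exp (- (q * c) * norm (- (\<kappa> *\<^sub>R a) + \<kappa> *\<^sub>R z) powr (2 * 1))) \<partial>lborel)"
    proof (rule nn_integral_cong)
      fix z
      have "norm (- (\<kappa> *\<^sub>R a) + \<kappa> *\<^sub>R z) = \<kappa> * norm (z - a)"
        using \<kappa> by (simp add: scaleR_diff_right[symmetric])
      then show "ennreal (exp (- c * (\<kappa> * norm (z - a))\<^sup>2) powr q) = ennreal (exp (- (q * c) * norm (- (\<kappa> *\<^sub>R a) + \<kappa> *\<^sub>R z) powr (2 * 1)))"
        using \<kappa> by (simp add: exp_powr_real mult_ac)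
    qed
    also have "\<dots> = ennreal (1 / \<bar>\<kappa>\<bar> ^ DIM(complex ^ 'n)) * (\<integral>\<^sup>+ y. ennreal (exp (- (q * c) * norm (y :: complex ^ 'n) powr (2 * 1))) \<partial>lborel)"
      using \<kappa> by (intro nn_integral_lborel_affine[where f = "\<lambda>y. ennreal (exp (- (q * c) * norm y powr (2 * 1)))"]) auto
    also have "(\<integral>\<^sup>+ y. ennreal (exp (- (q * c) * norm (y :: complex ^ 'n) powr (2 * 1))) \<partial>lborel)
       = ennreal (\<integral>y. exp (- (q * c) * norm (y :: complex ^ 'n) powr (2 * 1)) \<partial>lborel)"
      using Jint by (rule nn_integral_eq_integral) simp
    also have "1 / \<bar>\<kappa>\<bar> ^ DIM(complex ^ 'n) = \<kappa> powr (- (2 * CARD('n)))"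
      using \<kappa> by (simp add: powr_minus powr_realpow[symmetric] divide_inverse mult.commute)
    finally show ?thesis
      using ball_vol_pos[where 'n='n] by (simp add: J_def ennreal_mult[symmetric] mult_ac)
  qed
  show ?thesis
  proof (rule that[of "J powr (1 / q) + 1"])
    show "J powr (1 / q) + 1 > 0" by (simp add: add_nonneg_pos)
    fix \<kappa> :: real and a :: "complex ^ 'n" assume \<kappa>: "\<kappa> > 0"
    have "Lp_norm p (\<lambda>z. exp (- c * (\<kappa> * norm (z - a))\<^sup>2)) = (J * \<kappa> powr (- (2 * CARD('n)))) powr (1 / q)"
      using False main[OF \<kappa>, of a] J by (simp add: Lp_norm_def q_def)
    also have "\<dots> = J powr (1 / q) * \<kappa> powr (- (2 * CARD('n)) * inv_exponent p)"
      using J False by (simp add: powr_mult powr_powr inv_exponent_def q_def)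
    also have "\<dots> \<le> (J powr (1 / q) + 1) * \<kappa> powr (- (2 * CARD('n)) * inv_exponent p)"
      by (intro mult_right_mono) auto
    finally show "Lp_finite p (\<lambda>z. exp (- c * (\<kappa> * norm (z - a))\<^sup>2)) \<and>
      Lp_norm p (\<lambda>z. exp (- c * (\<kappa> * norm (z - a))\<^sup>2)) \<le> (J powr (1 / q) + 1) * \<kappa> powr (- (2 * CARD('n)) * inv_exponent p)"
      using main[OF \<kappa>, of a] False by (simp add: Lp_finite_def q_def)
  qed
qed

subsection \<open>Hoelder's inequality\<close>

lemma Lp_finite_AE_zero:
  assumes "p \<noteq> \<infinity>" "1 \<le> p" and [measurable]: "\<psi> \<in> borel_measurable dV" and nn: "\<And>z. 0 \<le> \<psi> z" and z: "(\<integral>\<^sup>+ z. ennreal (\<psi> z powr enn2real p) \<partial>dV) = 0"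
  shows "AE z in dV. \<psi> z = 0"
proof -
  have "AE z in dV. ennreal (\<psi> z powr enn2real p) = 0"
    using z by (subst (asm) nn_integral_0_iff_AE) auto
  then show ?thesis
  proof eventually_elim
    case (elim z)
    then have "\<not> 0 < \<psi> z powr enn2real p" by (simp add: ennreal_eq_0_iff not_less)
    then show ?case by simp
  qed
qed

lemma Hoelder_infinity:
  assumes [measurable]: "\<psi> \<in> borel_measurable dV" "\<psi>' \<in> borel_measurable dV"
    and nn: "\<And>z. 0 \<le> \<psi> z" "\<And>z. 0 \<le> \<psi>' z" and fin: "Lp_finite 1 \<psi>" "Lp_finite \<infinity> \<psi>'"
  shows "(\<integral>\<^sup>+ z. ennreal (\<psi> z * \<psi>' z) \<partial>dV) \<le> ennreal (Lp_norm 1 \<psi> * Lp_norm \<infinity> \<psi>')"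
proof -
  define s where "s = esssup dV (\<lambda>z. ennreal (\<psi>' z))"
  have s: "s < \<infinity>" using fin by (simp add: Lp_finite_def s_def)
  have i: "(\<integral>\<^sup>+ z. ennreal (\<psi> z) \<partial>dV) = ennreal (Lp_norm 1 \<psi>)"
    using fin(1) nn by (simp add: Lp_finite_def Lp_norm_def)
  have "(\<integral>\<^sup>+ z. ennreal (\<psi> z * \<psi>' z) \<partial>dV) \<le> (\<integral>\<^sup>+ z. ennreal (\<psi> z) * s \<partial>dV)"
  proof (rule nn_integral_mono_AE)
    have "AE z in dV. ennreal (\<psi>' z) \<le> s" unfolding s_def by (rule esssup_AE)
    then show "AE z in dV. ennreal (\<psi> z * \<psi>' z) \<le> ennreal (\<psi> z) * s"
      by eventually_elim (use nn in \<open>simp add: ennreal_mult mult_left_mono\<close>)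
  qed
  also have "\<dots> = (\<integral>\<^sup>+ z. ennreal (\<psi> z) \<partial>dV) * s" by (rule nn_integral_multc) measurable
  also have "\<dots> = ennreal (Lp_norm 1 \<psi> * Lp_norm \<infinity> \<psi>')"
    unfolding i using s by (simp add: Lp_norm_def s_def ennreal_mult)
  finally show ?thesis .
qed

text \<open>Young's inequality, applied pointwise to the normalised functions. The case of a vanishing
  factor has to be separated because the normalisation divides by the norms.\<close>

lemma Hoelder:
  assumes "1 \<le> p" and [measurable]: "\<psi> \<in> borel_measurable dV" "\<psi>' \<in> borel_measurable dV"
    and nn: "\<And>z. 0 \<le> \<psi> z" "\<And>z. 0 \<le> \<psi>' z" and fin: "Lp_finite p \<psi>" "Lp_finite (conj_exponent p) \<psi>'"
  shows "(\<integral>\<^sup>+ z. ennreal (\<psi> z * \<psi>' z) \<partial>dV) \<le> ennreal (Lp_norm p \<psi> * Lp_norm (conj_exponent p) \<psi>')"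
proof (cases "p = 1 \<or> p = \<infinity>")
  case True
  then show ?thesis
    using Hoelder_infinity[of \<psi> \<psi>'] Hoelder_infinity[of \<psi>' \<psi>] assms by (auto simp: conj_exponent_def mult.commute)
next
  case False
  define q where "q = enn2real p"
  define q' where "q' = q / (q - 1)"
  have "q \<ge> 1" unfolding q_def using enn2real_ge_1 assms False by blast
  moreover have "q \<noteq> 1" unfolding q_def using False by (metis ennreal_1 ennreal_enn2real infinity_ennreal_def top.not_eq_extremum)
  ultimately have q: "q > 1" by simp
  then have q': "q' > 1" "1 / q + 1 / q' = 1" by (simp_all add: q'_def field_simps)
  have cp: "conj_exponent p = ennreal q'" using False by (simp add: conj_exponent_def q'_def q_def)
  define I where "I = enn2real (\<integral>\<^sup>+ z. ennreal (\<psi> z powr q) \<partial>dV)"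
  define I' where "I' = enn2real (\<integral>\<^sup>+ z. ennreal (\<psi>' z powr q') \<partial>dV)"
  have I: "(\<integral>\<^sup>+ z. ennreal (\<psi> z powr q) \<partial>dV) = ennreal I" "I \<ge> 0"
    using fin(1) False by (simp_all add: Lp_finite_def q_def I_def)
  have I': "(\<integral>\<^sup>+ z. ennreal (\<psi>' z powr q') \<partial>dV) = ennreal I'" "I' \<ge> 0"
    using fin(2) q' by (simp_all add: Lp_finite_def cp I'_def)
  have n: "Lp_norm p \<psi> = I powr (1 / q)" "Lp_norm (conj_exponent p) \<psi>' = I' powr (1 / q')"
    using False q' by (simp_all add: Lp_norm_def cp q_def I_def I'_def)
  show ?thesis
  proof (cases "I = 0 \<or> I' = 0")
    case True
    then have "AE z in dV. \<psi> z * \<psi>' z = 0"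
    proof
      assume "I = 0"
      then have "AE z in dV. \<psi> z = 0"
        using Lp_finite_AE_zero[of p \<psi>] False assms I by (simp add: q_def)
      then show ?thesis by eventually_elim simp
    next
      assume "I' = 0"
      then have "AE z in dV. \<psi>' z = 0"
        using Lp_finite_AE_zero[of "conj_exponent p" \<psi>'] conj_exponent_ge_1[of p] assms I' q' by (simp add: cp)
      then show ?thesis by eventually_elim simp
    qed
    then have "(\<integral>\<^sup>+ z. ennreal (\<psi> z * \<psi>' z) \<partial>dV) = (\<integral>\<^sup>+ z. 0 \<partial>(dV :: (complex ^ 'a) measure))"
      by (intro nn_integral_cong_AE) (auto elim: eventually_mono)
    then show ?thesis by simp
  next
    case nz: False
    then have II: "I > 0" "I' > 0" using I I' by auto
    define a where "a = I powr (1 / q)"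
    define a' where "a' = I' powr (1 / q')"
    have a: "a > 0" "a' > 0" using II by (auto simp: a_def a'_def)
    have young: "x * y \<le> a * a' * (1 / q * (x powr q / I) + 1 / q' * (y powr q' / I'))" if "x \<ge> 0" "y \<ge> 0" for x y
    proof (cases "x = 0 \<or> y = 0")
      case True
      then show ?thesis using a II q q' by auto
    next
      case False
      then have xy: "x > 0" "y > 0" using that by auto
      have "(x powr q / I) powr (1 / q) * (y powr q' / I') powr (1 / q') \<le> 1 / q * (x powr q / I) + 1 / q' * (y powr q' / I')"
        using q q' xy II by (intro Youngs_inequality_0) auto
      moreover have "(x powr q / I) powr (1 / q) = x / a" using q xy II by (simp add: powr_divide powr_powr a_def)
      moreover have "(y powr q' / I') powr (1 / q') = y / a'" using q' xy II by (simp add: powr_divide powr_powr a'_def)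
      ultimately have "x / a * (y / a') \<le> 1 / q * (x powr q / I) + 1 / q' * (y powr q' / I')" by simp
      then have "a * a' * (x / a * (y / a')) \<le> a * a' * (1 / q * (x powr q / I) + 1 / q' * (y powr q' / I'))"
        using a by (intro mult_left_mono) auto
      then show ?thesis using a by simp
    qed
    have "(\<integral>\<^sup>+ z. ennreal (\<psi> z * \<psi>' z) \<partial>dV)
      \<le> (\<integral>\<^sup>+ z. ennreal (a * a' * (1 / q / I)) * ennreal (\<psi> z powr q) + ennreal (a * a' * (1 / q' / I')) * ennreal (\<psi>' z powr q') \<partial>dV)"
    proof (rule nn_integral_mono)
      fix z
      have "\<psi> z * \<psi>' z \<le> a * a' * (1 / q / I) * (\<psi> z powr q) + a * a' * (1 / q' / I') * (\<psi>' z powr q')"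
        using young[OF nn(1)[of z] nn(2)[of z]] by (simp add: algebra_simps)
      then have "ennreal (\<psi> z * \<psi>' z) \<le> ennreal (a * a' * (1 / q / I) * (\<psi> z powr q) + a * a' * (1 / q' / I') * (\<psi>' z powr q'))"
        by (rule ennreal_leI)
      also have "\<dots> = ennreal (a * a' * (1 / q / I)) * ennreal (\<psi> z powr q) + ennreal (a * a' * (1 / q' / I')) * ennreal (\<psi>' z powr q')"
      proof -
        have "a * a' * (1 / q / I) \<ge> 0" "a * a' * (1 / q' / I') \<ge> 0" using a q q' II by auto
        then show ?thesis by (simp only: ennreal_plus ennreal_mult mult_nonneg_nonneg powr_ge_zero)
      qed
      finally show "ennreal (\<psi> z * \<psi>' z) \<le> ennreal (a * a' * (1 / q / I)) * ennreal (\<psi> z powr q) + ennreal (a * a' * (1 / q' / I')) * ennreal (\<psi>' z powr q')" .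
    qed
    also have "\<dots> = ennreal (a * a' * (1 / q / I)) * ennreal I + ennreal (a * a' * (1 / q' / I')) * ennreal I'"
      unfolding I(1)[symmetric] I'(1)[symmetric]
      by (subst nn_integral_add, measurable, subst nn_integral_cmult, measurable, subst nn_integral_cmult, measurable)
    also have "\<dots> = ennreal (a * a' * (1 / q / I) * I + a * a' * (1 / q' / I') * I')"
      using a q q' II by (simp add: ennreal_mult[symmetric] ennreal_plus[symmetric] del: ennreal_plus)
    also have "a * a' * (1 / q / I) * I + a * a' * (1 / q' / I') * I' = a * a' * (1 / q + 1 / q')"
      using II by (simp add: distrib_left)
    also have "\<dots> = a * a'" unfolding q'(2) by simp
    finally show ?thesis by (simp add: n a_def a'_def)
  qed
qed

section \<open>The test space\<close>

text \<open>Boundedness near infinity becomes a global bound, since entire functions are bounded on balls.\<close>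

lemma E_space_iff:
  assumes "l \<ge> 1"
  shows "(f :: complex ^ 'n::finite \<Rightarrow> complex) \<in> E_space l \<longleftrightarrow> (\<exists>\<tau>>0. growth (l / 2) \<tau> f)"
proof
  assume "f \<in> E_space l"
  then obtain \<tau> where ent: "entire f" and \<tau>: "\<tau> > 0" and "(\<lambda>z. norm (f z)) \<in> O[at_infinity](\<lambda>z. exp (\<tau> * norm z powr l))"
    unfolding E_space_def by auto
  then obtain c where c: "c > 0" "\<forall>\<^sub>F z in at_infinity. norm (norm (f z)) \<le> c * norm (exp (\<tau> * norm z powr l))"
    by (elim landau_o.bigE)
  then obtain b where b: "\<And>z. b \<le> norm z \<Longrightarrow> norm (f z) \<le> c * exp (\<tau> * norm z powr l)"
    unfolding eventually_at_infinity by auto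
  have "bounded (f ` cball 0 b)"
    by (intro compact_imp_bounded compact_continuous_image entire_continuous_on ent compact_cball)
  then obtain B where B: "B > 0" "\<forall>z\<in>cball 0 b. norm (f z) \<le> B"
    unfolding bounded_pos by auto
  have "growth (l / 2) \<tau> f"
  proof (rule growthI[OF ent])
    show "0 \<le> B + c" using B c by simp
    fix z :: "complex ^ 'n"
    have e: "exp (\<tau> * norm z powr l) \<ge> 1" using \<tau> by simp
    have "norm (f z) \<le> (B + c) * exp (\<tau> * norm z powr l)"
    proof (cases "b \<le> norm z")
      case True
      then show ?thesis using b[of z] B e by (simp add: distrib_right add_increasing)
    next
      case False
      then have "norm (f z) \<le> B * 1" using B by auto
      also have "\<dots> \<le> B * exp (\<tau> * norm z powr l)" using B e by (intro mult_left_mono) auto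
      also have "\<dots> \<le> (B + c) * exp (\<tau> * norm z powr l)" using c by (simp add: distrib_right)
      finally show ?thesis .
    qed
    then show "norm (f z) \<le> (B + c) * exp (\<tau> * norm z powr (2 * (l / 2)))" by simp
  qed
  with \<tau> show "\<exists>\<tau>>0. growth (l / 2) \<tau> f" by blast
next
  assume "\<exists>\<tau>>0. growth (l / 2) \<tau> f"
  then obtain \<tau> where \<tau>: "\<tau> > 0" "growth (l / 2) \<tau> f" by blast
  obtain C where C: "C \<ge> 0" "\<And>z. norm (f z) \<le> C * exp (\<tau> * norm z powr (2 * (l / 2)))"
    by (rule growthE[OF \<tau>(2)], rule that)
  have "(\<lambda>z. norm (f z)) \<in> O[at_infinity](\<lambda>z. exp (\<tau> * norm z powr l))"
    by (rule bigoI[where c = C]) (use C in \<open>auto intro!: always_eventually\<close>)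
  then show "f \<in> E_space l" unfolding E_space_def using \<tau> growth_entire by blast
qed

lemma E_entire: "f \<in> E_space l \<Longrightarrow> entire f" by (simp add: E_space_def)

text \<open>Completing the square, \<open>\<tau> x \<le> \<tau>\<^sup>2/(4\<epsilon>) + \<epsilon> x\<^sup>2\<close> with \<open>x = |z|\<^sup>l\<close>.\<close>

lemma E_growth:
  fixes f :: "complex ^ 'n::finite \<Rightarrow> complex"
  assumes "l \<ge> 1" "f \<in> E_space l" "\<epsilon> > 0" shows "growth l \<epsilon> f"
proof -
  obtain \<tau> where \<tau>: "\<tau> > 0" "growth (l / 2) \<tau> f" using assms E_space_iff by blast
  obtain C where C: "C \<ge> 0" "\<And>z. norm (f z) \<le> C * exp (\<tau> * norm z powr (2 * (l / 2)))"
    by (rule growthE[OF \<tau>(2)], rule that)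
  show ?thesis
  proof (rule growthI)
    show "entire f" using assms E_entire by blast
    show "0 \<le> C * exp (\<tau>\<^sup>2 / (4 * \<epsilon>))" using C by simp
    fix z :: "complex ^ 'n"
    define x where "x = norm z powr l"
    have x2: "norm z powr (2 * l) = x\<^sup>2" by (simp add: x_def powr_powr mult.commute flip: powr_numeral)
    have "0 \<le> (2 * \<epsilon> * x - \<tau>)\<^sup>2 / (4 * \<epsilon>)" using \<open>\<epsilon> > 0\<close> by simp
    also have "\<dots> = \<epsilon> * x\<^sup>2 + \<tau>\<^sup>2 / (4 * \<epsilon>) - \<tau> * x" using \<open>\<epsilon> > 0\<close> by (simp add: power2_eq_square field_simps)
    finally have "\<tau> * x \<le> \<tau>\<^sup>2 / (4 * \<epsilon>) + \<epsilon> * x\<^sup>2" by simp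
    then have "C * exp (\<tau> * x) \<le> C * exp (\<tau>\<^sup>2 / (4 * \<epsilon>) + \<epsilon> * x\<^sup>2)" using C by (intro mult_left_mono) auto
    then show "norm (f z) \<le> C * exp (\<tau>\<^sup>2 / (4 * \<epsilon>)) * exp (\<epsilon> * norm z powr (2 * l))"
      using C(2)[of z] by (simp add: x2 exp_add mult.assoc x_def[symmetric])
  qed
qed

lemma growth_add: assumes "growth l a f" "growth l a g" shows "growth l a (\<lambda>z. f z + g z)"
proof -
  obtain C where C: "C \<ge> 0" "\<And>z. norm (f z) \<le> C * exp (a * norm z powr (2 * l))"
    by (rule growthE[OF assms(1)], rule that)
  obtain C' where C': "C' \<ge> 0" "\<And>z. norm (g z) \<le> C' * exp (a * norm z powr (2 * l))"
    by (rule growthE[OF assms(2)], rule that)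
  show ?thesis
  proof (rule growthI)
    show "entire (\<lambda>z. f z + g z)" using assms by (simp add: growth_entire entire_add)
    show "0 \<le> C + C'" using C C' by simp
    show "norm (f z + g z) \<le> (C + C') * exp (a * norm z powr (2 * l))" for z
      using norm_triangle_ineq[of "f z" "g z"] C(2)[of z] C'(2)[of z] by (simp add: distrib_right)
  qed
qed

lemma E_mult: assumes "l \<ge> 1" "f \<in> E_space l" "g \<in> E_space l" shows "(\<lambda>z. f z * g z) \<in> E_space l"
proof -
  obtain \<tau> \<tau>' where \<tau>: "\<tau> > 0" "growth (l / 2) \<tau> f" "\<tau>' > 0" "growth (l / 2) \<tau>' g"
    using assms E_space_iff by blast
  have "growth (l / 2) (\<tau> + \<tau>') (\<lambda>z. f z * g z)" by (rule growth_mult[OF \<tau>(2,4)])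
  then show ?thesis using \<tau>(1,3) E_space_iff[OF assms(1)] add_pos_pos by blast
qed

lemma E_add: assumes "l \<ge> 1" "f \<in> E_space l" "g \<in> E_space l" shows "(\<lambda>z. f z + g z) \<in> E_space l"
proof -
  obtain \<tau> \<tau>' where \<tau>: "\<tau> > 0" "growth (l / 2) \<tau> f" "\<tau>' > 0" "growth (l / 2) \<tau>' g"
    using assms E_space_iff by blast
  have "growth (l / 2) (\<tau> + \<tau>') (\<lambda>z. f z + g z)"
    by (intro growth_add growth_mono[OF \<tau>(2)] growth_mono[OF \<tau>(4)]) (use \<tau> in auto)
  then show ?thesis using \<tau>(1,3) E_space_iff[OF assms(1)] add_pos_pos by blast
qed

lemma E_homogeneous:
  assumes "l \<ge> 1" "entire q" "\<And>t z. q (t *s z) = t ^ k * q z" shows "q \<in> E_space l"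
  unfolding E_space_iff[OF assms(1)]
  using growth_homogeneous[OF assms(2,3), of 1 "l / 2"] assms(1) by (intro exI[of _ 1]) simp

lemma E_const: "l \<ge> 1 \<Longrightarrow> (\<lambda>z. c) \<in> E_space l"
  by (rule E_homogeneous[where k = 0]) (auto intro: entire_const)

lemma E_cmult: "l \<ge> 1 \<Longrightarrow> f \<in> E_space l \<Longrightarrow> (\<lambda>z. c * f z) \<in> E_space l"
  by (rule E_mult[OF _ E_const])

lemma E_diff: "l \<ge> 1 \<Longrightarrow> f \<in> E_space l \<Longrightarrow> g \<in> E_space l \<Longrightarrow> (\<lambda>z. f z - g z) \<in> E_space l"
  using E_add[of l f "\<lambda>z. - 1 * g z"] E_cmult[of l g "- 1"] by simp

lemma E_sum: "l \<ge> 1 \<Longrightarrow> (\<And>i. i \<in> I \<Longrightarrow> f i \<in> E_space l) \<Longrightarrow> (\<lambda>z. \<Sum>i\<in>I. f i z) \<in> E_space l"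
  by (induction I rule: infinite_finite_induct) (auto intro: E_const E_add)

lemma E_cdot_power: "l \<ge> 1 \<Longrightarrow> (\<lambda>z. cdot z w ^ k) \<in> E_space l"
  by (rule E_homogeneous[OF _ entire_cdot_power cdot_power_homogeneous])

lemma E_hpart: "l \<ge> 1 \<Longrightarrow> entire f \<Longrightarrow> hpart k f \<in> E_space l"
  by (rule E_homogeneous[OF _ entire_hpart hpart_homogeneous])

lemma component_eq_cdot: "z $ i = cdot z (axis i 1)"
  unfolding cdot_def axis_def by (simp add: if_distrib[of "\<lambda>x. _ * x"] if_distrib[of cnj] cong: if_cong)

lemma entire_component: "entire (\<lambda>z. z $ i)"
  unfolding component_eq_cdot by (rule entire_cdot)

lemma E_component: "l \<ge> 1 \<Longrightarrow> (\<lambda>z. z $ i) \<in> E_space l"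
  by (rule E_homogeneous[where k = 1, OF _ entire_component]) auto

lemma E_exp_cdot: assumes "l \<ge> 1" shows "(\<lambda>z. exp (cdot z w)) \<in> E_space l"
proof -
  have "growth (l / 2) (norm w + 1) (\<lambda>z. exp (cdot z w))"
  proof (rule growthI[where C = "exp (norm w + 1)"])
    show "entire (\<lambda>z. exp (cdot z w))" by (intro entire_exp entire_cdot)
    fix z :: "complex ^ 'a"
    have le: "r \<le> 1 + r powr l" if "r \<ge> 0" for r :: real
    proof (cases "r \<le> 1")
      case False
      then have "r powr 1 \<le> r powr l" using \<open>l \<ge> 1\<close> by (intro powr_mono) auto
      then show ?thesis using False by simp
    qed (simp add: add_increasing2)
    have "Re (cdot z w) \<le> norm z * norm w"
      using complex_Re_le_cmod norm_cdot_le order_trans by blast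
    also have "\<dots> \<le> (1 + norm z powr l) * (norm w + 1)" using le[of "norm z"] by (intro mult_mono) auto
    finally show "norm (exp (cdot z w)) \<le> exp (norm w + 1) * exp ((norm w + 1) * norm z powr (2 * (l / 2)))"
      by (simp add: exp_add[symmetric] algebra_simps)
  qed simp
  then show ?thesis using E_space_iff[OF assms] by (metis norm_ge_zero add_nonneg_pos zero_less_one)
qed

section \<open>Norms of exponentials\<close>

lemma powr_tangent:
  fixes x a l :: real
  assumes "x \<ge> 0" "a > 0" "l \<ge> 1"
  shows "a powr l + l * a powr (l - 1) * (x - a) \<le> x powr l"
proof -
  have bern: "1 + l * (s - 1) \<le> s powr l" if "s \<ge> 0" for s
  proof (cases "s = 0")
    case False
    have "(s powr l) powr (1 / l) * 1 powr (1 - 1 / l) \<le> 1 / l * s powr l + (1 - 1 / l) * 1"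
      using False that \<open>l \<ge> 1\<close> by (intro Youngs_inequality_0) auto
    then have "s \<le> 1 / l * s powr l + (1 - 1 / l)" using False that \<open>l \<ge> 1\<close> by (simp add: powr_powr)
    then have "l * s \<le> l * (1 / l * s powr l + (1 - 1 / l))" using \<open>l \<ge> 1\<close> by (intro mult_left_mono) auto
    also have "\<dots> = s powr l + l - 1" using \<open>l \<ge> 1\<close> by (simp add: distrib_left right_diff_distrib)
    finally show ?thesis by (simp add: right_diff_distrib)
  qed (use \<open>l \<ge> 1\<close> in auto)
  have "a powr l * (1 + l * (x / a - 1)) \<le> a powr l * (x / a) powr l"
    using bern[of "x / a"] assms by (intro mult_left_mono) auto
  moreover have "a powr l * (x / a) powr l = x powr l" using assms by (simp add: powr_divide)
  moreover have "a powr l = a powr (l - 1) * a" using assms by (simp add: powr_diff)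
  moreover have "(a powr (l - 1) * a) * (1 + l * (x / a - 1)) = a powr (l - 1) * a + l * a powr (l - 1) * (x - a)"
    using assms by (simp add: field_simps)
  ultimately show ?thesis by simp
qed

text \<open>With \<open>w = \<alpha> l x\<^sup>2\<^sup>l\<^sup>-\<^sup>1 u\<close>, the exponent of \<open>|exp(z \<cdot> w)|\<close> against the weight is maximal at \<open>z = x u\<close>.
  Convexity of \<open>t \<mapsto> t\<^sup>l\<close> in the variable \<open>t = |z|\<^sup>2\<close> gives the quadratic decay away from this point on
  the scale \<open>(1 + x)\<^sup>-\<^sup>(\<^sup>l\<^sup>-\<^sup>1\<^sup>)\<close>, up to a bounded error that takes care of small \<open>x\<close>.\<close>

lemma exp_exponent_bound:
  fixes z u :: "complex ^ 'n::finite"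
  assumes "l \<ge> 1" "\<alpha> > 0" "x \<ge> 0" "norm u = 1"
  shows "\<alpha> * l * x powr (2 * l - 1) * inner z u - \<alpha> / 2 * norm z powr (2 * l)
    \<le> (2 * l - 1) * (\<alpha> / 2) * x powr (2 * l) + 2 * \<alpha> * l
      - \<alpha> * l / 8 * 2 powr (- (2 * l - 2)) * ((1 + x) powr (l - 1) * norm (z - x *\<^sub>R u))\<^sup>2"
proof -
  define d where "d = norm (z - x *\<^sub>R u)"
  define \<kappa> where "\<kappa> = (1 + x) powr (l - 1)"
  define c where "c = \<alpha> * l / 8 * 2 powr (- (2 * l - 2))"
  have "inner u u = 1" using assms by (metis norm_eq_1)
  then have d2: "d\<^sup>2 = (norm z)\<^sup>2 - 2 * x * inner z u + x\<^sup>2"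
    unfolding d_def power2_norm_eq_inner by (simp add: inner_diff_left inner_diff_right inner_commute power2_eq_square algebra_simps)
  have nz: "norm z powr (2 * l) = ((norm z)\<^sup>2) powr l" by (simp add: powr_powr flip: powr_numeral)
  have \<kappa>2: "\<kappa>\<^sup>2 = (1 + x) powr (2 * l - 2)"
    using assms by (simp add: \<kappa>_def powr_powr algebra_simps flip: powr_numeral)
  have c2: "2 powr (- (2 * l - 2)) * 2 powr (2 * l - 2) = (1::real)" by (simp add: powr_add[symmetric])
  show ?thesis
  \<comment> \<open>For \<open>x \<ge> 1\<close> use the tangent at \<open>x\<^sup>2\<close>; below that the tangent at \<open>1\<close> suffices.\<close>
  proof (cases "x \<ge> 1")
    case True
    have t: "(x\<^sup>2) powr l + l * (x\<^sup>2) powr (l - 1) * ((norm z)\<^sup>2 - x\<^sup>2) \<le> ((norm z)\<^sup>2) powr l"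
      using True assms by (intro powr_tangent) auto
    have p1: "(x\<^sup>2) powr l = x powr (2 * l)" "(x\<^sup>2) powr (l - 1) = x powr (2 * l - 2)"
      using True by (simp_all add: powr_powr algebra_simps flip: powr_numeral)
    have p2: "x powr (2 * l - 1) = x powr (2 * l - 2) * x" "x powr (2 * l) = x powr (2 * l - 2) * x\<^sup>2"
      using True powr_add[of x "2 * l - 2" 1] powr_add[of x "2 * l - 2" 2] by simp_all
    define y where "y = x powr (2 * l - 2)"
    have "\<alpha> / 2 * (y * x\<^sup>2 + l * y * ((norm z)\<^sup>2 - x\<^sup>2)) \<le> \<alpha> / 2 * norm z powr (2 * l)"
      using t assms unfolding nz p1 p2 y_def by (intro mult_left_mono) auto
    moreover have "\<alpha> / 2 * (y * x\<^sup>2 + l * y * ((norm z)\<^sup>2 - x\<^sup>2))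
       = \<alpha> * l / 2 * (y * d\<^sup>2) + \<alpha> * l * (y * x) * inner z u - (2 * l - 1) * (\<alpha> / 2) * (y * x\<^sup>2)"
      unfolding d2 by (simp add: power2_eq_square field_simps)
    ultimately have 1: "\<alpha> * l * (y * x) * inner z u - \<alpha> / 2 * norm z powr (2 * l)
        \<le> (2 * l - 1) * (\<alpha> / 2) * (y * x\<^sup>2) - \<alpha> * l / 2 * (y * d\<^sup>2)"
      by linarith
    have "c * \<kappa>\<^sup>2 \<le> \<alpha> * l / 2 * y"
    proof -
      have "\<kappa>\<^sup>2 \<le> (2 * x) powr (2 * l - 2)" unfolding \<kappa>2 using True assms by (intro powr_mono2) auto
      also have "\<dots> = 2 powr (2 * l - 2) * y" by (simp add: powr_mult y_def)
      finally have "c * \<kappa>\<^sup>2 \<le> c * (2 powr (2 * l - 2) * y)" using assms by (intro mult_left_mono) (auto simp: c_def)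
      also have "\<dots> = \<alpha> * l / 8 * (2 powr (- (2 * l - 2)) * 2 powr (2 * l - 2)) * y" by (simp only: c_def mult.assoc)
      also have "\<dots> = \<alpha> * l / 8 * y" unfolding c2 by simp
      also have "\<dots> \<le> \<alpha> * l / 2 * y" using assms by (intro mult_right_mono) (auto simp: y_def)
      finally show ?thesis .
    qed
    then have "c * \<kappa>\<^sup>2 * d\<^sup>2 \<le> \<alpha> * l / 2 * y * d\<^sup>2" by (rule mult_right_mono) simp
    moreover have "2 * \<alpha> * l \<ge> 0" using assms by simp
    ultimately show ?thesis
      using 1 unfolding p2 y_def[symmetric] c_def[symmetric] \<kappa>_def[symmetric] d_def[symmetric] power_mult_distrib
      by (simp add: mult.assoc)
  next
    case False
    have t: "1 + l * ((norm z)\<^sup>2 - 1) \<le> norm z powr (2 * l)"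
      using powr_tangent[of "(norm z)\<^sup>2" 1 l] assms by (simp add: nz)
    have "inner z u \<le> norm z" using norm_cauchy_schwarz[of z u] assms by simp
    moreover have x1: "x powr (2 * l - 1) \<le> 1" "x powr (2 * l - 1) \<ge> 0" using False assms by (auto intro!: powr_le1)
    ultimately have "x powr (2 * l - 1) * inner z u \<le> 1 * norm z"
      by (meson mult_left_mono mult_right_mono norm_ge_zero order_trans)
    then have 1: "\<alpha> * l * x powr (2 * l - 1) * inner z u \<le> \<alpha> * l * norm z"
      using assms unfolding mult.assoc by (intro mult_left_mono) auto
    have 2: "\<alpha> / 2 * (1 + l * ((norm z)\<^sup>2 - 1)) \<le> \<alpha> / 2 * norm z powr (2 * l)"
      using t assms by (intro mult_left_mono) auto
    have "c * \<kappa>\<^sup>2 \<le> c * 2 powr (2 * l - 2)"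
      unfolding \<kappa>2 using False assms by (intro mult_left_mono powr_mono2) (auto simp: c_def)
    also have "\<dots> = \<alpha> * l / 8 * (2 powr (- (2 * l - 2)) * 2 powr (2 * l - 2))" by (simp only: c_def mult.assoc)
    also have "\<dots> = \<alpha> * l / 8" unfolding c2 by simp
    finally have "c * \<kappa>\<^sup>2 * d\<^sup>2 \<le> \<alpha> * l / 8 * d\<^sup>2" by (rule mult_right_mono) simp
    also have "d\<^sup>2 \<le> 2 * (norm z)\<^sup>2 + 2"
    proof -
      have "d \<le> norm z + x" unfolding d_def using norm_triangle_ineq4[of z "x *\<^sub>R u"] assms by simp
      then have "d\<^sup>2 \<le> (norm z + x)\<^sup>2" by (rule power_mono) (simp add: d_def)
      also have "\<dots> \<le> 2 * (norm z)\<^sup>2 + 2 * x\<^sup>2" using zero_le_power2[of "norm z - x"] by (simp add: power2_eq_square algebra_simps)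
      also have "x\<^sup>2 \<le> 1" using False assms by (simp add: power_le_one)
      finally show ?thesis by simp
    qed
    finally have 3: "c * \<kappa>\<^sup>2 * d\<^sup>2 \<le> \<alpha> * l / 8 * (2 * (norm z)\<^sup>2 + 2)"
      using assms by (simp add: mult_left_mono)
    have "0 \<le> \<alpha> * l * (norm z / 2 - 1)\<^sup>2" using assms by simp
    then have 4: "\<alpha> * l * norm z \<le> \<alpha> * l + \<alpha> * l / 4 * (norm z)\<^sup>2" by (simp add: power2_eq_square field_simps)
    have 5: "0 \<le> (2 * l - 1) * (\<alpha> / 2) * x powr (2 * l)" using assms by simp
    have 6: "0 \<le> \<alpha> * l" "0 \<le> \<alpha>" using assms by auto
    have "\<alpha> * l * x powr (2 * l - 1) * inner z u - \<alpha> / 2 * norm z powr (2 * l)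
       \<le> (2 * l - 1) * (\<alpha> / 2) * x powr (2 * l) + 2 * \<alpha> * l - c * \<kappa>\<^sup>2 * d\<^sup>2"
      using 1 2 3 4 5 6 by (simp add: algebra_simps)
    then show ?thesis
      unfolding c_def[symmetric] \<kappa>_def[symmetric] d_def[symmetric] power_mult_distrib by (simp add: mult.assoc)
  qed
qed

text \<open>By the previous estimate the weighted modulus lies below a Gaussian of width \<open>(1 + x)\<^sup>-\<^sup>(\<^sup>l\<^sup>-\<^sup>1\<^sup>)\<close>
  centred at \<open>x u\<close>, where the polynomial weight is comparable to \<open>(1 + x)\<^sup>\<rho>\<close>.\<close>

lemma exp_norm_bound:
  fixes l \<alpha> \<rho> :: real
  assumes "1 \<le> l" "1 \<le> p" "\<alpha> > 0"
  obtains C where "C > 0" "\<And>x (u :: complex ^ 'n::finite). x \<ge> 0 \<Longrightarrow> norm u = 1 \<Longrightarrow>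
      L_norm l p \<alpha> \<rho> (\<lambda>z. exp (cdot z ((\<alpha> * l * x powr (2 * l - 1)) *\<^sub>R u)))
      \<le> C * (1 + x) powr (\<rho> - 2 * CARD('n) * (l - 1) * inv_exponent p) * exp ((2 * l - 1) * (\<alpha> / 2) * x powr (2 * l))"
proof -
  define c where "c = \<alpha> * l / 8 * 2 powr (- (2 * l - 2))"
  have c: "c > 0" using assms by (simp add: c_def)
  then obtain C1 where C1: "C1 > 0" "\<And>D. D \<ge> 0 \<Longrightarrow> (1 + D) powr \<bar>\<rho>\<bar> \<le> C1 * exp (c / 2 * D\<^sup>2)"
    using poly_le_gauss[of "c / 2" "\<bar>\<rho>\<bar>"] by (metis half_gt_zero)
  obtain C2 where C2: "C2 > 0" "\<And>\<kappa> (a :: complex ^ 'n). \<kappa> > 0 \<Longrightarrow>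
      Lp_finite p (\<lambda>z. exp (- (c / 2) * (\<kappa> * norm (z - a))\<^sup>2)) \<and>
      Lp_norm p (\<lambda>z. exp (- (c / 2) * (\<kappa> * norm (z - a))\<^sup>2)) \<le> C2 * \<kappa> powr (- (2 * CARD('n)) * inv_exponent p)"
    using Lp_norm_gauss[of p "c / 2", where 'n = 'n] assms(2) c by (metis half_gt_zero)
  show ?thesis
  proof (rule that[of "C1 * exp (2 * \<alpha> * l) * C2"])
    show "C1 * exp (2 * \<alpha> * l) * C2 > 0" using C1 C2 by simp
    fix x :: real and u :: "complex ^ 'n" assume x: "x \<ge> 0" and u: "norm u = 1"
    define f where "f z = exp (cdot z ((\<alpha> * l * x powr (2 * l - 1)) *\<^sub>R u))" for z
    define \<kappa> where "\<kappa> = (1 + x) powr (l - 1)"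
    have \<kappa>: "\<kappa> \<ge> 1" using x assms by (auto simp: \<kappa>_def intro!: ge_one_powr_ge_zero)
    define K where "K = C1 * exp (2 * \<alpha> * l) * ((1 + x) powr \<rho> * exp ((2 * l - 1) * (\<alpha> / 2) * x powr (2 * l)))"
    have K: "K \<ge> 0" using C1 by (simp add: K_def)
    have fm: "f \<in> borel_measurable dV" unfolding f_def
      by (intro measurable_dV_borel entire_borel entire_exp entire_cdot)
    have bound: "weighted_abs l \<alpha> \<rho> f z \<le> K * exp (- (c / 2) * (\<kappa> * norm (z - x *\<^sub>R u))\<^sup>2)" for z
    proof -
      define d where "d = norm (z - x *\<^sub>R u)"
      define A where "A = \<alpha> * l * x powr (2 * l - 1) * inner z u"
      have nf: "norm (f z) = exp A"
        by (simp add: f_def A_def cdot_scaleR_right Re_cdot del: of_real_mult)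
      have e: "A - \<alpha> / 2 * norm z powr (2 * l) \<le> (2 * l - 1) * (\<alpha> / 2) * x powr (2 * l) + 2 * \<alpha> * l - c * (\<kappa> * d)\<^sup>2"
        unfolding A_def c_def \<kappa>_def d_def by (rule exp_exponent_bound[OF assms(1,3) x u])
      have w: "(1 + norm z) powr \<rho> \<le> (1 + x) powr \<rho> * (C1 * exp (c / 2 * (\<kappa> * d)\<^sup>2))"
      proof -
        have "\<bar>norm z - x\<bar> \<le> d" unfolding d_def using norm_triangle_ineq3[of z "x *\<^sub>R u"] x u by simp
        then have "(1 + \<bar>norm z - x\<bar>) powr \<bar>\<rho>\<bar> \<le> (1 + d) powr \<bar>\<rho>\<bar>" by (intro powr_mono2) auto
        then have "(1 + x) powr \<rho> * (1 + \<bar>norm z - x\<bar>) powr \<bar>\<rho>\<bar> \<le> (1 + x) powr \<rho> * (1 + d) powr \<bar>\<rho>\<bar>"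
          by (rule mult_left_mono) simp
        then have "(1 + norm z) powr \<rho> \<le> (1 + x) powr \<rho> * (1 + d) powr \<bar>\<rho>\<bar>"
          using peetre[OF norm_ge_zero x, of z \<rho>] by linarith
        also have "(1 + d) powr \<bar>\<rho>\<bar> \<le> C1 * exp (c / 2 * d\<^sup>2)" by (rule C1) (simp add: d_def)
        also have "\<dots> \<le> C1 * exp (c / 2 * (\<kappa> * d)\<^sup>2)"
        proof -
          have "d \<le> \<kappa> * d" using \<kappa> mult_right_mono[of 1 \<kappa> d] by (simp add: d_def)
          then have "d\<^sup>2 \<le> (\<kappa> * d)\<^sup>2" by (rule power_mono) (simp add: d_def)
          then show ?thesis using C1(1) c by simp
        qed
        finally show ?thesis by (simp add: mult_left_mono)
      qed
      have "weighted_abs l \<alpha> \<rho> f z = (1 + norm z) powr \<rho> * exp (A - \<alpha> / 2 * norm z powr (2 * l))"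
      proof -
        have "exp (A - \<alpha> / 2 * norm z powr (2 * l)) = exp A * exp (- (\<alpha> / 2) * norm z powr (2 * l))"
          by (simp add: exp_add[symmetric])
        then show ?thesis by (simp only: weighted_abs_def nf mult.assoc mult.commute mult.left_commute)
      qed
      also have "\<dots> \<le> ((1 + x) powr \<rho> * (C1 * exp (c / 2 * (\<kappa> * d)\<^sup>2))) * exp ((2 * l - 1) * (\<alpha> / 2) * x powr (2 * l) + 2 * \<alpha> * l - c * (\<kappa> * d)\<^sup>2)"
        using w e C1(1) by (intro mult_mono) auto
      also have "\<dots> = K * (exp (c / 2 * (\<kappa> * d)\<^sup>2) * exp (- c * (\<kappa> * d)\<^sup>2))"
      proof -
        have "exp ((2 * l - 1) * (\<alpha> / 2) * x powr (2 * l) + 2 * \<alpha> * l - c * (\<kappa> * d)\<^sup>2)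
          = exp ((2 * l - 1) * (\<alpha> / 2) * x powr (2 * l)) * exp (2 * \<alpha> * l) * exp (- c * (\<kappa> * d)\<^sup>2)"
          by (simp add: exp_add[symmetric])
        then show ?thesis by (simp only: K_def mult.assoc mult.commute mult.left_commute)
      qed
      also have "exp (c / 2 * (\<kappa> * d)\<^sup>2) * exp (- c * (\<kappa> * d)\<^sup>2) = exp (- (c / 2) * (\<kappa> * d)\<^sup>2)"
        by (simp add: exp_add[symmetric])
      finally show ?thesis unfolding d_def .
    qed
    have g: "Lp_finite p (\<lambda>z. exp (- (c / 2) * (\<kappa> * norm (z - x *\<^sub>R u))\<^sup>2))"
      "Lp_norm p (\<lambda>z. exp (- (c / 2) * (\<kappa> * norm (z - x *\<^sub>R u))\<^sup>2)) \<le> C2 * \<kappa> powr (- (2 * CARD('n)) * inv_exponent p)"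
      using C2(2)[of \<kappa> "x *\<^sub>R u"] \<kappa> by auto
    have "L_norm l p \<alpha> \<rho> f \<le> K * Lp_norm p (\<lambda>z. exp (- (c / 2) * (\<kappa> * norm (z - x *\<^sub>R u))\<^sup>2))"
      unfolding L_norm_eq
      by (rule Lp_norm_mono(2)[OF assms(2) _ _ weighted_abs_nonneg bound _ K g(1)])
         (use fm in \<open>auto intro!: measurable_dV_borel\<close>)
    also have "\<dots> \<le> K * (C2 * \<kappa> powr (- (2 * CARD('n)) * inv_exponent p))"
      using K g(2) by (rule mult_left_mono[rotated])
    also have "\<kappa> powr (- (2 * CARD('n)) * inv_exponent p) = (1 + x) powr (- (2 * CARD('n) * (l - 1) * inv_exponent p))"
      by (simp add: \<kappa>_def powr_powr mult_ac)
    also have "K * (C2 * (1 + x) powr (- (2 * CARD('n) * (l - 1) * inv_exponent p)))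
      = C1 * exp (2 * \<alpha> * l) * C2 * ((1 + x) powr \<rho> * (1 + x) powr (- (2 * CARD('n) * (l - 1) * inv_exponent p))) * exp ((2 * l - 1) * (\<alpha> / 2) * x powr (2 * l))"
      unfolding K_def by (simp only: mult.assoc mult.commute mult.left_commute)
    also have "(1 + x) powr \<rho> * (1 + x) powr (- (2 * CARD('n) * (l - 1) * inv_exponent p)) = (1 + x) powr (\<rho> - 2 * CARD('n) * (l - 1) * inv_exponent p)"
      by (simp add: powr_add[symmetric])
    finally show "L_norm l p \<alpha> \<rho> (\<lambda>z. exp (cdot z ((\<alpha> * l * x powr (2 * l - 1)) *\<^sub>R u)))
      \<le> C1 * exp (2 * \<alpha> * l) * C2 * (1 + x) powr (\<rho> - 2 * CARD('n) * (l - 1) * inv_exponent p) * exp ((2 * l - 1) * (\<alpha> / 2) * x powr (2 * l))"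
      unfolding f_def .
  qed
qed

lemma growth_norm_bound:
  fixes l \<alpha> \<rho> :: real
  assumes "1 \<le> l" "1 \<le> p" "\<alpha> > 0"
  obtains C where "C > 0" "\<And>K (f :: complex ^ 'n::finite \<Rightarrow> complex). K \<ge> 0 \<Longrightarrow> entire f \<Longrightarrow>
      (\<And>z. norm (f z) \<le> K * exp (\<alpha> / 4 * norm z powr (2 * l))) \<Longrightarrow>
      f \<in> L_space l p \<alpha> \<rho> \<and> L_norm l p \<alpha> \<rho> f \<le> K * C"
proof -
  have a8: "\<alpha> / 8 > 0" using assms by simp
  obtain C1 where C1: "C1 > 0" "\<And>D. D \<ge> 0 \<Longrightarrow> (1 + D) powr \<rho> \<le> C1 * exp (\<alpha> / 8 * D\<^sup>2)"
    using poly_le_gauss[OF a8, of \<rho>] by metis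
  obtain C2 where C2: "C2 > 0" "\<And>\<kappa> (a :: complex ^ 'n). \<kappa> > 0 \<Longrightarrow>
      Lp_finite p (\<lambda>z. exp (- (\<alpha> / 8) * (\<kappa> * norm (z - a))\<^sup>2)) \<and>
      Lp_norm p (\<lambda>z. exp (- (\<alpha> / 8) * (\<kappa> * norm (z - a))\<^sup>2)) \<le> C2 * \<kappa> powr (- (2 * CARD('n)) * inv_exponent p)"
    using Lp_norm_gauss[OF assms(2) a8, where 'n = 'n] by metis
  have sq: "(norm z)\<^sup>2 \<le> 1 + norm z powr (2 * l)" for z :: "complex ^ 'n"
  proof (cases "norm z \<le> 1")
    case True
    then have "(norm z)\<^sup>2 \<le> 1" by (simp add: power_le_one)
    then show ?thesis by (simp add: add_increasing2)
  next
    case False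
    then have "norm z powr 2 \<le> norm z powr (2 * l)" using assms by (intro powr_mono) auto
    then show ?thesis using False by simp
  qed
  define G where "G z = exp (- (\<alpha> / 8) * (1 * norm (z - 0))\<^sup>2)" for z :: "complex ^ 'n"
  have G: "Lp_finite p G" "Lp_norm p G \<le> C2" unfolding G_def using C2(2)[of 1 0] by auto
  show ?thesis
  proof (rule that[of "C1 * exp (\<alpha> / 4) * C2"])
    show "C1 * exp (\<alpha> / 4) * C2 > 0" using C1 C2 by simp
    fix K :: real and f :: "complex ^ 'n \<Rightarrow> complex"
    assume K: "K \<ge> 0" and ent: "entire f" and f: "\<And>z. norm (f z) \<le> K * exp (\<alpha> / 4 * norm z powr (2 * l))"
    have fm: "f \<in> borel_measurable dV" by (intro measurable_dV_borel entire_borel ent)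
    have bound: "weighted_abs l \<alpha> \<rho> f z \<le> K * C1 * exp (\<alpha> / 4) * G z" for z
    proof -
      have "weighted_abs l \<alpha> \<rho> f z \<le> (K * exp (\<alpha> / 4 * norm z powr (2 * l))) * (C1 * exp (\<alpha> / 8 * (norm z)\<^sup>2)) * exp (- (\<alpha> / 2) * norm z powr (2 * l))"
        unfolding weighted_abs_def using f C1 K by (intro mult_mono) auto
      also have "\<dots> = K * C1 * exp (\<alpha> / 8 * (norm z)\<^sup>2 - \<alpha> / 4 * norm z powr (2 * l))"
      proof -
        have "exp (\<alpha> / 4 * norm z powr (2 * l)) * exp (\<alpha> / 8 * (norm z)\<^sup>2) * exp (- (\<alpha> / 2) * norm z powr (2 * l)) = exp (\<alpha> / 8 * (norm z)\<^sup>2 - \<alpha> / 4 * norm z powr (2 * l))"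
          by (simp add: exp_add[symmetric])
        moreover have "(K * a) * (C1 * b) * c = K * C1 * (a * b * c)" for a b c :: real
          by (simp only: mult.assoc mult.commute mult.left_commute)
        ultimately show ?thesis by simp
      qed
      also have "\<dots> \<le> K * C1 * exp (\<alpha> / 4 + (- (\<alpha> / 8) * (norm z)\<^sup>2))"
      proof (intro mult_left_mono)
        have "\<alpha> / 4 * (norm z)\<^sup>2 \<le> \<alpha> / 4 * (1 + norm z powr (2 * l))" using sq[of z] assms by (intro mult_left_mono) auto
        then show "exp (\<alpha> / 8 * (norm z)\<^sup>2 - \<alpha> / 4 * norm z powr (2 * l)) \<le> exp (\<alpha> / 4 + (- (\<alpha> / 8) * (norm z)\<^sup>2))"
          by (simp add: algebra_simps)
      qed (use K C1 in auto)
      also have "\<dots> = K * C1 * exp (\<alpha> / 4) * G z" unfolding exp_add by (simp add: G_def)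
      finally show ?thesis .
    qed
    have K': "K * C1 * exp (\<alpha> / 4) \<ge> 0" using K C1 by simp
    have Gm: "G \<in> borel_measurable dV" unfolding G_def by (rule measurable_dV_borel) measurable
    have Gnn: "0 \<le> G z" for z by (simp add: G_def)
    note mono = Lp_norm_mono[OF assms(2) weighted_abs_measurable[OF fm] Gm weighted_abs_nonneg bound Gnn K' G(1)]
    have "L_norm l p \<alpha> \<rho> f \<le> K * C1 * exp (\<alpha> / 4) * Lp_norm p G" unfolding L_norm_eq by (rule mono(2))
    also have "\<dots> \<le> K * C1 * exp (\<alpha> / 4) * C2" using K' G(2) by (rule mult_left_mono[rotated])
    finally show "f \<in> L_space l p \<alpha> \<rho> \<and> L_norm l p \<alpha> \<rho> f \<le> K * (C1 * exp (\<alpha> / 4) * C2)"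
      using fm mono(1) by (simp add: L_space_iff mult.assoc)
  qed
qed

text \<open>The splitting \<open>w = \<alpha>w/(2g) + \<beta>w/(2g)\<close> is chosen so that both exponentials peak at the same
  point \<open>x u\<close>; then the exponents add, and \<open>1/p + 1/p' = 1\<close> removes the dependence on \<open>p\<close>.\<close>

lemma exp_norm_product_bound:
  fixes l \<alpha> \<beta> \<rho> \<eta> :: real
  assumes "1 \<le> l" "1 \<le> p" "\<alpha> > 0" "\<beta> > 0"
  defines "g \<equiv> (\<alpha> + \<beta>) / 2"
  obtains C where "C > 0" "\<And>w :: complex ^ 'n::finite.
    L_norm l p \<alpha> \<rho> (\<lambda>z. exp (cdot z ((\<alpha> / (2 * g)) *\<^sub>R w)))
      * L_norm l (conj_exponent p) \<beta> \<eta> (\<lambda>z. exp (cdot z ((\<beta> / (2 * g)) *\<^sub>R w)))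
    \<le> C * peak l g (\<rho> + \<eta> - 2 * CARD('n) * (l - 1)) (norm w)"
proof -
  have g: "g > 0" using assms by (simp add: g_def)
  obtain C1 where C1: "C1 > 0" "\<And>x (u :: complex ^ 'n). x \<ge> 0 \<Longrightarrow> norm u = 1 \<Longrightarrow>
      L_norm l p \<alpha> \<rho> (\<lambda>z. exp (cdot z ((\<alpha> * l * x powr (2 * l - 1)) *\<^sub>R u)))
      \<le> C1 * (1 + x) powr (\<rho> - 2 * CARD('n) * (l - 1) * inv_exponent p) * exp ((2 * l - 1) * (\<alpha> / 2) * x powr (2 * l))"
    using exp_norm_bound[OF assms(1,2,3), of \<rho>, where 'n = 'n] by metis
  obtain C2 where C2: "C2 > 0" "\<And>x (u :: complex ^ 'n). x \<ge> 0 \<Longrightarrow> norm u = 1 \<Longrightarrow>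
      L_norm l (conj_exponent p) \<beta> \<eta> (\<lambda>z. exp (cdot z ((\<beta> * l * x powr (2 * l - 1)) *\<^sub>R u)))
      \<le> C2 * (1 + x) powr (\<eta> - 2 * CARD('n) * (l - 1) * inv_exponent (conj_exponent p)) * exp ((2 * l - 1) * (\<beta> / 2) * x powr (2 * l))"
    using exp_norm_bound[OF assms(1) conj_exponent_ge_1[OF assms(2)] assms(4), of \<eta>, where 'n = 'n] by metis
  show ?thesis
  proof (rule that[of "C1 * C2"])
    show "C1 * C2 > 0" using C1 C2 by simp
    fix w :: "complex ^ 'n"
    define x where "x = (norm w / (2 * g * l)) powr (1 / (2 * l - 1))"
    \<comment> \<open>For \<open>w = 0\<close> any unit vector will do, since \<open>x = 0\<close>.\<close>
    define u :: "complex ^ 'n" where "u = (if w = 0 then axis undefined 1 else (1 / norm w) *\<^sub>R w)"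
    have x: "x \<ge> 0" by (simp add: x_def)
    have "norm (axis undefined (1 :: complex) :: complex ^ 'n) = 1"
      by (simp add: norm_eq_sqrt_inner inner_axis_axis)
    then have u: "norm u = 1" by (simp add: u_def)
    have wu: "w = norm w *\<^sub>R u" by (simp add: u_def)
    have xp: "x powr (2 * l - 1) = norm w / (2 * g * l)"
      using assms(1) g by (simp add: x_def powr_powr)
    have s: "(c * l * x powr (2 * l - 1)) *\<^sub>R u = (c / (2 * g)) *\<^sub>R w" for c
    proof -
      have "(c * l * x powr (2 * l - 1)) *\<^sub>R u = (c / (2 * g)) *\<^sub>R (norm w *\<^sub>R u)"
        using assms(1) unfolding xp by simp
      then show ?thesis using wu by simp
    qed
    have "L_norm l p \<alpha> \<rho> (\<lambda>z. exp (cdot z ((\<alpha> / (2 * g)) *\<^sub>R w)))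
      * L_norm l (conj_exponent p) \<beta> \<eta> (\<lambda>z. exp (cdot z ((\<beta> / (2 * g)) *\<^sub>R w)))
      \<le> (C1 * (1 + x) powr (\<rho> - 2 * CARD('n) * (l - 1) * inv_exponent p) * exp ((2 * l - 1) * (\<alpha> / 2) * x powr (2 * l)))
       * (C2 * (1 + x) powr (\<eta> - 2 * CARD('n) * (l - 1) * inv_exponent (conj_exponent p)) * exp ((2 * l - 1) * (\<beta> / 2) * x powr (2 * l)))"
      using C1(2)[OF x u] C2(2)[OF x u] C1(1) unfolding s
      by (intro mult_mono) (simp_all add: L_norm_eq Lp_norm_nonneg)
    also have "\<dots> = C1 * C2 * ((1 + x) powr (\<rho> - 2 * CARD('n) * (l - 1) * inv_exponent p) * (1 + x) powr (\<eta> - 2 * CARD('n) * (l - 1) * inv_exponent (conj_exponent p)))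
       * (exp ((2 * l - 1) * (\<alpha> / 2) * x powr (2 * l)) * exp ((2 * l - 1) * (\<beta> / 2) * x powr (2 * l)))"
      by (simp only: mult.assoc mult.commute mult.left_commute)
    also have "exp ((2 * l - 1) * (\<alpha> / 2) * x powr (2 * l)) * exp ((2 * l - 1) * (\<beta> / 2) * x powr (2 * l)) = exp ((2 * l - 1) * g * x powr (2 * l))"
      unfolding exp_add[symmetric] by (simp add: g_def field_simps)
    also have "(1 + x) powr (\<rho> - 2 * CARD('n) * (l - 1) * inv_exponent p) * (1 + x) powr (\<eta> - 2 * CARD('n) * (l - 1) * inv_exponent (conj_exponent p))
      = (1 + x) powr (\<rho> + \<eta> - 2 * CARD('n) * (l - 1))"
    proof -
      have "\<rho> - 2 * CARD('n) * (l - 1) * inv_exponent p + (\<eta> - 2 * CARD('n) * (l - 1) * inv_exponent (conj_exponent p))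
        = \<rho> + \<eta> - 2 * CARD('n) * (l - 1) * (inv_exponent p + inv_exponent (conj_exponent p))"
        by (simp add: algebra_simps)
      also have "\<dots> = \<rho> + \<eta> - 2 * CARD('n) * (l - 1)" unfolding inv_exponent_conj[OF assms(2)] by simp
      finally show ?thesis unfolding powr_add[symmetric] by (simp only:)
    qed
    finally show "L_norm l p \<alpha> \<rho> (\<lambda>z. exp (cdot z ((\<alpha> / (2 * g)) *\<^sub>R w)))
      * L_norm l (conj_exponent p) \<beta> \<eta> (\<lambda>z. exp (cdot z ((\<beta> / (2 * g)) *\<^sub>R w)))
      \<le> C1 * C2 * peak l g (\<rho> + \<eta> - 2 * CARD('n) * (l - 1)) (norm w)"
      unfolding peak_def x_def[symmetric] by (simp add: mult.assoc)
  qed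
qed

section \<open>A positive measure with the moments of the reproducing kernel\<close>

text \<open>Comparable to \<open>(1 + r)\<^sup>\<sigma> exp(g/4 r\<^sup>2\<^sup>l)\<close>, the growth allowed in \<open>F\<^sup>\<infinity>\<close>, in the form in which Laplace's
  method delivers it.\<close>

definition target_growth :: "real \<Rightarrow> real \<Rightarrow> real \<Rightarrow> real \<Rightarrow> real" where
  "target_growth l g \<sigma> r = (1 + r powr l / 2) powr (\<sigma> / l) * exp (g / 4 * r powr (2 * l))"

text \<open>For \<open>l = 1\<close> the moments are those of a point mass at \<open>g\<close>, which is what the Zolotarev measure
  degenerates to.\<close>

lemma moment_measure:
  fixes l g \<sigma> :: real
  assumes "l \<ge> 1" "g > 0"
  obtains N :: "real measure" and C :: real where "sets N = sets borel" "AE \<xi> in N. \<xi> \<ge> 0"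
    "\<And>k. (\<integral>\<^sup>+\<xi>. ennreal (\<xi> ^ k) \<partial>N) = ennreal (moment TYPE('n::finite) l g k)"
    "C > 0" "\<And>r. r \<ge> 0 \<Longrightarrow> (\<integral>\<^sup>+\<xi>. ennreal (peak l g (\<sigma> - 2 * CARD('n) * (l - 1)) (\<xi> * r)) \<partial>N) \<le> ennreal (C * target_growth l g \<sigma> r)"
proof (cases "l = 1")
  case True
  define c where "c = g ^ CARD('n) / Gamma (1 + real CARD('n))"
  have c: "c > 0" using assms by (simp add: c_def Gamma_real_pos)
  define N where "N = distr (scale_measure (ennreal c) (count_space {g})) borel (\<lambda>\<xi>. \<xi>)"
  show ?thesis
  proof (rule that[of N c])
    show "sets N = sets borel" by (simp add: N_def)
    have nn: "(\<integral>\<^sup>+\<xi>. f \<xi> \<partial>N) = ennreal c * f g" if "f \<in> borel_measurable borel" for f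
      unfolding N_def using that
      by (subst nn_integral_distr) (auto simp: nn_integral_scale_measure nn_integral_count_space_finite space_scale_measure)
    show "AE \<xi> in N. \<xi> \<ge> 0"
      unfolding N_def using assms
      by (subst AE_distr_iff) (auto intro!: AE_I2 simp: space_scale_measure)
    show "c > 0" by (rule c)
    show "(\<integral>\<^sup>+\<xi>. ennreal (\<xi> ^ k) \<partial>N) = ennreal (moment TYPE('n) l g k)" for k
    proof -
      have "(\<integral>\<^sup>+\<xi>. ennreal (\<xi> ^ k) \<partial>N) = ennreal (c * g ^ k)"
        using assms c by (subst nn) (simp_all add: ennreal_mult)
      moreover have "Gamma (1 + (real k + real CARD('n))) > 0" by (intro Gamma_real_pos) simp
      then have nz: "Gamma (1 + (real k + real CARD('n))) \<noteq> 0" by linarith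
      have "c * g ^ k = moment TYPE('n) l g k"
        using assms by (simp add: moment_def c_def True powr_add powr_realpow mult.commute nz)
      ultimately show ?thesis by simp
    qed
    show "(\<integral>\<^sup>+\<xi>. ennreal (peak l g (\<sigma> - 2 * CARD('n) * (l - 1)) (\<xi> * r)) \<partial>N) \<le> ennreal (c * target_growth l g \<sigma> r)" if "r \<ge> 0" for r
    proof -
      have "peak l g (\<sigma> - 2 * CARD('n) * (l - 1)) (g * r) = target_growth l g \<sigma> r"
        using assms that by (simp add: peak_def target_growth_def True power_divide)
      then have "(\<integral>\<^sup>+\<xi>. ennreal (peak l g (\<sigma> - 2 * CARD('n) * (l - 1)) (\<xi> * r)) \<partial>N) = ennreal c * ennreal (target_growth l g \<sigma> r)"
        by (subst nn) simp_all
      also have "\<dots> = ennreal (c * target_growth l g \<sigma> r)"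
        using c by (intro ennreal_mult[symmetric]) (auto simp: target_growth_def)
      finally show ?thesis by simp
    qed
  qed
next
  case False
  then have l: "l > 1" using assms by simp
  obtain C where C: "C > 0" "\<And>r. r \<ge> 0 \<Longrightarrow>
    (\<integral>\<^sup>+\<xi>. ennreal (peak l g (\<sigma> - 2 * CARD('n) * (l - 1)) (\<xi> * r)) \<partial>zol_measure CARD('n) l g)
    \<le> ennreal (C * (1 + r powr l / 2) powr (\<sigma> / l) * exp (g / 4 * r powr (2 * l)))"
    using zol_measure_peak[OF l assms(2), where \<sigma> = \<sigma> and n = "CARD('n)"] by metis
  show ?thesis
  proof (rule that[of "zol_measure CARD('n) l g" C])
    show "sets (zol_measure CARD('n) l g) = sets borel" by (simp add: zol_measure_def)
    show "(\<integral>\<^sup>+\<xi>. ennreal (\<xi> ^ k) \<partial>zol_measure CARD('n) l g) = ennreal (moment TYPE('n) l g k)" for k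
      by (rule zol_measure_moment[OF l assms(2)])
    show "(\<integral>\<^sup>+\<xi>. ennreal (peak l g (\<sigma> - 2 * CARD('n) * (l - 1)) (\<xi> * r)) \<partial>zol_measure CARD('n) l g) \<le> ennreal (C * target_growth l g \<sigma> r)" if "r \<ge> 0" for r
      using C(2)[OF that] by (simp add: target_growth_def mult.assoc)
  qed (auto simp: C zol_measure_nonneg)
qed

section \<open>The functional of a bounded Hankel form\<close>

text \<open>The constant \<open>C\<^sub>0\<close> is any admissible bound; it is carried through explicitly because the norm
  of the symbol has to be bounded by the smallest one.\<close>

locale bounded_hankel =
  fixes l \<alpha> \<beta> \<rho> \<eta> :: real and p :: ennreal
    and \<Lambda> :: "(complex ^ 'n::finite \<Rightarrow> complex) \<Rightarrow> (complex ^ 'n \<Rightarrow> complex) \<Rightarrow> complex" and C\<^sub>0 :: real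
  assumes l: "1 \<le> l" and p: "1 \<le> p" and \<alpha>: "0 < \<alpha>" and \<beta>: "0 < \<beta>" and hankel: "hankel_form l \<Lambda>" and C0: "C\<^sub>0 \<ge> 0"
    and bounded: "\<And>f g. f \<in> E_space l \<Longrightarrow> g \<in> E_space l \<Longrightarrow>
      norm (\<Lambda> f g) \<le> C\<^sub>0 * L_norm l p \<alpha> \<rho> f * L_norm l (conj_exponent p) \<beta> \<eta> g"
begin

definition T :: "(complex ^ 'n \<Rightarrow> complex) \<Rightarrow> complex" where "T h = \<Lambda> h (\<lambda>_. 1)"

definition g :: real where "g = (\<alpha> + \<beta>) / 2"

lemma g_pos: "g > 0" using \<alpha> \<beta> by (simp add: g_def)

lemma \<Lambda>_eq: "f \<in> E_space l \<Longrightarrow> h \<in> E_space l \<Longrightarrow> \<Lambda> f h = T (\<lambda>z. f z * h z)"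
  using hankel unfolding hankel_form_def T_def by blast

lemma T_add: "f \<in> E_space l \<Longrightarrow> h \<in> E_space l \<Longrightarrow> T (\<lambda>z. f z + h z) = T f + T h"
  using hankel E_const[OF l, of 1] unfolding hankel_form_def bilinear_form_on_def T_def by blast

lemma T_cmult: "f \<in> E_space l \<Longrightarrow> T (\<lambda>z. c * f z) = c * T f"
  using hankel E_const[OF l, of 1] unfolding hankel_form_def bilinear_form_on_def T_def by blast

lemma T_zero: "T (\<lambda>z. 0) = 0"
  using T_cmult[OF E_const[OF l, of 0], of 0] by simp

lemma T_sum: "(\<And>i. i \<in> I \<Longrightarrow> f i \<in> E_space l) \<Longrightarrow> T (\<lambda>z. \<Sum>i\<in>I. f i z) = (\<Sum>i\<in>I. T (f i))"
  by (induction I rule: infinite_finite_induct) (auto simp: T_zero T_add E_sum[OF l])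

lemma T_diff: "f \<in> E_space l \<Longrightarrow> h \<in> E_space l \<Longrightarrow> T (\<lambda>z. f z - h z) = T f - T h"
  using T_add[of f "\<lambda>z. - 1 * h z"] T_cmult[of h "- 1"] E_cmult[OF l, of h "- 1"] by simp

lemma T_growth_bound:
  obtains C where "C > 0" "\<And>K (f :: complex ^ 'n \<Rightarrow> complex). K \<ge> 0 \<Longrightarrow> f \<in> E_space l \<Longrightarrow>
     (\<And>z. norm (f z) \<le> K * exp (\<alpha> / 4 * norm z powr (2 * l))) \<Longrightarrow> norm (T f) \<le> K * C"
proof -
  obtain C where C: "C > 0" "\<And>K (f :: complex ^ 'n \<Rightarrow> complex). K \<ge> 0 \<Longrightarrow> entire f \<Longrightarrow>
      (\<And>z. norm (f z) \<le> K * exp (\<alpha> / 4 * norm z powr (2 * l))) \<Longrightarrow>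
      f \<in> L_space l p \<alpha> \<rho> \<and> L_norm l p \<alpha> \<rho> f \<le> K * C"
    using growth_norm_bound[OF l p \<alpha>, of \<rho>, where 'n = 'n] by metis
  define N where "N = L_norm l (conj_exponent p) \<beta> \<eta> (\<lambda>_ :: complex ^ 'n. 1)"
  have N: "N \<ge> 0" by (simp add: N_def L_norm_eq Lp_norm_nonneg)
  show ?thesis
  proof (rule that[of "C * (C\<^sub>0 * N + 1)"])
    show "C * (C\<^sub>0 * N + 1) > 0" using C(1) C0 N by (simp add: add_nonneg_pos)
    fix K :: real and f :: "complex ^ 'n \<Rightarrow> complex"
    assume K: "K \<ge> 0" and f: "f \<in> E_space l" and b: "\<And>z. norm (f z) \<le> K * exp (\<alpha> / 4 * norm z powr (2 * l))"
    have "norm (T f) \<le> C\<^sub>0 * L_norm l p \<alpha> \<rho> f * N"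
      unfolding T_def N_def by (rule bounded[OF f E_const[OF l]])
    also have "\<dots> \<le> C\<^sub>0 * (K * C) * N"
      using C(2)[OF K E_entire[OF f] b] C0 N by (intro mult_right_mono mult_left_mono) auto
    also have "\<dots> = K * (C * (C\<^sub>0 * N))" by simp
    also have "\<dots> \<le> K * (C * (C\<^sub>0 * N + 1))" using K C(1) by (intro mult_left_mono) auto
    finally show "norm (T f) \<le> K * (C * (C\<^sub>0 * N + 1))" .
  qed
qed

text \<open>The functional is continuous for the norm \<open>sup |f| exp(-\<alpha>/4 |z|\<^sup>2\<^sup>l)\<close>, and functions in \<open>E\<close> grow so
  slowly that their expansion into homogeneous parts converges geometrically in it.\<close>

lemma T_hpart_sums: assumes f: "f \<in> E_space l" shows "(\<lambda>k. T (hpart k f)) sums T f"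
proof -
  obtain CT where CT: "CT > 0" "\<And>K (f :: complex ^ 'n \<Rightarrow> complex). K \<ge> 0 \<Longrightarrow> f \<in> E_space l \<Longrightarrow>
     (\<And>z. norm (f z) \<le> K * exp (\<alpha> / 4 * norm z powr (2 * l))) \<Longrightarrow> norm (T f) \<le> K * CT"
    using T_growth_bound by metis
  \<comment> \<open>The doubled argument in the tail estimate multiplies \<open>|z|\<^sup>2\<^sup>l\<close> by \<open>2\<^sup>2\<^sup>l\<close>.\<close>
  define \<epsilon> where "\<epsilon> = \<alpha> / (4 * 2 powr (2 * l))"
  have \<epsilon>: "\<epsilon> > 0" "\<epsilon> * 2 powr (2 * l) = \<alpha> / 4" using \<alpha> by (simp_all add: \<epsilon>_def)
  obtain C where C: "C \<ge> 0" "\<And>z. norm (f z) \<le> C * exp (\<epsilon> * norm z powr (2 * l))"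
    by (rule growthE[OF E_growth[OF l f \<epsilon>(1)]], rule that)
  have ent: "entire f" using f by (rule E_entire)
  have hE: "hpart k f \<in> E_space l" for k by (rule E_hpart[OF l ent])
  have tail: "norm (T f - (\<Sum>k<N. T (hpart k f))) \<le> (1 / 2) ^ N * (C * 2 * CT)" for N
  proof -
    have "T f - (\<Sum>k<N. T (hpart k f)) = T (\<lambda>z. f z - (\<Sum>k<N. hpart k f z))"
      using hE by (simp add: T_diff[OF f] T_sum E_sum[OF l])
    also have "norm \<dots> \<le> (C * (1 / 2) ^ N * 2) * CT"
    proof (rule CT(2))
      show "0 \<le> C * (1 / 2) ^ N * 2" using C by simp
      show "(\<lambda>z. f z - (\<Sum>k<N. hpart k f z)) \<in> E_space l" using hE f by (intro E_diff E_sum l) auto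
      fix z :: "complex ^ 'n"
      have "norm (f z - (\<Sum>k<N. hpart k f z)) \<le> (C * exp (\<alpha> / 4 * norm z powr (2 * l))) * (1 / 2) ^ N * (2 / (2 - 1))"
      proof (rule norm_hpart_series_tail[OF ent])
        fix \<zeta> :: "complex ^ 'n" assume "norm \<zeta> \<le> 2 * norm z"
        then have "norm \<zeta> powr (2 * l) \<le> (2 * norm z) powr (2 * l)" using l by (intro powr_mono2) auto
        then have "\<epsilon> * norm \<zeta> powr (2 * l) \<le> \<epsilon> * (2 powr (2 * l) * norm z powr (2 * l))"
          using \<epsilon>(1) by (simp add: powr_mult)
        also have "\<dots> = \<alpha> / 4 * norm z powr (2 * l)" unfolding mult.assoc[symmetric] \<epsilon>(2) ..
        finally have "C * exp (\<epsilon> * norm \<zeta> powr (2 * l)) \<le> C * exp (\<alpha> / 4 * norm z powr (2 * l))"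
          using C(1) by (intro mult_left_mono) auto
        with C(2)[of \<zeta>] show "norm (f \<zeta>) \<le> C * exp (\<alpha> / 4 * norm z powr (2 * l))" by linarith
      qed (use C in auto)
      then show "norm (f z - (\<Sum>k<N. hpart k f z)) \<le> (C * (1 / 2) ^ N * 2) * exp (\<alpha> / 4 * norm z powr (2 * l))"
        by (simp add: mult_ac)
    qed
    finally show ?thesis by (simp only: mult.assoc mult.commute mult.left_commute)
  qed
  have "(\<lambda>N. (1 / 2) ^ N * (C * 2 * CT)) \<longlonglongrightarrow> 0 * (C * 2 * CT)"
    by (intro tendsto_mult_right LIMSEQ_realpow_zero) auto
  then have lim0: "(\<lambda>N. (1 / 2) ^ N * (C * 2 * CT)) \<longlonglongrightarrow> 0" by (simp only: mult_zero_left)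
  have "(\<lambda>N. T f - (\<Sum>k<N. T (hpart k f))) \<longlonglongrightarrow> 0"
    by (rule Lim_null_comparison[OF always_eventually lim0]) (intro allI tail)
  then have "(\<lambda>N. \<Sum>k<N. T (hpart k f)) \<longlonglongrightarrow> T f"
    by (rule Lim_transform2[OF tendsto_const])
  then show ?thesis by (simp add: sums_def)
qed

lemma cdot_power_Suc: "cdot z w ^ Suc k * q = (\<Sum>i\<in>UNIV. cnj (w $ i) * (cdot z w ^ k * (z $ i * q)))"
  by (simp add: cdot_def[of z w] sum_distrib_left sum_distrib_right mult_ac)

lemma T_cdot_power_Suc:
  assumes q: "q \<in> E_space l"
  shows "T (\<lambda>z. cdot z w ^ Suc k * q z) = (\<Sum>i\<in>UNIV. cnj (w $ i) * T (\<lambda>z. cdot z w ^ k * (z $ i * q z)))"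
proof -
  have E: "(\<lambda>z. cdot z w ^ k * (z $ i * q z)) \<in> E_space l" for i
    by (intro E_mult E_cdot_power E_component l q)
  have "T (\<lambda>z. cdot z w ^ Suc k * q z) = T (\<lambda>z. \<Sum>i\<in>UNIV. cnj (w $ i) * (cdot z w ^ k * (z $ i * q z)))"
    unfolding cdot_power_Suc ..
  also have "\<dots> = (\<Sum>i\<in>UNIV. T (\<lambda>z. cnj (w $ i) * (cdot z w ^ k * (z $ i * q z))))"
    by (rule T_sum) (intro E_cmult l E)
  also have "\<dots> = (\<Sum>i\<in>UNIV. cnj (w $ i) * T (\<lambda>z. cdot z w ^ k * (z $ i * q z)))"
    by (simp only: T_cmult[OF E])
  finally show ?thesis .
qed

text \<open>Expanding one factor \<open>z \<cdot> w\<close> into coordinates shows by induction that the expression is a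
  polynomial in \<open>w\<close>. The factor \<open>q\<close> collects the coordinates split off.\<close>

lemma entire_T_cdot_power: "q \<in> E_space l \<Longrightarrow> entire (\<lambda>w. cnj (T (\<lambda>z. cdot z w ^ k * q z)))"
proof (induction k arbitrary: q)
  case 0
  show ?case by (simp add: entire_const)
next
  case (Suc k)
  have "entire (\<lambda>w. \<Sum>i\<in>UNIV. w $ i * cnj (T (\<lambda>z. cdot z w ^ k * (z $ i * q z))))"
    by (intro entire_sum entire_mult entire_component Suc.IH E_mult E_component l Suc.prems)
  then show ?case unfolding T_cdot_power_Suc[OF Suc.prems] by simp
qed

lemma T_cdot_power_homogeneous:
  assumes q: "q \<in> E_space l"
  shows "cnj (T (\<lambda>z. cdot z (t *s w) ^ k * q z)) = t ^ k * cnj (T (\<lambda>z. cdot z w ^ k * q z))"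
proof -
  have "T (\<lambda>z. cdot z (t *s w) ^ k * q z) = T (\<lambda>z. cnj t ^ k * (cdot z w ^ k * q z))"
    by (simp add: cdot_scale_right power_mult_distrib mult.assoc)
  also have "\<dots> = cnj t ^ k * T (\<lambda>z. cdot z w ^ k * q z)"
    by (intro T_cmult E_mult E_cdot_power l q)
  finally show ?thesis by simp
qed

subsection \<open>Interchanging the functional with the pairing\<close>

lemma weight_integrable:
  fixes h F :: "complex ^ 'n \<Rightarrow> complex"
  assumes [measurable]: "h \<in> borel_measurable borel" and h: "\<And>z. norm (h z) \<le> C * exp (a * norm z powr (2 * l))"
    and F: "growth l a' F" "0 \<le> a'" "a + a' < \<gamma>"
  shows "integrable lborel (\<lambda>z. h z * cnj (F z) * of_real (exp (- \<gamma> * norm z powr (2 * l))))"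
proof -
  have "integrable lborel (\<lambda>z. F z * cnj (h z) * of_real (exp (- \<gamma> * norm z powr (2 * l))))"
    by (rule integral_hpart_series(1)[OF F(1), where C' = C and a' = a]) (use h F l in auto)
  then have "integrable lborel (\<lambda>z. cnj (F z * cnj (h z) * of_real (exp (- \<gamma> * norm z powr (2 * l)))))"
    by (rule integrable_cnj)
  then show ?thesis by (simp add: mult.commute)
qed

text \<open>Both sides are finite sums of products of a value of \<open>T\<close> on a monomial times \<open>q\<close> and an integral of
  \<open>h\<close> against a monomial. Splitting off one coordinate at a time moves \<open>z\<^sub>i\<close> into \<open>q\<close> and \<open>cnj w\<^sub>i\<close>
  into \<open>h\<close>; the latter destroys holomorphy, which is why the induction runs over measurable \<open>h\<close>.\<close>

lemma T_pairing:
  fixes h :: "complex ^ 'n \<Rightarrow> complex"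
  assumes "h \<in> borel_measurable borel" "\<And>z. norm (h z) \<le> C * exp (a * norm z powr (2 * l))" "a < g" "q \<in> E_space l"
  shows "(\<lambda>z. pairing l g h (\<lambda>w. cdot w z ^ k)) \<in> E_space l \<and>
    T (\<lambda>z. pairing l g h (\<lambda>w. cdot w z ^ k) * q z) = pairing l g h (\<lambda>w. cnj (T (\<lambda>z. cdot z w ^ k * q z)))"
  using assms
proof (induction k arbitrary: h q C a)
  case 0
  have [measurable]: "h \<in> borel_measurable borel" by fact
  have "pairing l g h (\<lambda>w. cnj (T q)) = pairing l g h (\<lambda>_. 1) * T q"
  proof -
    have "pairing l g h (\<lambda>w. cnj (T q)) = (1 / ball_vol TYPE('n)) *\<^sub>R
      (\<integral>w. T q * (h w * cnj 1 * of_real (exp (- g * norm w powr (2 * l)))) \<partial>lborel)"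
      by (subst pairing_lborel) (simp_all add: mult_ac)
    also have "\<dots> = T q * pairing l g h (\<lambda>_. 1)"
      unfolding integral_mult_right_zero by (subst pairing_lborel) simp_all
    finally show ?thesis by (simp only: mult.commute)
  qed
  then show ?case using 0 by (simp add: T_cmult E_const[OF l])
next
  case (Suc k)
  have [measurable]: "h \<in> borel_measurable borel" by fact
  define a' where "a' = (g - a) / 2"
  have a': "a' > 0" "a + a' < g" using Suc.prems(3) by (simp_all add: a'_def field_simps)
  define h' where "h' i w = h w * cnj (w $ i)" for i w
  have comp [measurable]: "(\<lambda>w :: complex ^ 'n. w $ i) \<in> borel_measurable borel" for i
    by (rule entire_borel[OF entire_component])
  have h'm [measurable]: "h' i \<in> borel_measurable borel" for i unfolding h'_def by measurable
  have h'b: "\<exists>C'. \<forall>z. norm (h' i z) \<le> C' * exp ((a + a') * norm z powr (2 * l))" for i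
  proof -
    obtain D where D: "D \<ge> 0" "\<And>z. norm ((z :: complex ^ 'n) $ i) \<le> D * exp (a' * norm z powr (2 * l))"
      by (rule growthE[OF E_growth[OF l E_component[OF l] a'(1)], of i], rule that)
    have C: "C \<ge> 0" using Suc.prems(2)[of 0] norm_ge_zero[of "h 0"] by (smt (verit) exp_gt_zero mult_neg_pos)
    have "norm (h' i z) \<le> (C * D) * exp ((a + a') * norm z powr (2 * l))" for z
    proof -
      have "norm (h' i z) \<le> (C * exp (a * norm z powr (2 * l))) * (D * exp (a' * norm z powr (2 * l)))"
        unfolding h'_def norm_mult complex_mod_cnj using Suc.prems(2) D C by (intro mult_mono) auto
      then show ?thesis by (simp add: exp_add distrib_right mult_ac)
    qed
    then show ?thesis by blast
  qed
  have peel: "pairing l g h (\<lambda>w. \<Sum>i\<in>UNIV. w $ i * F i w) = (\<Sum>i\<in>UNIV. pairing l g (h' i) (F i))"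
    if F: "\<And>i. F i \<in> E_space l" for F
  proof -
    have Fm [measurable]: "F i \<in> borel_measurable borel" for i using F E_entire entire_borel by blast
    have int: "integrable lborel (\<lambda>w. h' i w * cnj (F i w) * of_real (exp (- g * norm w powr (2 * l))))" for i
    proof -
      obtain C' where C': "\<And>z. norm (h' i z) \<le> C' * exp ((a + a') * norm z powr (2 * l))" using h'b by blast
      define a'' where "a'' = (g - (a + a')) / 2"
      have a'': "a'' > 0" "a + a' + a'' < g" using a'(2) by (simp_all add: a''_def field_simps)
      show ?thesis
        by (rule weight_integrable[OF h'm C' E_growth[OF l F a''(1)]]) (use a'' in auto)
    qed
    have "pairing l g h (\<lambda>w. \<Sum>i\<in>UNIV. w $ i * F i w) = (1 / ball_vol TYPE('n)) *\<^sub>R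
       (\<integral>w. (\<Sum>i\<in>UNIV. h' i w * cnj (F i w) * of_real (exp (- g * norm w powr (2 * l)))) \<partial>lborel)"
      by (subst pairing_lborel) (simp_all add: h'_def sum_distrib_left sum_distrib_right mult_ac)
    also have "\<dots> = (1 / ball_vol TYPE('n)) *\<^sub>R (\<Sum>i\<in>UNIV. \<integral>w. h' i w * cnj (F i w) * of_real (exp (- g * norm w powr (2 * l))) \<partial>lborel)"
      by (subst Bochner_Integration.integral_sum[OF int]) (rule refl)
    also have "\<dots> = (\<Sum>i\<in>UNIV. pairing l g (h' i) (F i))"
      by (simp add: pairing_lborel scaleR_sum_right)
    finally show ?thesis .
  qed
  have pk0: "pairing l g h (\<lambda>w. cdot w z ^ Suc k) = (\<Sum>i\<in>UNIV. z $ i * pairing l g (h' i) (\<lambda>w. cdot w z ^ k))" for z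
  proof -
    have "pairing l g h (\<lambda>w. cdot w z ^ Suc k) = pairing l g h (\<lambda>w. \<Sum>i\<in>UNIV. w $ i * (cnj (z $ i) * cdot w z ^ k))"
      by (simp add: cdot_def[of _ z] sum_distrib_left sum_distrib_right mult_ac)
    also have "\<dots> = (\<Sum>i\<in>UNIV. pairing l g (h' i) (\<lambda>w. cnj (z $ i) * cdot w z ^ k))"
      by (rule peel) (intro E_cmult E_cdot_power l)
    also have "\<dots> = (\<Sum>i\<in>UNIV. z $ i * pairing l g (h' i) (\<lambda>w. cdot w z ^ k))"
    proof (rule sum.cong[OF refl])
      fix i
      have "pairing l g (h' i) (\<lambda>w. cnj (z $ i) * cdot w z ^ k) = (1 / ball_vol TYPE('n)) *\<^sub>R
        (\<integral>w. z $ i * (h' i w * cnj (cdot w z ^ k) * of_real (exp (- g * norm w powr (2 * l)))) \<partial>lborel)"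
        by (subst pairing_lborel) (simp_all add: mult_ac)
      also have "\<dots> = z $ i * pairing l g (h' i) (\<lambda>w. cdot w z ^ k)"
        by (subst pairing_lborel) simp_all
      finally show "pairing l g (h' i) (\<lambda>w. cnj (z $ i) * cdot w z ^ k) = z $ i * pairing l g (h' i) (\<lambda>w. cdot w z ^ k)" .
    qed
    finally show ?thesis .
  qed
  have pk: "pairing l g h (\<lambda>w. cdot w z ^ Suc k) * q z = (\<Sum>i\<in>UNIV. pairing l g (h' i) (\<lambda>w. cdot w z ^ k) * (z $ i * q z))" for z
    unfolding pk0 sum_distrib_right by (rule sum.cong[OF refl]) (simp only: mult.assoc mult.commute mult.left_commute)
  have qi: "(\<lambda>z. z $ i * q z) \<in> E_space l" for i by (intro E_mult E_component l Suc.prems)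
  have IH: "(\<lambda>z. pairing l g (h' i) (\<lambda>w. cdot w z ^ k)) \<in> E_space l \<and> T (\<lambda>z. pairing l g (h' i) (\<lambda>w. cdot w z ^ k) * (z $ i * q z))
     = pairing l g (h' i) (\<lambda>w. cnj (T (\<lambda>z. cdot z w ^ k * (z $ i * q z))))" for i
  proof -
    obtain C' where C': "\<And>z. norm (h' i z) \<le> C' * exp ((a + a') * norm z powr (2 * l))" using h'b by blast
    show ?thesis by (rule Suc.IH[OF h'm C' a'(2) qi])
  qed
  have pE: "(\<lambda>z. pairing l g (h' i) (\<lambda>w. cdot w z ^ k) * (z $ i * q z)) \<in> E_space l" for i
    by (rule E_mult[OF l conjunct1[OF IH] qi])
  have "T (\<lambda>z. pairing l g h (\<lambda>w. cdot w z ^ Suc k) * q z)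
     = T (\<lambda>z. \<Sum>i\<in>UNIV. pairing l g (h' i) (\<lambda>w. cdot w z ^ k) * (z $ i * q z))"
    unfolding pk ..
  also have "\<dots> = (\<Sum>i\<in>UNIV. T (\<lambda>z. pairing l g (h' i) (\<lambda>w. cdot w z ^ k) * (z $ i * q z)))"
    by (rule T_sum) (rule pE)
  also have "\<dots> = (\<Sum>i\<in>UNIV. pairing l g (h' i) (\<lambda>w. cnj (T (\<lambda>z. cdot z w ^ k * (z $ i * q z)))))"
    by (simp only: conjunct2[OF IH])
  also have "\<dots> = pairing l g h (\<lambda>w. \<Sum>i\<in>UNIV. w $ i * cnj (T (\<lambda>z. cdot z w ^ k * (z $ i * q z))))"
  proof (rule peel[symmetric])
    show "(\<lambda>w. cnj (T (\<lambda>z. cdot z w ^ k * (z $ i * q z)))) \<in> E_space l" for i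
      by (rule E_homogeneous[OF l entire_T_cdot_power[OF qi] T_cdot_power_homogeneous[OF qi]])
  qed
  also have "(\<lambda>w. \<Sum>i\<in>UNIV. w $ i * cnj (T (\<lambda>z. cdot z w ^ k * (z $ i * q z)))) = (\<lambda>w. cnj (T (\<lambda>z. cdot z w ^ Suc k * q z)))"
    unfolding T_cdot_power_Suc[OF Suc.prems(4)] by simp
  finally have "T (\<lambda>z. pairing l g h (\<lambda>w. cdot w z ^ Suc k) * q z) = pairing l g h (\<lambda>w. cnj (T (\<lambda>z. cdot z w ^ Suc k * q z)))" .
  moreover have "(\<lambda>z. pairing l g h (\<lambda>w. cdot w z ^ Suc k)) \<in> E_space l"
    unfolding pk0 using IH by (intro E_sum E_mult E_component l) auto
  ultimately show ?case by blast
qed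

end

section \<open>The symbol of a bounded Hankel form\<close>

text \<open>Cauchy's estimate, for a series that is not given as a Taylor expansion.\<close>

lemma norm_power_series_coeff_le:
  fixes a :: "nat \<Rightarrow> complex"
  assumes sums: "\<And>t. (\<lambda>k. a k * t ^ k) sums f t" and "r > 0" and B: "\<And>t. norm t = r \<Longrightarrow> norm (f t) \<le> B"
  shows "r ^ k * norm (a k) \<le> B"
proof -
  have hol: "f holomorphic_on S" for S
  proof -
    have "f field_differentiable at x" for x
    proof -
      have "f holomorphic_on ball 0 (norm x + 1)"
        by (rule power_series_holomorphic[of 0 _ a f]) (use sums in simp)
      then show ?thesis by (rule holomorphic_on_imp_differentiable_at) auto
    qed
    then show ?thesis by (auto simp: holomorphic_on_def intro: field_differentiable_at_within)
  qed
  have "(\<lambda>k. (deriv ^^ k) f 0 / fact k * t ^ k) sums f t" for t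
    using holomorphic_power_series[OF hol, where z = 0 and r = "norm t + 1" and w = t] by simp
  from power_series_unique[OF sums this] have "a k = (deriv ^^ k) f 0 / fact k" by metis
  moreover have "norm ((deriv ^^ k) f 0) \<le> fact k * B / r ^ k"
    by (rule Cauchy_inequality) (use assms hol in \<open>auto intro: holomorphic_on_imp_continuous_on\<close>)
  ultimately show ?thesis using \<open>r > 0\<close>
    by (simp add: norm_divide pos_le_divide_eq pos_divide_le_eq mult.commute)
qed

lemma target_growth_le:
  assumes "l \<ge> 1" "g > 0"
  obtains C where "C > 0" "\<And>r. r \<ge> 0 \<Longrightarrow> target_growth l g \<sigma> r \<le> C * exp (g / 3 * r powr (2 * l))"
proof -
  have "g / 3 > 0" using assms by simp
  then obtain C where C: "C > 0" "\<And>D. D \<ge> 0 \<Longrightarrow> (1 + D) powr (\<sigma> / l) \<le> C * exp (g / 3 * D\<^sup>2)"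
    using poly_le_gauss[of "g / 3" "\<sigma> / l"] by metis
  show ?thesis
  proof (rule that[OF C(1)])
    fix r :: real assume r: "r \<ge> 0"
    have sq: "(r powr l / 2)\<^sup>2 = r powr (2 * l) / 4"
      using r by (simp add: power_divide powr_powr mult.commute flip: powr_numeral)
    have "target_growth l g \<sigma> r \<le> C * exp (g / 3 * (r powr l / 2)\<^sup>2) * exp (g / 4 * r powr (2 * l))"
      unfolding target_growth_def by (intro mult_right_mono C) auto
    also have "\<dots> = C * exp (g / 3 * r powr (2 * l))"
      unfolding sq mult.assoc exp_add[symmetric] by (simp add: field_simps)
    finally show "target_growth l g \<sigma> r \<le> C * exp (g / 3 * r powr (2 * l))" .
  qed
qed

text \<open>The quantities \<open>1 + r\<^sup>l/2\<close> and \<open>(1 + r)\<^sup>l\<close> are comparable within the factor \<open>2\<^sup>l\<^sup>+\<^sup>1\<close>.\<close>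

lemma target_growth_weight:
  assumes "l \<ge> 1" "g > 0"
  obtains C where "C > 0" "\<And>r. r \<ge> 0 \<Longrightarrow> target_growth l g \<sigma> r \<le> C * ((1 + r) powr \<sigma> * exp (g / 4 * r powr (2 * l)))"
proof -
  define c :: real where "c = 2 powr (l + 1)"
  have c: "c \<ge> 1" using assms by (auto simp: c_def intro!: ge_one_powr_ge_zero)
  show ?thesis
  proof (rule that[of "c powr \<bar>\<sigma> / l\<bar>"])
    show "c powr \<bar>\<sigma> / l\<bar> > 0" using c by simp
    fix r :: real assume r: "r \<ge> 0"
    have "r powr l \<le> (1 + r) powr l" "1 \<le> (1 + r) powr l"
      using r assms by (auto intro!: powr_mono2 ge_one_powr_ge_zero)
    then have "1 + r powr l / 2 \<le> 2 * (1 + r) powr l" by simp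
    also have "\<dots> \<le> c * (1 + r) powr l"
    proof -
      have "(2::real) powr 1 \<le> 2 powr (l + 1)" using assms by (intro powr_mono) auto
      then show ?thesis by (intro mult_right_mono) (auto simp: c_def)
    qed
    finally have 1: "1 + r powr l / 2 \<le> c * (1 + r) powr l" .
    have 2: "(1 + r) powr l \<le> c * (1 + r powr l / 2)"
    proof (cases "r \<le> 1")
      case True
      then have "(1 + r) powr l \<le> 2 powr l" using r assms by (intro powr_mono2) auto
      also have "\<dots> \<le> c * 1" by (simp add: c_def powr_add)
      also have "\<dots> \<le> c * (1 + r powr l / 2)" using c by (intro mult_left_mono) auto
      finally show ?thesis .
    next
      case False
      then have "(1 + r) powr l \<le> (2 * r) powr l" using assms by (intro powr_mono2) auto
      also have "\<dots> = c * (r powr l / 2)" by (simp add: c_def powr_mult powr_add)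
      also have "\<dots> \<le> c * (1 + r powr l / 2)" using c by (intro mult_left_mono) auto
      finally show ?thesis .
    qed
    have "(1 + r powr l / 2) powr (\<sigma> / l) \<le> c powr \<bar>\<sigma> / l\<bar> * ((1 + r) powr l) powr (\<sigma> / l)"
      by (rule powr_comparable[OF _ _ 1 2 c]) (use r in \<open>auto intro: add_pos_nonneg\<close>)
    also have "((1 + r) powr l) powr (\<sigma> / l) = (1 + r) powr \<sigma>" using assms by (simp add: powr_powr)
    finally show "target_growth l g \<sigma> r \<le> c powr \<bar>\<sigma> / l\<bar> * ((1 + r) powr \<sigma> * exp (g / 4 * r powr (2 * l)))"
      unfolding target_growth_def mult.assoc[symmetric] by (rule mult_right_mono) simp
  qed
qed

lemma target_growth_nonneg: "target_growth l g \<sigma> r \<ge> 0" by (simp add: target_growth_def)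

lemma norm_integral_le_nn_integral:
  "ennreal (norm (\<integral>x. f x \<partial>M)) \<le> (\<integral>\<^sup>+x. ennreal (norm (f x)) \<partial>M)"
  by (cases "integrable M f") (auto simp: integral_norm_bound_ennreal not_integrable_integral_eq)

lemma pairing_cmult_right:
  fixes h F :: "complex ^ 'n::finite \<Rightarrow> complex"
  assumes [measurable]: "h \<in> borel_measurable borel" "F \<in> borel_measurable borel"
  shows "pairing l \<gamma> h (\<lambda>w. c * F w) = cnj c * pairing l \<gamma> h F"
proof -
  have "pairing l \<gamma> h (\<lambda>w. c * F w) = (1 / ball_vol TYPE('n)) *\<^sub>R
     (\<integral>w. cnj c * (h w * cnj (F w) * of_real (exp (- \<gamma> * norm w powr (2 * l)))) \<partial>lborel)"
    by (subst pairing_lborel) (simp_all add: mult_ac)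
  also have "\<dots> = cnj c * pairing l \<gamma> h F"
    unfolding integral_mult_right_zero by (subst pairing_lborel) simp_all
  finally show ?thesis .
qed

lemma pairing_cnj:
  fixes h F :: "complex ^ 'n::finite \<Rightarrow> complex"
  assumes [measurable]: "h \<in> borel_measurable borel" "F \<in> borel_measurable borel"
  shows "pairing l \<gamma> h F = cnj (pairing l \<gamma> F h)"
proof -
  have "cnj (pairing l \<gamma> F h) = (1 / ball_vol TYPE('n)) *\<^sub>R
     cnj (\<integral>w. F w * cnj (h w) * of_real (exp (- \<gamma> * norm w powr (2 * l))) \<partial>lborel)"
    by (subst pairing_lborel) simp_all
  also have "\<dots> = pairing l \<gamma> h F"
    unfolding Bochner_Integration.integral_cnj[symmetric]
    by (subst pairing_lborel) (simp_all add: mult.commute)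
  finally show ?thesis ..
qed

context bounded_hankel
begin

text \<open>The part of degree \<open>k\<close> of the symbol, forced by testing the representation on \<open>z \<mapsto> (z \<cdot> w)\<^sup>k\<close>.\<close>

definition sym :: "nat \<Rightarrow> complex ^ 'n \<Rightarrow> complex" where
  "sym k w = of_real (moment TYPE('n) l g k / fact k) * cnj (T (\<lambda>z. cdot z w ^ k))"

lemma entire_sym: "entire (sym k)"
  unfolding sym_def using entire_T_cdot_power[OF E_const[OF l, of 1], of k] by (intro entire_cmult) simp

lemma sym_homogeneous: "sym k (t *s w) = t ^ k * sym k w"
  unfolding sym_def using T_cdot_power_homogeneous[OF E_const[OF l, of 1], of t w k] by simp

lemma moment_pos': "moment TYPE('n) l g k > 0"
  using moment_pos[of l g k, where 'n = 'n] l g_pos by simp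

text \<open>Write \<open>h\<^sub>k\<close> as a pairing of \<open>h\<close> with \<open>(\<cdot> \<cdot> w)\<^sup>k\<close> and pull \<open>T\<close> inside.\<close>

lemma T_hpart_eq_pairing: assumes h: "h \<in> E_space l" shows "T (hpart k h) = pairing l g h (sym k)"
proof -
  have ent: "entire h" using h by (rule E_entire)
  have g2: "g / 2 > 0" "g / 2 < g" using g_pos by auto
  have gr: "growth l (g / 2) h" by (rule E_growth[OF l h g2(1)])
  obtain C where C: "C \<ge> 0" "\<And>z. norm (h z) \<le> C * exp (g / 2 * norm z powr (2 * l))"
    by (rule growthE[OF gr], rule that)
  define c where "c = moment TYPE('n) l g k / fact k"
  have c: "c > 0" using moment_pos' by (simp add: c_def)
  have "T (\<lambda>z. pairing l g h (\<lambda>w. cdot w z ^ k) * 1) = pairing l g h (\<lambda>w. cnj (T (\<lambda>z. cdot z w ^ k * 1)))"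
    using T_pairing[OF entire_borel[OF ent] C(2) g2(2) E_const[OF l]] by blast
  moreover have "pairing l g h (\<lambda>w. cdot w z ^ k) = of_real (1 / c) * hpart k h z" for z
    using pairing_cdot_power[OF gr _ g2(2) l, of z k] g2(1) by (simp add: c_def)
  ultimately have "T (\<lambda>z. of_real (1 / c) * hpart k h z) = pairing l g h (\<lambda>w. cnj (T (\<lambda>z. cdot z w ^ k)))" by simp
  then have "of_real (1 / c) * T (hpart k h) = pairing l g h (\<lambda>w. cnj (T (\<lambda>z. cdot z w ^ k)))"
    by (subst (asm) T_cmult[OF E_hpart[OF l ent]])
  then have "T (hpart k h) = of_real c * pairing l g h (\<lambda>w. cnj (T (\<lambda>z. cdot z w ^ k)))"
    using c by (auto simp: field_simps)
  also have "\<dots> = pairing l g h (sym k)"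
    unfolding sym_def c_def[symmetric]
    using entire_T_cdot_power[OF E_const[OF l, of 1], of k]
    by (subst pairing_cmult_right) (auto intro: entire_borel ent)
  finally show ?thesis .
qed

text \<open>The expansion of \<open>Sexp\<close> into homogeneous parts, that is, the symbol before multiplication by the
  moments.\<close>

definition S where "S k w = cnj (T (\<lambda>z. cdot z w ^ k)) / fact k"

definition Sexp where "Sexp w = cnj (T (\<lambda>z. exp (cdot z w)))"

lemma sym_eq: "sym k w = of_real (moment TYPE('n) l g k) * S k w"
  by (simp add: sym_def S_def)

lemma Sexp_sums: "(\<lambda>k. S k w * t ^ k) sums Sexp (t *s w)"
proof -
  have "(\<lambda>k. T (hpart k (\<lambda>z. exp (cdot z (t *s w))))) sums T (\<lambda>z. exp (cdot z (t *s w)))"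
    by (rule T_hpart_sums[OF E_exp_cdot[OF l]])
  then have "(\<lambda>k. cnj (T (hpart k (\<lambda>z. exp (cdot z (t *s w)))))) sums Sexp (t *s w)"
    unfolding Sexp_def by (rule bounded_linear.sums[OF bounded_linear_cnj])
  moreover have "cnj (T (hpart k (\<lambda>z. exp (cdot z (t *s w))))) = S k w * t ^ k" for k
  proof -
    have "hpart k (\<lambda>z. exp (cdot z (t *s w))) = (\<lambda>z. (1 / fact k) * (cdot z (t *s w) ^ k * 1))"
      by (rule ext) (simp add: hpart_exp_cdot)
    then have "T (hpart k (\<lambda>z. exp (cdot z (t *s w)))) = (1 / fact k) * T (\<lambda>z. cdot z (t *s w) ^ k * 1)"
      using T_cmult[OF E_cdot_power[OF l], of "1 / fact k" "t *s w" k] by simp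
    then show ?thesis
      using T_cdot_power_homogeneous[OF E_const[OF l, of 1], of t w k] by (simp add: S_def)
  qed
  ultimately show ?thesis by simp
qed

lemma exp_cdot_split: "exp (cdot z w) = exp (cdot z ((\<alpha> / (2 * g)) *\<^sub>R w)) * exp (cdot z ((\<beta> / (2 * g)) *\<^sub>R w))"
proof -
  have e: "\<alpha> / (2 * g) + \<beta> / (2 * g) = 1"
    using \<alpha> \<beta> by (simp add: g_def add_divide_distrib[symmetric])
  have "cdot z ((\<alpha> / (2 * g)) *\<^sub>R w) + cdot z ((\<beta> / (2 * g)) *\<^sub>R w) = of_real (\<alpha> / (2 * g) + \<beta> / (2 * g)) * cdot z w"
    unfolding cdot_scaleR_right of_real_add by (simp only: distrib_right)
  also have "\<dots> = cdot z w" unfolding e by simp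
  finally show ?thesis by (simp add: exp_add[symmetric])
qed

text \<open>Integrating \<open>\<xi>\<^sup>k S\<^sub>k(w)\<close> against \<open>N\<close> gives \<open>M\<^sub>k S\<^sub>k(w)\<close>. Cauchy's estimate at radius \<open>\<xi>\<close> bounds each term by
  the peak function at \<open>\<xi>|w|\<close>, so every homogeneous part has the target growth; applied at \<open>2w\<close> this
  gives geometric convergence of \<open>\<Sum> M\<^sub>k S\<^sub>k\<close> and allows summation under the integral. The sum
  is then estimated once more through \<open>b(w) = \<integral> S(\<xi>w) dN(\<xi>)\<close>.\<close>

lemma symbol_exists:
  assumes CE: "C\<^sub>E > 0" "\<And>w :: complex ^ 'n. L_norm l p \<alpha> \<rho> (\<lambda>z. exp (cdot z ((\<alpha> / (2 * g)) *\<^sub>R w)))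
      * L_norm l (conj_exponent p) \<beta> \<eta> (\<lambda>z. exp (cdot z ((\<beta> / (2 * g)) *\<^sub>R w)))
      \<le> C\<^sub>E * peak l g (\<rho> + \<eta> - 2 * CARD('n) * (l - 1)) (norm w)"
    and N: "sets N = sets (borel :: real measure)" "AE \<xi> in N. \<xi> \<ge> 0"
      "\<And>k. (\<integral>\<^sup>+\<xi>. ennreal (\<xi> ^ k) \<partial>N) = ennreal (moment TYPE('n) l g k)"
      "C\<^sub>N > 0" "\<And>r. r \<ge> 0 \<Longrightarrow> (\<integral>\<^sup>+\<xi>. ennreal (peak l g (\<rho> + \<eta> - 2 * CARD('n) * (l - 1)) (\<xi> * r)) \<partial>N) \<le> ennreal (C\<^sub>N * target_growth l g (\<rho> + \<eta>) r)"
  obtains b where "entire b" "\<And>w. norm (b w) \<le> C\<^sub>0 * C\<^sub>E * C\<^sub>N * target_growth l g (\<rho> + \<eta>) (norm w)"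
    "\<And>k. hpart k b = sym k" "\<And>h. h \<in> E_space l \<Longrightarrow> T h = pairing l g h b"
proof -
  define H where "H = target_growth l g (\<rho> + \<eta>)"
  define pk where "pk = peak l g (\<rho> + \<eta> - 2 * CARD('n) * (l - 1))"
  have [measurable]: "pk \<in> borel_measurable borel" unfolding pk_def by (rule peak_measurable)
  have pk0: "pk t \<ge> 0" for t unfolding pk_def by (rule peak_nonneg)
  have [measurable_cong]: "sets N = sets borel" by (rule N)
  define K where "K = C\<^sub>0 * C\<^sub>E * C\<^sub>N"
  have K: "K \<ge> 0" using C0 CE N by (simp add: K_def)
  have CC: "C\<^sub>0 * C\<^sub>E \<ge> 0" using C0 CE by simp
  have Sexp_bound: "norm (Sexp w) \<le> C\<^sub>0 * C\<^sub>E * pk (norm w)" for w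
  proof -
    have "norm (Sexp w) = norm (\<Lambda> (\<lambda>z. exp (cdot z ((\<alpha> / (2 * g)) *\<^sub>R w))) (\<lambda>z. exp (cdot z ((\<beta> / (2 * g)) *\<^sub>R w))))"
      unfolding Sexp_def complex_mod_cnj \<Lambda>_eq[OF E_exp_cdot[OF l] E_exp_cdot[OF l]] exp_cdot_split[symmetric] ..
    also have "\<dots> \<le> C\<^sub>0 * (L_norm l p \<alpha> \<rho> (\<lambda>z. exp (cdot z ((\<alpha> / (2 * g)) *\<^sub>R w)))
      * L_norm l (conj_exponent p) \<beta> \<eta> (\<lambda>z. exp (cdot z ((\<beta> / (2 * g)) *\<^sub>R w))))"
      using bounded[OF E_exp_cdot[OF l] E_exp_cdot[OF l]] by (simp only: mult.assoc)
    also have "\<dots> \<le> C\<^sub>0 * (C\<^sub>E * pk (norm w))" unfolding pk_def by (intro mult_left_mono CE C0)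
    finally show ?thesis by (simp only: mult.assoc)
  qed
  have S_bound: "\<xi> ^ k * norm (S k w) \<le> C\<^sub>0 * C\<^sub>E * pk (\<xi> * norm w)" if "\<xi> \<ge> 0" for \<xi> k w
  proof (cases "\<xi> = 0")
    case False
    then have "\<xi> > 0" using that by simp
    then show ?thesis
    proof (rule norm_power_series_coeff_le[OF Sexp_sums])
      fix t :: complex assume "norm t = \<xi>"
      then show "norm (Sexp (t *s w)) \<le> C\<^sub>0 * C\<^sub>E * pk (\<xi> * norm w)" using Sexp_bound[of "t *s w"] by simp
    qed
  next
    case True
    show ?thesis
    proof (cases k)
      case 0
      have "Sexp (0 *s w) = S 0 w" by (rule sums_unique2[OF Sexp_sums powser_sums_zero])
      then show ?thesis using Sexp_bound[of "0 *s w"] True 0 by simp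
    qed (use True CC pk0 in simp)
  qed
  have ae: "AE \<xi> in N. \<bar>\<xi> ^ k\<bar> = \<xi> ^ k" for k using N(2) by eventually_elim simp
  have nnk: "(\<integral>\<^sup>+\<xi>. ennreal \<bar>\<xi> ^ k\<bar> \<partial>N) = ennreal (moment TYPE('n) l g k)" for k
    unfolding N(3)[symmetric] by (intro nn_integral_cong_AE) (use ae[of k] in \<open>auto elim!: eventually_mono\<close>)
  have intk: "integrable N (\<lambda>\<xi>. \<xi> ^ k)" for k
    unfolding integrable_iff_bounded using nnk[of k] by simp
  have momk: "(\<integral>\<xi>. \<xi> ^ k \<partial>N) = moment TYPE('n) l g k" for k
  proof -
    have "ennreal (\<integral>\<xi>. \<xi> ^ k \<partial>N) = (\<integral>\<^sup>+\<xi>. ennreal (\<xi> ^ k) \<partial>N)"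
      by (rule nn_integral_eq_integral[symmetric, OF intk]) (use N(2) in \<open>auto elim!: eventually_mono\<close>)
    moreover have "(\<integral>\<xi>. \<xi> ^ k \<partial>N) \<ge> 0"
      by (rule integral_nonneg_AE) (use N(2) in \<open>auto elim!: eventually_mono\<close>)
    ultimately show ?thesis using moment_pos'[of k] N(3)[of k] by (simp add: less_imp_le)
  qed
  have symb: "norm (sym k w) \<le> K * H (norm w)" for k w
  proof -
    have "ennreal (norm (sym k w)) = ennreal (moment TYPE('n) l g k) * ennreal (norm (S k w))"
      using moment_pos'[of k] by (simp add: sym_eq norm_mult ennreal_mult)
    also have "\<dots> = (\<integral>\<^sup>+\<xi>. ennreal (\<xi> ^ k) * ennreal (norm (S k w)) \<partial>N)"
      unfolding N(3)[symmetric] by (rule nn_integral_multc[symmetric]) measurable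
    also have "\<dots> \<le> (\<integral>\<^sup>+\<xi>. ennreal (C\<^sub>0 * C\<^sub>E) * ennreal (pk (\<xi> * norm w)) \<partial>N)"
    proof (rule nn_integral_mono_AE)
      show "AE \<xi> in N. ennreal (\<xi> ^ k) * ennreal (norm (S k w)) \<le> ennreal (C\<^sub>0 * C\<^sub>E) * ennreal (pk (\<xi> * norm w))"
        using N(2)
      proof eventually_elim
        case (elim \<xi>)
        have "ennreal (\<xi> ^ k) * ennreal (norm (S k w)) = ennreal (\<xi> ^ k * norm (S k w))"
          using elim by (intro ennreal_mult[symmetric]) auto
        also have "\<dots> \<le> ennreal (C\<^sub>0 * C\<^sub>E * pk (\<xi> * norm w))" by (intro ennreal_leI S_bound elim)
        also have "\<dots> = ennreal (C\<^sub>0 * C\<^sub>E) * ennreal (pk (\<xi> * norm w))" by (intro ennreal_mult CC pk0)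
        finally show ?case .
      qed
    qed
    also have "\<dots> = ennreal (C\<^sub>0 * C\<^sub>E) * (\<integral>\<^sup>+\<xi>. ennreal (pk (\<xi> * norm w)) \<partial>N)"
      by (rule nn_integral_cmult) measurable
    also have "\<dots> \<le> ennreal (C\<^sub>0 * C\<^sub>E) * ennreal (C\<^sub>N * H (norm w))"
      unfolding pk_def H_def by (intro mult_left_mono N(5)) auto
    also have "\<dots> = ennreal (K * H (norm w))"
      unfolding K_def using CC N(4) target_growth_nonneg[of l g "\<rho> + \<eta>"]
      by (simp add: ennreal_mult[symmetric] H_def mult.assoc)
    finally show ?thesis using K target_growth_nonneg by (simp add: H_def)
  qed
  \<comment> \<open>Homogeneity and the bound at \<open>2w\<close>.\<close>
  have sym2: "norm (sym k w) \<le> (K * H (2 * norm w)) * (1 / 2) ^ k" for k w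
  proof -
    have "2 ^ k * norm (sym k w) = norm (sym k (of_real 2 *s w))" unfolding sym_homogeneous by (simp add: norm_mult norm_power)
    also have "\<dots> \<le> K * H (2 * norm w)" using symb[of k "of_real 2 *s w"] by simp
    finally show ?thesis by (simp add: field_simps power_one_over)
  qed
  have geo: "summable (\<lambda>k. c * (1 / 2) ^ k)" for c :: real by (intro summable_mult summable_geometric) auto
  have symsum: "summable (\<lambda>k. norm (sym k w))" for w
    by (rule summable_comparison_test'[OF geo[of "K * H (2 * norm w)"], of 0]) (use sym2 in simp)
  define b where "b w = (\<Sum>k. sym k w)" for w
  have bsums: "(\<lambda>k. sym k w) sums b w" for w
    unfolding b_def by (rule summable_sums[OF summable_norm_cancel[OF symsum]])
  have ent: "entire b"
  proof (rule entire_uniform_limit[where F = "\<lambda>m w. \<Sum>k<m. sym k w"])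
    show "entire (\<lambda>w. \<Sum>k<m. sym k w)" for m by (intro entire_sum entire_sym)
    fix R :: real
    obtain CH where CH: "CH > 0" "\<And>r. r \<ge> 0 \<Longrightarrow> H r \<le> CH * exp (g / 3 * r powr (2 * l))"
      using target_growth_le[OF l g_pos, of "\<rho> + \<eta>"] unfolding H_def by metis
    define D where "D = K * (CH * exp (g / 3 * (2 * \<bar>R\<bar>) powr (2 * l)))"
    have HD: "K * H (2 * norm w) \<le> D" if "norm w \<le> R" for w :: "complex ^ 'n"
    proof -
      have "(2 * norm w) powr (2 * l) \<le> (2 * \<bar>R\<bar>) powr (2 * l)" using that l by (intro powr_mono2) auto
      then have "CH * exp (g / 3 * (2 * norm w) powr (2 * l)) \<le> CH * exp (g / 3 * (2 * \<bar>R\<bar>) powr (2 * l))"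
        using CH(1) g_pos by simp
      then have "H (2 * norm w) \<le> CH * exp (g / 3 * (2 * \<bar>R\<bar>) powr (2 * l))" using CH(2)[of "2 * norm w"] by simp
      then show ?thesis unfolding D_def using K by (rule mult_left_mono)
    qed
    show "uniform_limit (cball 0 R) (\<lambda>m w. \<Sum>k<m. sym k w) b sequentially"
      unfolding b_def
    proof (rule Weierstrass_m_test)
      show "summable (\<lambda>k. D * (1 / 2) ^ k)" by (rule geo)
      fix k w assume "w \<in> cball (0 :: complex ^ 'n) R"
      then have "(K * H (2 * norm w)) * (1 / 2) ^ k \<le> D * (1 / 2) ^ k" by (intro mult_right_mono HD) auto
      then show "norm (sym k w) \<le> D * (1 / 2) ^ k" using sym2[of k w] by linarith
    qed
  qed
  have hpb: "hpart k b = sym k" for k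
  proof
    show "hpart k b w = sym k w" for w
    proof (rule hpart_unique[OF ent])
      show "(\<lambda>k. sym k w * t ^ k) sums b (t *s w)" for t
        using bsums[of "t *s w"] unfolding sym_homogeneous by (simp only: mult.commute)
    qed
  qed
  have bb: "norm (b w) \<le> K * H (norm w)" for w
  proof -
    define F where "F k \<xi> = of_real (\<xi> ^ k) * S k w" for k and \<xi> :: real
    have Fint: "integrable N (F k)" for k unfolding F_def by (intro integrable_mult_left integrable_of_real intk)
    have Fval: "integral\<^sup>L N (F k) = sym k w" for k
      unfolding F_def sym_eq momk[symmetric] by (simp del: of_real_power)
    have "(\<lambda>k. integral\<^sup>L N (F k)) sums (\<integral>\<xi>. (\<Sum>k. F k \<xi>) \<partial>N)"
    proof (rule sums_integral)
      show "AE \<xi> in N. summable (\<lambda>k. norm (F k \<xi>))"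
        using N(2)
      proof eventually_elim
        case (elim \<xi>)
        show ?case
        proof (rule summable_comparison_test'[OF geo[of "C\<^sub>0 * C\<^sub>E * pk (2 * \<xi> * norm w)"], of 0])
          fix k :: nat
          have "(2 * \<xi>) ^ k * norm (S k w) \<le> C\<^sub>0 * C\<^sub>E * pk (2 * \<xi> * norm w)" using elim by (intro S_bound) auto
          then have "(2 * \<xi>) ^ k * norm (S k w) * (1 / 2) ^ k \<le> C\<^sub>0 * C\<^sub>E * pk (2 * \<xi> * norm w) * (1 / 2) ^ k"
            by (rule mult_right_mono) simp
          moreover have "norm (F k \<xi>) = (2 * \<xi>) ^ k * norm (S k w) * (1 / 2) ^ k"
            using elim by (simp add: F_def norm_mult norm_power power_mult_distrib power_one_over)
          ultimately show "norm (norm (F k \<xi>)) \<le> C\<^sub>0 * C\<^sub>E * pk (2 * \<xi> * norm w) * (1 / 2) ^ k"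
            unfolding real_norm_def abs_norm_cancel by linarith
        qed
      qed
      have "(\<integral>\<xi>. norm (F k \<xi>) \<partial>N) = norm (sym k w)" for k
      proof -
        have "(\<integral>\<xi>. norm (F k \<xi>) \<partial>N) = (\<integral>\<xi>. \<xi> ^ k * norm (S k w) \<partial>N)"
          by (rule integral_cong_AE)
             (use ae[of k] in \<open>auto elim!: eventually_mono simp: F_def norm_mult norm_power power_abs\<close>)
        also have "\<dots> = norm (sym k w)" using moment_pos'[of k] by (simp add: momk sym_eq norm_mult)
        finally show ?thesis .
      qed
      then show "summable (\<lambda>k. \<integral>\<xi>. norm (F k \<xi>) \<partial>N)" using symsum[of w] by simp
    qed (rule Fint)
    then have "b w = (\<integral>\<xi>. (\<Sum>k. F k \<xi>) \<partial>N)" unfolding Fval using bsums sums_unique2 by blast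
    moreover have "(\<Sum>k. F k \<xi>) = Sexp (of_real \<xi> *s w)" for \<xi>
      using Sexp_sums[of w "of_real \<xi>"] by (simp add: F_def sums_iff mult.commute)
    ultimately have "ennreal (norm (b w)) \<le> (\<integral>\<^sup>+\<xi>. ennreal (norm (Sexp (of_real \<xi> *s w))) \<partial>N)"
      using norm_integral_le_nn_integral[of N "\<lambda>\<xi>. Sexp (of_real \<xi> *s w)"] by simp
    also have "\<dots> \<le> (\<integral>\<^sup>+\<xi>. ennreal (C\<^sub>0 * C\<^sub>E) * ennreal (pk (\<xi> * norm w)) \<partial>N)"
    proof (rule nn_integral_mono_AE)
      show "AE \<xi> in N. ennreal (norm (Sexp (of_real \<xi> *s w))) \<le> ennreal (C\<^sub>0 * C\<^sub>E) * ennreal (pk (\<xi> * norm w))"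
        using N(2)
      proof eventually_elim
        case (elim \<xi>)
        have "ennreal (norm (Sexp (of_real \<xi> *s w))) \<le> ennreal (C\<^sub>0 * C\<^sub>E * pk (\<xi> * norm w))"
          using Sexp_bound[of "of_real \<xi> *s w"] elim by (intro ennreal_leI) simp
        also have "\<dots> = ennreal (C\<^sub>0 * C\<^sub>E) * ennreal (pk (\<xi> * norm w))" by (intro ennreal_mult CC pk0)
        finally show ?case .
      qed
    qed
    also have "\<dots> = ennreal (C\<^sub>0 * C\<^sub>E) * (\<integral>\<^sup>+\<xi>. ennreal (pk (\<xi> * norm w)) \<partial>N)"
      by (rule nn_integral_cmult) measurable
    also have "\<dots> \<le> ennreal (C\<^sub>0 * C\<^sub>E) * ennreal (C\<^sub>N * H (norm w))"
      unfolding pk_def H_def by (intro mult_left_mono N(5)) auto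
    also have "\<dots> = ennreal (K * H (norm w))"
      unfolding K_def using CC N(4) target_growth_nonneg[of l g "\<rho> + \<eta>"]
      by (simp add: ennreal_mult[symmetric] H_def mult.assoc)
    finally show ?thesis using K target_growth_nonneg by (simp add: H_def)
  qed
  have pair: "T h = pairing l g h b" if h: "h \<in> E_space l" for h
  proof -
    obtain CH where CH: "CH > 0" "\<And>r. r \<ge> 0 \<Longrightarrow> H r \<le> CH * exp (g / 3 * r powr (2 * l))"
      using target_growth_le[OF l g_pos, of "\<rho> + \<eta>"] unfolding H_def by metis
    have "growth l (g / 3) b"
    proof (rule growthI[OF ent])
      show "0 \<le> K * CH" using K CH by simp
      show "norm (b z) \<le> K * CH * exp (g / 3 * norm z powr (2 * l))" for z
        using bb[of z] mult_left_mono[OF CH(2)[of "norm z"] K] by (simp add: mult.assoc)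
    qed
    moreover have "growth l (g / 3) h" using E_growth[OF l h] g_pos by simp
    ultimately have "(\<lambda>k. pairing l g h (hpart k b)) sums pairing l g h b"
      using g_pos l by (intro pairing_sums(1)[of l "g / 3" h "g / 3" b g]) auto
    moreover have "(\<lambda>k. pairing l g h (hpart k b)) sums T h"
      unfolding hpb T_hpart_eq_pairing[OF h, symmetric] by (rule T_hpart_sums[OF h])
    ultimately show ?thesis by (rule sums_unique2[rotated])
  qed
  show ?thesis
    by (rule that[OF ent _ hpb pair]) (use bb in \<open>simp_all add: K_def H_def\<close>)
qed

text \<open>Pairing \<open>b\<close> with \<open>(\<cdot> \<cdot> w)\<^sup>k\<close> returns \<open>b\<^sub>k(w)\<close>, so the functional determines all homogeneous parts.\<close>

lemma symbol_unique:
  assumes b: "growth l (g / 3) b" and rep: "\<And>h. h \<in> E_space l \<Longrightarrow> T h = pairing l g h b"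
  shows "hpart k b = sym k"
proof
  fix w
  have entb: "entire b" using b by (rule growth_entire)
  define c where "c = moment TYPE('n) l g k / fact k"
  have c: "c > 0" using moment_pos' by (simp add: c_def)
  have "T (\<lambda>z. cdot z w ^ k) = pairing l g (\<lambda>z. cdot z w ^ k) b"
    by (rule rep[OF E_cdot_power[OF l]])
  also have "\<dots> = cnj (pairing l g b (\<lambda>z. cdot z w ^ k))"
    by (rule pairing_cnj) (auto intro: entire_borel entb entire_cdot_power)
  also have "pairing l g b (\<lambda>z. cdot z w ^ k) = of_real (1 / c) * hpart k b w"
    using pairing_cdot_power[OF b _ _ l, of g w k] g_pos by (simp add: c_def)
  finally show "hpart k b w = sym k w"
    unfolding sym_def c_def[symmetric] using c by simp
qed

end

section \<open>Supremum norms of entire functions\<close>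

text \<open>The set where a continuous function exceeds its essential supremum is open and null, hence empty.\<close>

lemma F_infinity_pointwise:
  fixes b :: "complex ^ 'n::finite \<Rightarrow> complex"
  assumes "l \<ge> 1" and b: "b \<in> F_space l \<infinity> a \<tau>"
  shows "weighted_abs l a \<tau> b z \<le> L_norm l \<infinity> a \<tau> b"
proof (rule ccontr)
  define U where "U = {z. L_norm l \<infinity> a \<tau> b < weighted_abs l a \<tau> b z}"
  assume "\<not> ?thesis"
  then have "z \<in> U" by (simp add: U_def)
  have cont: "continuous_on UNIV (weighted_abs l a \<tau> b)"
    unfolding weighted_abs_def
  proof (intro continuous_on_mult continuous_on_norm continuous_on_exp entire_continuous_on)
    show "entire b" using b by (simp add: F_space_def)
    show "continuous_on UNIV (\<lambda>z :: complex ^ 'n. norm z powr (2 * l))"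
      by (rule continuous_on_powr') (use assms in \<open>auto intro: continuous_intros\<close>)
    show "continuous_on UNIV (\<lambda>z :: complex ^ 'n. (1 + norm z) powr \<tau>)"
      by (rule continuous_on_powr) (auto intro: continuous_intros simp: add_nonneg_eq_0_iff)
  qed (rule continuous_on_const)
  have "open U" unfolding U_def by (rule open_Collect_less[OF continuous_on_const cont])
  define s where "s = esssup dV (\<lambda>z. ennreal (weighted_abs l a \<tau> b z))"
  have s: "s < \<infinity>" using b by (simp add: F_space_def L_space_def s_def)
  have n: "L_norm l \<infinity> a \<tau> b = enn2real s" by (simp add: L_norm_def s_def)
  have "AE z in dV. ennreal (weighted_abs l a \<tau> b z) \<le> s" unfolding s_def by (rule esssup_AE)
  then have "AE z in dV. z \<notin> U"
  proof eventually_elim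
    case (elim z)
    then have "weighted_abs l a \<tau> b z \<le> enn2real s"
      using enn2real_mono[OF elim] s weighted_abs_nonneg[of l a \<tau> b z] by simp
    then show ?case unfolding U_def mem_Collect_eq not_less n .
  qed
  then have "AE z in lebesgue. z \<notin> U" by (simp only: AE_dV)
  then have "U \<in> null_sets lebesgue"
    using AE_iff_null_sets[of U lebesgue] \<open>open U\<close> by (auto simp: borel_open)
  then have "negligible U" by (simp add: negligible_iff_null_sets)
  then show False using open_not_negligible[OF \<open>open U\<close>] \<open>z \<in> U\<close> by blast
qed

lemma L_infinity_intro:
  fixes b :: "complex ^ 'n::finite \<Rightarrow> complex"
  assumes "b \<in> borel_measurable dV" "K \<ge> 0" and le: "\<And>z. weighted_abs l a \<tau> b z \<le> K"
  shows "b \<in> L_space l \<infinity> a \<tau>" "L_norm l \<infinity> a \<tau> b \<le> K"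
proof -
  have [measurable]: "weighted_abs l a \<tau> b \<in> borel_measurable dV" by (rule weighted_abs_measurable[OF assms(1)])
  have *: "esssup dV (\<lambda>z. ennreal (weighted_abs l a \<tau> b z)) \<le> ennreal K"
    by (rule esssup_I) (auto intro!: ennreal_leI le)
  then show "b \<in> L_space l \<infinity> a \<tau>" using assms(1) by (auto simp: L_space_def intro: le_less_trans)
  have "enn2real (esssup dV (\<lambda>z. ennreal (weighted_abs l a \<tau> b z))) \<le> enn2real (ennreal K)"
    using * by (rule enn2real_mono) simp
  then show "L_norm l \<infinity> a \<tau> b \<le> K" using \<open>K \<ge> 0\<close> by (simp add: L_norm_def)
qed

lemma weighted_abs_le_iff:
  "weighted_abs l a \<tau> b z \<le> K \<longleftrightarrow> norm (b z) \<le> K * ((1 + norm z) powr (- \<tau>) * exp (a / 2 * norm z powr (2 * l)))"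
proof -
  have p: "0 < (1 + norm z) powr \<tau> * exp (- (a / 2) * norm z powr (2 * l))"
    by (intro mult_pos_pos) (simp_all add: add_nonneg_eq_0_iff)
  have e: "exp (a / 2 * norm z powr (2 * l)) = inverse (exp (- (a / 2) * norm z powr (2 * l)))"
    unfolding exp_minus[symmetric] by simp
  have i: "(1 + norm z) powr (- \<tau>) * exp (a / 2 * norm z powr (2 * l))
      = inverse ((1 + norm z) powr \<tau> * exp (- (a / 2) * norm z powr (2 * l)))"
    unfolding e powr_minus inverse_mult_distrib ..
  show ?thesis
    unfolding weighted_abs_def i mult.assoc using pos_le_divide_eq[OF p, of "norm (b z)" K]
    by (simp only: divide_inverse)
qed

text \<open>The polynomial factor is absorbed by raising \<open>g/4\<close> to \<open>g/3\<close>; any number below \<open>g/2\<close> would do, as the dilation in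
  \<open>bounded_symbol\<close> quadruples it and the doubled weight has to stay ahead.\<close>

lemma growth_of_poly_weight:
  fixes b :: "complex ^ 'n::finite \<Rightarrow> complex"
  assumes "l \<ge> 1" "g > 0" "entire b" "B \<ge> 0"
    and B: "\<And>z. norm (b z) \<le> B * ((1 + norm z) powr \<sigma> * exp (g / 4 * norm z powr (2 * l)))"
  shows "growth l (g / 3) b"
proof -
  have "g / 12 > 0" using assms by simp
  then obtain C where C: "C > 0" "\<And>D. D \<ge> 0 \<Longrightarrow> (1 + D) powr \<sigma> \<le> C * exp (g / 12 * D\<^sup>2)"
    by (rule poly_le_gauss[of "g / 12" \<sigma>]) (rule that)
  show ?thesis
  proof (rule growthI[OF \<open>entire b\<close>])
    show "0 \<le> B * (C * exp (g / 12))" using assms C by simp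
    fix z :: "complex ^ 'n"
    have sq: "(norm z)\<^sup>2 \<le> 1 + norm z powr (2 * l)"
    proof (cases "norm z \<le> 1")
      case True
      then have "(norm z)\<^sup>2 \<le> 1" by (simp add: power_le_one)
      then show ?thesis using powr_ge_zero[of "norm z" "2 * l"] by linarith
    next
      case False
      then have "norm z powr 2 \<le> norm z powr (2 * l)" using assms by (intro powr_mono) auto
      moreover have "norm z powr 2 = (norm z)\<^sup>2" using False by simp
      ultimately show ?thesis by linarith
    qed
    have "(1 + norm z) powr \<sigma> \<le> C * exp (g / 12 * (norm z)\<^sup>2)" by (rule C) simp
    also have "\<dots> \<le> C * exp (g / 12 * (1 + norm z powr (2 * l)))"
      using C sq assms by simp
    finally have "(1 + norm z) powr \<sigma> * exp (g / 4 * norm z powr (2 * l))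
        \<le> C * exp (g / 12 * (1 + norm z powr (2 * l))) * exp (g / 4 * norm z powr (2 * l))"
      by (rule mult_right_mono) simp
    also have "\<dots> = C * exp (g / 12) * exp (g / 3 * norm z powr (2 * l))"
      unfolding mult.assoc exp_add[symmetric] by (simp add: field_simps)
    finally have "B * ((1 + norm z) powr \<sigma> * exp (g / 4 * norm z powr (2 * l)))
        \<le> B * (C * exp (g / 12) * exp (g / 3 * norm z powr (2 * l)))" using \<open>B \<ge> 0\<close> by (rule mult_left_mono)
    then show "norm (b z) \<le> B * (C * exp (g / 12)) * exp (g / 3 * norm z powr (2 * l))"
      using B[of z] unfolding mult.assoc by linarith
  qed
qed

section \<open>The bounded symbol\<close>

text \<open>The factor \<open>2\<^sup>n\<^sup>/\<^sup>l\<close> and the dilation by \<open>2\<^sup>1\<^sup>/\<^sup>l\<close> together supply \<open>2\<^sup>(\<^sup>k\<^sup>+\<^sup>n\<^sup>)\<^sup>/\<^sup>l\<close> in degree \<open>k\<close>, the factor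
  by which the pairing shrinks when the additional exponential doubles the weight.\<close>

definition bounded_symbol :: "real \<Rightarrow> real \<Rightarrow> (complex ^ 'n::finite \<Rightarrow> complex) \<Rightarrow> complex ^ 'n \<Rightarrow> complex" where
  "bounded_symbol l g b z = of_real (2 powr (CARD('n) / l)) * b (of_real (2 powr (1 / l)) *s z)
     * of_real (exp (- g * norm z powr (2 * l)))"

lemma bounded_symbol_measurable:
  fixes b :: "complex ^ 'n::finite \<Rightarrow> complex"
  assumes "entire b" shows "bounded_symbol l g b \<in> borel_measurable borel"
proof -
  have [measurable]: "(\<lambda>z. b (of_real (2 powr (1 / l)) *s z + 0)) \<in> borel_measurable borel"
    by (rule entire_borel[OF entire_affine[OF assms]])
  show ?thesis unfolding bounded_symbol_def using \<open>_ \<in> borel_measurable borel\<close> by simp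
qed

lemma dilation_powr:
  fixes z :: "complex ^ 'n::finite"
  assumes "l \<ge> 1"
  shows "norm (of_real (2 powr (1 / l)) *s z) powr (2 * l) = 4 * norm z powr (2 * l)"
proof -
  have "(2 powr (1 / l)) powr (2 * l) = (2 :: real) powr 2" using assms by (simp add: powr_powr)
  then show ?thesis by (simp add: powr_mult)
qed

lemma bounded_symbol_bound:
  fixes b :: "complex ^ 'n::finite \<Rightarrow> complex"
  assumes "l \<ge> 1" "B \<ge> 0" and B: "\<And>z. norm (b z) \<le> B * ((1 + norm z) powr \<sigma> * exp (g / 4 * norm z powr (2 * l)))"
  shows "norm (bounded_symbol l g b z) \<le> 2 powr (CARD('n) / l) * 2 powr \<bar>\<sigma>\<bar> * B * (1 + norm z) powr \<sigma>"
proof -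
  define s :: real where "s = 2 powr (1 / l)"
  have s: "1 \<le> s" "s \<le> 2"
  proof -
    show "1 \<le> s" using assms by (simp add: s_def ge_one_powr_ge_zero)
    have "s \<le> 2 powr 1" unfolding s_def using assms by (intro powr_mono) auto
    then show "s \<le> 2" by simp
  qed
  have ns: "norm (of_real s *s z) = s * norm z" using s by simp
  have "1 * norm z \<le> s * norm z" "s * norm z \<le> 2 * norm z" using s by (intro mult_right_mono; simp)+
  then have "1 + s * norm z \<le> 2 * (1 + norm z)" "1 + norm z \<le> 2 * (1 + s * norm z)"
    using norm_ge_zero[of z] by (simp_all only: distrib_left)
  then have "(1 + s * norm z) powr \<sigma> \<le> 2 powr \<bar>\<sigma>\<bar> * (1 + norm z) powr \<sigma>"
    by (rule powr_comparable[rotated 2]) (use s in \<open>simp_all add: add_pos_nonneg\<close>)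
  moreover have "norm (b (of_real s *s z)) \<le> B * ((1 + s * norm z) powr \<sigma> * exp (g * norm z powr (2 * l)))"
    using B[of "of_real s *s z"] dilation_powr[OF \<open>l \<ge> 1\<close>, of z] unfolding ns s_def[symmetric] by simp
  ultimately have "norm (b (of_real s *s z)) \<le> B * (2 powr \<bar>\<sigma>\<bar> * (1 + norm z) powr \<sigma> * exp (g * norm z powr (2 * l)))"
    using \<open>B \<ge> 0\<close> by (meson mult_left_mono mult_right_mono exp_ge_zero order_trans)
  then have "2 powr (CARD('n) / l) * norm (b (of_real s *s z)) * exp (- g * norm z powr (2 * l))
      \<le> 2 powr (CARD('n) / l) * (B * (2 powr \<bar>\<sigma>\<bar> * (1 + norm z) powr \<sigma> * exp (g * norm z powr (2 * l)))) * exp (- g * norm z powr (2 * l))"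
    by (intro mult_right_mono mult_left_mono) auto
  also have "\<dots> = 2 powr (CARD('n) / l) * 2 powr \<bar>\<sigma>\<bar> * B * (1 + norm z) powr \<sigma> * (exp (g * norm z powr (2 * l)) * exp (- g * norm z powr (2 * l)))"
    by (simp only: mult.assoc mult.commute mult.left_commute)
  also have "exp (g * norm z powr (2 * l)) * exp (- g * norm z powr (2 * l)) = 1"
    unfolding exp_add[symmetric] by simp
  finally show ?thesis by (simp add: bounded_symbol_def norm_mult s_def)
qed

text \<open>Both sides are compared degree by degree.\<close>

lemma pairing_bounded_symbol:
  fixes h b :: "complex ^ 'n::finite \<Rightarrow> complex"
  assumes l: "l \<ge> 1" and g: "g > 0" and h: "h \<in> E_space l" and b: "growth l (g / 3) b"
  shows "pairing l g h (bounded_symbol l g b) = pairing l g h b"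
proof -
  define s :: complex where "s = of_real (2 powr (1 / l))"
  define bs where "bs z = b (s *s z)" for z
  have enth: "entire h" and entb: "entire b" using h b by (auto intro: E_entire growth_entire)
  have entbs: "entire bs" using entire_affine[OF entb, of s 0] by (simp add: bs_def[abs_def])
  have hg: "growth l (g / 3) h" using E_growth[OF l h] g by simp
  obtain C where C: "C \<ge> 0" "\<And>z. norm (b z) \<le> C * exp (g / 3 * norm z powr (2 * l))"
    by (rule growthE[OF b], rule that)
  have bsg: "growth l (4 * g / 3) bs"
  proof (rule growthI[OF entbs C(1)])
    show "norm (bs z) \<le> C * exp (4 * g / 3 * norm z powr (2 * l))" for z
      using C(2)[of "s *s z"] dilation_powr[OF l, of z] by (simp add: bs_def s_def mult_ac)
  qed
  have hp: "hpart k bs = (\<lambda>z. s ^ k * hpart k b z)" for k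
  proof
    show "hpart k bs z = s ^ k * hpart k b z" for z
    proof (rule hpart_unique[OF entbs])
      show "(\<lambda>k. s ^ k * hpart k b z * t ^ k) sums bs (t *s z)" for t
        using hpart_sums[OF entb, of z "t * s"]
        by (simp add: bs_def vector_smult_assoc power_mult_distrib mult_ac)
    qed
  qed
  have [measurable]: "h \<in> borel_measurable borel" "bs \<in> borel_measurable borel"
    using enth entbs by (auto intro: entire_borel)
  have "pairing l g h (bounded_symbol l g b) = (1 / ball_vol TYPE('n)) *\<^sub>R
     (\<integral>z. of_real (2 powr (CARD('n) / l)) * (h z * cnj (bs z) * of_real (exp (- (2 * g) * norm z powr (2 * l)))) \<partial>lborel)"
  proof (subst pairing_lborel)
    have "exp (- (2 * g) * norm z powr (2 * l)) = exp (- g * norm z powr (2 * l)) * exp (- g * norm z powr (2 * l))" for z :: "complex ^ 'n"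
      unfolding exp_add[symmetric] by simp
    then have e: "complex_of_real (exp (- (2 * g) * norm z powr (2 * l)))
        = of_real (exp (- g * norm z powr (2 * l))) * of_real (exp (- g * norm z powr (2 * l)))" for z :: "complex ^ 'n"
      by (simp only: of_real_mult)
    show "(1 / ball_vol TYPE('n)) *\<^sub>R (\<integral>z. h z * cnj (bounded_symbol l g b z) * of_real (exp (- g * norm z powr (2 * l))) \<partial>lborel)
      = (1 / ball_vol TYPE('n)) *\<^sub>R (\<integral>z. of_real (2 powr (CARD('n) / l)) * (h z * cnj (bs z) * of_real (exp (- (2 * g) * norm z powr (2 * l)))) \<partial>lborel)"
      unfolding e by (simp add: bounded_symbol_def bs_def s_def mult_ac)
  qed (use bounded_symbol_measurable[OF entb] in simp_all)
  also have "\<dots> = of_real (2 powr (CARD('n) / l)) * pairing l (2 * g) h bs"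
    unfolding integral_mult_right_zero by (subst pairing_lborel) simp_all
  finally have 1: "pairing l g h (bounded_symbol l g b) = of_real (2 powr (CARD('n) / l)) * pairing l (2 * g) h bs" .
  have "(\<lambda>k. pairing l (2 * g) h (hpart k bs)) sums pairing l (2 * g) h bs"
    by (rule pairing_sums(1)[OF hg bsg]) (use l g in auto)
  then have 2: "(\<lambda>k. of_real (2 powr (CARD('n) / l)) * pairing l (2 * g) h (hpart k bs)) sums pairing l g h (bounded_symbol l g b)"
    unfolding 1 by (rule sums_mult)
  have 3: "(\<lambda>k. pairing l g h (hpart k b)) sums pairing l g h b"
    by (rule pairing_sums(1)[OF hg b]) (use l g in auto)
  have "of_real (2 powr (CARD('n) / l)) * pairing l (2 * g) h (hpart k bs) = pairing l g h (hpart k b)" for k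
  proof -
    have "pairing l (2 * g) h (hpart k bs) = pairing l (2 * g) (hpart k h) (hpart k bs)"
      by (rule pairing_sums(2)[OF hg bsg]) (use l g in auto)
    also have "\<dots> = cnj (s ^ k) * pairing l (2 * g) (hpart k h) (hpart k b)"
      unfolding hp by (rule pairing_cmult_right) (auto intro: entire_borel entire_hpart enth entb)
    finally have "of_real (2 powr (CARD('n) / l)) * pairing l (2 * g) h (hpart k bs)
        = of_real (2 powr (CARD('n) / l) * (2 powr (1 / l)) ^ k) * pairing l (2 * g) (hpart k h) (hpart k b)"
      by (simp add: s_def)
    also have "2 powr (CARD('n) / l) * (2 powr (1 / l)) ^ k = (2::real) powr ((k + CARD('n)) / l)"
      by (simp add: powr_realpow[symmetric] powr_powr powr_add[symmetric] add_divide_distrib add.commute)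
    also have "of_real (2 powr ((k + CARD('n)) / l)) * pairing l (2 * g) (hpart k h) (hpart k b)
        = pairing l g (hpart k h) (hpart k b)"
      by (rule pairing_homogeneous_double[symmetric])
         (auto intro: entire_hpart enth entb hpart_homogeneous l g)
    also have "\<dots> = pairing l g h (hpart k b)"
      by (rule pairing_sums(2)[OF hg b, symmetric]) (use l g in auto)
    finally show ?thesis .
  qed
  with 2 3 show ?thesis using sums_unique2 by simp
qed

section \<open>Bounded forms\<close>

text \<open>The weights in the two norms multiply to the weight of the pairing, and \<open>\<phi>\<close> is controlled by the
  product of the polynomial factors.\<close>

lemma pairing_bounded:
  fixes f h \<phi> :: "complex ^ 'n::finite \<Rightarrow> complex"
  assumes p: "1 \<le> p" and [measurable]: "\<phi> \<in> borel_measurable dV" and "K \<ge> 0"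
    and K: "\<And>z. norm (\<phi> z) \<le> K * (1 + norm z) powr (\<rho> + \<eta>)"
    and f: "f \<in> L_space l p \<alpha> \<rho>" and h: "h \<in> L_space l (conj_exponent p) \<beta> \<eta>"
  shows "integrable dV (\<lambda>z. f z * h z * cnj (\<phi> z) * of_real (exp (- ((\<alpha> + \<beta>) / 2) * norm z powr (2 * l))))"
    and "norm (pairing l ((\<alpha> + \<beta>) / 2) (\<lambda>z. f z * h z) \<phi>) \<le> K * L_norm l p \<alpha> \<rho> f * L_norm l (conj_exponent p) \<beta> \<eta> h"
proof -
  define F where "F z = f z * h z * cnj (\<phi> z) * complex_of_real (exp (- ((\<alpha> + \<beta>) / 2) * norm z powr (2 * l)))" for z
  define N where "N = L_norm l p \<alpha> \<rho> f * L_norm l (conj_exponent p) \<beta> \<eta> h"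
  have N: "N \<ge> 0" unfolding N_def L_norm_eq by (intro mult_nonneg_nonneg Lp_norm_nonneg)
  have [measurable]: "f \<in> borel_measurable dV" "h \<in> borel_measurable dV" using f h by (auto simp: L_space_iff)
  have [measurable]: "(\<lambda>z :: complex ^ 'n. complex_of_real (exp (- ((\<alpha> + \<beta>) / 2) * norm z powr (2 * l)))) \<in> borel_measurable dV"
    by (rule measurable_dV_borel) measurable
  have [measurable]: "F \<in> borel_measurable dV" unfolding F_def[abs_def] by measurable
  have le: "norm (F z) \<le> K * (weighted_abs l \<alpha> \<rho> f z * weighted_abs l \<beta> \<eta> h z)" for z
  proof -
    define e where "e = exp (- ((\<alpha> + \<beta>) / 2) * norm z powr (2 * l))"
    have e: "e = exp (- (\<alpha> / 2) * norm z powr (2 * l)) * exp (- (\<beta> / 2) * norm z powr (2 * l))"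
      unfolding e_def exp_add[symmetric] by (simp add: field_simps)
    have "norm (F z) = norm (f z) * norm (h z) * norm (\<phi> z) * e" by (simp add: F_def norm_mult e_def)
    also have "\<dots> \<le> norm (f z) * norm (h z) * (K * (1 + norm z) powr (\<rho> + \<eta>)) * e"
      by (intro mult_right_mono mult_left_mono K) (auto simp: e_def)
    also have "\<dots> = K * (weighted_abs l \<alpha> \<rho> f z * weighted_abs l \<beta> \<eta> h z)"
      unfolding weighted_abs_def e powr_add by (simp only: mult.assoc mult.commute mult.left_commute)
    finally show ?thesis .
  qed
  have "(\<integral>\<^sup>+z. ennreal (norm (F z)) \<partial>dV) \<le> (\<integral>\<^sup>+z. ennreal K * ennreal (weighted_abs l \<alpha> \<rho> f z * weighted_abs l \<beta> \<eta> h z) \<partial>dV)"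
    by (intro nn_integral_mono) (use le \<open>K \<ge> 0\<close> weighted_abs_nonneg in \<open>auto simp flip: ennreal_mult' intro!: ennreal_leI\<close>)
  also have "\<dots> = ennreal K * (\<integral>\<^sup>+z. ennreal (weighted_abs l \<alpha> \<rho> f z * weighted_abs l \<beta> \<eta> h z) \<partial>dV)"
    by (rule nn_integral_cmult) measurable
  also have "\<dots> \<le> ennreal K * ennreal N"
    unfolding N_def L_norm_eq
    by (intro mult_left_mono Hoelder p weighted_abs_measurable weighted_abs_nonneg)
       (use f h in \<open>auto simp: L_space_iff\<close>)
  also have "\<dots> = ennreal (K * N)" using \<open>K \<ge> 0\<close> N by (simp add: ennreal_mult)
  finally have b: "(\<integral>\<^sup>+z. ennreal (norm (F z)) \<partial>dV) \<le> ennreal (K * N)" .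
  then have "(\<integral>\<^sup>+z. ennreal (norm (F z)) \<partial>dV) < \<infinity>" by (rule le_less_trans) simp
  then have "integrable dV F" by (simp add: integrable_iff_bounded)
  then show "integrable dV (\<lambda>z. f z * h z * cnj (\<phi> z) * of_real (exp (- ((\<alpha> + \<beta>) / 2) * norm z powr (2 * l))))"
    unfolding F_def[abs_def] .
  have "ennreal (norm (\<integral>z. F z \<partial>dV)) \<le> ennreal (K * N)"
    using norm_integral_le_nn_integral[of dV F] b by (rule order_trans)
  then have "norm (\<integral>z. F z \<partial>dV) \<le> K * N" using \<open>K \<ge> 0\<close> N by simp
  then show "norm (pairing l ((\<alpha> + \<beta>) / 2) (\<lambda>z. f z * h z) \<phi>) \<le> K * L_norm l p \<alpha> \<rho> f * L_norm l (conj_exponent p) \<beta> \<eta> h"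
    unfolding pairing_def F_def N_def by (simp only: mult.assoc)
qed

lemma pairing_bilinear:
  fixes \<phi> :: "complex ^ 'n::finite \<Rightarrow> complex"
  assumes p: "1 \<le> p" and \<phi>: "\<phi> \<in> borel_measurable dV" and "K \<ge> 0"
    and K: "\<And>z. norm (\<phi> z) \<le> K * (1 + norm z) powr (\<rho> + \<eta>)"
  shows "bilinear_form_on (L_space l p \<alpha> \<rho>) (L_space l (conj_exponent p) \<beta> \<eta>)
    (\<lambda>f h. pairing l ((\<alpha> + \<beta>) / 2) (\<lambda>z. f z * h z) \<phi>)"
proof -
  note int = pairing_bounded(1)[OF p \<phi> \<open>K \<ge> 0\<close> K]
  show ?thesis
    unfolding bilinear_form_on_def
  proof (intro conjI ballI allI)
    fix f\<^sub>1 f\<^sub>2 g :: "complex ^ 'n \<Rightarrow> complex" assume *: "f\<^sub>1 \<in> L_space l p \<alpha> \<rho>" "f\<^sub>2 \<in> L_space l p \<alpha> \<rho>" "g \<in> L_space l (conj_exponent p) \<beta> \<eta>"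
    show "pairing l ((\<alpha> + \<beta>) / 2) (\<lambda>z. (f\<^sub>1 z + f\<^sub>2 z) * g z) \<phi>
      = pairing l ((\<alpha> + \<beta>) / 2) (\<lambda>z. f\<^sub>1 z * g z) \<phi> + pairing l ((\<alpha> + \<beta>) / 2) (\<lambda>z. f\<^sub>2 z * g z) \<phi>"
      unfolding pairing_def distrib_right
      by (rule Bochner_Integration.integral_add[OF int[OF *(1,3)] int[OF *(2,3)]])
  next
    fix c :: complex and f g :: "complex ^ 'n \<Rightarrow> complex"
    have "pairing l ((\<alpha> + \<beta>) / 2) (\<lambda>z. c * (f z * g z)) \<phi> = c * pairing l ((\<alpha> + \<beta>) / 2) (\<lambda>z. f z * g z) \<phi>"
      unfolding pairing_def mult.assoc by (rule integral_mult_right_zero)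
    then show "pairing l ((\<alpha> + \<beta>) / 2) (\<lambda>z. c * f z * g z) \<phi> = c * pairing l ((\<alpha> + \<beta>) / 2) (\<lambda>z. f z * g z) \<phi>"
      "pairing l ((\<alpha> + \<beta>) / 2) (\<lambda>z. f z * (c * g z)) \<phi> = c * pairing l ((\<alpha> + \<beta>) / 2) (\<lambda>z. f z * g z) \<phi>"
      by (simp_all only: mult.assoc mult.left_commute)
  next
    fix f g\<^sub>1 g\<^sub>2 :: "complex ^ 'n \<Rightarrow> complex" assume *: "f \<in> L_space l p \<alpha> \<rho>" "g\<^sub>1 \<in> L_space l (conj_exponent p) \<beta> \<eta>" "g\<^sub>2 \<in> L_space l (conj_exponent p) \<beta> \<eta>"
    show "pairing l ((\<alpha> + \<beta>) / 2) (\<lambda>z. f z * (g\<^sub>1 z + g\<^sub>2 z)) \<phi>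
      = pairing l ((\<alpha> + \<beta>) / 2) (\<lambda>z. f z * g\<^sub>1 z) \<phi> + pairing l ((\<alpha> + \<beta>) / 2) (\<lambda>z. f z * g\<^sub>2 z) \<phi>"
      unfolding pairing_def distrib_left distrib_right
      by (rule Bochner_Integration.integral_add[OF int[OF *(1,2)] int[OF *(1,3)]])
  qed
qed

lemma E_subset_L:
  assumes "1 \<le> l" "1 \<le> p" "\<alpha> > 0"
  shows "(E_space l :: (complex ^ 'n::finite \<Rightarrow> complex) set) \<subseteq> L_space l p \<alpha> \<rho>"
proof
  fix f :: "complex ^ 'n \<Rightarrow> complex" assume f: "f \<in> E_space l"
  have "growth l (\<alpha> / 4) f" using E_growth[OF \<open>1 \<le> l\<close> f] assms by simp
  then obtain K where K: "K \<ge> 0" "\<And>z. norm (f z) \<le> K * exp (\<alpha> / 4 * norm z powr (2 * l))"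
    by (rule growthE) (rule that)
  obtain C where "C > 0" "\<And>K (f :: complex ^ 'n \<Rightarrow> complex). K \<ge> 0 \<Longrightarrow> entire f \<Longrightarrow>
      (\<And>z. norm (f z) \<le> K * exp (\<alpha> / 4 * norm z powr (2 * l))) \<Longrightarrow> f \<in> L_space l p \<alpha> \<rho> \<and> L_norm l p \<alpha> \<rho> f \<le> K * C"
    by (rule growth_norm_bound[OF assms, of \<rho>, where 'n = 'n]) (rule that; blast)
  from this(2)[OF K(1) E_entire[OF f] K(2)] show "f \<in> L_space l p \<alpha> \<rho>" by simp
qed

lemma form_norm_on_le:
  assumes "C \<ge> 0" "\<And>f g. f \<in> A \<Longrightarrow> g \<in> B \<Longrightarrow> norm (\<Lambda> f g) \<le> C * N f * M g"
  shows "form_norm_on A B N M \<Lambda> \<le> C"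
  unfolding form_norm_on_def by (rule cInf_lower) (use assms in \<open>auto intro: bdd_belowI[of _ 0]\<close>)

lemma form_norm_on_ge:
  assumes "bounded_form_on A B N M \<Lambda>"
    and "\<And>C. C \<ge> 0 \<Longrightarrow> (\<And>f g. f \<in> A \<Longrightarrow> g \<in> B \<Longrightarrow> norm (\<Lambda> f g) \<le> C * N f * M g) \<Longrightarrow> x \<le> C"
  shows "x \<le> form_norm_on A B N M \<Lambda>"
  unfolding form_norm_on_def
proof (rule cInf_greatest)
  show "{C. 0 \<le> C \<and> (\<forall>f\<in>A. \<forall>g\<in>B. norm (\<Lambda> f g) \<le> C * N f * M g)} \<noteq> {}"
    using assms(1) unfolding bounded_form_on_def by (auto intro: less_imp_le)
qed (use assms(2) in auto)

section \<open>The characterisation\<close>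

text \<open>One constant serves all forms and all admissible bounds \<open>C\<^sub>0\<close>. Taking the infimum over \<open>C\<^sub>0\<close> later gives the estimate
  by the norm of the form, and uniqueness extends it from the symbol constructed here to
  every symbol.\<close>

lemma symbol_of_bounded_form:
  fixes l \<alpha> \<beta> \<rho> \<eta> :: real
  assumes l: "1 \<le> l" and p: "1 \<le> p" and ab: "\<alpha> > 0" "\<beta> > 0"
  shows "\<exists>C>0. \<forall>(\<Lambda> :: (complex ^ 'n::finite \<Rightarrow> complex) \<Rightarrow> (complex ^ 'n \<Rightarrow> complex) \<Rightarrow> complex) C\<^sub>0.
    hankel_form l \<Lambda> \<and> C\<^sub>0 \<ge> 0 \<and>
      (\<forall>f\<in>E_space l. \<forall>g\<in>E_space l. norm (\<Lambda> f g) \<le> C\<^sub>0 * L_norm l p \<alpha> \<rho> f * L_norm l (conj_exponent p) \<beta> \<eta> g) \<longrightarrow>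
    (\<exists>b\<in>F_space l \<infinity> ((\<alpha> + \<beta>) / 4) (- \<rho> - \<eta>). \<forall>f\<in>E_space l. \<forall>g\<in>E_space l. \<Lambda> f g = pairing l ((\<alpha> + \<beta>) / 2) (\<lambda>z. f z * g z) b) \<and>
    (\<forall>b\<in>F_space l \<infinity> ((\<alpha> + \<beta>) / 4) (- \<rho> - \<eta>). (\<forall>f\<in>E_space l. \<forall>g\<in>E_space l. \<Lambda> f g = pairing l ((\<alpha> + \<beta>) / 2) (\<lambda>z. f z * g z) b) \<longrightarrow>
       L_norm l \<infinity> ((\<alpha> + \<beta>) / 4) (- \<rho> - \<eta>) b \<le> C * C\<^sub>0)"
proof -
  define \<gamma> where "\<gamma> = (\<alpha> + \<beta>) / 2"
  define \<sigma> where "\<sigma> = \<rho> + \<eta>"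
  have \<gamma>: "\<gamma> > 0" using ab by (simp add: \<gamma>_def)
  have par: "(\<alpha> + \<beta>) / 4 = \<gamma> / 2" "- \<rho> - \<eta> = - \<sigma>" by (simp_all add: \<gamma>_def \<sigma>_def)
  obtain C\<^sub>E where CE: "C\<^sub>E > 0" "\<And>w :: complex ^ 'n. L_norm l p \<alpha> \<rho> (\<lambda>z. exp (cdot z ((\<alpha> / (2 * \<gamma>)) *\<^sub>R w)))
      * L_norm l (conj_exponent p) \<beta> \<eta> (\<lambda>z. exp (cdot z ((\<beta> / (2 * \<gamma>)) *\<^sub>R w)))
      \<le> C\<^sub>E * peak l \<gamma> (\<rho> + \<eta> - 2 * CARD('n) * (l - 1)) (norm w)"
    using exp_norm_product_bound[OF l p ab, of \<rho> \<eta>, where 'n = 'n, folded \<gamma>_def] by metis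
  obtain N :: "real measure" and C\<^sub>N :: real where N: "sets N = sets borel" "AE \<xi> in N. \<xi> \<ge> 0"
    "\<And>k. (\<integral>\<^sup>+\<xi>. ennreal (\<xi> ^ k) \<partial>N) = ennreal (moment TYPE('n) l \<gamma> k)"
    "C\<^sub>N > 0" "\<And>r. r \<ge> 0 \<Longrightarrow> (\<integral>\<^sup>+\<xi>. ennreal (peak l \<gamma> (\<rho> + \<eta> - 2 * CARD('n) * (l - 1)) (\<xi> * r)) \<partial>N) \<le> ennreal (C\<^sub>N * target_growth l \<gamma> (\<rho> + \<eta>) r)"
    by (rule moment_measure[OF l \<gamma>, of "\<rho> + \<eta>", where 'n = 'n]) (rule that; blast)
  obtain C\<^sub>W where W: "C\<^sub>W > 0" "\<And>r. r \<ge> 0 \<Longrightarrow> target_growth l \<gamma> (\<rho> + \<eta>) r \<le> C\<^sub>W * ((1 + r) powr (\<rho> + \<eta>) * exp (\<gamma> / 4 * r powr (2 * l)))"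
    by (rule target_growth_weight[OF l \<gamma>, of "\<rho> + \<eta>"]) (rule that; blast)
  show ?thesis
  proof (intro exI[of _ "C\<^sub>E * C\<^sub>N * C\<^sub>W"] conjI allI impI; (elim conjE)?)
    show "C\<^sub>E * C\<^sub>N * C\<^sub>W > 0" using CE N W by simp
    fix \<Lambda> :: "(complex ^ 'n \<Rightarrow> complex) \<Rightarrow> (complex ^ 'n \<Rightarrow> complex) \<Rightarrow> complex" and C\<^sub>0 :: real
    assume h: "hankel_form l \<Lambda>" "C\<^sub>0 \<ge> 0" "\<forall>f\<in>E_space l. \<forall>g\<in>E_space l.
      norm (\<Lambda> f g) \<le> C\<^sub>0 * L_norm l p \<alpha> \<rho> f * L_norm l (conj_exponent p) \<beta> \<eta> g"
    interpret bounded_hankel l \<alpha> \<beta> \<rho> \<eta> p \<Lambda> C\<^sub>0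
      by unfold_locales (use assms h in auto)
    have g: "g = \<gamma>" by (simp add: g_def \<gamma>_def)
    obtain b where b: "entire b" "\<And>w. norm (b w) \<le> C\<^sub>0 * C\<^sub>E * C\<^sub>N * target_growth l g (\<rho> + \<eta>) (norm w)"
      "\<And>k. hpart k b = sym k" "\<And>h. h \<in> E_space l \<Longrightarrow> T h = pairing l g h b"
      by (rule symbol_exists[OF CE[folded g] N[folded g]], assumption) (rule that; blast)
    define K where "K = C\<^sub>E * C\<^sub>N * C\<^sub>W * C\<^sub>0"
    have K: "K \<ge> 0" using CE N W h by (simp add: K_def)
    have bK: "weighted_abs l (\<gamma> / 2) (- \<sigma>) b z \<le> K" for z
    proof -
      have c: "C\<^sub>0 * C\<^sub>E * C\<^sub>N \<ge> 0" using CE N h by simp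
      have "C\<^sub>0 * C\<^sub>E * C\<^sub>N * target_growth l g (\<rho> + \<eta>) (norm z)
          \<le> C\<^sub>0 * C\<^sub>E * C\<^sub>N * (C\<^sub>W * ((1 + norm z) powr (\<rho> + \<eta>) * exp (\<gamma> / 4 * norm z powr (2 * l))))"
        unfolding g by (intro mult_left_mono W c) simp
      also have "\<dots> = K * ((1 + norm z) powr (- (- \<sigma>)) * exp (\<gamma> / 2 / 2 * norm z powr (2 * l)))"
        by (simp add: K_def \<sigma>_def mult_ac add.commute[of \<eta>])
      finally show ?thesis unfolding weighted_abs_le_iff using b(2)[of z] by linarith
    qed
    have meas: "b \<in> borel_measurable dV" using b(1) by (intro measurable_dV_borel entire_borel)
    have bF: "b \<in> F_space l \<infinity> (\<gamma> / 2) (- \<sigma>)"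
      unfolding F_space_def using L_infinity_intro(1)[OF meas K bK] b(1) by simp
    have bN: "L_norm l \<infinity> (\<gamma> / 2) (- \<sigma>) b \<le> K" by (rule L_infinity_intro(2)[OF meas K bK])
    have rep: "\<Lambda> f h = pairing l \<gamma> (\<lambda>z. f z * h z) b" if "f \<in> E_space l" "h \<in> E_space l" for f h
      using b(4)[OF E_mult[OF l that]] \<Lambda>_eq[OF that] by (simp add: g)
    have "L_norm l \<infinity> (\<gamma> / 2) (- \<sigma>) b' \<le> K"
      if b': "b' \<in> F_space l \<infinity> (\<gamma> / 2) (- \<sigma>)"
        and r: "\<forall>f\<in>E_space l. \<forall>h\<in>E_space l. \<Lambda> f h = pairing l \<gamma> (\<lambda>z. f z * h z) b'" for b'
    proof -
      have ent: "entire b'" using b' by (simp add: F_space_def)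
      have "growth l (g / 3) b'"
        unfolding g
      proof (rule growth_of_poly_weight[OF l \<gamma> ent])
        show "0 \<le> L_norm l \<infinity> (\<gamma> / 2) (- \<sigma>) b'" unfolding L_norm_eq by (rule Lp_norm_nonneg)
        show "norm (b' z) \<le> L_norm l \<infinity> (\<gamma> / 2) (- \<sigma>) b' * ((1 + norm z) powr \<sigma> * exp (\<gamma> / 4 * norm z powr (2 * l)))" for z
          using F_infinity_pointwise[OF l b', of z] unfolding weighted_abs_le_iff by simp
      qed
      moreover have "T h = pairing l g h b'" if "h \<in> E_space l" for h
        using bspec[OF bspec[OF r that] E_const[OF l, of 1]] by (simp add: T_def g)
      ultimately have hp: "hpart k b' = sym k" for k by (rule symbol_unique)
      have "b' = b"
      proof
        fix z
        show "b' z = b z"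
          using hpart_sums_1[OF ent, of z] hpart_sums_1[OF b(1), of z] unfolding hp b(3) by (rule sums_unique2)
      qed
      then show ?thesis using bN by simp
    qed
    then show "\<exists>b\<in>F_space l \<infinity> ((\<alpha> + \<beta>) / 4) (- \<rho> - \<eta>). \<forall>f\<in>E_space l. \<forall>g\<in>E_space l. \<Lambda> f g = pairing l ((\<alpha> + \<beta>) / 2) (\<lambda>z. f z * g z) b"
      "\<forall>b\<in>F_space l \<infinity> ((\<alpha> + \<beta>) / 4) (- \<rho> - \<eta>). (\<forall>f\<in>E_space l. \<forall>g\<in>E_space l. \<Lambda> f g = pairing l ((\<alpha> + \<beta>) / 2) (\<lambda>z. f z * g z) b) \<longrightarrow>
         L_norm l \<infinity> ((\<alpha> + \<beta>) / 4) (- \<rho> - \<eta>) b \<le> C\<^sub>E * C\<^sub>N * C\<^sub>W * C\<^sub>0"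
      unfolding par \<gamma>_def[symmetric] K_def[symmetric] using bF rep by blast+
  qed
qed

text \<open>The function \<open>\<phi>\<close> is \<open>bounded_symbol\<close>; the bound on the Lebesgue spaces contains the bound on \<open>E\<close>.\<close>

lemma bounded_form_of_symbol:
  fixes l \<alpha> \<beta> \<rho> \<eta> :: real
  assumes l: "1 \<le> l" and p: "1 \<le> p" and ab: "\<alpha> > 0" "\<beta> > 0"
  shows "\<exists>C>0. \<forall>b \<in> F_space l \<infinity> ((\<alpha> + \<beta>) / 4) (- \<rho> - \<eta>) :: (complex ^ 'n::finite \<Rightarrow> complex) set.
      \<exists>\<phi>\<in>L_space l \<infinity> 0 (- \<rho> - \<eta>).
        (\<forall>f\<in>E_space l. \<forall>g\<in>E_space l. pairing l ((\<alpha> + \<beta>) / 2) (\<lambda>z. f z * g z) \<phi> = pairing l ((\<alpha> + \<beta>) / 2) (\<lambda>z. f z * g z) b) \<and>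
        bilinear_form_on (L_space l p \<alpha> \<rho>) (L_space l (conj_exponent p) \<beta> \<eta>) (\<lambda>f g. pairing l ((\<alpha> + \<beta>) / 2) (\<lambda>z. f z * g z) \<phi>) \<and>
        (\<forall>f\<in>L_space l p \<alpha> \<rho>. \<forall>g\<in>L_space l (conj_exponent p) \<beta> \<eta>. norm (pairing l ((\<alpha> + \<beta>) / 2) (\<lambda>z. f z * g z) \<phi>)
           \<le> C * L_norm l \<infinity> ((\<alpha> + \<beta>) / 4) (- \<rho> - \<eta>) b * L_norm l p \<alpha> \<rho> f * L_norm l (conj_exponent p) \<beta> \<eta> g)"
proof -
  define \<gamma> where "\<gamma> = (\<alpha> + \<beta>) / 2"
  define \<sigma> where "\<sigma> = \<rho> + \<eta>"
  have \<gamma>: "\<gamma> > 0" using ab by (simp add: \<gamma>_def)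
  have par: "(\<alpha> + \<beta>) / 4 = \<gamma> / 2" "- \<rho> - \<eta> = - \<sigma>" by (simp_all add: \<gamma>_def \<sigma>_def)
  define C where "C = 2 powr (CARD('n) / l) * 2 powr \<bar>\<sigma>\<bar>"
  show ?thesis
  proof (intro exI[of _ C] conjI ballI, goal_cases)
    case 1
    show ?case by (simp add: C_def)
  next
    case (2 b)
    define B where "B = L_norm l \<infinity> (\<gamma> / 2) (- \<sigma>) b"
    have b: "b \<in> F_space l \<infinity> (\<gamma> / 2) (- \<sigma>)" using 2 unfolding par .
    have ent: "entire b" using b by (simp add: F_space_def)
    have B: "B \<ge> 0" unfolding B_def L_norm_eq by (rule Lp_norm_nonneg)
    have bB: "norm (b z) \<le> B * ((1 + norm z) powr \<sigma> * exp (\<gamma> / 4 * norm z powr (2 * l)))" for z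
      using F_infinity_pointwise[OF l b, of z] unfolding weighted_abs_le_iff B_def by simp
    define \<phi> where "\<phi> = bounded_symbol l \<gamma> b"
    have meas: "\<phi> \<in> borel_measurable dV" unfolding \<phi>_def by (intro measurable_dV_borel bounded_symbol_measurable ent)
    have CB: "C * B \<ge> 0" using B by (simp add: C_def)
    have \<phi>: "norm (\<phi> z) \<le> C * B * (1 + norm z) powr (\<rho> + \<eta>)" for z
      using bounded_symbol_bound[OF l B bB, of z] unfolding \<phi>_def C_def \<sigma>_def .
    have "weighted_abs l 0 (- \<sigma>) \<phi> z \<le> C * B" for z
      unfolding weighted_abs_le_iff using \<phi>[of z] by (simp add: \<sigma>_def add.commute)
    then have "\<phi> \<in> L_space l \<infinity> 0 (- \<sigma>)" by (rule L_infinity_intro(1)[OF meas CB])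
    moreover have "pairing l \<gamma> (\<lambda>z. f z * h z) \<phi> = pairing l \<gamma> (\<lambda>z. f z * h z) b"
      if "f \<in> E_space l" "h \<in> E_space l" for f h
      unfolding \<phi>_def by (rule pairing_bounded_symbol[OF l \<gamma> E_mult[OF l that] growth_of_poly_weight[OF l \<gamma> ent B bB]])
    ultimately show ?case
      using pairing_bilinear[OF p meas CB \<phi>, where l = l and \<alpha> = \<alpha> and \<beta> = \<beta>]
        pairing_bounded(2)[OF p meas CB \<phi>, where l = l and \<alpha> = \<alpha> and \<beta> = \<beta>]
      unfolding par \<gamma>_def[symmetric] B_def[symmetric] by blast
  qed
qed

theorem theorem1p1:
  fixes l \<alpha> \<beta> \<rho> \<eta> :: real and p :: ennreal
  assumes "1 \<le> l" and "1 \<le> p" and "0 < \<alpha>" and "0 < \<beta>"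
  defines "E \<equiv> E_space l :: (complex ^ 'n::finite \<Rightarrow> complex) set"
    and "F\<^sub>b \<equiv> F_space l \<infinity> ((\<alpha> + \<beta>) / 4) (- \<rho> - \<eta>) :: (complex ^ 'n \<Rightarrow> complex) set"
    and "norm\<^sub>b \<equiv> L_norm l \<infinity> ((\<alpha> + \<beta>) / 4) (- \<rho> - \<eta>) :: (complex ^ 'n \<Rightarrow> complex) \<Rightarrow> real"
    and "L\<^sub>1 \<equiv> L_space l p \<alpha> \<rho> :: (complex ^ 'n \<Rightarrow> complex) set"
    and "L\<^sub>2 \<equiv> L_space l (conj_exponent p) \<beta> \<eta> :: (complex ^ 'n \<Rightarrow> complex) set"
    and "N\<^sub>1 \<equiv> L_norm l p \<alpha> \<rho> :: (complex ^ 'n \<Rightarrow> complex) \<Rightarrow> real"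
    and "N\<^sub>2 \<equiv> L_norm l (conj_exponent p) \<beta> \<eta> :: (complex ^ 'n \<Rightarrow> complex) \<Rightarrow> real"
    and "L\<^sub>\<phi> \<equiv> L_space l \<infinity> 0 (- \<rho> - \<eta>) :: (complex ^ 'n \<Rightarrow> complex) set"
    and "form \<equiv> (\<lambda>b f g. pairing l ((\<alpha> + \<beta>) / 2) (\<lambda>z. f z * g z) b)
           :: (complex ^ 'n \<Rightarrow> complex) \<Rightarrow> (complex ^ 'n \<Rightarrow> complex) \<Rightarrow> (complex ^ 'n \<Rightarrow> complex) \<Rightarrow> complex"
  shows "(\<forall>\<Lambda>. hankel_form l \<Lambda> \<longrightarrow>
            (bounded_form_on E E N\<^sub>1 N\<^sub>2 \<Lambda> \<longleftrightarrow> (\<exists>b\<in>F\<^sub>b. \<forall>f\<in>E. \<forall>g\<in>E. \<Lambda> f g = form b f g))) \<and>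
         (\<exists>C>0. \<forall>\<Lambda>. hankel_form l \<Lambda> \<and> bounded_form_on E E N\<^sub>1 N\<^sub>2 \<Lambda> \<longrightarrow>
            (\<forall>b\<in>F\<^sub>b. (\<forall>f\<in>E. \<forall>g\<in>E. \<Lambda> f g = form b f g) \<longrightarrow>
               form_norm_on E E N\<^sub>1 N\<^sub>2 \<Lambda> \<le> C * norm\<^sub>b b \<and>
               norm\<^sub>b b \<le> C * form_norm_on E E N\<^sub>1 N\<^sub>2 \<Lambda>) \<and>
            (\<exists>\<phi>\<in>L\<^sub>\<phi>.
               bilinear_form_on L\<^sub>1 L\<^sub>2 (form \<phi>) \<and>
               bounded_form_on L\<^sub>1 L\<^sub>2 N\<^sub>1 N\<^sub>2 (form \<phi>) \<and>
               (\<forall>f\<in>E. \<forall>g\<in>E. form \<phi> f g = \<Lambda> f g) \<and>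
               form_norm_on L\<^sub>1 L\<^sub>2 N\<^sub>1 N\<^sub>2 (form \<phi>) \<le> C * form_norm_on E E N\<^sub>1 N\<^sub>2 \<Lambda> \<and>
               form_norm_on E E N\<^sub>1 N\<^sub>2 \<Lambda> \<le> C * form_norm_on L\<^sub>1 L\<^sub>2 N\<^sub>1 N\<^sub>2 (form \<phi>)))"
proof -
  have p': "1 \<le> conj_exponent p" using \<open>1 \<le> p\<close> by (rule conj_exponent_ge_1)
  have EL: "E \<subseteq> L\<^sub>1" "E \<subseteq> L\<^sub>2"
    unfolding E_def L\<^sub>1_def L\<^sub>2_def using assms(1-4) p' by (simp_all add: E_subset_L)
  have "\<exists>C>0. \<forall>\<Lambda> C\<^sub>0. hankel_form l \<Lambda> \<and> C\<^sub>0 \<ge> 0 \<and> (\<forall>f\<in>E. \<forall>g\<in>E. norm (\<Lambda> f g) \<le> C\<^sub>0 * N\<^sub>1 f * N\<^sub>2 g) \<longrightarrow>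
      (\<exists>b\<in>F\<^sub>b. \<forall>f\<in>E. \<forall>g\<in>E. \<Lambda> f g = form b f g) \<and>
      (\<forall>b\<in>F\<^sub>b. (\<forall>f\<in>E. \<forall>g\<in>E. \<Lambda> f g = form b f g) \<longrightarrow> norm\<^sub>b b \<le> C * C\<^sub>0)"
    unfolding E_def F\<^sub>b_def norm\<^sub>b_def N\<^sub>1_def N\<^sub>2_def form_def
    by (rule symbol_of_bounded_form[OF assms(1-4)])
  then obtain C\<^sub>A where CA: "C\<^sub>A > 0" and A: "\<forall>\<Lambda> C\<^sub>0. hankel_form l \<Lambda> \<and> C\<^sub>0 \<ge> 0 \<and>
      (\<forall>f\<in>E. \<forall>g\<in>E. norm (\<Lambda> f g) \<le> C\<^sub>0 * N\<^sub>1 f * N\<^sub>2 g) \<longrightarrow>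
      (\<exists>b\<in>F\<^sub>b. \<forall>f\<in>E. \<forall>g\<in>E. \<Lambda> f g = form b f g) \<and>
      (\<forall>b\<in>F\<^sub>b. (\<forall>f\<in>E. \<forall>g\<in>E. \<Lambda> f g = form b f g) \<longrightarrow> norm\<^sub>b b \<le> C\<^sub>A * C\<^sub>0)" by blast
  have "\<exists>C>0. \<forall>b\<in>F\<^sub>b. \<exists>\<phi>\<in>L\<^sub>\<phi>.
      (\<forall>f\<in>E. \<forall>g\<in>E. form \<phi> f g = form b f g) \<and> bilinear_form_on L\<^sub>1 L\<^sub>2 (form \<phi>) \<and>
      (\<forall>f\<in>L\<^sub>1. \<forall>g\<in>L\<^sub>2. norm (form \<phi> f g) \<le> C * norm\<^sub>b b * N\<^sub>1 f * N\<^sub>2 g)"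
    unfolding E_def F\<^sub>b_def norm\<^sub>b_def N\<^sub>1_def N\<^sub>2_def form_def L\<^sub>1_def L\<^sub>2_def L\<^sub>\<phi>_def
    by (rule bounded_form_of_symbol[OF assms(1-4)])
  then obtain C\<^sub>B where CB: "C\<^sub>B > 0" and B: "\<forall>b\<in>F\<^sub>b. \<exists>\<phi>\<in>L\<^sub>\<phi>.
      (\<forall>f\<in>E. \<forall>g\<in>E. form \<phi> f g = form b f g) \<and> bilinear_form_on L\<^sub>1 L\<^sub>2 (form \<phi>) \<and>
      (\<forall>f\<in>L\<^sub>1. \<forall>g\<in>L\<^sub>2. norm (form \<phi> f g) \<le> C\<^sub>B * norm\<^sub>b b * N\<^sub>1 f * N\<^sub>2 g)" by blast
  have nb: "norm\<^sub>b b \<ge> 0" for b unfolding norm\<^sub>b_def L_norm_eq by (rule Lp_norm_nonneg)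
  have N0: "0 \<le> N\<^sub>1 f" "0 \<le> N\<^sub>2 f" for f unfolding N\<^sub>1_def N\<^sub>2_def L_norm_eq by (rule Lp_norm_nonneg)+
  have rep_bound: "norm (\<Lambda> f g) \<le> C\<^sub>B * norm\<^sub>b b * N\<^sub>1 f * N\<^sub>2 g"
    if b: "b \<in> F\<^sub>b" "\<forall>f\<in>E. \<forall>g\<in>E. \<Lambda> f g = form b f g" and "f \<in> E" "g \<in> E" for \<Lambda> b f g
  proof -
    obtain \<phi> where "\<forall>f\<in>E. \<forall>g\<in>E. form \<phi> f g = form b f g"
      "\<forall>f\<in>L\<^sub>1. \<forall>g\<in>L\<^sub>2. norm (form \<phi> f g) \<le> C\<^sub>B * norm\<^sub>b b * N\<^sub>1 f * N\<^sub>2 g" using bspec[OF B b(1)] by blast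
    then show ?thesis using that EL by (metis subsetD)
  qed
  have rep_bounded: "bounded_form_on E E N\<^sub>1 N\<^sub>2 \<Lambda>"
    if b: "b \<in> F\<^sub>b" "\<forall>f\<in>E. \<forall>g\<in>E. \<Lambda> f g = form b f g" for \<Lambda> b
    unfolding bounded_form_on_def
  proof (intro exI conjI ballI)
    show "C\<^sub>B * norm\<^sub>b b + 1 > 0" using CB nb[of b] by (simp add: add_nonneg_pos)
    fix f g assume "f \<in> E" "g \<in> E"
    then have "norm (\<Lambda> f g) \<le> C\<^sub>B * norm\<^sub>b b * N\<^sub>1 f * N\<^sub>2 g" by (rule rep_bound[OF b])
    also have "\<dots> \<le> (C\<^sub>B * norm\<^sub>b b + 1) * N\<^sub>1 f * N\<^sub>2 g" using N0 by (intro mult_right_mono) auto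
    finally show "norm (\<Lambda> f g) \<le> (C\<^sub>B * norm\<^sub>b b + 1) * N\<^sub>1 f * N\<^sub>2 g" .
  qed
  have symbol: "\<exists>b\<in>F\<^sub>b. \<forall>f\<in>E. \<forall>g\<in>E. \<Lambda> f g = form b f g"
    if \<Lambda>: "hankel_form l \<Lambda>" "bounded_form_on E E N\<^sub>1 N\<^sub>2 \<Lambda>" for \<Lambda>
  proof -
    obtain C where C: "C > 0" "\<forall>f\<in>E. \<forall>g\<in>E. norm (\<Lambda> f g) \<le> C * N\<^sub>1 f * N\<^sub>2 g"
      using \<Lambda>(2) unfolding bounded_form_on_def by blast
    show ?thesis
      by (rule A[THEN spec, THEN spec, THEN mp, THEN conjunct1, OF conjI[OF \<Lambda>(1) conjI[OF less_imp_le[OF C(1)] C(2)]]])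
  qed
  have upper: "form_norm_on E E N\<^sub>1 N\<^sub>2 \<Lambda> \<le> C\<^sub>B * norm\<^sub>b b"
    if b: "b \<in> F\<^sub>b" "\<forall>f\<in>E. \<forall>g\<in>E. \<Lambda> f g = form b f g" for \<Lambda> b
    by (rule form_norm_on_le) (use rep_bound[OF b] CB nb in auto)
  have lower: "norm\<^sub>b b \<le> C\<^sub>A * form_norm_on E E N\<^sub>1 N\<^sub>2 \<Lambda>"
    if \<Lambda>: "hankel_form l \<Lambda>" "bounded_form_on E E N\<^sub>1 N\<^sub>2 \<Lambda>"
      and b: "b \<in> F\<^sub>b" "\<forall>f\<in>E. \<forall>g\<in>E. \<Lambda> f g = form b f g" for \<Lambda> b
  proof -
    have "norm\<^sub>b b / C\<^sub>A \<le> form_norm_on E E N\<^sub>1 N\<^sub>2 \<Lambda>"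
    proof (rule form_norm_on_ge[OF \<Lambda>(2)])
      fix C\<^sub>0 :: real assume C0: "C\<^sub>0 \<ge> 0" "\<And>f g. f \<in> E \<Longrightarrow> g \<in> E \<Longrightarrow> norm (\<Lambda> f g) \<le> C\<^sub>0 * N\<^sub>1 f * N\<^sub>2 g"
      then have "\<forall>f\<in>E. \<forall>g\<in>E. norm (\<Lambda> f g) \<le> C\<^sub>0 * N\<^sub>1 f * N\<^sub>2 g" by blast
      from A[THEN spec, THEN spec, THEN mp, THEN conjunct2, OF conjI[OF \<Lambda>(1) conjI[OF C0(1) this]]] b
      have "norm\<^sub>b b \<le> C\<^sub>A * C\<^sub>0" by blast
      then show "norm\<^sub>b b / C\<^sub>A \<le> C\<^sub>0" using CA by (simp add: pos_divide_le_eq mult.commute)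
    qed
    then show ?thesis using CA by (simp add: pos_divide_le_eq mult.commute)
  qed
  \<comment> \<open>Dominates the four constants \<open>C\<^sub>A\<close>, \<open>C\<^sub>B\<close>, \<open>C\<^sub>B C\<^sub>A\<close> and \<open>1\<close> of the four norm inequalities.\<close>
  define C where "C = C\<^sub>A + C\<^sub>B + C\<^sub>B * C\<^sub>A + 1"
  have "C\<^sub>B * C\<^sub>A > 0" using CA CB by simp
  then have C: "C > 0" "C\<^sub>A \<le> C" "C\<^sub>B \<le> C" "C\<^sub>B * C\<^sub>A \<le> C" "1 \<le> C"
    using CA CB unfolding C_def by linarith+
  have equivalence: "(\<forall>b\<in>F\<^sub>b. (\<forall>f\<in>E. \<forall>g\<in>E. \<Lambda> f g = form b f g) \<longrightarrow>
       form_norm_on E E N\<^sub>1 N\<^sub>2 \<Lambda> \<le> C * norm\<^sub>b b \<and> norm\<^sub>b b \<le> C * form_norm_on E E N\<^sub>1 N\<^sub>2 \<Lambda>) \<and>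
     (\<exists>\<phi>\<in>L\<^sub>\<phi>. bilinear_form_on L\<^sub>1 L\<^sub>2 (form \<phi>) \<and> bounded_form_on L\<^sub>1 L\<^sub>2 N\<^sub>1 N\<^sub>2 (form \<phi>) \<and>
       (\<forall>f\<in>E. \<forall>g\<in>E. form \<phi> f g = \<Lambda> f g) \<and>
       form_norm_on L\<^sub>1 L\<^sub>2 N\<^sub>1 N\<^sub>2 (form \<phi>) \<le> C * form_norm_on E E N\<^sub>1 N\<^sub>2 \<Lambda> \<and>
       form_norm_on E E N\<^sub>1 N\<^sub>2 \<Lambda> \<le> C * form_norm_on L\<^sub>1 L\<^sub>2 N\<^sub>1 N\<^sub>2 (form \<phi>))"
    if \<Lambda>: "hankel_form l \<Lambda>" "bounded_form_on E E N\<^sub>1 N\<^sub>2 \<Lambda>" for \<Lambda>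
  proof (intro conjI ballI impI)
    define n where "n = form_norm_on E E N\<^sub>1 N\<^sub>2 \<Lambda>"
    have n0: "n \<ge> 0" unfolding n_def by (rule form_norm_on_ge[OF \<Lambda>(2)])
    {
      fix b assume b: "b \<in> F\<^sub>b" "\<forall>f\<in>E. \<forall>g\<in>E. \<Lambda> f g = form b f g"
      show "form_norm_on E E N\<^sub>1 N\<^sub>2 \<Lambda> \<le> C * norm\<^sub>b b"
        using upper[OF b] mult_right_mono[OF C(3) nb[of b]] by linarith
      show "norm\<^sub>b b \<le> C * form_norm_on E E N\<^sub>1 N\<^sub>2 \<Lambda>"
        using lower[OF \<Lambda> b] mult_right_mono[OF C(2) n0] unfolding n_def by linarith
    }
    obtain b where b: "b \<in> F\<^sub>b" "\<forall>f\<in>E. \<forall>g\<in>E. \<Lambda> f g = form b f g" using symbol[OF \<Lambda>] by blast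
    obtain \<phi> where \<phi>: "\<phi> \<in> L\<^sub>\<phi>" "\<forall>f\<in>E. \<forall>g\<in>E. form \<phi> f g = form b f g" "bilinear_form_on L\<^sub>1 L\<^sub>2 (form \<phi>)"
      "\<forall>f\<in>L\<^sub>1. \<forall>g\<in>L\<^sub>2. norm (form \<phi> f g) \<le> C\<^sub>B * norm\<^sub>b b * N\<^sub>1 f * N\<^sub>2 g" using bspec[OF B b(1)] by blast
    have bounded: "bounded_form_on L\<^sub>1 L\<^sub>2 N\<^sub>1 N\<^sub>2 (form \<phi>)"
      unfolding bounded_form_on_def
    proof (intro exI conjI ballI)
      show "C\<^sub>B * norm\<^sub>b b + 1 > 0" using CB nb[of b] by (simp add: add_nonneg_pos)
      fix f g assume "f \<in> L\<^sub>1" "g \<in> L\<^sub>2"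
      then have "norm (form \<phi> f g) \<le> C\<^sub>B * norm\<^sub>b b * N\<^sub>1 f * N\<^sub>2 g" using \<phi>(4) by blast
      also have "\<dots> \<le> (C\<^sub>B * norm\<^sub>b b + 1) * N\<^sub>1 f * N\<^sub>2 g" using N0 by (intro mult_right_mono) auto
      finally show "norm (form \<phi> f g) \<le> (C\<^sub>B * norm\<^sub>b b + 1) * N\<^sub>1 f * N\<^sub>2 g" .
    qed
    have "form_norm_on L\<^sub>1 L\<^sub>2 N\<^sub>1 N\<^sub>2 (form \<phi>) \<le> C\<^sub>B * norm\<^sub>b b"
      by (rule form_norm_on_le) (use \<phi>(4) CB nb in auto)
    also have "\<dots> \<le> C\<^sub>B * (C\<^sub>A * n)" unfolding n_def by (intro mult_left_mono lower[OF \<Lambda> b]) (use CB in simp)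
    also have "\<dots> \<le> C * n" using mult_right_mono[OF C(4) n0] by (simp only: mult.assoc)
    finally have norm_le: "form_norm_on L\<^sub>1 L\<^sub>2 N\<^sub>1 N\<^sub>2 (form \<phi>) \<le> C * form_norm_on E E N\<^sub>1 N\<^sub>2 \<Lambda>" unfolding n_def .
    have "n \<le> form_norm_on L\<^sub>1 L\<^sub>2 N\<^sub>1 N\<^sub>2 (form \<phi>)"
    proof (rule form_norm_on_ge[OF bounded])
      fix C' :: real assume "C' \<ge> 0" and C': "\<And>f g. f \<in> L\<^sub>1 \<Longrightarrow> g \<in> L\<^sub>2 \<Longrightarrow> norm (form \<phi> f g) \<le> C' * N\<^sub>1 f * N\<^sub>2 g"
      show "n \<le> C'" unfolding n_def
      proof (rule form_norm_on_le[OF \<open>C' \<ge> 0\<close>])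
        fix f g assume fg: "f \<in> E" "g \<in> E"
        then have "\<Lambda> f g = form \<phi> f g" using b(2) \<phi>(2) by simp
        then show "norm (\<Lambda> f g) \<le> C' * N\<^sub>1 f * N\<^sub>2 g" using C'[of f g] fg EL by auto
      qed
    qed
    moreover from this have "form_norm_on L\<^sub>1 L\<^sub>2 N\<^sub>1 N\<^sub>2 (form \<phi>) \<le> C * form_norm_on L\<^sub>1 L\<^sub>2 N\<^sub>1 N\<^sub>2 (form \<phi>)"
      using n0 mult_right_mono[OF C(5), of "form_norm_on L\<^sub>1 L\<^sub>2 N\<^sub>1 N\<^sub>2 (form \<phi>)"] by linarith
    ultimately have norm_ge: "form_norm_on E E N\<^sub>1 N\<^sub>2 \<Lambda> \<le> C * form_norm_on L\<^sub>1 L\<^sub>2 N\<^sub>1 N\<^sub>2 (form \<phi>)" unfolding n_def by linarith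
    show "\<exists>\<phi>\<in>L\<^sub>\<phi>. bilinear_form_on L\<^sub>1 L\<^sub>2 (form \<phi>) \<and> bounded_form_on L\<^sub>1 L\<^sub>2 N\<^sub>1 N\<^sub>2 (form \<phi>) \<and>
       (\<forall>f\<in>E. \<forall>g\<in>E. form \<phi> f g = \<Lambda> f g) \<and>
       form_norm_on L\<^sub>1 L\<^sub>2 N\<^sub>1 N\<^sub>2 (form \<phi>) \<le> C * form_norm_on E E N\<^sub>1 N\<^sub>2 \<Lambda> \<and>
       form_norm_on E E N\<^sub>1 N\<^sub>2 \<Lambda> \<le> C * form_norm_on L\<^sub>1 L\<^sub>2 N\<^sub>1 N\<^sub>2 (form \<phi>)"
    proof (intro bexI conjI ballI)
      show "form \<phi> f g = \<Lambda> f g" if "f \<in> E" "g \<in> E" for f g using b(2) \<phi>(2) that by simp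
    qed (fact \<phi> bounded norm_le norm_ge)+
  qed
  show ?thesis
  proof (intro conjI allI impI iffI exI[of _ C])
    fix \<Lambda> :: "(complex ^ 'n \<Rightarrow> complex) \<Rightarrow> (complex ^ 'n \<Rightarrow> complex) \<Rightarrow> complex"
    assume "hankel_form l \<Lambda>"
    then show "\<exists>b\<in>F\<^sub>b. \<forall>f\<in>E. \<forall>g\<in>E. \<Lambda> f g = form b f g" if "bounded_form_on E E N\<^sub>1 N\<^sub>2 \<Lambda>" using that by (rule symbol)
    show "bounded_form_on E E N\<^sub>1 N\<^sub>2 \<Lambda>" if "\<exists>b\<in>F\<^sub>b. \<forall>f\<in>E. \<forall>g\<in>E. \<Lambda> f g = form b f g" using that rep_bounded by blast
  qed (use C(1) equivalence in blast)+
qed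

end
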